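(* Let $K$ be a field of characteristic $0$, let ${\bf X}=(X,\operatorname{rk})$ be a polymatroid with $|X|=d$, and let $V$ (with $n=\dim V$) together with subspaces $V_x\subseteq V$, $x\in X$, be a realization of ${\bf X}$ over $K$. Let $W$ be a finite-dimensional $K$-vector space. Then $$\big(\sigma^{\,n-\operatorname{rk}(X)}\,\mathcal{P}[{\bf X}]\big)\star W=\sum_{A\subseteq X}(-1)^{|A|}\langle J_A(W)\rangle$$ and $$\big(\sigma^{n}\,\mathcal{H}[{\bf X}](\sigma^{-1},-1)\big)\star W=\langle J(W)\rangle .$$
   Context: A (discrete) polymatroid is a pair ${\bf X}=(X,\operatorname{rk})$ with $X$ a finite set and $\operatorname{rk}$ a function from subsets of $X$ to $\{0,1,2,\dots\}$ with $\operatorname{rk}(\emptyset)=0$, $\operatorname{rk}(A)\le\operatorname{rk}(B)$ for $A\subseteq B$, and $\operatorname{rk}(A\cup B)+\operatorname{rk}(A\cap B)\le\operatorname{rk}(A)+\operatorname{rk}(B)$. For $A\subseteq X$, ${\bf X}|_A=(A,\operatorname{rk}|_A)$. Let $\mathrm{Sym}=\mathbb{Z}[e_1,e_2,\dots]$ be the graded ring of symmetric functions with Schur basis $s_\lambda$, and $\overline{\mathrm{Sym}}=\mathbb{Z}[[e_1,e_2,\dots]]$. Put $\sigma=1+s_1+s_2+s_3+\cdots\in\overline{\mathrm{Sym}}$ (so $\sigma^{-1}=1-e_1+e_2-\cdots$). Define $\mathcal{P}[{\bf X}]\in\mathrm{Sym}$ recursively: $\mathcal{P}[{\bf X}]=1$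 if $X=\emptyset$; otherwise $\mathcal{P}[{\bf X}]$ is the sum of the homogeneous components of degrees $0,1,\dots,|X|-1$ of $-\sum_{A\subsetneq X}\mathcal{P}[{\bf X}|_A]\,\sigma^{\operatorname{rk}(X)-\operatorname{rk}(A)}(-1)^{|X|-|A|}$. Define $\mathcal{H}[{\bf X}](q,t)=\sum_{A\subseteq X}\mathcal{P}[{\bf X}|_A]q^{\operatorname{rk}(A)}t^{|A|}$; $\mathcal{H}[{\bf X}](\sigma^{-1},-1)\in\overline{\mathrm{Sym}}$ is obtained by substituting $q=\sigma^{-1}$, $t=-1$. A realization of ${\bf X}$ over $K$ is a finite-dimensional $K$-vector space $V$ with subspaces $V_x$, $x\in X$, such that $\operatorname{rk}(A)=\dim V-\dim V_A$ for all $A\subseteq X$, where $V_A=\bigcap_{x\in A}V_x$ ($V_\emptyset=V$). For a $K$-vector space $W$ with dual $W^\star$, let $R(W)=K[V\otimes W^\star]$ (polynomial functions), let $J_x(W)\subseteq R(W)$ be the vanishing ideal of $V_x\otimes W^\star$, $J_A(W)=\prod_{x\in A}J_x(W)$ (with $J_\emptyset(W)=R(W)$), and $J(W)=J_X(W)$. These are $\mathrm{GL}(W)$-modules. For a $\mathrm{GL}(W)$-module $M$ in which each irreducible rational representation occurs with finite multiplicity, $\langle M\rangle$ is the function assigning to each isomorphism class of irreducible representation its multiplicity in $M$; these functions form an abelian group. For $f=\sum_\lambda a_\lambda s_\lambda\in\overline{\mathrm{Sym}}$ define $f\star W=\sum_\lambda a_\lambda\langle S_\lambda(W)\rangle$,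 where $S_\lambda$ is the Schur functor (so $S_\lambda(W)=0$ if $\lambda$ has more than $\dim W$ parts). *)

theory Defs
  imports
    Complex_Main
    "HOL-Library.Multiset"
    "HOL-Library.FuncSet"
    "HOL-Library.Function_Algebras"
    "HOL-Combinatorics.Permutations"
begin

section \<open>Symmetric functions\<close>

text \<open>
  Formal power series over the integers in variables indexed by the natural numbers. A monomial
  is the multiset of the indices of its variables, so that its degree is the size of the multiset.
\<close>

typedef xps = "UNIV :: (nat multiset \<Rightarrow> int) set"
  morphisms xcoeff Abs_xps ..

setup_lifting type_definition_xps

lemma xps_eqI: "(\<And>M. xcoeff f M = xcoeff g M) \<Longrightarrow> f = g"
  by transfer auto

lemma finite_mset_splits: "finite {(A, B). A + B = (M :: 'a multiset)}"
proof (induction M)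
  case empty
  have "{(A, B). A + B = ({#} :: 'a multiset)} = {({#}, {#})}" by auto
  then show ?case by simp
next
  case (add x M)
  let ?S = "{(A, B). A + B = M}"
  have "{(A, B). A + B = add_mset x M}
      \<subseteq> (\<lambda>(A, B). (add_mset x A, B)) ` ?S \<union> (\<lambda>(A, B). (A, add_mset x B)) ` ?S"
  proof clarify
    fix A B
    assume eq: "A + B = add_mset x M"
      and n: "(A, B) \<notin> (\<lambda>(A, B). (A, add_mset x B)) ` ?S"
    then have "x \<in># A + B" by simp
    then consider "x \<in># A" | "x \<in># B" by auto
    then show "(A, B) \<in> (\<lambda>(A, B). (add_mset x A, B)) ` ?S"
    proof cases
      case 1
      then obtain A' where A': "A = add_mset x A'" by (metis multi_member_split)
      with eq have "A' + B = M" by simp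
      then show ?thesis using A' by (intro image_eqI[of _ _ "(A', B)"]) auto
    next
      case 2
      then obtain B' where B': "B = add_mset x B'" by (metis multi_member_split)
      with eq have "A + B' = M" by simp
      then have "(A, B) \<in> (\<lambda>(A, B). (A, add_mset x B)) ` ?S"
        using B' by (intro image_eqI[of _ _ "(A, B')"]) auto
      with n show ?thesis by contradiction
    qed
  qed
  then show ?case using add by (meson finite_UnI finite_imageI finite_subset)
qed

lemma finite_mset_splits': "finite {p. fst p + snd p = (M :: 'a multiset)}"
  using finite_mset_splits[of M] by (simp add: case_prod_unfold)

instantiation xps :: comm_ring_1
begin

lift_definition zero_xps :: xps is "\<lambda>_. 0" .
lift_definition one_xps :: xps is "\<lambda>M. if M = {#} then 1 else 0" .
lift_definition plus_xps :: "xps \<Rightarrow> xps \<Rightarrow> xps" is "\<lambda>f g M. f M + g M" .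
lift_definition minus_xps :: "xps \<Rightarrow> xps \<Rightarrow> xps" is "\<lambda>f g M. f M - g M" .
lift_definition uminus_xps :: "xps \<Rightarrow> xps" is "\<lambda>f M. - f M" .
lift_definition times_xps :: "xps \<Rightarrow> xps \<Rightarrow> xps"
  is "\<lambda>f g M. \<Sum>(A, B) \<in> {(A, B). A + B = M}. f A * g B" .

instance
proof
  fix a b c :: xps
  show "a * b * c = a * (b * c)"
  proof (rule xps_eqI)
    fix M
    let ?D = "\<lambda>M. {(A, B). A + B = (M :: nat multiset)}"
    let ?f = "xcoeff a" and ?g = "xcoeff b" and ?h = "xcoeff c"
    have "xcoeff (a * b * c) M = (\<Sum>(Q, C)\<in>?D M. \<Sum>(A, B)\<in>?D Q. ?f A * ?g B * ?h C)"
      by (simp add: times_xps.rep_eq sum_distrib_right case_prod_unfold)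
    also have "\<dots> = (\<Sum>((Q, C), (A, B))\<in>(SIGMA p:?D M. ?D (fst p)). ?f A * ?g B * ?h C)"
      by (subst sum.Sigma[symmetric])
         (auto simp: finite_mset_splits' case_prod_unfold)
    also have "\<dots> = (\<Sum>((A, Q), (B, C))\<in>(SIGMA p:?D M. ?D (snd p)). ?f A * ?g B * ?h C)"
      by (rule sum.reindex_bij_witness[of _
            "\<lambda>((A, Q), (B, C)). ((A + B, C), (A, B))"
            "\<lambda>((Q, C), (A, B)). ((A, B + C), (B, C))"])
         (auto simp: ac_simps)
    also have "\<dots> = (\<Sum>(A, Q)\<in>?D M. \<Sum>(B, C)\<in>?D Q. ?f A * ?g B * ?h C)"
      by (subst sum.Sigma[symmetric])
         (auto simp: finite_mset_splits' case_prod_unfold)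
    also have "\<dots> = xcoeff (a * (b * c)) M"
      by (simp add: times_xps.rep_eq sum_distrib_left case_prod_unfold ac_simps)
    finally show "xcoeff (a * b * c) M = xcoeff (a * (b * c)) M" .
  qed
  show "a * b = b * a"
    by (rule xps_eqI, unfold times_xps.rep_eq)
       (rule sum.reindex_bij_witness[of _ prod.swap prod.swap]; auto simp: ac_simps)
  show "1 * a = a"
  proof (rule xps_eqI)
    fix M
    have "xcoeff (1 * a) M = (\<Sum>(A, B)\<in>{({#}, M)}. xcoeff 1 A * xcoeff a B)"
      unfolding times_xps.rep_eq
      by (rule sum.mono_neutral_right)
         (auto simp: finite_mset_splits one_xps.rep_eq split: if_splits)
    then show "xcoeff (1 * a) M = xcoeff a M" by (simp add: one_xps.rep_eq)
  qed
  show "(a + b) * c = a * c + b * c"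
    by (rule xps_eqI)
       (simp add: times_xps.rep_eq plus_xps.rep_eq case_prod_unfold distrib_right sum.distrib)
  show "a + b + c = a + (b + c)" by transfer auto
  show "a + b = b + a" by transfer auto
  show "0 + a = a" by transfer auto
  show "- a + a = 0" by transfer auto
  show "a - b = a + - b" by transfer auto
  show "(0 :: xps) \<noteq> 1"
    by transfer (metis zero_neq_one)
qed

end

text \<open>
  \<open>Sym_bar\<close> is the completed ring of symmetric functions: by the fundamental theorem on symmetric
  functions the symmetric power series in the variables are exactly the power series in the
  elementary symmetric functions. \<open>Sym\<close> consists of the symmetric series of bounded degree.
\<close>

definition Sym_bar :: "xps set" where
  "Sym_bar = {f. \<forall>\<pi>. bij \<pi> \<longrightarrow> (\<forall>M. xcoeff f (image_mset \<pi> M) = xcoeff f M)}"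

definition Sym :: "xps set" where
  "Sym = {f \<in> Sym_bar. \<exists>n. \<forall>M. n < size M \<longrightarrow> xcoeff f M = 0}"

definition is_partition :: "nat list \<Rightarrow> bool" where
  "is_partition lam \<longleftrightarrow> sorted_wrt (\<ge>) lam \<and> 0 \<notin> set lam"

definition cells :: "nat list \<Rightarrow> (nat \<times> nat) set" where
  "cells lam = {(i, j). i < length lam \<and> j < lam ! i}"

definition ssyt :: "nat list \<Rightarrow> (nat \<times> nat \<Rightarrow> nat) set" where
  "ssyt lam = {T \<in> extensional (cells lam).
     (\<forall>i j j'. (i, j) \<in> cells lam \<and> (i, j') \<in> cells lam \<and> j < j' \<longrightarrow> T (i, j) \<le> T (i, j')) \<and>
     (\<forall>i i' j. (i, j) \<in> cells lam \<and> (i', j) \<in> cells lam \<and> i < i' \<longrightarrow> T (i, j) < T (i', j))}"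

text \<open>The Schur function, as the generating function of semistandard tableaux by content.\<close>

definition schur :: "nat list \<Rightarrow> xps" where
  "schur lam = Abs_xps (\<lambda>M. int (card {T \<in> ssyt lam. image_mset T (mset_set (cells lam)) = M}))"

text \<open>
  The infinite linear combination of all Schur functions with given coefficients; in each degree
  it is a finite sum.
\<close>

definition schur_sum :: "(nat list \<Rightarrow> int) \<Rightarrow> xps" where
  "schur_sum a = Abs_xps (\<lambda>M. \<Sum>lam | is_partition lam \<and> sum_list lam = size M.
     a lam * xcoeff (schur lam) M)"

definition schur_coeff :: "xps \<Rightarrow> nat list \<Rightarrow> int" where
  "schur_coeff f = (THE a. f = schur_sum a \<and> (\<forall>lam. \<not> is_partition lam \<longrightarrow> a lam = 0))"

definition sigma :: xps where
  "sigma = schur_sum (\<lambda>lam. if length lam \<le> 1 then 1 else 0)"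

definition sigma_inv :: xps where
  "sigma_inv = (THE u. sigma * u = 1)"

lemma xcoeff_sigma: "xcoeff sigma M = 1"
proof -
  define lam where "lam = (if M = {#} then [] else [size M])"
  define k where "k = size M"
  have part: "{mu. is_partition mu \<and> sum_list mu = size M \<and> length mu \<le> 1} = {lam}"
  proof -
    have "mu = lam" if "is_partition mu" "sum_list mu = size M" "length mu \<le> 1" for mu
      using that by (cases mu) (auto simp: lam_def is_partition_def)
    moreover have "is_partition lam \<and> sum_list lam = size M \<and> length lam \<le> 1"
      by (auto simp: lam_def is_partition_def)
    ultimately show ?thesis by auto
  qed
  have finpart: "finite {mu. is_partition mu \<and> sum_list mu = size M}"
  proof (rule finite_subset)
    have "length mu \<le> sum_list mu" if "0 \<notin> set mu" for mu :: "nat list"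
      using that by (induction mu) auto
    moreover have "set mu \<subseteq> {..sum_list mu}" for mu :: "nat list"
      by (auto intro: member_le_sum_list)
    ultimately show "{mu. is_partition mu \<and> sum_list mu = size M}
        \<subseteq> {mu. set mu \<subseteq> {..size M} \<and> length mu \<le> size M}"
      unfolding is_partition_def by (metis (mono_tags, lifting) Collect_mono)
    show "finite {mu. set mu \<subseteq> {..size M} \<and> length mu \<le> size M}"
      by (rule finite_lists_length_le) simp
  qed
  have cells: "cells lam = Pair 0 ` {..<k}"
    by (auto simp: cells_def lam_def k_def)
  have content: "image_mset T (mset_set (cells lam)) = mset (map (\<lambda>j. T (0, j)) [0..<k])"
    for T :: "nat \<times> nat \<Rightarrow> nat"
  proof -
    have "mset_set (cells lam) = image_mset (Pair 0) (mset_set {..<k})"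
      unfolding cells by (rule image_mset_mset_set[symmetric]) (auto simp: inj_on_def)
    then show ?thesis
      by (simp add: multiset.map_comp comp_def lessThan_atLeast0)
  qed
  let ?L = "sorted_list_of_multiset M"
  let ?T = "\<lambda>c. if c \<in> cells lam then ?L ! snd c else undefined"
  have lenL: "length ?L = k"
    unfolding k_def by (metis mset_sorted_list_of_multiset size_mset)
  have mapT: "map (\<lambda>j. ?T (0, j)) [0..<k] = ?L"
    by (rule nth_equalityI) (auto simp: lenL cells)
  have "{T \<in> ssyt lam. image_mset T (mset_set (cells lam)) = M} = {?T}"
  proof (intro equalityI subsetI)
    fix T assume "T \<in> {T \<in> ssyt lam. image_mset T (mset_set (cells lam)) = M}"
    then have T: "T \<in> ssyt lam" and c: "mset (map (\<lambda>j. T (0, j)) [0..<k]) = M"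
      by (auto simp: content)
    have "sorted (map (\<lambda>j. T (0, j)) [0..<k])"
      using T by (auto simp: ssyt_def cells sorted_wrt_iff_nth_less)
    then have eq: "map (\<lambda>j. T (0, j)) [0..<k] = ?L"
      using c by (metis sorted_list_of_multiset_mset sorted_sort_id)
    have "T c = ?T c" for c
    proof (cases "c \<in> cells lam")
      case True
      then obtain j where "c = (0, j)" "j < k" by (auto simp: cells)
      then show ?thesis using True arg_cong[OF eq, of "\<lambda>l. l ! j"] by simp
    next
      case False
      then show ?thesis using T unfolding ssyt_def extensional_def by (cases c) simp
    qed
    then show "T \<in> {?T}" by auto
  next
    fix T assume "T \<in> {?T}"
    then have T: "T = ?T" by simp
    have "?T \<in> ssyt lam"
      using sorted_sorted_list_of_multiset[of M] lenL
      by (auto simp: ssyt_def extensional_def cells sorted_iff_nth_mono)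
    moreover have "image_mset ?T (mset_set (cells lam)) = M"
      unfolding content mapT by simp
    ultimately show "T \<in> {T \<in> ssyt lam. image_mset T (mset_set (cells lam)) = M}"
      using T by simp
  qed
  then have "xcoeff (schur lam) M = 1"
    by (simp add: schur_def Abs_xps_inverse)
  moreover have "xcoeff sigma M
      = (\<Sum>mu | is_partition mu \<and> sum_list mu = size M \<and> length mu \<le> 1. xcoeff (schur mu) M)"
    using finpart
    by (auto simp: sigma_def schur_sum_def Abs_xps_inverse split: if_splits
        intro!: sum.mono_neutral_cong_right)
  ultimately show ?thesis by (simp only: part) simp
qed

lemma sigma_times_alternating_elementary:
  "sigma * Abs_xps (\<lambda>M. if \<forall>x. count M x \<le> 1 then (-1) ^ size M else 0) = 1"
    (is "sigma * ?u = 1")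
proof (rule xps_eqI)
  fix M :: "nat multiset"
  have "xcoeff (sigma * ?u) M
      = (\<Sum>(A, B)\<in>{(A, B). A + B = M}. if \<forall>x. count B x \<le> 1 then (-1) ^ size B else 0)"
    by (simp add: times_xps.rep_eq xcoeff_sigma Abs_xps_inverse case_prod_unfold)
  also have "\<dots> = (\<Sum>(A, B)\<in>{(A, B). A + B = M \<and> (\<forall>x. count B x \<le> 1)}. (-1) ^ size B)"
    by (rule sum.mono_neutral_cong_right) (auto simp: finite_mset_splits split: if_splits)
  also have "\<dots> = (\<Sum>S\<in>Pow (set_mset M). (-1) ^ card S)"
  proof (rule sum.reindex_bij_witness[of _
        "\<lambda>S. (M - mset_set S, mset_set S)" "\<lambda>(A, B). set_mset B"])
    fix p assume "p \<in> {(A, B). A + B = M \<and> (\<forall>x. count B x \<le> 1)}"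
    then obtain A B where p: "p = (A, B)" "A + B = M" "\<forall>x. count B x \<le> 1" by auto
    have B: "mset_set (set_mset B) = B"
    proof (rule multiset_eqI)
      fix x show "count (mset_set (set_mset B)) x = count B x"
        using p(3)[rule_format, of x] count_greater_zero_iff[of B x]
        by (cases "x \<in># B") (simp_all add: count_mset_set' not_in_iff del: count_greater_zero_iff)
    qed
    then show "(\<lambda>S. (M - mset_set S, mset_set S)) ((\<lambda>(A, B). set_mset B) p) = p"
      using p by auto
    show "(\<lambda>(A, B). set_mset B) p \<in> Pow (set_mset M)" using p by auto
    show "(-1) ^ card ((\<lambda>(A, B). set_mset B) p) = (case p of (A, B) \<Rightarrow> (-1 :: int) ^ size B)"
      using p(1) arg_cong[OF B, of size] by simp
  next
    fix S assume "S \<in> Pow (set_mset M)"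
    then have S: "S \<subseteq> set_mset M" "finite S" by (auto intro: finite_subset)
    then show "(\<lambda>(A, B). set_mset B) ((\<lambda>S. (M - mset_set S, mset_set S)) S) = S" by simp
    have "mset_set S \<subseteq># M"
      using S by (auto simp: subseteq_mset_def count_mset_set' Suc_le_eq)
    then show "(\<lambda>S. (M - mset_set S, mset_set S)) S \<in> {(A, B). A + B = M \<and> (\<forall>x. count B x \<le> 1)}"
      by (auto simp: count_mset_set')
  qed
  also have "\<dots> = (if M = {#} then 1 else 0)"
    using prod_add[of "set_mset M" "\<lambda>_. -1 :: int" "\<lambda>_. 1"] by (cases "M = {#}") (simp_all add: zero_power card_gt_0_iff)
  finally show "xcoeff (sigma * ?u) M = xcoeff 1 M"
    by (simp add: one_xps.rep_eq)
qed

lemma sigma_sigma_inv: "sigma * sigma_inv = 1"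
proof -
  obtain v where v: "sigma * v = 1"
    using sigma_times_alternating_elementary by blast
  show ?thesis
    unfolding sigma_inv_def
  proof (rule theI)
    show "sigma * v = 1" by (fact v)
    fix u assume "sigma * u = 1"
    then have "v * (sigma * u) = v" by simp
    moreover have "v * (sigma * u) = sigma * v * u" by (simp only: ac_simps)
    ultimately show "u = v" using v by simp
  qed
qed

text \<open>The sum of the homogeneous components of degree less than \<open>n\<close>.\<close>

definition trunc :: "nat \<Rightarrow> xps \<Rightarrow> xps" where
  "trunc n f = Abs_xps (\<lambda>M. if size M < n then xcoeff f M else 0)"


section \<open>Polymatroids and their symmetric functions\<close>

definition polymatroid :: "'x set \<Rightarrow> ('x set \<Rightarrow> nat) \<Rightarrow> bool" where
  "polymatroid X rk \<longleftrightarrow> finite X \<and> rk {} = 0 \<and>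
     (\<forall>A B. A \<subseteq> B \<and> B \<subseteq> X \<longrightarrow> rk A \<le> rk B) \<and>
     (\<forall>A B. A \<subseteq> X \<and> B \<subseteq> X \<longrightarrow> rk (A \<union> B) + rk (A \<inter> B) \<le> rk A + rk B)"

text \<open>
  The restriction of \<open>(X, rk)\<close> to \<open>A\<close> is \<open>(A, rk)\<close>: only the values of \<open>rk\<close> on subsets of the
  ground set matter. Infinite ground sets are not polymatroids and get a dummy value.
\<close>

function polyP :: "'x set \<Rightarrow> ('x set \<Rightarrow> nat) \<Rightarrow> xps" where
  "polyP X rk = (if finite X \<and> X \<noteq> {}
     then trunc (card X)
       (- (\<Sum>A | A \<subset> X. polyP A rk * sigma ^ (rk X - rk A) * (-1) ^ (card X - card A)))
     else 1)"
  by auto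
termination
  by (relation "measure (\<lambda>(X, rk). card X)") (auto intro: psubset_card_mono)

declare polyP.simps [simp del]

lemma Sym_bar_minus: "f \<in> Sym_bar \<Longrightarrow> - f \<in> Sym_bar"
  by (auto simp: Sym_bar_def uminus_xps.rep_eq)

lemma Sym_bar_one: "1 \<in> Sym_bar"
  by (auto simp: Sym_bar_def one_xps.rep_eq)

lemma Sym_bar_sum: "(\<And>i. i \<in> I \<Longrightarrow> f i \<in> Sym_bar) \<Longrightarrow> sum f I \<in> Sym_bar"
  by (induction I rule: infinite_finite_induct)
     (auto simp: Sym_bar_def zero_xps.rep_eq plus_xps.rep_eq)

lemma Sym_bar_mult:
  assumes "f \<in> Sym_bar" "g \<in> Sym_bar"
  shows "f * g \<in> Sym_bar"
  unfolding Sym_bar_def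
proof (clarify)
  fix \<pi> :: "nat \<Rightarrow> nat" and M
  assume \<pi>: "bij \<pi>"
  then have [simp]: "image_mset (inv \<pi>) (image_mset \<pi> A) = A"
      "image_mset \<pi> (image_mset (inv \<pi>) A) = A" for A
    by (simp_all add: multiset.map_comp comp_def bij_is_inj bij_is_surj surj_f_inv_f)
  have "(\<Sum>(A, B)\<in>{(A, B). A + B = image_mset \<pi> M}. xcoeff f A * xcoeff g B)
      = (\<Sum>(A, B)\<in>{(A, B). A + B = M}. xcoeff f A * xcoeff g B)"
  proof (rule sum.reindex_bij_witness[of _
        "\<lambda>(A, B). (image_mset \<pi> A, image_mset \<pi> B)"
        "\<lambda>(A, B). (image_mset (inv \<pi>) A, image_mset (inv \<pi>) B)"])
    fix p assume "p \<in> {(A, B). A + B = image_mset \<pi> M}"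
    then obtain A B where p: "p = (A, B)" "A + B = image_mset \<pi> M" by auto
    have "image_mset (inv \<pi>) (A + B) = M" unfolding p(2) by simp
    then show "(\<lambda>(A, B). (image_mset (inv \<pi>) A, image_mset (inv \<pi>) B)) p \<in> {(A, B). A + B = M}"
      unfolding p(1) by simp
    show "(case (\<lambda>(A, B). (image_mset (inv \<pi>) A, image_mset (inv \<pi>) B)) p of
        (A, B) \<Rightarrow> xcoeff f A * xcoeff g B) = (case p of (A, B) \<Rightarrow> xcoeff f A * xcoeff g B)"
      using p assms bij_imp_bij_inv[OF \<pi>] by (simp add: Sym_bar_def)
  qed auto
  then show "xcoeff (f * g) (image_mset \<pi> M) = xcoeff (f * g) M"
    by (simp add: times_xps.rep_eq)
qed

lemma Sym_bar_power: "f \<in> Sym_bar \<Longrightarrow> f ^ n \<in> Sym_bar"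
  by (induction n) (auto simp: Sym_bar_one Sym_bar_mult)

lemma polyP_in_Sym: "polyP X rk \<in> Sym"
proof (induction X rk rule: polyP.induct)
  case (1 X rk)
  show ?case
  proof (cases "finite X \<and> X \<noteq> {}")
    case True
    let ?f = "- (\<Sum>A | A \<subset> X. polyP A rk * sigma ^ (rk X - rk A) * (-1) ^ (card X - card A))"
    have "sigma \<in> Sym_bar" by (simp add: Sym_bar_def xcoeff_sigma)
    moreover have "polyP A rk \<in> Sym_bar" if "A \<subset> X" for A
      using 1 True that by (auto simp: Sym_def)
    ultimately have "?f \<in> Sym_bar"
      by (intro Sym_bar_minus Sym_bar_sum Sym_bar_mult Sym_bar_power Sym_bar_one) auto
    then have "trunc (card X) ?f \<in> Sym"
      by (auto simp: Sym_def Sym_bar_def trunc_def Abs_xps_inverse intro!: exI[of _ "card X"])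
    then show ?thesis using True by (simp add: polyP.simps[of X])
  next
    case False
    then show ?thesis
      by (auto simp: polyP.simps[of X] Sym_def Sym_bar_one one_xps.rep_eq)
  qed
qed

definition polyH :: "'x set \<Rightarrow> ('x set \<Rightarrow> nat) \<Rightarrow> xps \<Rightarrow> xps \<Rightarrow> xps" where
  "polyH X rk q t = (\<Sum>A\<in>Pow X. polyP A rk * q ^ rk A * t ^ card A)"

definition realization ::
    "('k::field \<Rightarrow> 'v::ab_group_add \<Rightarrow> 'v) \<Rightarrow> ('x \<Rightarrow> 'v set) \<Rightarrow> 'x set \<Rightarrow> ('x set \<Rightarrow> nat) \<Rightarrow> bool"
  where
  "realization sV V X rk \<longleftrightarrow> (\<forall>x\<in>X. module.subspace sV (V x)) \<and>
     (\<forall>A\<subseteq>X. int (rk A) = int (vector_space.dim sV UNIV) - int (vector_space.dim sV (\<Inter>x\<in>A. V x)))"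


section \<open>Representations of the general linear group\<close>

definition dual_space :: "('k::field \<Rightarrow> 'v::ab_group_add \<Rightarrow> 'v) \<Rightarrow> ('v \<Rightarrow> 'k) set" where
  "dual_space s = {\<xi>. Vector_Spaces.linear s (*) \<xi>}"

definition GL :: "('k::field \<Rightarrow> 'w::ab_group_add \<Rightarrow> 'w) \<Rightarrow> ('w \<Rightarrow> 'w) set" where
  "GL sW = {g. Vector_Spaces.linear sW sW g \<and> bij g}"

text \<open>
  Regular functions on \<open>GL sW\<close> (values off \<open>GL sW\<close> are irrelevant): the algebra generated by the
  matrix entries of \<open>g\<close> and of its inverse, which contains the inverse of the determinant.
\<close>

inductive_set regular_fun ::
    "('k::field \<Rightarrow> 'w::ab_group_add \<Rightarrow> 'w) \<Rightarrow> (('w \<Rightarrow> 'w) \<Rightarrow> 'k) set" for sW where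
  const: "(\<lambda>g. c) \<in> regular_fun sW"
| entry: "\<eta> \<in> dual_space sW \<Longrightarrow> (\<lambda>g. \<eta> (g w)) \<in> regular_fun sW"
| inv_entry: "\<eta> \<in> dual_space sW \<Longrightarrow> (\<lambda>g. \<eta> (inv g w)) \<in> regular_fun sW"
| add: "r \<in> regular_fun sW \<Longrightarrow> r' \<in> regular_fun sW \<Longrightarrow> r + r' \<in> regular_fun sW"
| mult: "r \<in> regular_fun sW \<Longrightarrow> r' \<in> regular_fun sW \<Longrightarrow> r * r' \<in> regular_fun sW"

record ('k, 'w, 'm) glmod =
  gl_space :: "'m set"
  gl_scale :: "'k \<Rightarrow> 'm \<Rightarrow> 'm"
  gl_act :: "('w \<Rightarrow> 'w) \<Rightarrow> 'm \<Rightarrow> 'm"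

definition gl_module ::
    "('k::field \<Rightarrow> 'w::ab_group_add \<Rightarrow> 'w) \<Rightarrow> ('k, 'w, 'm::ab_group_add) glmod \<Rightarrow> bool" where
  "gl_module sW M \<longleftrightarrow> vector_space (gl_scale M) \<and> module.subspace (gl_scale M) (gl_space M) \<and>
     (\<forall>g\<in>GL sW. \<forall>u\<in>gl_space M. gl_act M g u \<in> gl_space M) \<and>
     (\<forall>g\<in>GL sW. \<forall>u\<in>gl_space M. \<forall>v\<in>gl_space M. gl_act M g (u + v) = gl_act M g u + gl_act M g v) \<and>
     (\<forall>g\<in>GL sW. \<forall>c. \<forall>u\<in>gl_space M. gl_act M g (gl_scale M c u) = gl_scale M c (gl_act M g u)) \<and>
     (\<forall>u\<in>gl_space M. gl_act M id u = u) \<and>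
     (\<forall>g\<in>GL sW. \<forall>h\<in>GL sW. \<forall>u\<in>gl_space M. gl_act M (g \<circ> h) u = gl_act M g (gl_act M h u))"

definition gl_submodule ::
    "('k::field \<Rightarrow> 'w::ab_group_add \<Rightarrow> 'w) \<Rightarrow> ('k, 'w, 'm::ab_group_add) glmod \<Rightarrow> 'm set \<Rightarrow> bool"
  where
  "gl_submodule sW M N \<longleftrightarrow> N \<subseteq> gl_space M \<and> module.subspace (gl_scale M) N \<and>
     (\<forall>g\<in>GL sW. \<forall>u\<in>N. gl_act M g u \<in> N)"

definition irreducible_module ::
    "('k::field \<Rightarrow> 'w::ab_group_add \<Rightarrow> 'w) \<Rightarrow> ('k, 'w, 'm::ab_group_add) glmod \<Rightarrow> bool" where
  "irreducible_module sW M \<longleftrightarrow> gl_module sW M \<and> gl_space M \<noteq> {0} \<and>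
     (\<forall>N. gl_submodule sW M N \<longrightarrow> N = {0} \<or> N = gl_space M)"

definition rational_module ::
    "('k::field \<Rightarrow> 'w::ab_group_add \<Rightarrow> 'w) \<Rightarrow> ('k, 'w, 'm::ab_group_add) glmod \<Rightarrow> bool" where
  "rational_module sW M \<longleftrightarrow> gl_module sW M \<and>
     (\<exists>B. finite B \<and> gl_space M = module.span (gl_scale M) B) \<and>
     (\<forall>\<xi>\<in>dual_space (gl_scale M). \<forall>u\<in>gl_space M. \<exists>r\<in>regular_fun sW. \<forall>g\<in>GL sW. \<xi> (gl_act M g u) = r g)"

definition isomorphic_modules ::
    "('k::field \<Rightarrow> 'w::ab_group_add \<Rightarrow> 'w) \<Rightarrow> ('k, 'w, 'm::ab_group_add) glmod
      \<Rightarrow> ('k, 'w, 'u::ab_group_add) glmod \<Rightarrow> bool" where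
  "isomorphic_modules sW M U \<longleftrightarrow> (\<exists>h. bij_betw h (gl_space M) (gl_space U) \<and>
     (\<forall>u\<in>gl_space M. \<forall>v\<in>gl_space M. h (u + v) = h u + h v) \<and>
     (\<forall>c. \<forall>u\<in>gl_space M. h (gl_scale M c u) = gl_scale U c (h u)) \<and>
     (\<forall>g\<in>GL sW. \<forall>u\<in>gl_space M. h (gl_act M g u) = gl_act U g (h u)))"

text \<open>\<open>M\<close> is the internal direct sum of the set \<open>D\<close> of irreducible submodules.\<close>

definition irreducible_decomposition ::
    "('k::field \<Rightarrow> 'w::ab_group_add \<Rightarrow> 'w) \<Rightarrow> ('k, 'w, 'm::ab_group_add) glmod
      \<Rightarrow> 'm set set \<Rightarrow> bool" where
  "irreducible_decomposition sW M D \<longleftrightarrow>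
     (\<forall>N\<in>D. gl_submodule sW M N \<and> irreducible_module sW (M\<lparr>gl_space := N\<rparr>)) \<and>
     gl_space M = module.span (gl_scale M) (\<Union>D) \<and>
     (\<forall>N\<in>D. N \<inter> module.span (gl_scale M) (\<Union>(D - {N})) = {0})"

text \<open>The (finite) number of summands isomorphic to \<open>U\<close> in a decomposition into irreducibles.\<close>

definition gl_mult ::
    "('k::field \<Rightarrow> 'w::ab_group_add \<Rightarrow> 'w) \<Rightarrow> ('k, 'w, 'm::ab_group_add) glmod
      \<Rightarrow> ('k, 'w, 'u::ab_group_add) glmod \<Rightarrow> nat" where
  "gl_mult sW M U = (THE m. \<exists>D. irreducible_decomposition sW M D \<and>
     finite {N \<in> D. isomorphic_modules sW (M\<lparr>gl_space := N\<rparr>) U} \<and>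
     m = card {N \<in> D. isomorphic_modules sW (M\<lparr>gl_space := N\<rparr>) U})"


section \<open>Schur functors\<close>

definition fscale :: "'k::field \<Rightarrow> ('a \<Rightarrow> 'k) \<Rightarrow> 'a \<Rightarrow> 'k" where
  "fscale c f = (\<lambda>a. c * f a)"

text \<open>
  The tensor power of \<open>W\<close> indexed by a finite set \<open>I\<close>, inside the multilinear forms on \<open>I\<close>-indexed
  families of linear forms on \<open>W\<close>: the pure tensor of \<open>(w c)\<close> sends \<open>(\<xi> c)\<close> to the product of all
  \<open>\<xi> c (w c)\<close>.
\<close>

definition pure_tensor ::
    "('k::field \<Rightarrow> 'w::ab_group_add \<Rightarrow> 'w) \<Rightarrow> 'i set \<Rightarrow> ('i \<Rightarrow> 'w) \<Rightarrow> ('i \<Rightarrow> 'w \<Rightarrow> 'k) \<Rightarrow> 'k" where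
  "pure_tensor sW I w = (\<lambda>\<xi>. if \<forall>c\<in>I. \<xi> c \<in> dual_space sW then \<Prod>c\<in>I. \<xi> c (w c) else 0)"

definition tensor_power ::
    "('k::field \<Rightarrow> 'w::ab_group_add \<Rightarrow> 'w) \<Rightarrow> 'i set \<Rightarrow> (('i \<Rightarrow> 'w \<Rightarrow> 'k) \<Rightarrow> 'k) set" where
  "tensor_power sW I = module.span fscale (range (pure_tensor sW I))"

definition row_group :: "nat list \<Rightarrow> (nat \<times> nat \<Rightarrow> nat \<times> nat) set" where
  "row_group lam = {p. p permutes cells lam \<and> (\<forall>c. fst (p c) = fst c)}"

definition column_group :: "nat list \<Rightarrow> (nat \<times> nat \<Rightarrow> nat \<times> nat) set" where
  "column_group lam = {q. q permutes cells lam \<and> (\<forall>c. snd (q c) = snd c)}"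

text \<open>
  A permutation \<open>p\<close> of the cells acts on tensors from the left by \<open>t \<mapsto> (\<lambda>\<xi>. t (\<xi> \<circ> p))\<close>, which
  moves the vector in position \<open>c\<close> to position \<open>p c\<close>.
\<close>

definition young_symmetrizer ::
    "nat list \<Rightarrow> ((nat \<times> nat \<Rightarrow> 'w \<Rightarrow> 'k::field) \<Rightarrow> 'k) \<Rightarrow> (nat \<times> nat \<Rightarrow> 'w \<Rightarrow> 'k) \<Rightarrow> 'k" where
  "young_symmetrizer lam t = (\<lambda>\<xi>. \<Sum>p\<in>row_group lam. \<Sum>q\<in>column_group lam.
     of_int (sign q) * t (\<xi> \<circ> p \<circ> q))"

definition schur_functor ::
    "('k::field \<Rightarrow> 'w::ab_group_add \<Rightarrow> 'w) \<Rightarrow> nat list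
      \<Rightarrow> ('k, 'w, (nat \<times> nat \<Rightarrow> 'w \<Rightarrow> 'k) \<Rightarrow> 'k) glmod" where
  "schur_functor sW lam =
     \<lparr>gl_space = young_symmetrizer lam ` tensor_power sW (cells lam),
      gl_scale = fscale,
      gl_act = (\<lambda>g t \<xi>. t (\<lambda>c. \<xi> c \<circ> g))\<rparr>"

text \<open>
  The value of \<open>f \<star> W\<close> at the irreducible representation \<open>U\<close>. Only finitely many \<open>S\<^sub>\<lambda>(W)\<close>
  contain \<open>U\<close>.
\<close>

definition sym_star ::
    "('k::field \<Rightarrow> 'w::ab_group_add \<Rightarrow> 'w) \<Rightarrow> xps \<Rightarrow> ('k, 'w, 'u::ab_group_add) glmod \<Rightarrow> int" where
  "sym_star sW f U = (\<Sum>lam | is_partition lam \<and> gl_mult sW (schur_functor sW lam) U \<noteq> 0.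
     schur_coeff f lam * int (gl_mult sW (schur_functor sW lam) U))"


section \<open>Products of ideals of subspaces\<close>

text \<open>
  The tensor product of a subspace \<open>S\<close> of \<open>V\<close> with the dual of \<open>W\<close>, inside \<open>Hom(W, V)\<close>:
  \<open>v \<otimes> \<eta>\<close> is the linear map sending \<open>w\<close> to \<open>\<eta> w\<close> times \<open>v\<close>.
\<close>

definition tensor_dual ::
    "('k::field \<Rightarrow> 'v::ab_group_add \<Rightarrow> 'v) \<Rightarrow> ('k \<Rightarrow> 'w::ab_group_add \<Rightarrow> 'w) \<Rightarrow> 'v set
      \<Rightarrow> ('w \<Rightarrow> 'v) set" where
  "tensor_dual sV sW S = module.span (\<lambda>c \<phi> w. sV c (\<phi> w))
     {(\<lambda>w. sV (\<eta> w) v) | v \<eta>. v \<in> S \<and> \<eta> \<in> dual_space sW}"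

text \<open>
  Polynomial functions on the tensor product of \<open>V\<close> with the dual of \<open>W\<close>, extended by zero to the
  whole type. The linear forms on this space are spanned by the functions \<open>\<phi> \<mapsto> \<xi> (\<phi> w)\<close>.
\<close>

inductive_set poly_fun ::
    "('k::field \<Rightarrow> 'v::ab_group_add \<Rightarrow> 'v) \<Rightarrow> ('k \<Rightarrow> 'w::ab_group_add \<Rightarrow> 'w)
      \<Rightarrow> (('w \<Rightarrow> 'v) \<Rightarrow> 'k) set" for sV sW where
  const: "(\<lambda>\<phi>. if \<phi> \<in> tensor_dual sV sW UNIV then c else 0) \<in> poly_fun sV sW"
| coord: "\<xi> \<in> dual_space sV \<Longrightarrow>
    (\<lambda>\<phi>. if \<phi> \<in> tensor_dual sV sW UNIV then \<xi> (\<phi> w) else 0) \<in> poly_fun sV sW"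
| add: "f \<in> poly_fun sV sW \<Longrightarrow> f' \<in> poly_fun sV sW \<Longrightarrow> f + f' \<in> poly_fun sV sW"
| mult: "f \<in> poly_fun sV sW \<Longrightarrow> f' \<in> poly_fun sV sW \<Longrightarrow> f * f' \<in> poly_fun sV sW"

definition vanishing_ideal ::
    "('k::field \<Rightarrow> 'v::ab_group_add \<Rightarrow> 'v) \<Rightarrow> ('k \<Rightarrow> 'w::ab_group_add \<Rightarrow> 'w) \<Rightarrow> 'v set
      \<Rightarrow> (('w \<Rightarrow> 'v) \<Rightarrow> 'k) set" where
  "vanishing_ideal sV sW S = {f \<in> poly_fun sV sW. \<forall>\<phi>\<in>tensor_dual sV sW S. f \<phi> = 0}"

text \<open>
  The product of the vanishing ideals, i.e. the ideal generated by the products of their elements.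
  The factor \<open>r\<close> makes the empty product the whole ring.
\<close>

definition prod_ideal ::
    "('k::field \<Rightarrow> 'v::ab_group_add \<Rightarrow> 'v) \<Rightarrow> ('k \<Rightarrow> 'w::ab_group_add \<Rightarrow> 'w) \<Rightarrow> ('x \<Rightarrow> 'v set)
      \<Rightarrow> 'x set \<Rightarrow> (('w \<Rightarrow> 'v) \<Rightarrow> 'k) set" where
  "prod_ideal sV sW V A = module.span fscale
     {r * (\<Prod>x\<in>A. f x) | r f. r \<in> poly_fun sV sW \<and> (\<forall>x\<in>A. f x \<in> vanishing_ideal sV sW (V x))}"

text \<open>
  An element \<open>g\<close> of \<open>GL(W)\<close> acts on \<open>v \<otimes> \<eta>\<close> by composing \<open>\<eta>\<close> with the inverse of \<open>g\<close>, hence on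
  functions by \<open>f \<mapsto> (\<lambda>\<phi>. f (\<phi> \<circ> g))\<close>.
\<close>

definition J_module ::
    "('k::field \<Rightarrow> 'v::ab_group_add \<Rightarrow> 'v) \<Rightarrow> ('k \<Rightarrow> 'w::ab_group_add \<Rightarrow> 'w) \<Rightarrow> ('x \<Rightarrow> 'v set)
      \<Rightarrow> 'x set \<Rightarrow> ('k, 'w, ('w \<Rightarrow> 'v) \<Rightarrow> 'k) glmod" where
  "J_module sV sW V A =
     \<lparr>gl_space = prod_ideal sV sW V A, gl_scale = fscale, gl_act = (\<lambda>g f \<phi>. f (\<phi> \<circ> g))\<rparr>"

end

theory Submission
  imports Defs "HOL-Computational_Algebra.Polynomial" "HOL-Computational_Algebra.Primes" "HOL-Library.Infinite_Set"
begin

text \<open>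
  A polynomial representation of \<open>GL(W)\<close> is determined by its weight multiplicities, and the Schur functor
  of \<open>\<lambda>\<close> has the Schur polynomial of \<open>\<lambda>\<close> as its character. So everything reduces to the characters of the
  ideals \<open>J_A(W)\<close>. Write \<open>V_B\<close> for the intersection of the subspaces indexed by \<open>B\<close>. Coordinate functions
  along \<open>V_B\<close> are nonzerodivisors for all \<open>J_A\<close>, \<open>A \<subseteq> B\<close>, and cutting down by all of them divides the
  characters by \<open>\<sigma>\<close> to the power \<open>dim V_B\<close> and leads to an arrangement with zero intersection. There the
  complex formed by the \<open>J_A\<close> is exact in degrees at least \<open>|B|\<close>: modulo a generic linear form this holds
  by induction on the dimension, and such a form is a sum of linear forms from the single ideals, which
  yields a contracting homotopy. Hence the alternating sum of the \<open>J_A\<close>, \<open>A \<subseteq> B\<close>, becomes after division by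
  that power of \<open>\<sigma>\<close> a polynomial of degree less than \<open>|B|\<close>, and this is the recursion defining \<open>P\<close>.
\<close>

section \<open>Linear algebra\<close>

definition (in vector_space) findim :: "'b set \<Rightarrow> bool" where
  "findim S \<longleftrightarrow> (\<exists>B. finite B \<and> S \<subseteq> span B)"

context vector_space
begin

lemma findim_mono: "findim T \<Longrightarrow> S \<subseteq> T \<Longrightarrow> findim S"
  unfolding findim_def by blast

lemma findim_span: "finite B \<Longrightarrow> findim (span B)"
  unfolding findim_def by blast

lemma findim_basis:
  assumes "subspace S" "findim S"
  obtains B where "finite B" "B \<subseteq> S" "independent B" "span B = S" "card B = dim S"
proof -
  obtain C where C: "finite C" "S \<subseteq> span C" using assms findim_def by blast
  obtain B where B: "B \<subseteq> S" "independent B" "S \<subseteq> span B" "card B = dim S"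
    using basis_exists by blast
  have "finite B" using independent_span_bound[OF C(1) B(2)] B C by auto
  moreover have "span B = S" using B assms span_minimal by blast
  ultimately show ?thesis using that B by blast
qed

lemma dim_mono_findim:
  assumes "S \<subseteq> T" "findim T"
  shows "dim S \<le> dim T"
proof -
  have "findim (span T)"
    using assms unfolding findim_def by (metis span_minimal subspace_span)
  then obtain B where B: "finite B" "span B = span T" "card B = dim (span T)"
    using findim_basis subspace_span by metis
  have "dim S \<le> card B" using B assms dim_le_card[of S B] span_superset by blast
  then show ?thesis using B by simp
qed

lemma dim_singleton_0 [simp]: "dim {0} = 0"
  using dim_span[of "{}"] dim_eq_card_independent[OF independent_empty] by simp

lemma dim_eq_0_iff:
  assumes "subspace S" "findim S"
  shows "dim S = 0 \<longleftrightarrow> S = {0}"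
  using findim_basis[OF assms] by (metis card_0_eq dim_singleton_0 span_empty)

lemma subspace_nonzero_element:
  assumes "subspace S" "S \<noteq> {0}"
  obtains u where "u \<in> S" "u \<noteq> 0"
  using assms subspace_0 by blast

lemma independent_disjoint_spans:
  assumes "independent B" "span B \<inter> span C = {0}"
  shows "B \<inter> C = {}"
proof -
  have "a = 0" if "a \<in> B" "a \<in> C" for a
    using that span_base[of a B] span_base[of a C] assms(2) by blast
  then show ?thesis using assms(1) dependent_zero by auto
qed

lemma independent_Un:
  assumes B: "independent B" and C: "independent C" and disj: "span B \<inter> span C = {0}"
  shows "independent (B \<union> C)"
proof -
  have no_relation: False
    if A: "independent A" "span A \<inter> span D = {0}" "a \<in> A" "a \<notin> D" "a \<in> span (A \<union> D - {a})" for A D a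
  proof -
    have "A \<union> D - {a} = (A - {a}) \<union> D" using A(4) by blast
    then have "a \<in> {x + y |x y. x \<in> span (A - {a}) \<and> y \<in> span D}"
      using A(5) by (simp only: span_Un)
    then obtain x y where xy: "a = x + y" "x \<in> span (A - {a})" "y \<in> span D" by blast
    have "x \<in> span A" using xy(2) span_mono[of "A - {a}" A] by blast
    then have "a - x \<in> span A" using A(3) span_base span_diff by blast
    then have "y = 0" using xy A(2) by auto
    then show False using A(1,3) xy unfolding dependent_def by auto
  qed
  have "B \<inter> C = {}" by (rule independent_disjoint_spans[OF B disj])
  show ?thesis
    unfolding dependent_def
  proof clarify
    fix a assume a: "a \<in> B \<union> C" "a \<in> span (B \<union> C - {a})"
    show False
    proof (cases "a \<in> B")
      case True
      then show ?thesis using no_relation[OF B disj True] a(2) \<open>B \<inter> C = {}\<close> by blast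
    next
      case False
      have "span C \<inter> span B = {0}" "C \<union> B = B \<union> C" using disj by auto
      then show ?thesis using no_relation[OF C, of B a] a False by simp
    qed
  qed
qed

lemma dim_direct_sum2:
  assumes S: "subspace S" "findim S" and T: "subspace T" "findim T" and "S \<inter> T = {0}"
  shows "dim (span (S \<union> T)) = dim S + dim T"
proof -
  obtain B where B: "finite B" "independent B" "span B = S" "card B = dim S"
    using findim_basis[OF S] by blast
  obtain C where C: "finite C" "independent C" "span C = T" "card C = dim T"
    using findim_basis[OF T] by blast
  have "independent (B \<union> C)" using B C assms(5) by (intro independent_Un) auto
  moreover have "B \<inter> C = {}" using B C assms(5) by (intro independent_disjoint_spans) auto
  moreover have "span (S \<union> T) = span (B \<union> C)"
    unfolding B(3)[symmetric] C(3)[symmetric] by (simp add: span_Un span_span)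
  ultimately show ?thesis
    using B C by (simp add: dim_eq_card_independent card_Un_disjoint)
qed

end

definition (in vector_space) independent_family :: "'b set set \<Rightarrow> bool" where
  "independent_family D \<longleftrightarrow> (\<forall>F v. finite F \<and> F \<subseteq> D \<and> (\<forall>N\<in>F. v N \<in> N) \<and> (\<Sum>N\<in>F. v N) = 0 \<longrightarrow>
     (\<forall>N\<in>F. v N = 0))"

context vector_space
begin

lemma independent_familyD:
  "independent_family D \<Longrightarrow> finite F \<Longrightarrow> F \<subseteq> D \<Longrightarrow> (\<And>N. N \<in> F \<Longrightarrow> v N \<in> N) \<Longrightarrow> (\<Sum>N\<in>F. v N) = 0 \<Longrightarrow>
     N \<in> F \<Longrightarrow> v N = 0"
  unfolding independent_family_def by blast

lemma independent_family_subset: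
  "independent_family D \<Longrightarrow> D' \<subseteq> D \<Longrightarrow> independent_family D'"
  unfolding independent_family_def by (meson subset_trans)

lemma independent_family_insert:
  assumes D: "independent_family D" and T: "T \<inter> span (\<Union>D) = {0}"
  shows "independent_family (insert T D)"
  unfolding independent_family_def
proof clarify
  fix F v N
  assume F: "finite F" "F \<subseteq> insert T D" "\<forall>N\<in>F. v N \<in> N" "(\<Sum>N\<in>F. v N) = 0" and N: "N \<in> F"
  have rest: "F - {T} \<subseteq> D" using F(2) by blast
  have "v T = 0" if "T \<in> F"
  proof -
    have "(\<Sum>N\<in>F-{T}. v N) \<in> span (\<Union>D)"
      using rest F(3) by (intro span_sum span_base) blast
    moreover have "v T = - (\<Sum>N\<in>F-{T}. v N)"
      using F(4) sum.remove[OF F(1) that, of v] by (simp add: add_eq_0_iff2)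
    ultimately have "v T \<in> T \<inter> span (\<Union>D)" using F(3) that span_neg by auto
    then show ?thesis using T by blast
  qed
  moreover from this have "(\<Sum>N\<in>F-{T}. v N) = 0"
    using F(1,4) by (cases "T \<in> F") (simp_all add: sum.remove)
  ultimately show "v N = 0"
    using independent_familyD[OF D _ rest, of v N] F(1,3) N by (cases "N = T") auto
qed

lemma in_span_Union_sum:
  assumes "u \<in> span (\<Union>D)" and sub: "\<And>N. N \<in> D \<Longrightarrow> subspace N"
  obtains F v where "finite F" "F \<subseteq> D" "\<And>N. N \<in> F \<Longrightarrow> v N \<in> N" "u = (\<Sum>N\<in>F. v N)"
proof -
  obtain t r where t: "finite t" "t \<subseteq> \<Union>D" "u = (\<Sum>a\<in>t. scale (r a) a)"
    using assms(1) unfolding span_explicit by blast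
  have "\<forall>a\<in>t. \<exists>N\<in>D. a \<in> N" using t(2) by blast
  then obtain g where g: "\<And>a. a \<in> t \<Longrightarrow> g a \<in> D \<and> a \<in> g a" by metis
  define v where "v N = (\<Sum>a | a \<in> t \<and> g a = N. scale (r a) a)" for N
  have "v N \<in> N" if "N \<in> g ` t" for N
    unfolding v_def using that g sub by (intro subspace_sum subspace_scale) auto
  moreover have "u = (\<Sum>N\<in>g ` t. v N)"
    unfolding t(3) v_def by (rule sum.group[symmetric]) (use t(1) in auto)
  ultimately show ?thesis using that[of "g ` t" v] g t(1) by blast
qed

lemma independent_family_Int_span:
  assumes D: "independent_family D" and sub: "\<And>N. N \<in> D \<Longrightarrow> subspace N" and N: "N \<in> D"
  shows "N \<inter> span (\<Union>(D - {N})) = {0}"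
proof -
  have "x = 0" if x: "x \<in> N" "x \<in> span (\<Union>(D - {N}))" for x
  proof -
    obtain F v where F: "finite F" "F \<subseteq> D - {N}" "\<And>M. M \<in> F \<Longrightarrow> v M \<in> M" "x = (\<Sum>M\<in>F. v M)"
      using in_span_Union_sum[OF x(2)] sub by blast
    have "(\<Sum>M\<in>F. (v(N := - x)) M) = (\<Sum>M\<in>F. v M)" using F(2) by (intro sum.cong) auto
    moreover have "N \<notin> F" using F(2) by blast
    ultimately have "(\<Sum>M\<in>insert N F. (v(N := - x)) M) = 0" using F(1,4) by simp
    then have "(v(N := - x)) N = 0"
    proof (rule independent_familyD[OF D, rotated 3])
      show "(v(N := - x)) M \<in> M" if "M \<in> insert N F" for M
        using that F(3) x(1) subspace_neg[OF sub[OF N]] by auto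
    qed (use F N in auto)
    then show "x = 0" by simp
  qed
  then show ?thesis using subspace_0[OF sub[OF N]] span_zero by blast
qed

lemma independent_familyI:
  assumes "\<And>N. N \<in> D \<Longrightarrow> N \<inter> span (\<Union>(D - {N})) = {0}"
  shows "independent_family D"
  unfolding independent_family_def
proof clarify
  fix F v N
  assume F: "finite F" "F \<subseteq> D" "\<forall>N\<in>F. v N \<in> N" "(\<Sum>N\<in>F. v N) = 0" and N: "N \<in> F"
  have "v N = - (\<Sum>M\<in>F-{N}. v M)"
    using F(4) sum.remove[OF F(1) N, of v] by (simp add: add_eq_0_iff2)
  also have "\<dots> \<in> span (\<Union>(D - {N}))"
    using F by (intro span_neg span_sum span_base) blast
  finally show "v N = 0" using assms[of N] F N by blast
qed

lemma dim_independent_family: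
  assumes "finite F" "independent_family F" "\<And>N. N \<in> F \<Longrightarrow> subspace N" "\<And>N. N \<in> F \<Longrightarrow> findim N"
  shows "findim (span (\<Union>F)) \<and> dim (span (\<Union>F)) = (\<Sum>N\<in>F. dim N)"
  using assms
proof (induction F)
  case empty
  show ?case using findim_span[of "{}"] by simp
next
  case (insert N F)
  have IH: "findim (span (\<Union>F))" "dim (span (\<Union>F)) = (\<Sum>N\<in>F. dim N)"
    using insert independent_family_subset by auto
  have N: "subspace N" "findim N" using insert.prems by auto
  have "insert N F - {N} = F" using insert.hyps by simp
  then have disj: "N \<inter> span (\<Union>F) = {0}"
    using independent_family_Int_span[OF insert.prems(1) insert.prems(2), of N] by simp
  have split: "span (\<Union>(insert N F)) = span (N \<union> span (\<Union>F))" by (simp add: span_Un span_span)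
  obtain B C where BC: "finite B" "N \<subseteq> span B" "finite C" "span (\<Union>F) \<subseteq> span C"
    using N(2) IH(1) unfolding findim_def by blast
  have "N \<union> span (\<Union>F) \<subseteq> span (B \<union> C)"
    using BC span_mono[of B "B \<union> C"] span_mono[of C "B \<union> C"] by auto
  then have "findim (span (\<Union>(insert N F)))"
    unfolding split findim_def using BC by (meson finite_UnI span_minimal subspace_span)
  then show ?case
    using dim_direct_sum2[OF N subspace_span IH(1) disj] IH(2) insert.hyps split by simp
qed

lemma finite_independent_family:
  assumes D: "independent_family D" "\<And>N. N \<in> D \<Longrightarrow> subspace N" "\<And>N. N \<in> D \<Longrightarrow> N \<noteq> {0}"
    and fin: "findim (\<Union>D)"
  shows "finite D"
proof -
  obtain B where B: "finite B" "\<Union>D \<subseteq> span B" using fin findim_def by blast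
  have bound: "card F \<le> card B" if F: "finite F" "F \<subseteq> D" for F
  proof -
    have "findim N" if "N \<in> F" for N using findim_mono[OF fin] that F by blast
    then have eq: "dim (span (\<Union>F)) = (\<Sum>N\<in>F. dim N)" and pos: "\<And>N. N \<in> F \<Longrightarrow> 1 \<le> dim N"
      using dim_independent_family[OF F(1) independent_family_subset[OF D(1) F(2)]] D(2,3) F(2) dim_eq_0_iff
      by (auto simp: Suc_le_eq subset_iff intro!: gr0I)
    have "card F = (\<Sum>N\<in>F. 1)" by simp
    also have "\<dots> \<le> dim (span (\<Union>F))" unfolding eq by (rule sum_mono) (rule pos)
    also have "\<dots> \<le> card B"
      by (rule dim_le_card[OF span_minimal[OF _ subspace_span] B(1)]) (use B(2) F(2) in blast)
    finally show ?thesis .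
  qed
  show ?thesis
  proof (rule ccontr)
    assume "infinite D"
    then obtain F where "F \<subseteq> D" "card F = Suc (card B)" "finite F"
      using infinite_arbitrarily_large by blast
    then show False using bound by fastforce
  qed
qed

end

context vector_space_pair
begin

lemma findim_image:
  assumes f: "Vector_Spaces.linear s1 s2 f" and S: "vs1.findim S"
  shows "vs2.findim (f ` S)"
proof -
  obtain B where B: "finite B" "S \<subseteq> vs1.span B" using S vs1.findim_def by blast
  have "f ` S \<subseteq> vs2.span (f ` B)" using B linear_span_image[OF f, of B] by auto
  then show ?thesis using B vs2.findim_def by blast
qed

lemma dim_image_inj:
  assumes f: "Vector_Spaces.linear s1 s2 f" and S: "vs1.subspace S" and inj: "inj_on f S"
  shows "vs2.dim (f ` S) = vs1.dim S"
proof -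
  obtain B where B: "B \<subseteq> S" "vs1.independent B" "S \<subseteq> vs1.span B" "card B = vs1.dim S"
    using vs1.basis_exists by blast
  have S_eq: "vs1.span B = S" using B S vs1.span_minimal by blast
  then have "vs2.independent (f ` B)"
    using linear_independent_injective_image[OF f B(2)] inj by simp
  moreover have "vs2.span (f ` B) = f ` S" unfolding linear_span_image[OF f] S_eq ..
  ultimately show ?thesis
    using vs2.dim_span_eq_card_independent card_image[OF inj_on_subset[OF inj B(1)]] B(4) by metis
qed

lemma linear_inj_on_iff_kernel:
  assumes f: "Vector_Spaces.linear s1 s2 f" and S: "vs1.subspace S"
  shows "inj_on f S \<longleftrightarrow> {s \<in> S. f s = 0} = {0}"
  using linear_inj_on_iff_eq_0[OF f S] vs1.subspace_0[OF S] linear_0[OF f] by auto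

lemma subspace_kernel_on:
  assumes f: "Vector_Spaces.linear s1 s2 f" and S: "vs1.subspace S"
  shows "vs1.subspace {s \<in> S. f s = 0}"
  using S unfolding vs1.subspace_def
  by (auto simp: linear_0[OF f] linear_add[OF f] linear_scale[OF f])

lemma rank_nullity:
  assumes f: "Vector_Spaces.linear s1 s2 f" and S: "vs1.subspace S" "vs1.findim S"
  shows "vs1.dim S = vs1.dim {s \<in> S. f s = 0} + vs2.dim (f ` S)"
proof -
  let ?K = "{s \<in> S. f s = 0}"
  obtain g where g: "range g \<subseteq> S" "Vector_Spaces.linear s2 s1 g" "\<And>v. v \<in> f ` S \<Longrightarrow> f (g v) = v"
    using linear_exists_right_inverse_on[OF f S(1)] by blast
  interpret swap: vector_space_pair s2 s1 ..
  let ?C = "g ` f ` S"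
  have C: "vs1.subspace ?C" "?C \<subseteq> S"
    using swap.linear_subspace_image[OF g(2) linear_subspace_image[OF f S(1)]] g(1) by auto
  have inj: "inj_on f ?C" using g(3) by (auto simp: inj_on_def)
  have "f ` ?C = f ` S" by (simp add: image_image g(3))
  then have dim_C: "vs1.dim ?C = vs2.dim (f ` S)" using dim_image_inj[OF f C(1) inj] by simp
  have disj: "?K \<inter> ?C = {0}"
    using inj C vs1.subspace_0[OF S(1)] linear_0[OF f] linear_inj_on_iff_kernel[OF f C(1)] by blast
  have "S \<subseteq> vs1.span (?K \<union> ?C)"
  proof
    fix s assume s: "s \<in> S"
    have "s - g (f s) \<in> ?K"
      using s g(1,3) vs1.subspace_diff[OF S(1) s, of "g (f s)"] linear_diff[OF f] by auto
    then have "(s - g (f s)) + g (f s) \<in> vs1.span (?K \<union> ?C)"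
      using s by (intro vs1.span_add vs1.span_base) auto
    then show "s \<in> vs1.span (?K \<union> ?C)" by simp
  qed
  then have "vs1.span (?K \<union> ?C) = S" using C(2) S(1) vs1.span_minimal[of "?K \<union> ?C" S] by blast
  then show ?thesis
    using vs1.dim_direct_sum2[OF subspace_kernel_on[OF f S(1)] _ C(1) _ disj] dim_C
      vs1.findim_mono[OF S(2)] C(2) by auto
qed

lemma dim_eq_of_exact_pair:
  assumes f: "Vector_Spaces.linear s1 s2 f" and g: "Vector_Spaces.linear s2 s1 g"
    and S: "vs1.subspace S" "vs1.findim S" and T: "vs2.subspace T" "vs2.findim T"
    and "g ` T = {s \<in> S. f s = 0}" "f ` S = {t \<in> T. g t = 0}"
  shows "vs1.dim S = vs2.dim T"
proof -
  interpret swap: vector_space_pair s2 s1 ..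
  show ?thesis using rank_nullity[OF f S] swap.rank_nullity[OF g T] assms(7,8) by simp
qed

lemma linear_extend_vanishing:
  assumes U: "vs1.subspace U" and T: "vs1.subspace T" and f: "Vector_Spaces.linear s1 s2 f"
    and zero: "\<And>u. u \<in> U \<Longrightarrow> u \<in> T \<Longrightarrow> f u = 0"
  obtains g where "Vector_Spaces.linear s1 s2 g" "\<And>t. t \<in> T \<Longrightarrow> g t = 0" "\<And>u. u \<in> U \<Longrightarrow> g u = f u"
proof -
  interpret endo: vector_space_pair s1 s1 ..
  obtain p where p: "range p \<subseteq> T" "Vector_Spaces.linear s1 s1 p" "\<And>t. t \<in> T \<Longrightarrow> p t = t"
    using endo.linear_exists_left_inverse_on[OF vs1.linear_id T] by auto
  define q where "q v = v - p v" for v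
  have q: "Vector_Spaces.linear s1 s1 q"
    unfolding q_def using endo.linear_compose_sub[OF vs1.linear_id p(2)] by simp
  obtain r where r: "range r \<subseteq> U" "Vector_Spaces.linear s1 s1 r" "\<And>v. v \<in> q ` U \<Longrightarrow> q (r v) = v"
    using endo.linear_exists_right_inverse_on[OF q U] by blast
  have "f (r (q u)) = f u" if u: "u \<in> U" for u
  proof -
    let ?d = "r (q u) - u"
    have "q ?d = 0" using r(3)[of "q u"] u endo.linear_diff[OF q] by simp
    then have "?d \<in> T" using p(1) unfolding q_def by (metis eq_iff_diff_eq_0 rangeI subsetD)
    moreover have "?d \<in> U" using r(1) u vs1.subspace_diff[OF U] by blast
    ultimately have "f ?d = 0" by (rule zero[rotated])
    then show ?thesis by (simp add: linear_diff[OF f])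
  qed
  moreover have "f (r (q t)) = 0" if "t \<in> T" for t
    using p(3)[OF that] endo.linear_0[OF r(2)] linear_0[OF f] by (simp add: q_def)
  moreover have "Vector_Spaces.linear s1 s2 (\<lambda>v. f (r (q v)))"
    using Vector_Spaces.linear_compose[OF Vector_Spaces.linear_compose[OF q r(2)] f] by (simp add: comp_def)
  ultimately show ?thesis using that by blast
qed

lemma partial_linear_extend:
  assumes S: "vs1.subspace S" and add: "\<And>u v. u \<in> S \<Longrightarrow> v \<in> S \<Longrightarrow> f (u + v) = f u + f v"
    and scale: "\<And>c u. u \<in> S \<Longrightarrow> f (s1 c u) = s2 c (f u)"
  obtains g where "Vector_Spaces.linear s1 s2 g" "\<And>u. u \<in> S \<Longrightarrow> g u = f u"
proof -
  obtain B where B: "B \<subseteq> S" "vs1.independent B" "S \<subseteq> vs1.span B"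
    by (rule vs1.basis_exists[of S])
  let ?g = "construct B f"
  have g: "Vector_Spaces.linear s1 s2 ?g" by (rule linear_construct[OF B(2)])
  have "f 0 = 0" using scale[OF vs1.subspace_0[OF S], of 0] by simp
  then have "vs1.subspace {u \<in> S. ?g u = f u}"
    using S unfolding vs1.subspace_def
    by (auto simp: linear_0[OF g] linear_add[OF g] linear_scale[OF g] add scale)
  then have "vs1.span B \<subseteq> {u \<in> S. ?g u = f u}"
    using B(1) construct_basis[OF B(2)] by (intro vs1.span_minimal) auto
  then show ?thesis using that[OF g] B(3) by blast
qed

end

definition (in vector_space) spectral :: "('b \<Rightarrow> 'b) \<Rightarrow> 'a \<Rightarrow> 'a set \<Rightarrow> ('b \<Rightarrow> 'b) \<Rightarrow> bool" where
  "spectral H \<theta> \<Theta> P \<longleftrightarrow> Vector_Spaces.linear scale scale P \<and>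
    (\<forall>u. H u = scale \<theta> u \<longrightarrow> P u = u) \<and> (\<forall>\<eta>\<in>\<Theta>. \<forall>u. H u = scale \<eta> u \<longrightarrow> P u = 0) \<and>
    (\<forall>S. subspace S \<longrightarrow> (\<forall>u\<in>S. H u \<in> S) \<longrightarrow> (\<forall>u\<in>S. P u \<in> S)) \<and>
    (\<forall>F. Vector_Spaces.linear scale scale F \<longrightarrow> (\<forall>u. F (H u) = H (F u)) \<longrightarrow> (\<forall>u. F (P u) = P (F u)))"

lemma (in vector_space) spectral_insert:
  assumes H: "Vector_Spaces.linear scale scale H" and \<eta>: "\<theta> \<noteq> \<eta>" and P: "spectral H \<theta> \<Theta> P"
  shows "spectral H \<theta> (insert \<eta> \<Theta>) (\<lambda>u. scale (1 / (\<theta> - \<eta>)) (H (P u) - scale \<eta> (P u)))" (is "spectral _ _ _ ?Q")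
proof -
  interpret endo: vector_space_pair scale scale ..
  have linP: "Vector_Spaces.linear scale scale P"
    and fixed: "\<And>u. H u = scale \<theta> u \<Longrightarrow> P u = u"
    and killed: "\<And>\<nu> u. \<nu> \<in> \<Theta> \<Longrightarrow> H u = scale \<nu> u \<Longrightarrow> P u = 0"
    and inv: "\<And>S u. subspace S \<Longrightarrow> \<forall>u\<in>S. H u \<in> S \<Longrightarrow> u \<in> S \<Longrightarrow> P u \<in> S"
    and comm: "\<And>F u. Vector_Spaces.linear scale scale F \<Longrightarrow> \<forall>u. F (H u) = H (F u) \<Longrightarrow> F (P u) = P (F u)"
    using P by (auto simp: spectral_def)
  have "Vector_Spaces.linear scale scale ?Q"
    by (intro endo.linear_compose_scale_right endo.linear_compose_sub linP
        Vector_Spaces.linear_compose[OF linP H, unfolded comp_def])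
  moreover have "?Q u = u" if "H u = scale \<theta> u" for u
    using \<eta> fixed[OF that] by (simp add: that flip: scale_left_diff_distrib)
  moreover have "?Q u = 0" if \<nu>: "\<nu> \<in> insert \<eta> \<Theta>" "H u = scale \<nu> u" for \<nu> u
  proof (cases "\<nu> = \<eta>")
    case True
    have "H (P u) = P (H u)" by (rule comm[OF H]) simp
    then show ?thesis using True \<nu>(2) by (simp add: endo.linear_scale[OF linP])
  next
    case False
    then show ?thesis using killed[of \<nu> u] \<nu> by (simp add: endo.linear_0[OF H])
  qed
  moreover have "?Q u \<in> S" if S: "subspace S" "\<forall>u\<in>S. H u \<in> S" "u \<in> S" for S u
    using S inv[OF S] by (intro subspace_scale subspace_diff) auto
  moreover have "F (?Q u) = ?Q (F u)" if F: "Vector_Spaces.linear scale scale F" "\<forall>u. F (H u) = H (F u)" for F u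
    using F(2) comm[OF F] by (simp add: endo.linear_scale[OF F(1)] endo.linear_diff[OF F(1)])
  ultimately show ?thesis unfolding spectral_def by blast
qed

lemma (in vector_space) spectral_projection:
  assumes H: "Vector_Spaces.linear scale scale H" and \<Theta>: "finite \<Theta>" "\<theta> \<notin> \<Theta>"
  obtains P where "Vector_Spaces.linear scale scale P" "\<And>u. H u = scale \<theta> u \<Longrightarrow> P u = u"
    "\<And>\<eta> u. \<eta> \<in> \<Theta> \<Longrightarrow> H u = scale \<eta> u \<Longrightarrow> P u = 0"
    "\<And>S u. subspace S \<Longrightarrow> (\<And>u. u \<in> S \<Longrightarrow> H u \<in> S) \<Longrightarrow> u \<in> S \<Longrightarrow> P u \<in> S"
    "\<And>F u. Vector_Spaces.linear scale scale F \<Longrightarrow> (\<And>u. F (H u) = H (F u)) \<Longrightarrow> F (P u) = P (F u)"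
proof -
  have "\<exists>P. spectral H \<theta> \<Theta> P"
    using \<Theta>
  proof (induction \<Theta>)
    case empty
    have "spectral H \<theta> {} (\<lambda>u. u)" unfolding spectral_def using linear_ident by simp
    then show ?case by blast
  next
    case (insert \<eta> \<Theta>)
    then show ?case using spectral_insert[OF H] by (metis insertCI)
  qed
  then obtain P where "spectral H \<theta> \<Theta> P" ..
  then show ?thesis by (intro that[of P]) (auto simp: spectral_def)
qed

lemma (in vector_space) eigen_components_in_subspace:
  assumes H: "Vector_Spaces.linear scale scale H" and S: "subspace S" "\<And>u. u \<in> S \<Longrightarrow> H u \<in> S"
    and F: "finite F" "inj_on \<theta> F" "\<And>i. i \<in> F \<Longrightarrow> H (u i) = scale (\<theta> i) (u i)"
    and sum: "(\<Sum>i\<in>F. u i) \<in> S" and j: "j \<in> F"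
  shows "u j \<in> S"
proof -
  interpret endo: vector_space_pair scale scale ..
  have "finite (\<theta> ` (F - {j}))" "\<theta> j \<notin> \<theta> ` (F - {j})" using F(1,2) j by (auto simp: inj_on_def)
  then obtain P where P: "Vector_Spaces.linear scale scale P" "\<And>v. H v = scale (\<theta> j) v \<Longrightarrow> P v = v"
    "\<And>\<eta> v. \<eta> \<in> \<theta> ` (F - {j}) \<Longrightarrow> H v = scale \<eta> v \<Longrightarrow> P v = 0"
    "\<And>S u. subspace S \<Longrightarrow> (\<And>u. u \<in> S \<Longrightarrow> H u \<in> S) \<Longrightarrow> u \<in> S \<Longrightarrow> P u \<in> S"
    by (rule spectral_projection[OF H]) blast
  have "P (\<Sum>i\<in>F. u i) = (\<Sum>i\<in>F. if i = j then u j else 0)"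
    unfolding endo.linear_sum[OF P(1)] using P(2,3) F(3) by (intro sum.cong) auto
  then have "P (\<Sum>i\<in>F. u i) = u j" using F(1) j by simp
  then show ?thesis using P(4)[OF S sum] by simp
qed

lemma (in finite_dimensional_vector_space) finite_eigenvalues:
  assumes X: "Vector_Spaces.linear scale scale X"
  shows "finite {\<theta>. \<exists>w. w \<noteq> 0 \<and> X w = scale \<theta> w}" (is "finite ?\<Theta>")
proof (rule ccontr)
  interpret endo: vector_space_pair scale scale ..
  assume "infinite ?\<Theta>"
  then obtain F where F: "F \<subseteq> ?\<Theta>" "card F = Suc (card Basis)" "finite F"
    using infinite_arbitrarily_large by blast
  then obtain v where v: "\<And>\<theta>. \<theta> \<in> F \<Longrightarrow> v \<theta> \<noteq> 0 \<and> X (v \<theta>) = scale \<theta> (v \<theta>)"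
    using bchoice[of F "\<lambda>\<theta> w. w \<noteq> 0 \<and> X w = scale \<theta> w"] by blast
  have inj: "inj_on v F"
    by (rule inj_onI) (metis v scale_right_imp_eq)
  have "independent (v ` F)"
  proof (rule independent_if_scalars_zero)
    show "finite (v ` F)" using F by simp
    fix f x assume zero: "(\<Sum>x\<in>v ` F. scale (f x) x) = 0" and "x \<in> v ` F"
    then obtain \<theta> where \<theta>: "\<theta> \<in> F" "x = v \<theta>" by blast
    have "scale (f (v \<theta>)) (v \<theta>) \<in> {0}"
    proof (rule eigen_components_in_subspace[OF X _ _ F(3) _ _ _ \<theta>(1), where \<theta>="\<lambda>\<theta>. \<theta>"])
      show "X (scale (f (v \<theta>)) (v \<theta>)) = scale \<theta> (scale (f (v \<theta>)) (v \<theta>))" if "\<theta> \<in> F" for \<theta>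
        using v[OF that] by (simp add: endo.linear_scale[OF X] mult.commute)
      show "(\<Sum>\<theta>\<in>F. scale (f (v \<theta>)) (v \<theta>)) \<in> {0}" using zero by (simp add: sum.reindex[OF inj])
    qed (auto simp: endo.linear_0[OF X])
    then show "f x = 0" using v[OF \<theta>(1)] \<theta>(2) by simp
  qed
  then have "card (v ` F) \<le> card Basis"
    using independent_span_bound[OF finite_Basis, of "v ` F"] by (simp add: span_Basis)
  then show False using F(2) card_image[OF inj] by simp
qed

definition (in vector_space) eigenspace :: "('b \<Rightarrow> 'b) \<Rightarrow> 'b set \<Rightarrow> 'a \<Rightarrow> 'b set" where
  "eigenspace H N \<theta> = {u \<in> N. H u = scale \<theta> u}"

context vector_space
begin

lemma eigenspace_subset: "eigenspace H N \<theta> \<subseteq> N"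
  by (auto simp: eigenspace_def)

lemma subspace_eigenspace:
  assumes H: "Vector_Spaces.linear scale scale H" and N: "subspace N"
  shows "subspace (eigenspace H N \<theta>)"
proof -
  interpret endo: vector_space_pair scale scale ..
  show ?thesis
    using N unfolding subspace_def eigenspace_def
    by (auto simp: endo.linear_0[OF H] endo.linear_add[OF H] endo.linear_scale[OF H] scale_right_distrib
        scale_left_commute)
qed

lemma eigenspace_span:
  assumes H: "Vector_Spaces.linear scale scale H" and v: "\<And>j. j \<in> J \<Longrightarrow> H (v j) = scale (w j) (v j)"
  shows "eigenspace H (span (v ` J)) \<theta> = span (v ` {j \<in> J. w j = \<theta>})"
proof
  interpret endo: vector_space_pair scale scale ..
  show "span (v ` {j \<in> J. w j = \<theta>}) \<subseteq> eigenspace H (span (v ` J)) \<theta>"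
    by (intro span_minimal subspace_eigenspace[OF H subspace_span]) (auto simp: eigenspace_def v span_base)
  show "eigenspace H (span (v ` J)) \<theta> \<subseteq> span (v ` {j \<in> J. w j = \<theta>})"
  proof
    fix u assume "u \<in> eigenspace H (span (v ` J)) \<theta>"
    then have u: "u \<in> span (v ` J)" "H u = scale \<theta> u" by (auto simp: eigenspace_def)
    obtain t r where t: "finite t" "t \<subseteq> v ` J" "u = (\<Sum>x\<in>t. scale (r x) x)"
      using u(1) unfolding span_explicit by blast
    obtain F where F: "F \<subseteq> J" "inj_on v F" "t = v ` F" using t(2) unfolding subset_image_inj by blast
    have "finite F" using t(1) F(2,3) finite_imageD by blast
    then have "finite (w ` F - {\<theta>})" "\<theta> \<notin> w ` F - {\<theta>}" by auto
    then obtain P where P: "Vector_Spaces.linear scale scale P" "\<And>v. H v = scale \<theta> v \<Longrightarrow> P v = v"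
      "\<And>\<eta> v. \<eta> \<in> w ` F - {\<theta>} \<Longrightarrow> H v = scale \<eta> v \<Longrightarrow> P v = 0"
      by (rule spectral_projection[OF H]) blast
    have "u = P u" using P(2)[OF u(2)] by simp
    also have "\<dots> = (\<Sum>j\<in>F. scale (r (v j)) (P (v j)))"
      unfolding t(3) F(3) by (simp add: sum.reindex[OF F(2)] endo.linear_sum[OF P(1)] endo.linear_scale[OF P(1)])
    also have "\<dots> \<in> span (v ` {j \<in> J. w j = \<theta>})"
    proof (intro span_sum span_scale)
      fix j assume j: "j \<in> F"
      have "P (v j) = (if w j = \<theta> then v j else 0)"
        using P(2)[of "v j"] P(3)[of "w j" "v j"] v[of j] F(1) j by (cases "w j = \<theta>") auto
      then show "P (v j) \<in> span (v ` {j \<in> J. w j = \<theta>})" using j F(1) by (auto intro: span_base span_zero)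
    qed
    finally show "u \<in> span (v ` {j \<in> J. w j = \<theta>})" .
  qed
qed

lemma eigenspace_span_Union:
  assumes H: "Vector_Spaces.linear scale scale H" and D: "independent_family D"
    and sub: "\<And>N. N \<in> D \<Longrightarrow> subspace N" and inv: "\<And>N u. N \<in> D \<Longrightarrow> u \<in> N \<Longrightarrow> H u \<in> N"
  shows "eigenspace H (span (\<Union>D)) \<theta> = span (\<Union>N\<in>D. eigenspace H N \<theta>)"
proof
  interpret endo: vector_space_pair scale scale ..
  show "span (\<Union>N\<in>D. eigenspace H N \<theta>) \<subseteq> eigenspace H (span (\<Union>D)) \<theta>"
    by (intro span_minimal subspace_eigenspace[OF H subspace_span]) (auto simp: eigenspace_def intro: span_base)
  show "eigenspace H (span (\<Union>D)) \<theta> \<subseteq> span (\<Union>N\<in>D. eigenspace H N \<theta>)"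
  proof
    fix u assume "u \<in> eigenspace H (span (\<Union>D)) \<theta>"
    then have u: "u \<in> span (\<Union>D)" "H u = scale \<theta> u" by (auto simp: eigenspace_def)
    obtain F v where F: "finite F" "F \<subseteq> D" "\<And>N. N \<in> F \<Longrightarrow> v N \<in> N" "u = (\<Sum>N\<in>F. v N)"
      using in_span_Union_sum[OF u(1) sub] by blast
    have zero: "(\<Sum>N\<in>F. H (v N) - scale \<theta> (v N)) = 0"
      using u(2) by (simp add: F(4) endo.linear_sum[OF H] scale_sum_right sum_subtractf)
    have "H (v N) - scale \<theta> (v N) \<in> N" if "N \<in> F" for N
      using that F(2) F(3)[OF that] by (intro subspace_diff subspace_scale sub inv) auto
    then have "H (v N) - scale \<theta> (v N) = 0" if "N \<in> F" for N
      using independent_familyD[OF D F(1,2) _ zero that] by blast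
    then have "v N \<in> eigenspace H N \<theta>" if "N \<in> F" for N
      using that F(3) by (simp add: eigenspace_def)
    then show "u \<in> span (\<Union>N\<in>D. eigenspace H N \<theta>)"
      unfolding F(4) using F(2) by (intro span_sum span_base) blast
  qed
qed

lemma dim_eigenspace_span_Union:
  assumes H: "Vector_Spaces.linear scale scale H" and D: "independent_family D"
    and sub: "\<And>N. N \<in> D \<Longrightarrow> subspace N" and inv: "\<And>N u. N \<in> D \<Longrightarrow> u \<in> N \<Longrightarrow> H u \<in> N"
    and fin: "findim (eigenspace H (span (\<Union>D)) \<theta>)"
  shows "finite {N \<in> D. eigenspace H N \<theta> \<noteq> {0}}" (is "finite ?D")
    and "dim (eigenspace H (span (\<Union>D)) \<theta>) = (\<Sum>N | N \<in> D \<and> eigenspace H N \<theta> \<noteq> {0}. dim (eigenspace H N \<theta>))"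
proof -
  let ?E = "\<lambda>N. eigenspace H N \<theta>"
  have subE: "subspace (?E N)" if "N \<in> D" for N by (rule subspace_eigenspace[OF H sub[OF that]])
  have finE: "findim (?E N)" if "N \<in> D" for N
    by (rule findim_mono[OF fin]) (use that in \<open>auto simp: eigenspace_def intro: span_base\<close>)
  have inj: "inj_on ?E ?D"
  proof (rule inj_onI, rule ccontr)
    fix M N assume *: "M \<in> ?D" "N \<in> ?D" "?E M = ?E N" "M \<noteq> N"
    then obtain x where x: "x \<in> ?E M" "x \<noteq> 0" using subspace_nonzero_element[OF subE] by blast
    have "x \<in> N" "x \<in> M" using x * eigenspace_subset by blast+
    then have "x \<in> M \<inter> span (\<Union>(D - {M}))" using * by (auto intro: span_base)
    then show False using independent_family_Int_span[OF D sub, of M] * x(2) by auto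
  qed
  have ind: "independent_family (?E ` ?D)"
    unfolding independent_family_def
  proof clarify
    fix F v E
    assume F: "finite F" "F \<subseteq> ?E ` ?D" "\<forall>E\<in>F. v E \<in> E" "(\<Sum>E\<in>F. v E) = 0" and E: "E \<in> F"
    obtain G where G: "finite G" "G \<subseteq> ?D" "F = ?E ` G" using finite_subset_image[OF F(1,2)] by blast
    have "(\<Sum>N\<in>G. v (?E N)) = 0"
      using F(4) sum.reindex[OF inj_on_subset[OF inj G(2)], of v] by (simp add: G(3))
    moreover have "v (?E N) \<in> N" if "N \<in> G" for N using F(3) G(3) that eigenspace_subset by blast
    ultimately have "v (?E N) = 0" if "N \<in> G" for N
      using independent_familyD[OF D G(1), of "\<lambda>N. v (?E N)" N] G(2) that by auto
    then show "v E = 0" using E G(3) by auto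
  qed
  have span_eq: "eigenspace H (span (\<Union>D)) \<theta> = span (\<Union>(?E ` ?D))"
  proof -
    have "(\<Union>N\<in>D. ?E N) \<subseteq> insert 0 (\<Union>(?E ` ?D))" by blast
    then have "span (\<Union>N\<in>D. ?E N) \<subseteq> span (\<Union>(?E ` ?D))"
      using span_mono[of _ "insert 0 (\<Union>(?E ` ?D))"] by (simp only: span_insert_0)
    moreover have "span (\<Union>(?E ` ?D)) \<subseteq> span (\<Union>N\<in>D. ?E N)" by (rule span_mono) blast
    moreover have "eigenspace H (span (\<Union>D)) \<theta> = span (\<Union>N\<in>D. ?E N)"
      by (rule eigenspace_span_Union[OF H D sub inv])
    ultimately show ?thesis by (simp only: subset_antisym)
  qed
  have "findim (\<Union>(?E ` ?D))" using findim_mono[OF fin] span_eq span_superset by blast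
  then have "finite (?E ` ?D)"
    using finite_independent_family[OF ind] subE by blast
  then show fin': "finite ?D" using finite_imageD inj by blast
  have "dim (eigenspace H (span (\<Union>D)) \<theta>) = (\<Sum>E\<in>?E ` ?D. dim E)"
    unfolding span_eq using dim_independent_family[OF _ ind] fin' subE finE by auto
  then show "dim (eigenspace H (span (\<Union>D)) \<theta>) = (\<Sum>N\<in>?D. dim (?E N))"
    by (simp add: sum.reindex[OF inj])
qed

end

section \<open>Function spaces\<close>

lemma sum_fun_apply: "(\<Sum>i\<in>A. f i) x = (\<Sum>i\<in>A. f i x)"
  by (induction A rule: infinite_finite_induct) auto

interpretation fs: vector_space "fscale :: 'k::field \<Rightarrow> ('a \<Rightarrow> 'k) \<Rightarrow> 'a \<Rightarrow> 'k"
  by unfold_locales (auto simp: fscale_def algebra_simps fun_eq_iff)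

interpretation fsp: vector_space_pair "fscale :: 'k::field \<Rightarrow> ('a \<Rightarrow> 'k) \<Rightarrow> 'a \<Rightarrow> 'k"
  "fscale :: 'k::field \<Rightarrow> ('b \<Rightarrow> 'k) \<Rightarrow> 'b \<Rightarrow> 'k" ..

abbreviation flinear :: "(('a \<Rightarrow> 'k::field) \<Rightarrow> 'b \<Rightarrow> 'k) \<Rightarrow> bool" where
  "flinear \<equiv> Vector_Spaces.linear fscale fscale"

lemma flinearI:
  "(\<And>u v. f (u + v) = f u + f v) \<Longrightarrow> (\<And>c u. f (fscale c u) = fscale c (f u)) \<Longrightarrow> flinear f"
  by (simp add: Vector_Spaces.linear_iff fs.vector_space_axioms)

lemma fscale_apply: "fscale c f x = c * f x"
  by (simp add: fscale_def)

lemmas fs_simps = fun_eq_iff fscale_apply sum_fun_apply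

lemma flinear_id: "flinear (\<lambda>t. t)"
  by (rule flinearI) auto

lemma flinear_compose: "flinear F \<Longrightarrow> flinear F' \<Longrightarrow> flinear (\<lambda>t. F (F' t))"
  by (rule flinearI) (simp_all only: fsp.linear_add fsp.linear_scale)

lemma flinear_sum: "(\<And>i. i \<in> A \<Longrightarrow> flinear (F i)) \<Longrightarrow> flinear (\<lambda>t. \<Sum>i\<in>A. F i t)"
  by (rule fsp.linear_compose_sum) auto

lemma flinear_scale: "flinear F \<Longrightarrow> flinear (\<lambda>t. fscale c (F t))"
  by (rule fsp.linear_compose_scale_right)

lemma flinear_times: "flinear (\<lambda>f. g * f)" for g :: "'a \<Rightarrow> 'k::field"
  by (rule flinearI) (auto simp: fs_simps algebra_simps)

lemma flinear_precompose: "flinear (\<lambda>f x. f (\<phi> x))"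
  by (rule flinearI) (auto simp: fs_simps)

lemma subspace_is_kernel:
  fixes S :: "('a \<Rightarrow> 'k::field) set"
  assumes "fs.subspace S"
  obtains q :: "('a \<Rightarrow> 'k) \<Rightarrow> 'a \<Rightarrow> 'k" where "flinear q" "\<forall>u. q u = 0 \<longleftrightarrow> u \<in> S"
proof -
  obtain p where p: "range p \<subseteq> S" "flinear p" "\<And>v. v \<in> S \<Longrightarrow> p v = v"
    using fsp.linear_exists_left_inverse_on[OF flinear_id assms] by auto
  show ?thesis
  proof (rule that[of "\<lambda>u. u - p u"])
    show "flinear (\<lambda>u. u - p u)" by (rule fsp.linear_compose_sub[OF flinear_id p(2)])
    show "\<forall>u. u - p u = 0 \<longleftrightarrow> u \<in> S" using p(1,3) by (auto simp: subset_iff)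
  qed
qed

lemma polynomial_curve_in_subspace:
  fixes v :: "'i \<Rightarrow> 'a \<Rightarrow> 'k::field"
  assumes A: "infinite A" and S: "fs.subspace S" and F: "finite F"
    and inS: "\<And>s. s \<in> A \<Longrightarrow> (\<Sum>i\<in>F. fscale (s ^ e i) (v i)) \<in> S"
  shows "(\<Sum>i\<in>F. fscale (s ^ e i) (v i)) \<in> S"
proof -
  obtain q :: "('a \<Rightarrow> 'k) \<Rightarrow> 'a \<Rightarrow> 'k" where q: "flinear q" "\<forall>u. q u = 0 \<longleftrightarrow> u \<in> S"
    by (rule subspace_is_kernel[OF S])
  have "q (\<Sum>i\<in>F. fscale (s ^ e i) (v i)) x = 0" for x
  proof -
    let ?p = "\<Sum>i\<in>F. monom (q (v i) x) (e i)"
    have eval: "poly ?p s = q (\<Sum>i\<in>F. fscale (s ^ e i) (v i)) x" for s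
      by (simp add: poly_sum poly_monom fsp.linear_sum[OF q(1)] fsp.linear_scale[OF q(1)] sum_fun_apply
          fscale_apply mult.commute)
    have "q (\<Sum>i\<in>F. fscale (s ^ e i) (v i)) = 0" if "s \<in> A" for s using inS[OF that] q(2) by blast
    then have "poly ?p s = 0" if "s \<in> A" for s using that by (simp add: eval)
    then have "A \<subseteq> {s. poly ?p s = 0}" by blast
    then have "?p = 0" using poly_roots_finite A finite_subset by blast
    then show ?thesis using eval[of s] by simp
  qed
  then have "q (\<Sum>i\<in>F. fscale (s ^ e i) (v i)) = 0" by (simp add: fun_eq_iff)
  then show ?thesis by (simp only: q(2))
qed

definition slice :: "'i \<Rightarrow> ('i \<times> 'a \<Rightarrow> 'k) \<Rightarrow> 'a \<Rightarrow> 'k" where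
  "slice i c = (\<lambda>y. c (i, y))"

definition inject :: "'i \<Rightarrow> ('a \<Rightarrow> 'k::zero) \<Rightarrow> 'i \<times> 'a \<Rightarrow> 'k" where
  "inject i f = (\<lambda>(j, y). if j = i then f y else 0)"

definition fprod :: "'i set \<Rightarrow> ('i \<Rightarrow> ('a \<Rightarrow> 'k::field) set) \<Rightarrow> ('i \<times> 'a \<Rightarrow> 'k) set" where
  "fprod F N = {c. (\<forall>i\<in>F. slice i c \<in> N i) \<and> (\<forall>i. i \<notin> F \<longrightarrow> slice i c = 0)}"

lemma flinear_slice: "flinear (slice i)"
  by (rule flinearI) (auto simp: slice_def fs_simps)

lemma flinear_inject: "flinear (inject i)"
  by (rule flinearI) (auto simp: inject_def fs_simps)

lemma slice_inject: "slice j (inject i f) = (if j = i then f else 0)"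
  by (auto simp: slice_def inject_def)

lemma slice_ext: "(\<And>i. slice i c = slice i c') \<Longrightarrow> c = c'"
  by (auto simp: slice_def fun_eq_iff)

lemma subspace_fprod: "(\<And>i. i \<in> F \<Longrightarrow> fs.subspace (N i)) \<Longrightarrow> fs.subspace (fprod F N)"
  unfolding fs.subspace_def fprod_def
  by (auto simp: fsp.linear_0[OF flinear_slice] fsp.linear_add[OF flinear_slice]
      fsp.linear_scale[OF flinear_slice])

lemma slice_image_fprod:
  assumes "\<And>i. i \<in> F \<Longrightarrow> fs.subspace (N i)" "i \<in> F"
  shows "slice i ` fprod F N = N i"
proof
  show "N i \<subseteq> slice i ` fprod F N"
  proof
    fix f assume "f \<in> N i"
    then have "inject i f \<in> fprod F N"
      using assms fs.subspace_0 by (auto simp: fprod_def slice_inject)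
    then show "f \<in> slice i ` fprod F N" by (rule rev_image_eqI) (simp add: slice_inject)
  qed
qed (use assms in \<open>auto simp: fprod_def\<close>)

lemma findim_fprod:
  assumes "finite F" "\<And>i. i \<in> F \<Longrightarrow> fs.findim (N i)"
  shows "fs.findim (fprod F N)"
proof -
  obtain B where B: "\<And>i. i \<in> F \<Longrightarrow> finite (B i) \<and> N i \<subseteq> fs.span (B i)"
    using assms(2) unfolding fs.findim_def by metis
  let ?B = "\<Union>i\<in>F. inject i ` B i"
  have "fprod F N \<subseteq> fs.span ?B"
  proof
    fix c assume c: "c \<in> fprod F N"
    have "c = (\<Sum>i\<in>F. inject i (slice i c))"
    proof (rule slice_ext)
      fix j
      have "slice j (\<Sum>i\<in>F. inject i (slice i c)) = (\<Sum>i\<in>F. if j = i then slice i c else 0)"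
        by (simp add: fsp.linear_sum[OF flinear_slice] slice_inject)
      then show "slice j c = slice j (\<Sum>i\<in>F. inject i (slice i c))"
        using assms(1) c by (simp add: fprod_def)
    qed
    also have "\<dots> \<in> fs.span ?B"
    proof (rule fs.span_sum)
      fix i assume i: "i \<in> F"
      then have "slice i c \<in> fs.span (B i)" using c B by (auto simp: fprod_def)
      then have "inject i (slice i c) \<in> fs.span (inject i ` B i)"
        unfolding fsp.linear_span_image[OF flinear_inject] by (rule imageI)
      moreover have "inject i ` B i \<subseteq> ?B" using i by blast
      ultimately show "inject i (slice i c) \<in> fs.span ?B" by (rule subsetD[OF fs.span_mono, rotated])
    qed
    finally show "c \<in> fs.span ?B" .
  qed
  moreover have "finite ?B" using assms(1) B by auto
  ultimately show ?thesis unfolding fs.findim_def by blast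
qed

lemma dim_fprod:
  assumes "finite F" "\<And>i. i \<in> F \<Longrightarrow> fs.subspace (N i)" "\<And>i. i \<in> F \<Longrightarrow> fs.findim (N i)"
  shows "fs.dim (fprod F N) = (\<Sum>i\<in>F. fs.dim (N i))"
  using assms
proof (induction F)
  case empty
  have "fprod {} N = {0}" by (auto simp: fprod_def slice_def fun_eq_iff)
  then show ?case by simp
next
  case (insert i F)
  have "0 \<in> N i" using insert.prems(1)[of i] fs.subspace_0[of "N i"] by simp
  then have "{c \<in> fprod (insert i F) N. slice i c = 0} = fprod F N"
    using insert.hyps unfolding fprod_def by auto
  then show ?case
    using fsp.rank_nullity[OF flinear_slice subspace_fprod findim_fprod, of "insert i F" N i]
      slice_image_fprod[of "insert i F" N i] insert by simp
qed

section \<open>Semisimple modules\<close>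

type_synonym ('g, 'a, 'k) action = "'g \<Rightarrow> ('a \<Rightarrow> 'k) \<Rightarrow> 'a \<Rightarrow> 'k"

definition stable :: "'g set \<Rightarrow> ('g, 'a, 'k::field) action \<Rightarrow> ('a \<Rightarrow> 'k) set \<Rightarrow> bool" where
  "stable G act N \<longleftrightarrow> fs.subspace N \<and> (\<forall>g\<in>G. \<forall>u\<in>N. act g u \<in> N)"

definition simple_sub :: "'g set \<Rightarrow> ('g, 'a, 'k::field) action \<Rightarrow> ('a \<Rightarrow> 'k) set \<Rightarrow> bool" where
  "simple_sub G act N \<longleftrightarrow> stable G act N \<and> N \<noteq> {0} \<and>
     (\<forall>N'. N' \<subseteq> N \<longrightarrow> stable G act N' \<longrightarrow> N' = {0} \<or> N' = N)"

definition equivariant_on ::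
    "'g set \<Rightarrow> ('g, 'a, 'k::field) action \<Rightarrow> ('g, 'b, 'k) action
      \<Rightarrow> ('a \<Rightarrow> 'k) set \<Rightarrow> (('a \<Rightarrow> 'k) \<Rightarrow> 'b \<Rightarrow> 'k) \<Rightarrow> bool" where
  "equivariant_on G act act' N h \<longleftrightarrow> flinear h \<and> (\<forall>g\<in>G. \<forall>u\<in>N. h (act g u) = act' g (h u))"

lemma stableD:
  "stable G act N \<Longrightarrow> fs.subspace N"
  "stable G act N \<Longrightarrow> g \<in> G \<Longrightarrow> u \<in> N \<Longrightarrow> act g u \<in> N"
  by (auto simp: stable_def)

lemma simple_subD:
  "simple_sub G act N \<Longrightarrow> stable G act N" "simple_sub G act N \<Longrightarrow> N \<noteq> {0}"
  "simple_sub G act N \<Longrightarrow> stable G act N' \<Longrightarrow> N' \<subseteq> N \<Longrightarrow> N' = {0} \<or> N' = N"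
  by (auto simp: simple_sub_def)

lemma equivariant_onD:
  "equivariant_on G act act' N h \<Longrightarrow> flinear h"
  "equivariant_on G act act' N h \<Longrightarrow> g \<in> G \<Longrightarrow> u \<in> N \<Longrightarrow> h (act g u) = act' g (h u)"
  by (auto simp: equivariant_on_def)

lemma equivariant_on_subset:
  "equivariant_on G act act' N h \<Longrightarrow> N' \<subseteq> N \<Longrightarrow> equivariant_on G act act' N' h"
  unfolding equivariant_on_def by blast

lemma simple_sub_subspace: "simple_sub G act N \<Longrightarrow> fs.subspace N"
  by (rule stableD(1)[OF simple_subD(1)])

lemma stable_Int: "stable G act N \<Longrightarrow> stable G act N' \<Longrightarrow> stable G act (N \<inter> N')"
  by (auto simp: stable_def fs.subspace_inter)

lemma stable_zero: "(\<And>g. g \<in> G \<Longrightarrow> flinear (act g)) \<Longrightarrow> stable G act {0}"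
  by (auto simp: stable_def fsp.linear_0)

lemma stable_span:
  assumes lin: "\<And>g. g \<in> G \<Longrightarrow> flinear (act g)" and S: "\<And>g u. g \<in> G \<Longrightarrow> u \<in> S \<Longrightarrow> act g u \<in> fs.span S"
  shows "stable G act (fs.span S)"
  unfolding stable_def
proof (intro conjI ballI)
  fix g u assume g: "g \<in> G" and u: "u \<in> fs.span S"
  have "act g u \<in> fs.span (act g ` S)" using u fsp.linear_span_image[OF lin[OF g], of S] by blast
  moreover have "fs.span (act g ` S) \<subseteq> fs.span S"
    by (rule fs.span_minimal) (use S g in auto)
  ultimately show "act g u \<in> fs.span S" by blast
qed simp

lemma stable_span_Union:
  assumes "\<And>g. g \<in> G \<Longrightarrow> flinear (act g)" and T: "\<And>T. T \<in> \<T> \<Longrightarrow> stable G act T"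
  shows "stable G act (fs.span (\<Union>\<T>))"
  by (rule stable_span[OF assms(1)]) (auto intro!: fs.span_base dest: stableD(2)[OF T])

lemma stable_image:
  assumes p: "equivariant_on G act act' T p" and T: "stable G act T"
  shows "stable G act' (p ` T)"
  unfolding stable_def
proof (intro conjI ballI)
  show "fs.subspace (p ` T)" by (rule fsp.linear_subspace_image[OF equivariant_onD(1)[OF p] stableD(1)[OF T]])
  fix g u assume g: "g \<in> G" and "u \<in> p ` T"
  then obtain v where v: "v \<in> T" "u = p v" by blast
  then show "act' g u \<in> p ` T"
    using equivariant_onD(2)[OF p g v(1)] stableD(2)[OF T g v(1)] by (metis imageI)
qed

lemma stable_preimage:
  assumes p: "equivariant_on G act act' T p" and T: "stable G act T" and N: "stable G act' N"
  shows "stable G act {u \<in> T. p u \<in> N}"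
proof -
  have "{u \<in> T. p u \<in> N} = T \<inter> p -` N" by auto
  then have "fs.subspace {u \<in> T. p u \<in> N}"
    using fs.subspace_inter stableD(1)[OF T]
      fsp.linear_subspace_vimage[OF equivariant_onD(1)[OF p] stableD(1)[OF N]] by metis
  then show ?thesis
    unfolding stable_def using equivariant_onD(2)[OF p] stableD(2)[OF T] stableD(2)[OF N] by simp
qed

lemma simple_Int_stable:
  assumes "simple_sub G act T" "stable G act N"
  shows "T \<inter> N = {0} \<or> T \<subseteq> N"
  using simple_subD(3)[OF assms(1) stable_Int[OF simple_subD(1)[OF assms(1)] assms(2)]] by blast

lemma simple_image:
  assumes lin: "\<And>g. g \<in> G \<Longrightarrow> flinear (act' g)"
    and T: "simple_sub G act T" and p: "equivariant_on G act act' T p" and nonzero: "p ` T \<noteq> {0}"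
  shows "simple_sub G act' (p ` T)" "inj_on p T"
proof -
  have T_stable: "stable G act T" by (rule simple_subD(1)[OF T])
  have subT: "fs.subspace T" by (rule stableD(1)[OF T_stable])
  have preimage: "{u \<in> T. p u \<in> N} = {0} \<or> {u \<in> T. p u \<in> N} = T" if "stable G act' N" for N
    by (rule simple_subD(3)[OF T stable_preimage[OF p T_stable that]]) auto
  have p0: "p 0 = 0" by (rule fsp.linear_0[OF equivariant_onD(1)[OF p]])
  have "{u \<in> T. p u \<in> {0}} \<noteq> T"
    using nonzero fs.subspace_0[OF subT] p0 by force
  then have "{u \<in> T. p u = 0} = {0}" using preimage[OF stable_zero[OF lin]] by simp
  then show "inj_on p T"
    by (simp add: fsp.linear_inj_on_iff_kernel[OF equivariant_onD(1)[OF p] subT])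
  show "simple_sub G act' (p ` T)"
    unfolding simple_sub_def
  proof (intro conjI stable_image[OF p T_stable] nonzero allI impI)
    fix N assume N: "N \<subseteq> p ` T" "stable G act' N"
    have "N = p ` {u \<in> T. p u \<in> N}" using N(1) by auto
    then show "N = {0} \<or> N = p ` T" using preimage[OF N(2)] p0 by auto
  qed
qed

definition fmod :: "('w \<Rightarrow> 'w, 'a, 'k::field) action \<Rightarrow> ('a \<Rightarrow> 'k) set \<Rightarrow> ('k, 'w, 'a \<Rightarrow> 'k) glmod" where
  "fmod act N = \<lparr>gl_space = N, gl_scale = fscale, gl_act = act\<rparr>"

lemma fmod_simps [simp]:
  "gl_space (fmod act N) = N" "gl_scale (fmod act N) = fscale" "gl_act (fmod act N) = act"
  "(fmod act N)\<lparr>gl_space := N'\<rparr> = fmod act N'"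
  by (simp_all add: fmod_def)

lemma isomorphic_modules_refl: "isomorphic_modules sW M M"
  unfolding isomorphic_modules_def by (rule exI[of _ "\<lambda>x. x"]) (simp add: bij_betw_def)

lemma isomorphic_modules_trans:
  assumes "isomorphic_modules sW A B" "isomorphic_modules sW B C"
  shows "isomorphic_modules sW A C"
proof -
  obtain h where h: "bij_betw h (gl_space A) (gl_space B)"
    "\<And>u v. u \<in> gl_space A \<Longrightarrow> v \<in> gl_space A \<Longrightarrow> h (u + v) = h u + h v"
    "\<And>c u. u \<in> gl_space A \<Longrightarrow> h (gl_scale A c u) = gl_scale B c (h u)"
    "\<And>g u. g \<in> GL sW \<Longrightarrow> u \<in> gl_space A \<Longrightarrow> h (gl_act A g u) = gl_act B g (h u)"
    using assms(1) unfolding isomorphic_modules_def by blast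
  obtain k where k: "bij_betw k (gl_space B) (gl_space C)"
    "\<And>u v. u \<in> gl_space B \<Longrightarrow> v \<in> gl_space B \<Longrightarrow> k (u + v) = k u + k v"
    "\<And>c u. u \<in> gl_space B \<Longrightarrow> k (gl_scale B c u) = gl_scale C c (k u)"
    "\<And>g u. g \<in> GL sW \<Longrightarrow> u \<in> gl_space B \<Longrightarrow> k (gl_act B g u) = gl_act C g (k u)"
    using assms(2) unfolding isomorphic_modules_def by blast
  have "h u \<in> gl_space B" if "u \<in> gl_space A" for u using h(1) that by (auto simp: bij_betw_def)
  then show ?thesis
    unfolding isomorphic_modules_def
    by (intro exI[of _ "k \<circ> h"]) (auto simp: h k intro: bij_betw_trans[OF h(1) k(1)])
qed

lemma isomorphic_modules_sym:
  assumes iso: "isomorphic_modules sW (fmod act N) U" and N: "stable (GL sW) act N"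
  shows "isomorphic_modules sW U (fmod act N)"
proof -
  obtain h where h: "bij_betw h N (gl_space U)"
    "\<And>u v. u \<in> N \<Longrightarrow> v \<in> N \<Longrightarrow> h (u + v) = h u + h v"
    "\<And>c u. u \<in> N \<Longrightarrow> h (fscale c u) = gl_scale U c (h u)"
    "\<And>g u. g \<in> GL sW \<Longrightarrow> u \<in> N \<Longrightarrow> h (act g u) = gl_act U g (h u)"
    using iso unfolding isomorphic_modules_def fmod_simps by blast
  let ?k = "inv_into N h"
  have k: "?k u \<in> N" "h (?k u) = u" if "u \<in> gl_space U" for u
    using h(1) that by (auto simp: bij_betw_def inv_into_into f_inv_into_f)
  have k_eqI: "?k v = u" if "u \<in> N" "h u = v" for u v
    using h(1) that by (auto simp: bij_betw_def)
  show ?thesis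
    unfolding isomorphic_modules_def fmod_simps
  proof (intro exI[of _ ?k] conjI ballI allI)
    show "bij_betw ?k (gl_space U) N" by (rule bij_betw_inv_into[OF h(1)])
  qed (simp_all add: k_eqI h k stableD(2)[OF N] fs.subspace_add[OF stableD(1)[OF N]]
      fs.subspace_scale[OF stableD(1)[OF N]])
qed

lemma isomorphic_fmodI:
  "bij_betw h N N' \<Longrightarrow> equivariant_on (GL sW) act act' N h \<Longrightarrow>
     isomorphic_modules sW (fmod act N) (fmod act' N')"
  unfolding isomorphic_modules_def equivariant_on_def fmod_simps
  by (blast intro: fsp.linear_add fsp.linear_scale)

lemma isomorphic_fmodE:
  assumes "isomorphic_modules sW (fmod act N) (fmod act' N')" and N: "stable (GL sW) act N"
  obtains h where "bij_betw h N N'" "equivariant_on (GL sW) act act' N h"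
proof -
  obtain f where f: "bij_betw f N N'" "\<And>u v. u \<in> N \<Longrightarrow> v \<in> N \<Longrightarrow> f (u + v) = f u + f v"
    "\<And>c u. u \<in> N \<Longrightarrow> f (fscale c u) = fscale c (f u)"
    "\<And>g u. g \<in> GL sW \<Longrightarrow> u \<in> N \<Longrightarrow> f (act g u) = act' g (f u)"
    using assms(1) unfolding isomorphic_modules_def fmod_simps by blast
  obtain h where h: "flinear h" "\<And>u. u \<in> N \<Longrightarrow> h u = f u"
    using fsp.partial_linear_extend[OF stableD(1)[OF N] f(2,3)] by blast
  have "bij_betw h N N'" using f(1) h(2) by (simp cong: bij_betw_cong)
  moreover have "equivariant_on (GL sW) act act' N h"
    using h f(4) stableD(2)[OF N] by (simp add: equivariant_on_def)
  ultimately show ?thesis by (rule that)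
qed

lemma image_zero_or_isomorphic:
  assumes "\<And>g. g \<in> GL sW \<Longrightarrow> flinear (act' g)" "simple_sub (GL sW) act T" "equivariant_on (GL sW) act act' T p"
  shows "p ` T = {0} \<or>
    simple_sub (GL sW) act' (p ` T) \<and> isomorphic_modules sW (fmod act T) (fmod act' (p ` T))"
  using simple_image[OF assms] isomorphic_fmodI[OF _ assms(3)] by (auto simp: bij_betw_def)

lemma isomorphic_by_projection:
  assumes lin: "\<And>g. g \<in> GL sW \<Longrightarrow> flinear (act g)" "\<And>g. g \<in> GL sW \<Longrightarrow> flinear (act' g)"
    and Q: "stable (GL sW) actQ Q" and N: "simple_sub (GL sW) act N" and N': "simple_sub (GL sW) act' N'"
    and p: "equivariant_on (GL sW) actQ act Q p" "p ` Q \<subseteq> N"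
    and p': "equivariant_on (GL sW) actQ act' Q p'" "p' ` Q \<subseteq> N'"
    and joint: "\<And>c. c \<in> Q \<Longrightarrow> p c = 0 \<Longrightarrow> p' c = 0 \<Longrightarrow> c = 0"
    and c0: "c0 \<in> Q" "p c0 \<noteq> 0" "\<And>c. c \<in> Q \<Longrightarrow> p c = 0 \<Longrightarrow> p' c \<noteq> p' c0"
  shows "isomorphic_modules sW (fmod actQ Q) (fmod act N)"
proof -
  let ?K = "{c \<in> Q. p c \<in> {0}}"
  have K: "stable (GL sW) actQ ?K" by (rule stable_preimage[OF p(1) Q stable_zero[OF lin(1)]])
  have "stable (GL sW) act' (p' ` ?K)"
    by (rule stable_image[OF equivariant_on_subset[OF p'(1)] K]) auto
  then have "p' ` ?K = {0} \<or> p' ` ?K = N'" by (rule simple_subD(3)[OF N']) (use p'(2) in auto)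
  moreover have "p' c0 \<in> N'" using c0(1) p'(2) by blast
  moreover have "p' c0 \<notin> p' ` ?K"
  proof
    assume "p' c0 \<in> p' ` ?K"
    then obtain c where "c \<in> Q" "p c = 0" "p' c0 = p' c" by blast
    then show False using c0(3)[of c] by simp
  qed
  ultimately have "p' ` ?K = {0}" by blast
  then have "c = 0" if "c \<in> Q" "p c = 0" for c using joint[OF that] that by blast
  then have "inj_on p Q"
    using fsp.linear_inj_on_iff_eq_0[OF equivariant_onD(1)[OF p(1)] stableD(1)[OF Q]] by blast
  moreover have "p ` Q = N"
    using simple_subD(3)[OF N stable_image[OF p(1) Q] p(2)] c0(1,2) by blast
  ultimately show ?thesis by (intro isomorphic_fmodI[OF _ p(1)]) (simp add: bij_betw_def)
qed

lemma maximal_independent_subfamily: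
  assumes lin: "\<And>g. g \<in> G \<Longrightarrow> flinear (act g)" and S: "\<And>T. T \<in> \<S> \<Longrightarrow> simple_sub G act T"
    and N: "stable G act N"
  obtains \<C> where "\<C> \<subseteq> \<S>" "N \<notin> \<C>" "fs.independent_family (insert N \<C>)"
    "\<Union>\<S> \<subseteq> fs.span (\<Union>(insert N \<C>))"
proof -
  let ?A = "{\<C>. \<C> \<subseteq> \<S> - {N} \<and> fs.independent_family (insert N \<C>)}"
  have "fs.independent_family {N}"
    unfolding fs.independent_family_def by (auto dest: subset_singletonD)
  then have "?A \<noteq> {}" by blast
  then have "\<exists>\<C>\<in>?A. \<forall>X\<in>?A. \<C> \<subseteq> X \<longrightarrow> X = \<C>"
  proof (rule subset_Zorn_nonempty)
    fix \<K> assume K: "\<K> \<noteq> {}" "subset.chain ?A \<K>"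
    have KA: "\<K> \<subseteq> ?A" using K(2) by (simp add: subset.chain_def)
    have "fs.independent_family (insert N (\<Union>\<K>))"
      unfolding fs.independent_family_def
    proof clarify
      fix F v M
      assume F: "finite F" "F \<subseteq> insert N (\<Union>\<K>)" "\<forall>M\<in>F. v M \<in> M" "(\<Sum>M\<in>F. v M) = 0" "M \<in> F"
      have "finite (F - {N})" "F - {N} \<subseteq> \<Union>\<K>" using F(1,2) by auto
      then obtain \<C> where C: "\<C> \<in> \<K>" "F - {N} \<subseteq> \<C>"
        using finite_subset_Union_chain[OF _ _ K] by metis
      then have "fs.independent_family (insert N \<C>)" "F \<subseteq> insert N \<C>" using KA by auto
      then show "v M = 0" using F by (intro fs.independent_familyD[of "insert N \<C>" F v]) auto
    qed
    then show "\<Union>\<K> \<in> ?A" using KA by blast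
  qed
  then obtain \<C> where C: "\<C> \<subseteq> \<S> - {N}" "fs.independent_family (insert N \<C>)"
    and maximal: "\<And>X. X \<subseteq> \<S> - {N} \<Longrightarrow> fs.independent_family (insert N X) \<Longrightarrow> \<C> \<subseteq> X \<Longrightarrow> X = \<C>"
    by auto
  let ?M = "fs.span (\<Union>(insert N \<C>))"
  have M: "stable G act ?M"
    by (rule stable_span_Union[OF lin]) (use C(1) N S simple_subD(1) in blast)+
  have "T \<subseteq> ?M" if T: "T \<in> \<S>" for T
  proof (rule ccontr)
    assume not_sub: "\<not> T \<subseteq> ?M"
    then have "T \<inter> ?M = {0}" using simple_Int_stable[OF S[OF T] M] by blast
    then have "fs.independent_family (insert N (insert T \<C>))"
      unfolding insert_commute[of N] by (rule fs.independent_family_insert[OF C(2)])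
    moreover have notin: "T \<notin> insert N \<C>"
      using not_sub fs.span_superset[of "\<Union>(insert N \<C>)"] by blast
    moreover from this have "insert T \<C> \<subseteq> \<S> - {N}" using T C(1) by blast
    ultimately have "insert T \<C> = \<C>" by (intro maximal) auto
    then show False using notin by blast
  qed
  then have "\<Union>\<S> \<subseteq> ?M" by blast
  moreover have "\<C> \<subseteq> \<S>" "N \<notin> \<C>" using C(1) by blast+
  ultimately show ?thesis using C(2) by (intro that)
qed

lemma stable_projection:
  assumes lin: "\<And>g. g \<in> G \<Longrightarrow> flinear (act g)" and S: "\<And>T. T \<in> \<S> \<Longrightarrow> simple_sub G act T"
    and N: "stable G act N"
  obtains p where "equivariant_on G act act (fs.span (\<Union>\<S>)) p" "p ` fs.span (\<Union>\<S>) \<subseteq> N"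
    "\<And>u. u \<in> N \<Longrightarrow> p u = u"
proof -
  obtain \<C> where C: "\<C> \<subseteq> \<S>" "N \<notin> \<C>" "fs.independent_family (insert N \<C>)"
    "\<Union>\<S> \<subseteq> fs.span (\<Union>(insert N \<C>))"
    by (rule maximal_independent_subfamily[OF lin S N])
  let ?C = "fs.span (\<Union>\<C>)"
  have subs: "fs.subspace T" if "T \<in> insert N \<C>" for T
    using that C(1) S simple_sub_subspace stableD(1)[OF N] by blast
  have C_stable: "stable G act ?C" by (rule stable_span_Union[OF lin]) (use C(1) S simple_subD(1) in blast)+
  have "insert N \<C> - {N} = \<C>" using C(2) by blast
  then have disj: "N \<inter> ?C = {0}" using fs.independent_family_Int_span[OF C(3) subs, of N] by simp
  obtain p where p: "flinear p" "\<And>c. c \<in> ?C \<Longrightarrow> p c = 0" "\<And>u. u \<in> N \<Longrightarrow> p u = u"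
    by (rule fsp.linear_extend_vanishing[OF stableD(1)[OF N] fs.subspace_span flinear_id])
      (use disj in blast)+
  have decomp: "\<exists>n c. u = n + c \<and> n \<in> N \<and> c \<in> ?C" if "u \<in> fs.span (\<Union>\<S>)" for u
  proof -
    have "fs.span (\<Union>\<S>) \<subseteq> fs.span (N \<union> \<Union>\<C>)"
      using fs.span_minimal[OF C(4) fs.subspace_span] by simp
    then have "u \<in> fs.span (N \<union> \<Union>\<C>)" using that by blast
    moreover have "fs.span N = N" using stableD(1)[OF N] by (simp add: fs.span_eq_iff)
    ultimately show ?thesis unfolding fs.span_Un by auto
  qed
  show ?thesis
  proof (rule that[of p])
    show "p ` fs.span (\<Union>\<S>) \<subseteq> N"
    proof clarify
      fix u assume "u \<in> fs.span (\<Union>\<S>)"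
      then obtain n c where "u = n + c" "n \<in> N" "c \<in> ?C" using decomp by blast
      then show "p u \<in> N" by (simp add: fsp.linear_add[OF p(1)] p)
    qed
    show "equivariant_on G act act (fs.span (\<Union>\<S>)) p"
      unfolding equivariant_on_def
    proof (intro conjI p(1) ballI)
      fix g u assume g: "g \<in> G" and "u \<in> fs.span (\<Union>\<S>)"
      then obtain n c where u: "u = n + c" "n \<in> N" "c \<in> ?C" using decomp by blast
      then have "act g n \<in> N" "act g c \<in> ?C" using stableD(2)[OF N g] stableD(2)[OF C_stable g] by auto
      then show "p (act g u) = act g (p u)"
        by (simp add: u fsp.linear_add[OF p(1)] fsp.linear_add[OF lin[OF g]] p)
    qed
  qed (rule p(3))
qed

definition isotypic_parts where
  "isotypic_parts sW act \<S> N = {T. T \<subseteq> N \<and> simple_sub (GL sW) act T \<and>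
     (\<exists>T'\<in>\<S>. isomorphic_modules sW (fmod act T') (fmod act T))}"

lemma stable_eq_span_isotypic_parts:
  assumes lin: "\<And>g. g \<in> GL sW \<Longrightarrow> flinear (act g)"
    and S: "\<And>T. T \<in> \<S> \<Longrightarrow> simple_sub (GL sW) act T"
    and N: "stable (GL sW) act N" "N \<subseteq> fs.span (\<Union>\<S>)"
  shows "N = fs.span (\<Union>(isotypic_parts sW act \<S> N))" (is "_ = fs.span (\<Union>?D)")
proof
  show "fs.span (\<Union>?D) \<subseteq> N"
    by (rule fs.span_minimal) (use stableD(1)[OF N(1)] in \<open>auto simp: isotypic_parts_def\<close>)
  obtain p where p: "equivariant_on (GL sW) act act (fs.span (\<Union>\<S>)) p" "p ` fs.span (\<Union>\<S>) \<subseteq> N"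
    "\<And>u. u \<in> N \<Longrightarrow> p u = u"
    by (rule stable_projection[OF lin S N(1)]) blast+
  have "p ` T \<subseteq> fs.span (\<Union>?D)" if T: "T \<in> \<S>" for T
  proof -
    have TS: "T \<subseteq> fs.span (\<Union>\<S>)" using T fs.span_base by blast
    have "p ` T = {0} \<or> p ` T \<in> ?D"
      using image_zero_or_isomorphic[OF lin S[OF T] equivariant_on_subset[OF p(1) TS]] TS p(2) T
      unfolding isotypic_parts_def by blast
    then show ?thesis
    proof
      assume "p ` T = {0}"
      then show ?thesis by (simp only:) (simp add: fs.span_zero)
    next
      assume "p ` T \<in> ?D"
      then have "p ` T \<subseteq> \<Union>?D" by (rule Union_upper)
      then show ?thesis using fs.span_superset by (rule order_trans)
    qed
  qed
  then have "p ` fs.span (\<Union>\<S>) \<subseteq> fs.span (\<Union>?D)"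
    unfolding fsp.linear_span_image[OF equivariant_onD(1)[OF p(1)], symmetric]
    by (intro fs.span_minimal) auto
  then show "N \<subseteq> fs.span (\<Union>?D)" using p(3) N(2) by force
qed

lemma simple_sub_iso_summand:
  assumes lin: "\<And>g. g \<in> GL sW \<Longrightarrow> flinear (act g)"
    and S: "\<And>T. T \<in> \<S> \<Longrightarrow> simple_sub (GL sW) act T"
    and N: "simple_sub (GL sW) act N" "N \<subseteq> fs.span (\<Union>\<S>)"
  obtains T where "T \<in> \<S>" "isomorphic_modules sW (fmod act T) (fmod act N)"
proof -
  have "N = fs.span (\<Union>(isotypic_parts sW act \<S> N))"
    by (rule stable_eq_span_isotypic_parts[OF lin S simple_subD(1)[OF N(1)] N(2)])
  then have "isotypic_parts sW act \<S> N \<noteq> {}"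
    using simple_subD(2)[OF N(1)] by auto
  then obtain T T' where T: "T \<subseteq> N" "simple_sub (GL sW) act T" "T' \<in> \<S>"
    "isomorphic_modules sW (fmod act T') (fmod act T)"
    unfolding isotypic_parts_def by blast
  then have "T = N"
    using simple_subD(3)[OF N(1) simple_subD(1)[OF T(2)] T(1)] simple_subD(2)[OF T(2)] by blast
  then show ?thesis using T that by blast
qed

lemma exists_simple_sub:
  assumes C: "stable G act C" "fs.findim C" "C \<noteq> {0}"
  obtains Z where "Z \<subseteq> C" "simple_sub G act Z"
proof -
  let ?P = "\<lambda>Z. stable G act Z \<and> Z \<subseteq> C \<and> Z \<noteq> {0}"
  obtain Z where Z: "?P Z" and minimal: "\<And>Z'. ?P Z' \<Longrightarrow> fs.dim Z \<le> fs.dim Z'"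
    using ex_has_least_nat[of ?P C fs.dim] C by blast
  have "Z' = {0} \<or> Z' = Z" if Z': "Z' \<subseteq> Z" "stable G act Z'" for Z'
  proof (rule ccontr)
    assume neg: "\<not> (Z' = {0} \<or> Z' = Z)"
    have fin: "fs.findim Z" "fs.findim Z'" using fs.findim_mono[OF C(2)] Z Z' by blast+
    obtain B where B: "finite B" "B \<subseteq> Z'" "fs.independent B" "fs.span B = Z'" "card B = fs.dim Z'"
      by (rule fs.findim_basis[OF stableD(1)[OF Z'(2)] fin(2)])
    obtain x where x: "x \<in> Z" "x \<notin> Z'" using neg Z' by blast
    have "x \<notin> B" "fs.independent (insert x B)" using fs.independent_insertI[of x B] B x by blast+
    then have "Suc (fs.dim Z') = fs.dim (insert x B)"
      using B(1,5) fs.dim_eq_card_independent by (metis card_insert_disjoint)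
    also have "\<dots> \<le> fs.dim Z" by (rule fs.dim_mono_findim[OF _ fin(1)]) (use B x Z' in blast)
    finally show False using minimal[of Z'] neg Z Z' by force
  qed
  then have "simple_sub G act Z" unfolding simple_sub_def using Z by blast
  then show ?thesis using that Z by blast
qed

lemma span_simple_subs_if_projections:
  assumes lin: "\<And>g. g \<in> G \<Longrightarrow> flinear (act g)" and M: "stable G act M" "fs.findim M"
    and projection: "\<And>N. stable G act N \<Longrightarrow> N \<subseteq> M \<Longrightarrow>
      \<exists>P. equivariant_on G act act M P \<and> P ` M \<subseteq> N \<and> (\<forall>u\<in>N. P u = u)"
  shows "M = fs.span (\<Union>{Z. Z \<subseteq> M \<and> simple_sub G act Z})" (is "M = ?S")
proof
  show SM: "?S \<subseteq> M" by (rule fs.span_minimal[OF _ stableD(1)[OF M(1)]]) blast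
  have "stable G act ?S" by (rule stable_span_Union[OF lin]) (auto dest: simple_subD(1))
  then obtain P where P: "equivariant_on G act act M P" "P ` M \<subseteq> ?S" "\<And>u. u \<in> ?S \<Longrightarrow> P u = u"
    using projection[OF _ SM] by auto
  note linP = equivariant_onD(1)[OF P(1)]
  let ?C = "{u \<in> M. P u \<in> {0}}"
  have C: "stable G act ?C" by (rule stable_preimage[OF P(1) M(1) stable_zero[OF lin]])
  have C_zero: "?C = {0}"
  proof (rule ccontr)
    assume nonzero: "?C \<noteq> {0}"
    have "fs.findim ?C" by (rule fs.findim_mono[OF M(2)]) blast
    then obtain Z where Z: "Z \<subseteq> ?C" "simple_sub G act Z" using exists_simple_sub[OF C _ nonzero] by blast
    obtain x where x: "x \<in> Z" "x \<noteq> 0"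
      using fs.subspace_nonzero_element[OF simple_sub_subspace[OF Z(2)] simple_subD(2)[OF Z(2)]] by blast
    have "x \<in> ?S" by (rule fs.span_base) (use Z x in blast)
    then show False using P(3)[of x] Z(1) x by auto
  qed
  show "M \<subseteq> ?S"
  proof
    fix u assume u: "u \<in> M"
    have "P u \<in> ?S" using P(2) u by blast
    then have "u - P u \<in> ?C"
      using u SM fs.subspace_diff[OF stableD(1)[OF M(1)]] P(3) by (auto simp: fsp.linear_diff[OF linP])
    then have "u - P u = 0" unfolding C_zero by simp
    then show "u \<in> ?S" using \<open>P u \<in> ?S\<close> by simp
  qed
qed

section \<open>Alternating sums\<close>

lemma sum_alternating_Pow:
  "finite A \<Longrightarrow> (\<Sum>K\<in>Pow A. (-1) ^ card K) = (if A = {} then 1 else 0 :: 'k::comm_ring_1)"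
  using prod_add[of A "\<lambda>_. -1 :: 'k" "\<lambda>_. 1"]
  by (cases "A = {}") (simp_all add: zero_power card_gt_0_iff)

lemma sum_alternating_interval:
  assumes "finite B" "C \<subseteq> B"
  shows "(\<Sum>A | A \<in> Pow B \<and> C \<subseteq> A. (-1) ^ card (B - A)) = (if C = B then 1 else 0 :: 'k::comm_ring_1)"
proof -
  have "(\<Sum>A | A \<in> Pow B \<and> C \<subseteq> A. (-1) ^ card (B - A)) = (\<Sum>K\<in>Pow (B - C). (-1) ^ card K :: 'k)"
    by (rule sum.reindex_bij_witness[of _ "\<lambda>K. B - K" "\<lambda>A. B - A"])
      (use assms(2) in \<open>auto simp: double_diff\<close>)
  also have "\<dots> = (if C = B then 1 else 0)"
    using assms by (auto simp: sum_alternating_Pow)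
  finally show ?thesis .
qed

lemma moebius_Pow:
  fixes c :: "'x set \<Rightarrow> 'r::comm_ring_1"
  assumes B: "finite B"
  shows "(\<Sum>A\<in>Pow B. (-1) ^ card A * (\<Sum>C\<in>Pow A. (-1) ^ card C * c C)) = c B"
proof -
  have sign: "(-1) ^ card A = (-1) ^ card B * ((-1) ^ card (B - A) :: 'r)" if "A \<subseteq> B" for A
  proof -
    have "card B = card A + card (B - A)"
      using that B by (simp add: card_Diff_subset card_mono finite_subset)
    then have "(-1) ^ card B * ((-1) ^ card (B - A) :: 'r) = (-1) ^ card A * ((-1) ^ card (B - A) * (-1) ^ card (B - A))"
      by (simp only: power_add mult.assoc)
    then show ?thesis by simp
  qed
  have "(\<Sum>A\<in>Pow B. (-1) ^ card A * (\<Sum>C\<in>Pow A. (-1) ^ card C * c C))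
      = (\<Sum>A\<in>Pow B. \<Sum>C | C \<in> Pow B \<and> C \<subseteq> A. (-1) ^ card A * ((-1) ^ card C * c C))"
    unfolding sum_distrib_left by (intro sum.cong) auto
  also have "\<dots> = (\<Sum>C\<in>Pow B. \<Sum>A | A \<in> Pow B \<and> C \<subseteq> A. (-1) ^ card A * ((-1) ^ card C * c C))"
    by (rule sum.swap_restrict) (simp_all add: B)
  also have "\<dots> = (\<Sum>C\<in>Pow B. (-1) ^ card B * (-1) ^ card C * c C *
      (\<Sum>A | A \<in> Pow B \<and> C \<subseteq> A. (-1) ^ card (B - A)))"
    unfolding sum_distrib_left
  proof (intro sum.cong refl)
    fix C A assume "A \<in> {A. A \<in> Pow B \<and> C \<subseteq> A}"
    then show "(-1) ^ card A * ((-1) ^ card C * c C)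
        = (-1) ^ card B * (-1) ^ card C * c C * (-1) ^ card (B - A)"
      by (subst sign) (simp_all add: mult_ac)
  qed
  also have "\<dots> = (\<Sum>C\<in>Pow B. if C = B then c B else 0)"
    by (intro sum.cong refl) (subst sum_alternating_interval[OF B]; simp)
  finally show ?thesis using B by simp
qed

lemma inclusion_exclusion_surjections:
  fixes F :: "('i \<Rightarrow> 'i) \<Rightarrow> 'k::comm_ring_1"
  assumes I: "finite I"
  shows "(\<Sum>J\<in>Pow I. (-1) ^ card (I - J) * (\<Sum>f\<in>PiE I (\<lambda>_. J). F f))
    = (\<Sum>p | p permutes I. F (restrict p I))"
proof -
  let ?\<F> = "PiE I (\<lambda>_. I)"
  have fin: "finite ?\<F>" using I by (simp add: finite_PiE)
  have restrict_range: "PiE I (\<lambda>_. J) = {f \<in> ?\<F>. f ` I \<subseteq> J}" if "J \<subseteq> I" for J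
    using that by (auto simp: PiE_iff extensional_def)
  have "(\<Sum>J\<in>Pow I. (-1) ^ card (I - J) * (\<Sum>f\<in>PiE I (\<lambda>_. J). F f))
      = (\<Sum>J\<in>Pow I. \<Sum>f | f \<in> ?\<F> \<and> f ` I \<subseteq> J. (-1) ^ card (I - J) * F f)"
    unfolding sum_distrib_left by (intro sum.cong refl restrict_range) simp
  also have "\<dots> = (\<Sum>f\<in>?\<F>. (\<Sum>J | J \<in> Pow I \<and> f ` I \<subseteq> J. (-1) ^ card (I - J)) * F f)"
    unfolding sum_distrib_right by (rule sum.swap_restrict) (simp_all add: I fin)
  also have "\<dots> = (\<Sum>f\<in>?\<F>. if f ` I = I then F f else 0)"
    by (intro sum.cong refl) (subst sum_alternating_interval[OF I]; auto)
  also have "\<dots> = (\<Sum>f\<in>{f \<in> ?\<F>. f ` I = I}. F f)"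
    by (rule sum.inter_filter[OF fin, symmetric])
  also have "\<dots> = (\<Sum>p | p permutes I. F (restrict p I))"
  proof (rule sum.reindex_bij_witness[of _ "\<lambda>p. restrict p I" "\<lambda>f c. if c \<in> I then f c else c"])
    fix f assume "f \<in> {f \<in> ?\<F>. f ` I = I}"
    then have f: "f \<in> ?\<F>" "f ` I = I" by auto
    then show r: "restrict (\<lambda>c. if c \<in> I then f c else c) I = f"
      by (auto simp: restrict_def fun_eq_iff PiE_iff extensional_def)
    show "F (restrict (\<lambda>c. if c \<in> I then f c else c) I) = F f" by (simp only: r)
    have "inj_on f I" using f I by (simp add: eq_card_imp_inj_on)
    then show "(\<lambda>c. if c \<in> I then f c else c) \<in> {p. p permutes I}"
      using f(2) by (auto simp: bij_betw_def inj_on_def intro!: bij_imp_permutes)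
  next
    fix p assume "p \<in> {p. p permutes I}"
    then have p: "p permutes I" by simp
    show "(\<lambda>c. if c \<in> I then restrict p I c else c) = p"
      using p by (auto simp: fun_eq_iff permutes_def)
    show "restrict p I \<in> {f \<in> ?\<F>. f ` I = I}"
      using permutes_image[OF p] by (auto simp: PiE_iff)
  qed
  finally show ?thesis .
qed

section \<open>Tensor powers\<close>

type_synonym ('i, 'w, 'k) tensor = "('i \<Rightarrow> 'w \<Rightarrow> 'k) \<Rightarrow> 'k"

lemma vector_space_mult: "vector_space ((*) :: 'k::field \<Rightarrow> 'k \<Rightarrow> 'k)"
  by unfold_locales (auto simp: algebra_simps)

lemma (in vector_space) dual_space_iff:
  "\<xi> \<in> dual_space scale \<longleftrightarrow> (\<forall>u v. \<xi> (u + v) = \<xi> u + \<xi> v) \<and> (\<forall>c u. \<xi> (scale c u) = c * \<xi> u)"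
  by (simp add: dual_space_def Vector_Spaces.linear_iff vector_space_axioms vector_space_mult)

lemma (in vector_space) dual_spaceD:
  assumes "\<xi> \<in> dual_space scale"
  shows "\<xi> (u + v) = \<xi> u + \<xi> v" "\<xi> (scale c u) = c * \<xi> u" "\<xi> 0 = 0" "\<xi> (u - v) = \<xi> u - \<xi> v"
    "\<xi> (\<Sum>i\<in>A. f i) = (\<Sum>i\<in>A. \<xi> (f i))"
proof -
  interpret \<xi>: Vector_Spaces.linear scale "(*)" \<xi> using assms by (simp add: dual_space_def)
  show "\<xi> (u + v) = \<xi> u + \<xi> v" "\<xi> (scale c u) = c * \<xi> u" "\<xi> 0 = 0" "\<xi> (u - v) = \<xi> u - \<xi> v"
    "\<xi> (\<Sum>i\<in>A. f i) = (\<Sum>i\<in>A. \<xi> (f i))"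
    by (rule \<xi>.add \<xi>.scale \<xi>.zero \<xi>.diff \<xi>.sum)+
qed

locale enumerated_basis = finite_dimensional_vector_space sW BW
  for sW :: "'k::field_char_0 \<Rightarrow> 'w::ab_group_add \<Rightarrow> 'w" and BW +
  fixes b :: "nat \<Rightarrow> 'w" and m :: nat
  assumes b_bij: "bij_betw b {..<m} BW"
begin

abbreviation "dual \<equiv> dual_space sW"
abbreviation "lin \<equiv> Vector_Spaces.linear sW sW"
abbreviation "pure \<equiv> pure_tensor sW"
abbreviation "E \<equiv> tensor_power sW"

abbreviation indices :: "'i set \<Rightarrow> ('i \<Rightarrow> nat) set" where
  "indices I \<equiv> PiE I (\<lambda>_. {..<m})"

definition coord :: "nat \<Rightarrow> 'w \<Rightarrow> 'k" where
  "coord j w = representation BW w (b j)"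

lemma linI: "(\<And>u v. X (u + v) = X u + X v) \<Longrightarrow> (\<And>c u. X (sW c u) = sW c (X u)) \<Longrightarrow> lin X"
  by (simp add: Vector_Spaces.linear_iff vector_space_axioms)

lemma linD:
  assumes "lin X"
  shows "X (u + v) = X u + X v" "X (sW c u) = sW c (X u)" "X (\<Sum>i\<in>A. f i) = (\<Sum>i\<in>A. X (f i))"
proof -
  interpret Vector_Spaces.linear sW sW X by fact
  show "X (u + v) = X u + X v" "X (sW c u) = sW c (X u)" "X (\<Sum>i\<in>A. f i) = (\<Sum>i\<in>A. X (f i))"
    using add scale sum by auto
qed

lemma b_inj: "i < m \<Longrightarrow> j < m \<Longrightarrow> b i = b j \<longleftrightarrow> i = j"
  using b_bij by (auto simp: bij_betw_def inj_on_def)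

lemma b_in: "i < m \<Longrightarrow> b i \<in> BW"
  using b_bij by (auto simp: bij_betw_def)

lemma coord_dual: "coord j \<in> dual"
  unfolding dual_space_iff coord_def
  by (simp add: representation_add[OF independent_Basis] representation_scale[OF independent_Basis] span_Basis)

lemma coord_b: "i < m \<Longrightarrow> j < m \<Longrightarrow> coord j (b i) = (if i = j then 1 else 0)"
  by (simp add: coord_def representation_basis[OF independent_Basis b_in] b_inj)

lemma coord_expand: "w = (\<Sum>j<m. sW (coord j w) (b j))"
proof -
  have "w = (\<Sum>x\<in>BW. sW (representation BW w x) x)"
    using sum_representation_eq[OF independent_Basis _ finite_Basis subset_refl, of w]
    by (simp add: span_Basis)
  also have "\<dots> = (\<Sum>j<m. sW (coord j w) (b j))"
    unfolding coord_def by (rule sum.reindex_bij_betw[OF b_bij, symmetric])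
  finally show ?thesis .
qed

lemma coord_sum: "i < m \<Longrightarrow> coord i (\<Sum>j<m. sW (a j) (b j)) = a i"
  by (simp add: dual_spaceD[OF coord_dual] coord_b if_distrib[of "(*) _"] sum.delta cong: if_cong)

lemma coord_ext: "(\<And>j. j < m \<Longrightarrow> coord j v = coord j w) \<Longrightarrow> v = w"
  using coord_expand[of v] coord_expand[of w] by simp

lemma dual_expand: "\<xi> \<in> dual \<Longrightarrow> \<xi> w = (\<Sum>j<m. coord j w * \<xi> (b j))"
  using arg_cong[OF coord_expand[of w], of \<xi>] by (simp add: dual_spaceD)

lemma dual_comp: "\<xi> \<in> dual \<Longrightarrow> lin X \<Longrightarrow> \<xi> \<circ> X \<in> dual"
  unfolding dual_space_iff by (simp add: linD)

lemma lin_id: "lin id"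
  by (auto intro!: linI)

lemma lin_comp: "lin X \<Longrightarrow> lin Y \<Longrightarrow> lin (X \<circ> Y)"
  by (auto intro!: linI simp: linD)

lemma lin_sum: "(\<And>i. i \<in> A \<Longrightarrow> lin (Y i)) \<Longrightarrow> lin (\<lambda>w. \<Sum>i\<in>A. Y i w)"
  by (rule linI) (auto simp: linD sum.distrib scale_sum_right intro!: sum.cong)

lemma lin_scale: "lin X \<Longrightarrow> lin (\<lambda>w. sW c (X w))"
  by (rule linI) (auto simp: linD scale_right_distrib mult.commute)

lemma lin_add: "lin X \<Longrightarrow> lin Y \<Longrightarrow> lin (\<lambda>w. X w + Y w)"
  by (rule linI) (auto simp: linD algebra_simps scale_right_distrib)

lemma GL_lin: "g \<in> GL sW \<Longrightarrow> lin g"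
  by (simp add: GL_def)

lemma GL_inv:
  assumes "g \<in> GL sW"
  shows "inv g \<in> GL sW" "g \<circ> inv g = id" "inv g \<circ> g = id"
proof -
  have g: "lin g" "bij g" using assms by (auto simp: GL_def)
  show "g \<circ> inv g = id" "inv g \<circ> g = id"
    using g(2) by (auto simp: bij_is_surj bij_is_inj surj_iff[symmetric])
  have "lin (inv g)"
  proof (rule linI)
    show "inv g (u + v) = inv g u + inv g v" for u v
      by (rule inv_f_eq[OF bij_is_inj[OF g(2)]]) (simp add: linD[OF g(1)] surj_f_inv_f bij_is_surj[OF g(2)])
    show "inv g (sW c u) = sW c (inv g u)" for u c
      by (rule inv_f_eq[OF bij_is_inj[OF g(2)]]) (simp add: linD[OF g(1)] surj_f_inv_f bij_is_surj[OF g(2)])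
  qed
  then show "inv g \<in> GL sW" using bij_imp_bij_inv[OF g(2)] by (simp add: GL_def)
qed

lemma GL_comp: "g \<in> GL sW \<Longrightarrow> h \<in> GL sW \<Longrightarrow> g \<circ> h \<in> GL sW"
  by (auto simp: GL_def intro: lin_comp bij_comp)

lemma GL_id: "id \<in> GL sW"
  by (simp add: GL_def lin_id)

lemma GL_if_inj:
  assumes X: "lin X" and inj: "\<And>w. X w = 0 \<Longrightarrow> w = 0"
  shows "X \<in> GL sW"
proof -
  interpret X: Vector_Spaces.linear sW sW X by (fact X)
  interpret endo: finite_dimensional_vector_space_pair sW BW sW BW ..
  have "inj X" using inj unfolding X.inj_iff_eq_0 by blast
  moreover have "surj X" using endo.linear_injective_imp_surjective[OF X \<open>inj X\<close>] by simp
  ultimately show ?thesis using X by (simp add: GL_def bij_def)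
qed

lemma infinite_invertible_shifts:
  assumes X: "lin X"
  shows "infinite {s. (\<lambda>w. X w + sW s (id w)) \<in> GL sW}"
proof -
  let ?\<Theta> = "{\<theta>. \<exists>w. w \<noteq> 0 \<and> X w = sW \<theta> w}"
  have "(\<lambda>w. X w + sW s (id w)) \<in> GL sW" if s: "s \<in> - uminus ` ?\<Theta>" for s
  proof (rule GL_if_inj)
    show "lin (\<lambda>w. X w + sW s (id w))" by (intro lin_add lin_scale X lin_id)
    fix w assume "X w + sW s (id w) = 0"
    then have eigen: "X w = sW (- s) w" by (simp add: add_eq_0_iff2)
    show "w = 0"
    proof (rule ccontr)
      assume "w \<noteq> 0"
      then have "- s \<in> ?\<Theta>" using eigen by blast
      then have "- (- s) \<in> uminus ` ?\<Theta>" by (rule imageI)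
      then show False using s by simp
    qed
  qed
  then have "- uminus ` ?\<Theta> \<subseteq> {s. (\<lambda>w. X w + sW s (id w)) \<in> GL sW}" by blast
  moreover have "infinite (- uminus ` ?\<Theta>)"
    unfolding Compl_eq_Diff_UNIV
    by (intro Diff_infinite_finite finite_imageI finite_eigenvalues[OF X] infinite_UNIV_char_0)
  ultimately show ?thesis using finite_subset by blast
qed

definition matrix_unit :: "nat \<Rightarrow> nat \<Rightarrow> 'w \<Rightarrow> 'w" where
  "matrix_unit i j w = sW (coord j w) (b i)"

lemma lin_matrix_unit: "lin (matrix_unit i j)"
  by (rule linI) (simp_all add: matrix_unit_def dual_spaceD[OF coord_dual] scale_left_distrib)

definition dual_family :: "'i set \<Rightarrow> ('i \<Rightarrow> 'w \<Rightarrow> 'k) \<Rightarrow> bool" where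
  "dual_family I \<xi> \<longleftrightarrow> (\<forall>c\<in>I. \<xi> c \<in> dual)"

definition basis_tensor :: "'i set \<Rightarrow> ('i \<Rightarrow> nat) \<Rightarrow> ('i, 'w, 'k) tensor" where
  "basis_tensor I T = pure I (b \<circ> T)"

definition tcoord :: "('i \<Rightarrow> nat) \<Rightarrow> ('i, 'w, 'k) tensor \<Rightarrow> 'k" where
  "tcoord T t = t (\<lambda>c. coord (T c))"

lemma tcoord_linear:
  "tcoord T 0 = 0" "tcoord T (t + u) = tcoord T t + tcoord T u" "tcoord T (fscale a t) = a * tcoord T t"
  "tcoord T (t - u) = tcoord T t - tcoord T u" "tcoord T (\<Sum>i\<in>A. f i) = (\<Sum>i\<in>A. tcoord T (f i))"
  by (simp_all add: tcoord_def fscale_apply sum_fun_apply)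

lemma pure_apply: "pure I w \<xi> = (if dual_family I \<xi> then \<Prod>c\<in>I. \<xi> c (w c) else 0)"
  by (simp add: pure_tensor_def dual_family_def)

lemma dual_family_coord: "dual_family I (\<lambda>c. coord (T c))"
  by (simp add: dual_family_def coord_dual)

lemma tcoord_pure: "tcoord T (pure I w) = (\<Prod>c\<in>I. coord (T c) (w c))"
  by (simp add: tcoord_def pure_apply dual_family_coord)

lemma pure_in_E: "pure I w \<in> E I"
  unfolding tensor_power_def by (rule fs.span_base) simp

lemma basis_tensor_in_E: "basis_tensor I T \<in> E I"
  unfolding basis_tensor_def by (rule pure_in_E)

lemma E_subspace: "fs.subspace (E I)"
  unfolding tensor_power_def by (rule fs.subspace_span)

lemma E_eqI:
  assumes "flinear f" "flinear g" "\<And>w. f (pure I w) = g (pure I w)" "t \<in> E I"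
  shows "f t = g t"
  using fsp.linear_eq_on_span[OF assms(1,2), of "range (pure I)" t] assms(3,4)
  unfolding tensor_power_def by blast

lemma E_memI:
  assumes "flinear f" "fs.subspace S" "\<And>w. f (pure I w) \<in> S" "t \<in> E I"
  shows "f t \<in> S"
proof -
  have "E I \<subseteq> f -` S"
    unfolding tensor_power_def
    by (rule fs.span_minimal[OF _ fsp.linear_subspace_vimage[OF assms(1,2)]]) (use assms(3) in auto)
  then show ?thesis using assms(4) by auto
qed

lemma flinear_tcoord: "flinear (\<lambda>t. fscale (tcoord T t) y)"
  by (rule flinearI) (auto simp: tcoord_linear fs_simps algebra_simps)

lemma finite_indices: "finite I \<Longrightarrow> finite (indices I)"
  by (simp add: finite_PiE)

lemma pure_expand:
  assumes "finite I"
  shows "pure I w = (\<Sum>T\<in>indices I. fscale (tcoord T (pure I w)) (basis_tensor I T))"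
proof
  fix \<xi>
  show "pure I w \<xi> = (\<Sum>T\<in>indices I. fscale (tcoord T (pure I w)) (basis_tensor I T)) \<xi>"
  proof (cases "dual_family I \<xi>")
    case True
    have "pure I w \<xi> = (\<Prod>c\<in>I. \<Sum>j<m. coord j (w c) * \<xi> c (b j))"
      using True by (auto simp: pure_apply dual_family_def intro!: prod.cong dual_expand)
    also have "\<dots> = (\<Sum>T\<in>indices I. \<Prod>c\<in>I. coord (T c) (w c) * \<xi> c (b (T c)))"
      by (rule prod_sum_PiE[OF assms]) auto
    finally show ?thesis
      using True by (simp add: sum_fun_apply fscale_apply tcoord_pure basis_tensor_def pure_apply prod.distrib)
  next
    case False
    then show ?thesis by (simp add: sum_fun_apply fscale_apply basis_tensor_def pure_apply)
  qed
qed

lemma tcoord_basis_tensor: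
  assumes "finite I" "S \<in> indices I" "T \<in> indices I"
  shows "tcoord S (basis_tensor I T) = (if S = T then 1 else 0)"
proof -
  have "tcoord S (basis_tensor I T) = (\<Prod>c\<in>I. if S c = T c then 1 else 0)"
    unfolding basis_tensor_def tcoord_pure
    using assms by (intro prod.cong) (auto simp: coord_b PiE_iff)
  also have "\<dots> = (if \<forall>c\<in>I. S c = T c then 1 else 0)"
    using assms(1) by auto
  finally show ?thesis using assms(2,3) PiE_ext by (metis (no_types, lifting))
qed

lemma E_expand:
  assumes "finite I" "t \<in> E I"
  shows "t = (\<Sum>T\<in>indices I. fscale (tcoord T t) (basis_tensor I T))"
  by (rule E_eqI[OF flinear_id _ pure_expand[OF assms(1)] assms(2)]) (intro flinear_sum flinear_tcoord)

lemma E_ext: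
  assumes "finite I" "u \<in> E I" "v \<in> E I" "\<And>T. T \<in> indices I \<Longrightarrow> tcoord T u = tcoord T v"
  shows "u = v"
proof -
  have "(\<Sum>T\<in>indices I. fscale (tcoord T u) (basis_tensor I T))
      = (\<Sum>T\<in>indices I. fscale (tcoord T v) (basis_tensor I T))"
    by (rule sum.cong[OF refl]) (simp only: assms(4))
  then show ?thesis using E_expand[OF assms(1,2)] E_expand[OF assms(1,3)] by simp
qed

lemma E_nonzero_tcoord:
  assumes "finite I" "u \<in> E I" "u \<noteq> 0"
  obtains T where "T \<in> indices I" "tcoord T u \<noteq> 0"
  using E_ext[OF assms(1,2) fs.subspace_0[OF E_subspace]] assms(3) by (auto simp: tcoord_linear)

lemma E_span: "finite I \<Longrightarrow> E I = fs.span (basis_tensor I ` indices I)"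
proof
  assume I: "finite I"
  show "E I \<subseteq> fs.span (basis_tensor I ` indices I)"
  proof
    fix t assume t: "t \<in> E I"
    have "(\<Sum>T\<in>indices I. fscale (tcoord T t) (basis_tensor I T)) \<in> fs.span (basis_tensor I ` indices I)"
      by (intro fs.span_sum fs.span_scale fs.span_base imageI)
    then show "t \<in> fs.span (basis_tensor I ` indices I)" using E_expand[OF I t] by simp
  qed
  show "fs.span (basis_tensor I ` indices I) \<subseteq> E I"
    by (rule fs.span_minimal[OF _ E_subspace]) (auto simp: basis_tensor_in_E)
qed

lemma E_findim: "finite I \<Longrightarrow> fs.findim (E I)"
  by (simp add: E_span fs.findim_span finite_indices)

definition tensor_op :: "'i set \<Rightarrow> ('i \<Rightarrow> 'w \<Rightarrow> 'w) \<Rightarrow> ('i, 'w, 'k) tensor \<Rightarrow> ('i, 'w, 'k) tensor" where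
  "tensor_op I Y t = (\<lambda>\<xi>. if dual_family I \<xi> then t (\<lambda>c. \<xi> c \<circ> Y c) else 0)"

lemma flinear_tensor_op: "flinear (tensor_op I Y)"
  by (rule flinearI) (auto simp: tensor_op_def fs_simps)

lemma dual_family_comp:
  "dual_family I \<xi> \<Longrightarrow> (\<And>c. c \<in> I \<Longrightarrow> lin (Y c)) \<Longrightarrow> dual_family I (\<lambda>c. \<xi> c \<circ> Y c)"
  by (simp add: dual_family_def dual_comp)

lemma tensor_op_pure: "(\<And>c. c \<in> I \<Longrightarrow> lin (Y c)) \<Longrightarrow> tensor_op I Y (pure I w) = pure I (\<lambda>c. Y c (w c))"
  by (auto simp: tensor_op_def pure_apply dual_family_comp fun_eq_iff)

lemma tensor_op_E: "(\<And>c. c \<in> I \<Longrightarrow> lin (Y c)) \<Longrightarrow> t \<in> E I \<Longrightarrow> tensor_op I Y t \<in> E I"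
  by (rule E_memI[OF flinear_tensor_op E_subspace]) (simp_all add: tensor_op_pure pure_in_E)

lemma tensor_op_id: "t \<in> E I \<Longrightarrow> tensor_op I (\<lambda>_. id) t = t"
  by (rule E_eqI[OF flinear_tensor_op flinear_id]) (simp_all add: tensor_op_pure lin_id)

lemma tensor_op_comp:
  "(\<And>c. c \<in> I \<Longrightarrow> lin (Y c)) \<Longrightarrow> tensor_op I Y (tensor_op I Z t) = tensor_op I (\<lambda>c. Y c \<circ> Z c) t"
  by (auto simp: tensor_op_def dual_family_comp comp_assoc fun_eq_iff)

lemma tensor_op_cong:
  assumes "\<And>c. c \<in> I \<Longrightarrow> Y c = Z c" "\<And>c. c \<in> I \<Longrightarrow> lin (Z c)" "t \<in> E I"
  shows "tensor_op I Y t = tensor_op I Z t"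
proof (rule E_eqI[OF flinear_tensor_op flinear_tensor_op _ assms(3)])
  fix w show "tensor_op I Y (pure I w) = tensor_op I Z (pure I w)"
    using assms(1,2) by (simp add: tensor_op_pure) (auto simp: pure_apply fun_eq_iff intro!: prod.cong)
qed

lemma tensor_op_sum:
  assumes I: "finite I" and F: "\<And>c. c \<in> I \<Longrightarrow> finite (F c)"
    and Y: "\<And>c i. c \<in> I \<Longrightarrow> i \<in> F c \<Longrightarrow> lin (Y c i)" and t: "t \<in> E I"
  shows "tensor_op I (\<lambda>c w. \<Sum>i\<in>F c. Y c i w) t = (\<Sum>f\<in>PiE I F. tensor_op I (\<lambda>c. Y c (f c)) t)"
proof (rule E_eqI[OF flinear_tensor_op _ _ t])
  show "flinear (\<lambda>t. \<Sum>f\<in>PiE I F. tensor_op I (\<lambda>c. Y c (f c)) t)" by (intro flinear_sum flinear_tensor_op)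
  fix w
  have "tensor_op I (\<lambda>c w. \<Sum>i\<in>F c. Y c i w) (pure I w) = pure I (\<lambda>c. \<Sum>i\<in>F c. Y c i (w c))"
    by (rule tensor_op_pure) (intro lin_sum Y)
  also have "\<dots> = (\<Sum>f\<in>PiE I F. pure I (\<lambda>c. Y c (f c) (w c)))"
  proof
    fix \<xi>
    show "pure I (\<lambda>c. \<Sum>i\<in>F c. Y c i (w c)) \<xi> = (\<Sum>f\<in>PiE I F. pure I (\<lambda>c. Y c (f c) (w c))) \<xi>"
      using prod_sum_PiE[of I F "\<lambda>c i. \<xi> c (Y c i (w c))", OF I F]
      by (cases "dual_family I \<xi>") (auto simp: sum_fun_apply pure_apply dual_family_def dual_spaceD intro!: sum.neutral)
  qed
  also have "\<dots> = (\<Sum>f\<in>PiE I F. tensor_op I (\<lambda>c. Y c (f c)) (pure I w))"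
    by (intro sum.cong refl tensor_op_pure[symmetric]) (auto simp: Y PiE_iff)
  finally show "tensor_op I (\<lambda>c w. \<Sum>i\<in>F c. Y c i w) (pure I w)
      = (\<Sum>f\<in>PiE I F. tensor_op I (\<lambda>c. Y c (f c)) (pure I w))" .
qed

lemma tensor_op_scale:
  assumes Y: "\<And>c. c \<in> I \<Longrightarrow> lin (Y c)" and t: "t \<in> E I"
  shows "tensor_op I (\<lambda>c w. sW (a c) (Y c w)) t = fscale (\<Prod>c\<in>I. a c) (tensor_op I Y t)"
proof (rule E_eqI[OF flinear_tensor_op _ _ t])
  show "flinear (\<lambda>t. fscale (\<Prod>c\<in>I. a c) (tensor_op I Y t))" by (intro flinear_scale flinear_tensor_op)
  fix w
  have "tensor_op I (\<lambda>c w. sW (a c) (Y c w)) (pure I w) = pure I (\<lambda>c. sW (a c) (Y c (w c)))"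
    by (rule tensor_op_pure) (intro lin_scale Y)
  then show "tensor_op I (\<lambda>c w. sW (a c) (Y c w)) (pure I w) = fscale (\<Prod>c\<in>I. a c) (tensor_op I Y (pure I w))"
    by (auto simp: tensor_op_pure[OF Y] pure_apply dual_family_def dual_spaceD fs_simps prod.distrib)
qed

lemma tensor_op_line:
  assumes I: "finite I" and X: "lin X" and Y: "lin Y" and t: "t \<in> E I"
  shows "tensor_op I (\<lambda>_ w. X w + sW s (Y w)) t
    = (\<Sum>f\<in>PiE I (\<lambda>_. UNIV). fscale (s ^ card {c \<in> I. f c}) (tensor_op I (\<lambda>c. if f c then Y else X) t))"
proof -
  let ?Z = "\<lambda>i. if i then Y else X"
  have lin_Z: "lin (?Z i)" for i using X Y by simp
  have "(\<lambda>(_ :: 'a) w. X w + sW s (Y w)) = (\<lambda>_ w. \<Sum>i\<in>UNIV. sW (if i then s else 1) (?Z i w))"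
    by (simp add: UNIV_bool)
  then have "tensor_op I (\<lambda>_ w. X w + sW s (Y w)) t
      = (\<Sum>f\<in>PiE I (\<lambda>_. UNIV). tensor_op I (\<lambda>c w. sW (if f c then s else 1) (?Z (f c) w)) t)"
    using tensor_op_sum[OF I, of "\<lambda>_. UNIV" "\<lambda>_ i w. sW (if i then s else 1) (?Z i w)" t]
    by (simp add: lin_scale lin_Z t)
  also have "\<dots> = (\<Sum>f\<in>PiE I (\<lambda>_. UNIV). fscale (s ^ card {c \<in> I. f c}) (tensor_op I (\<lambda>c. ?Z (f c)) t))"
    using I by (simp add: tensor_op_scale[OF lin_Z t] prod.If_cases Int_def)
  finally show ?thesis .
qed

definition tensor_act :: "('w \<Rightarrow> 'w) \<Rightarrow> ('i, 'w, 'k) tensor \<Rightarrow> ('i, 'w, 'k) tensor" where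
  "tensor_act g t = (\<lambda>\<xi>. t (\<lambda>c. \<xi> c \<circ> g))"

lemma flinear_tensor_act: "flinear (tensor_act g)"
  by (rule flinearI) (auto simp: tensor_act_def fs_simps)

lemma tensor_act_comp: "tensor_act (g \<circ> h) t = tensor_act g (tensor_act h t)"
  by (simp add: tensor_act_def comp_assoc)

lemma tensor_act_id: "tensor_act id t = t"
  by (simp add: tensor_act_def)

lemma tensor_act_pure:
  fixes I :: "'i set"
  assumes g: "g \<in> GL sW"
  shows "tensor_act g (pure I w) = pure I (g \<circ> w)"
proof
  fix \<xi> :: "'i \<Rightarrow> 'w \<Rightarrow> 'k"
  have "\<xi> c \<in> dual" if "\<xi> c \<circ> g \<in> dual" for c
    using dual_comp[OF that GL_lin[OF GL_inv(1)[OF g]]] GL_inv(2)[OF g] by (simp add: comp_assoc)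
  then have "dual_family I (\<lambda>c. \<xi> c \<circ> g) \<longleftrightarrow> dual_family I \<xi>"
    using GL_lin[OF g] by (auto simp: dual_family_def dual_comp)
  then show "tensor_act g (pure I w) \<xi> = pure I (g \<circ> w) \<xi>" by (simp add: tensor_act_def pure_apply)
qed

lemma tensor_act_eq_op:
  assumes "g \<in> GL sW" "t \<in> E I"
  shows "tensor_act g t = tensor_op I (\<lambda>_. g) t"
  by (rule E_eqI[OF flinear_tensor_act flinear_tensor_op _ assms(2)])
    (simp add: tensor_act_pure[OF assms(1)] tensor_op_pure GL_lin[OF assms(1)] comp_def)

lemma E_stable: "stable (GL sW) tensor_act (E I)"
  unfolding stable_def using E_subspace by (auto simp: tensor_act_eq_op intro!: tensor_op_E GL_lin)

lemma tensor_op_in_stable: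
  assumes I: "finite I" and X: "lin X" and N: "stable (GL sW) tensor_act N" "N \<subseteq> E I" and v: "v \<in> N"
  shows "tensor_op I (\<lambda>_. X) v \<in> N"
proof -
  have vE: "v \<in> E I" using v N by blast
  have "tensor_op I (\<lambda>_ w. X w + sW 0 (id w)) v \<in> N"
    unfolding tensor_op_line[OF I X lin_id vE]
  proof (rule polynomial_curve_in_subspace[OF infinite_invertible_shifts[OF X] stableD(1)[OF N(1)]])
    fix s assume "s \<in> {s. (\<lambda>w. X w + sW s (id w)) \<in> GL sW}"
    then have g: "(\<lambda>w. X w + sW s (id w)) \<in> GL sW" by simp
    show "(\<Sum>f\<in>PiE I (\<lambda>_. UNIV). fscale (s ^ card {c \<in> I. f c}) (tensor_op I (\<lambda>c. if f c then id else X) v)) \<in> N"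
      using stableD(2)[OF N(1) g v] by (simp only: tensor_act_eq_op[OF g vE] tensor_op_line[OF I X lin_id vE])
  qed (simp add: I finite_PiE)
  then show ?thesis by simp
qed

definition perm_act :: "('i \<Rightarrow> 'i) \<Rightarrow> ('i, 'w, 'k) tensor \<Rightarrow> ('i, 'w, 'k) tensor" where
  "perm_act p t = (\<lambda>\<xi>. t (\<xi> \<circ> p))"

lemma flinear_perm_act: "flinear (perm_act p)"
  by (rule flinearI) (auto simp: perm_act_def fs_simps)

lemma perm_act_comp: "perm_act p (perm_act q t) = perm_act (p \<circ> q) t"
  by (simp add: perm_act_def comp_assoc)

lemma perm_act_id: "perm_act id t = t"
  by (simp add: perm_act_def)

lemma perm_act_pure:
  assumes p: "p permutes I"
  shows "perm_act p (pure I w) = pure I (w \<circ> inv p)"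
proof
  fix \<xi>
  have d: "dual_family I (\<xi> \<circ> p) \<longleftrightarrow> dual_family I \<xi>"
    using permutes_image[OF p] unfolding dual_family_def by (metis (no_types, lifting) comp_apply imageE imageI)
  have "(\<Prod>c\<in>I. \<xi> c (w (inv p c))) = (\<Prod>c\<in>I. \<xi> (p c) (w (inv p (p c))))"
    using prod.permute[OF p, of "\<lambda>c. \<xi> c (w (inv p c))"] by (simp add: comp_def)
  then show "perm_act p (pure I w) \<xi> = pure I (w \<circ> inv p) \<xi>"
    using d by (simp add: perm_act_def pure_apply permutes_inverses[OF p])
qed

lemma perm_act_E: "p permutes I \<Longrightarrow> t \<in> E I \<Longrightarrow> perm_act p t \<in> E I"
  by (rule E_memI[OF flinear_perm_act E_subspace]) (simp_all add: perm_act_pure pure_in_E)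

lemma perm_act_E_stable: "stable {p. p permutes I} perm_act (E I)"
  unfolding stable_def using E_subspace perm_act_E by auto

lemma tensor_act_perm_act: "tensor_act g (perm_act p t) = perm_act p (tensor_act g t)"
  by (simp add: tensor_act_def perm_act_def comp_def)

lemma indices_comp: "p permutes I \<Longrightarrow> T \<in> indices I \<Longrightarrow> T \<circ> p \<in> indices I"
  by (auto simp: PiE_iff extensional_def permutes_in_image permutes_not_in)

lemma perm_act_conjugates_tensor_op:
  assumes p: "p permutes I" and Y: "\<And>c. lin (Y c)" and t: "t \<in> E I"
  shows "perm_act p (tensor_op I Y (perm_act (inv p) t)) = tensor_op I (\<lambda>c. Y (inv p c)) t"
proof (rule E_eqI[OF _ flinear_tensor_op _ t])
  show "flinear (\<lambda>t. perm_act p (tensor_op I Y (perm_act (inv p) t)))"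
    by (intro flinear_compose[OF flinear_perm_act] flinear_compose[OF flinear_tensor_op] flinear_perm_act)
  fix w
  have "inv (inv p) = p" by (rule inv_inv_eq[OF permutes_bij[OF p]])
  then show "perm_act p (tensor_op I Y (perm_act (inv p) (pure I w))) = tensor_op I (\<lambda>c. Y (inv p c)) (pure I w)"
    by (simp add: perm_act_pure[OF p] perm_act_pure[OF permutes_inv[OF p]] tensor_op_pure[OF Y] comp_def
        permutes_inverses[OF p])
qed

lemma polarization:
  assumes I: "finite I" and Y: "\<And>i. lin (Y i)" and t: "t \<in> E I"
  shows "(\<Sum>p | p permutes I. tensor_op I (\<lambda>c. Y (p c)) t)
    = (\<Sum>J\<in>Pow I. fscale ((-1) ^ card (I - J)) (tensor_op I (\<lambda>_ w. \<Sum>i\<in>J. Y i w) t))"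
proof
  fix \<xi>
  have "(\<Sum>J\<in>Pow I. fscale ((-1) ^ card (I - J)) (tensor_op I (\<lambda>_ w. \<Sum>i\<in>J. Y i w) t)) \<xi>
      = (\<Sum>J\<in>Pow I. (-1) ^ card (I - J) * (\<Sum>f\<in>PiE I (\<lambda>_. J). tensor_op I (\<lambda>c. Y (f c)) t \<xi>))"
    unfolding sum_fun_apply fscale_apply
  proof (intro sum.cong refl arg_cong2[where f="(*)"])
    fix J assume "J \<in> Pow I"
    then have "finite J" using I finite_subset by auto
    then show "tensor_op I (\<lambda>_ w. \<Sum>i\<in>J. Y i w) t \<xi> = (\<Sum>f\<in>PiE I (\<lambda>_. J). tensor_op I (\<lambda>c. Y (f c)) t \<xi>)"
      using tensor_op_sum[OF I, of "\<lambda>_. J" "\<lambda>_. Y" t] Y t by (simp add: sum_fun_apply)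
  qed
  also have "\<dots> = (\<Sum>p | p permutes I. tensor_op I (\<lambda>c. Y (restrict p I c)) t \<xi>)"
    by (rule inclusion_exclusion_surjections[OF I])
  also have "\<dots> = (\<Sum>p | p permutes I. tensor_op I (\<lambda>c. Y (p c)) t) \<xi>"
    unfolding sum_fun_apply by (intro sum.cong refl fun_cong[OF tensor_op_cong[OF _ Y t]]) simp
  finally show "(\<Sum>p | p permutes I. tensor_op I (\<lambda>c. Y (p c)) t) \<xi>
      = (\<Sum>J\<in>Pow I. fscale ((-1) ^ card (I - J)) (tensor_op I (\<lambda>_ w. \<Sum>i\<in>J. Y i w) t)) \<xi>" by simp
qed

lemma symmetrized_tensor_op_in_stable:
  assumes I: "finite I" and Y: "\<And>i. lin (Y i)" and N: "stable (GL sW) tensor_act N" "N \<subseteq> E I" and v: "v \<in> N"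
  shows "(\<Sum>p | p permutes I. tensor_op I (\<lambda>c. Y (p c)) v) \<in> N"
proof -
  have subN: "fs.subspace N" using stableD(1)[OF N(1)] .
  have "v \<in> E I" using v N by blast
  then show ?thesis
    unfolding polarization[of I Y v, OF I Y \<open>v \<in> E I\<close>]
    by (intro fs.subspace_sum[OF subN] fs.subspace_scale[OF subN] tensor_op_in_stable[OF I _ N v] lin_sum Y)
qed

lemma tensor_op_matrix_unit:
  assumes t: "t \<in> E I"
  shows "tensor_op I (\<lambda>c. matrix_unit (S c) (T c)) t = fscale (tcoord T t) (basis_tensor I S)"
proof (rule E_eqI[OF flinear_tensor_op flinear_tcoord _ t])
  fix w
  have "tensor_op I (\<lambda>c. matrix_unit (S c) (T c)) (pure I w) = pure I (\<lambda>c. matrix_unit (S c) (T c) (w c))"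
    by (rule tensor_op_pure[OF lin_matrix_unit])
  then show "tensor_op I (\<lambda>c. matrix_unit (S c) (T c)) (pure I w) = fscale (tcoord T (pure I w)) (basis_tensor I S)"
    by (auto simp: fs_simps basis_tensor_def tcoord_pure pure_apply matrix_unit_def dual_family_def dual_spaceD
        prod.distrib)
qed

lemma linear_map_expand:
  assumes I: "finite I" and B: "flinear B" "\<And>t. t \<in> E I \<Longrightarrow> B t \<in> E I" and v: "v \<in> E I"
  shows "B v = (\<Sum>T\<in>indices I. \<Sum>S\<in>indices I. fscale (tcoord S (B (basis_tensor I T)))
    (tensor_op I (\<lambda>c. matrix_unit (S c) (T c)) v))"
proof -
  have "B v = B (\<Sum>T\<in>indices I. fscale (tcoord T v) (basis_tensor I T))" using E_expand[OF I v] by simp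
  also have "\<dots> = (\<Sum>T\<in>indices I. fscale (tcoord T v) (B (basis_tensor I T)))"
    by (simp only: fsp.linear_sum[OF B(1)] fsp.linear_scale[OF B(1)])
  also have "\<dots> = (\<Sum>T\<in>indices I. fscale (tcoord T v)
      (\<Sum>S\<in>indices I. fscale (tcoord S (B (basis_tensor I T))) (basis_tensor I S)))"
    using E_expand[OF I B(2)[OF basis_tensor_in_E]] by (intro sum.cong refl arg_cong2[where f=fscale])
  finally show ?thesis
    by (simp only: tensor_op_matrix_unit[OF v] fs.scale_sum_right fs.scale_scale mult.commute)
qed

lemma perm_equivariant_in_stable:
  fixes I :: "'i set"
  assumes I: "finite I" and B: "flinear B" "\<And>t. t \<in> E I \<Longrightarrow> B t \<in> E I"
    and equivariant: "\<And>p t. p permutes I \<Longrightarrow> t \<in> E I \<Longrightarrow> B (perm_act p t) = perm_act p (B t)"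
    and N: "stable (GL sW) tensor_act N" "N \<subseteq> E I" and v: "v \<in> N"
  shows "B v \<in> N"
proof -
  have subN: "fs.subspace N" using stableD(1)[OF N(1)] .
  have vE: "v \<in> E I" using v N by blast
  let ?P = "{p. p permutes I}" and ?\<beta> = "\<lambda>S T. tcoord S (B (basis_tensor I T))"
  let ?U = "\<lambda>S T c. matrix_unit (S c) (T c)"
  have conjugate: "B v = (\<Sum>T\<in>indices I. \<Sum>S\<in>indices I. fscale (?\<beta> S T) (tensor_op I (\<lambda>c. ?U S T (inv p c)) v))"
    if p: "p permutes I" for p
  proof -
    have v': "perm_act (inv p) v \<in> E I" by (rule perm_act_E[OF permutes_inv[OF p] vE])
    have "B v = perm_act p (B (perm_act (inv p) v))"
      using equivariant[OF p v'] by (simp add: perm_act_comp perm_act_id permutes_inv_o[OF p])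
    then show ?thesis
      by (simp only: linear_map_expand[OF I B v'] fsp.linear_sum[OF flinear_perm_act]
          fsp.linear_scale[OF flinear_perm_act] perm_act_conjugates_tensor_op[OF p lin_matrix_unit vE])
  qed
  have "(\<Sum>p\<in>?P. B v) = (\<Sum>p\<in>?P. \<Sum>T\<in>indices I. \<Sum>S\<in>indices I. fscale (?\<beta> S T) (tensor_op I (\<lambda>c. ?U S T (inv p c)) v))"
    by (intro sum.cong refl conjugate) simp
  also have "\<dots> = (\<Sum>T\<in>indices I. \<Sum>S\<in>indices I. fscale (?\<beta> S T) (\<Sum>p\<in>?P. tensor_op I (\<lambda>c. ?U S T (inv p c)) v))"
    unfolding fs.scale_sum_right by (subst sum.swap) (intro sum.cong refl sum.swap)
  also have "\<dots> = (\<Sum>T\<in>indices I. \<Sum>S\<in>indices I. fscale (?\<beta> S T) (\<Sum>p\<in>?P. tensor_op I (\<lambda>c. ?U S T (p c)) v))"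
    by (intro sum.cong refl arg_cong2[where f=fscale] sum_permutations_inverse[symmetric])
  also have "\<dots> \<in> N"
    by (intro fs.subspace_sum[OF subN] fs.subspace_scale[OF subN]
        symmetrized_tensor_op_in_stable[OF I lin_matrix_unit N v])
  finally have "fscale (of_nat (card ?P)) (B v) \<in> N" by (simp only: fs.sum_constant_scale)
  moreover have "card ?P \<noteq> 0" using card_permutations[OF refl I] by simp
  ultimately show ?thesis
    using fs.subspace_scale[OF subN, of "fscale (of_nat (card ?P)) (B v)" "inverse (of_nat (card ?P))"] by simp
qed

lemma maschke:
  fixes I :: "'i set"
  assumes I: "finite I" and Z: "stable {p. p permutes I} perm_act Z"
  obtains P where "equivariant_on {p. p permutes I} perm_act perm_act UNIV P" "range P \<subseteq> Z" "\<forall>u\<in>Z. P u = u"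
proof -
  let ?G = "{p. p permutes I}"
  have subZ: "fs.subspace Z" using stableD(1)[OF Z] .
  obtain P0 where P0: "range P0 \<subseteq> Z" "flinear P0" "\<forall>v\<in>Z. P0 v = v"
    using fsp.linear_exists_left_inverse_on[OF flinear_id subZ] by auto
  have cardG: "of_nat (card ?G) \<noteq> (0 :: 'k)" using card_permutations[OF refl I] by simp
  define S where "S u = (\<Sum>q\<in>?G. perm_act q (P0 (perm_act (inv q) u)))" for u
  define P where "P u = fscale (inverse (of_nat (card ?G))) (S u)" for u
  have "flinear S"
    unfolding S_def
    by (intro flinear_sum flinear_compose[OF flinear_perm_act] flinear_compose[OF P0(2)] flinear_perm_act)
  moreover have "S (perm_act p u) = perm_act p (S u)" if p: "p permutes I" for p u
  proof -
    have summand: "perm_act (p \<circ> q) (P0 (perm_act (inv (p \<circ> q)) (perm_act p u)))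
        = perm_act p (perm_act q (P0 (perm_act (inv q) u)))" if q: "q permutes I" for q
    proof -
      have "inv (p \<circ> q) \<circ> p = inv q"
        using o_inv_distrib[OF permutes_bij[OF p] permutes_bij[OF q]] permutes_inv_o(2)[OF p]
        by (simp add: comp_assoc)
      then show ?thesis by (simp only: perm_act_comp)
    qed
    have "S (perm_act p u) = (\<Sum>q\<in>?G. perm_act (p \<circ> q) (P0 (perm_act (inv (p \<circ> q)) (perm_act p u))))"
      unfolding S_def by (rule setum_permutations_compose_left[OF p])
    also have "\<dots> = perm_act p (S u)"
      unfolding S_def fsp.linear_sum[OF flinear_perm_act] by (intro sum.cong refl summand) simp
    finally show ?thesis .
  qed
  ultimately have "equivariant_on ?G perm_act perm_act UNIV P"
    unfolding equivariant_on_def P_def by (simp add: flinear_scale fsp.linear_scale[OF flinear_perm_act])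
  moreover have "range P \<subseteq> Z"
    unfolding P_def S_def
    by (intro image_subsetI fs.subspace_scale[OF subZ] fs.subspace_sum[OF subZ] stableD(2)[OF Z]) (use P0(1) in auto)
  moreover have "P u = u" if u: "u \<in> Z" for u
  proof -
    have "perm_act q (P0 (perm_act (inv q) u)) = u" if q: "q permutes I" for q
      using stableD(2)[OF Z _ u, of "inv q"] permutes_inv[OF q] P0(3)
      by (simp add: perm_act_comp perm_act_id permutes_inv_o[OF q])
    then have "S u = fscale (of_nat (card ?G)) u" by (simp add: S_def fs.sum_constant_scale del: sum_constant)
    then show ?thesis using cardG by (simp add: P_def)
  qed
  ultimately show ?thesis using that by blast
qed

definition gl_span :: "('i, 'w, 'k) tensor \<Rightarrow> ('i, 'w, 'k) tensor set" where
  "gl_span x = fs.span ((\<lambda>g. tensor_act g x) ` GL sW)"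

lemma gl_span_stable: "stable (GL sW) tensor_act (gl_span x)"
  unfolding gl_span_def
  by (rule stable_span[OF flinear_tensor_act]) (auto intro!: fs.span_base GL_comp simp flip: tensor_act_comp)

lemma gl_span_self: "x \<in> gl_span x"
  unfolding gl_span_def by (rule fs.span_base) (auto simp: tensor_act_id intro!: image_eqI[of _ _ id] GL_id)

lemma gl_span_minimal: "stable (GL sW) tensor_act N \<Longrightarrow> x \<in> N \<Longrightarrow> gl_span x \<subseteq> N"
  unfolding gl_span_def by (rule fs.span_minimal) (auto simp: stable_def)

lemma gl_span_operator:
  assumes "y \<in> gl_span x"
  obtains a where "flinear a" "\<And>p t. a (perm_act p t) = perm_act p (a t)" "a x = y"
proof -
  obtain F r where F: "finite F" "F \<subseteq> (\<lambda>g. tensor_act g x) ` GL sW" "y = (\<Sum>u\<in>F. fscale (r u) u)"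
    using assms unfolding gl_span_def fs.span_explicit by blast
  obtain G where G: "finite G" "inj_on (\<lambda>g. tensor_act g x) G" "F = (\<lambda>g. tensor_act g x) ` G"
    using F(2) subset_image_inj by (metis F(1) finite_imageD)
  let ?a = "\<lambda>t. \<Sum>g\<in>G. fscale (r (tensor_act g x)) (tensor_act g t)"
  show ?thesis
  proof (rule that[of ?a])
    show "flinear ?a" by (intro flinear_sum flinear_scale flinear_tensor_act)
    show "?a (perm_act p t) = perm_act p (?a t)" for p t
      by (simp only: tensor_act_perm_act fsp.linear_sum[OF flinear_perm_act] fsp.linear_scale[OF flinear_perm_act])
    show "?a x = y" unfolding F(3) G(3) by (simp add: sum.reindex[OF G(2)])
  qed
qed

lemma gl_span_simple:
  fixes I :: "'i set"
  assumes I: "finite I" and Z: "simple_sub {p. p permutes I} perm_act Z" "Z \<subseteq> E I" and x: "x \<in> Z" "x \<noteq> 0"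
  shows "simple_sub (GL sW) tensor_act (gl_span x)"
  unfolding simple_sub_def
proof (intro conjI gl_span_stable allI impI)
  show "gl_span x \<noteq> {0}" using gl_span_self[of x] x(2) by blast
  fix N assume N: "N \<subseteq> gl_span x" "stable (GL sW) tensor_act N"
  show "N = {0} \<or> N = gl_span x"
  proof (cases "N = {0}")
    case False
    then obtain y where y: "y \<in> N" "y \<noteq> 0" using fs.subspace_nonzero_element[OF stableD(1)[OF N(2)]] by blast
    obtain a where a: "flinear a" "\<And>p t. a (perm_act p t) = perm_act p (a t)" "a x = y"
      using gl_span_operator[of y x] y N by blast
    have equivariant: "equivariant_on {p. p permutes I} perm_act perm_act Z a"
      unfolding equivariant_on_def using a(1,2) by blast
    have "a ` Z \<noteq> {0}" using a(3) y(2) x(1) by blast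
    note image = simple_image[OF flinear_perm_act Z(1) equivariant this]
    obtain P where P: "equivariant_on {p. p permutes I} perm_act perm_act UNIV P" "range P \<subseteq> a ` Z"
      "\<forall>u\<in>a ` Z. P u = u"
      by (rule maschke[OF I simple_subD(1)[OF image(1)]])
    obtain \<theta> where \<theta>: "range \<theta> \<subseteq> Z" "flinear \<theta>" "\<forall>v\<in>Z. \<theta> (a v) = v"
      using fsp.linear_exists_left_inverse_on[OF a(1) simple_sub_subspace[OF Z(1)] image(2)] by blast
    have "\<theta> (P y) \<in> N"
    proof (rule perm_equivariant_in_stable[OF I _ _ _ N(2) _ y(1), where B="\<lambda>t. \<theta> (P t)"])
      show "flinear (\<lambda>t. \<theta> (P t))" by (rule flinear_compose[OF \<theta>(2) equivariant_onD(1)[OF P(1)]])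
      show "\<theta> (P t) \<in> E I" for t using \<theta>(1) Z(2) by blast
      show "\<theta> (P (perm_act p t)) = perm_act p (\<theta> (P t))" if p: "p permutes I" for p t
      proof -
        obtain z where z: "z \<in> Z" "P t = a z" using P(2) by blast
        then have "P (perm_act p t) = a (perm_act p z)" using equivariant_onD(2)[OF P(1)] p a(2) by simp
        moreover have "perm_act p z \<in> Z" using stableD(2)[OF simple_subD(1)[OF Z(1)] _ z(1)] p by blast
        ultimately show ?thesis using \<theta>(3) z by simp
      qed
      show "N \<subseteq> E I" using N(1) gl_span_minimal[OF E_stable] x(1) Z(2) by blast
    qed
    then have "x \<in> N" using P(3) \<theta>(3) x(1) a(3) by force
    then show ?thesis using gl_span_minimal[OF N(2)] N(1) by blast
  qed simp
qed

lemma E_sum_of_simples: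
  fixes I :: "'i set"
  assumes I: "finite I"
  shows "E I = fs.span (\<Union>{N. N \<subseteq> E I \<and> simple_sub (GL sW) tensor_act N})" (is "_ = fs.span (\<Union>?\<S>)")
proof
  show "fs.span (\<Union>?\<S>) \<subseteq> E I" by (rule fs.span_minimal[OF _ E_subspace]) blast
  let ?G = "{p. p permutes I}"
  have "E I = fs.span (\<Union>{Z. Z \<subseteq> E I \<and> simple_sub ?G perm_act Z})"
  proof (rule span_simple_subs_if_projections[OF flinear_perm_act perm_act_E_stable E_findim[OF I]])
    fix N assume "stable ?G perm_act N"
    then show "\<exists>P. equivariant_on ?G perm_act perm_act (E I) P \<and> P ` E I \<subseteq> N \<and> (\<forall>u\<in>N. P u = u)"
      by (rule maschke[OF I]) (blast intro: equivariant_on_subset)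
  qed
  also have "\<dots> \<subseteq> fs.span (\<Union>?\<S>)"
  proof (rule fs.span_minimal[OF _ fs.subspace_span], clarify)
    fix Z x assume Z: "Z \<subseteq> E I" "simple_sub ?G perm_act Z" "x \<in> Z"
    show "x \<in> fs.span (\<Union>?\<S>)"
    proof (cases "x = 0")
      case False
      have "gl_span x \<in> ?\<S>"
        using gl_span_simple[OF I Z(2,1,3) False] gl_span_minimal[OF E_stable] Z(1,3) by blast
      then show ?thesis using gl_span_self[of x] by (intro fs.span_base) blast
    qed (simp add: fs.span_zero)
  qed
  finally show "E I \<subseteq> fs.span (\<Union>?\<S>)" .
qed

end

section \<open>Weights and highest weights\<close>

definition nprime :: "nat \<Rightarrow> nat" where
  "nprime = enumerate {p. prime p}"

lemma prime_nprime: "prime (nprime i)"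
  using enumerate_in_set[OF primes_infinite, of i] by (simp add: nprime_def)

lemma nprime_nonzero: "of_nat (nprime i) \<noteq> (0 :: 'k::field_char_0)"
  using prime_nprime[of i] by (auto dest: prime_gt_0_nat)

lemma inj_nprime: "inj nprime"
  unfolding nprime_def using primes_infinite by (rule strict_mono_imp_inj_on[OF strict_mono_enumerate])

text \<open>Weights are encoded as eigenvalues of the diagonal matrix whose entries are distinct primes.\<close>

definition weight_scalar :: "nat multiset \<Rightarrow> 'k::field_char_0" where
  "weight_scalar M = of_nat (\<Prod>i\<in>#M. nprime i)"

lemma weight_scalar_inj: "weight_scalar M = (weight_scalar N :: 'k::field_char_0) \<longleftrightarrow> M = N"
proof
  assume "weight_scalar M = (weight_scalar N :: 'k)"
  then have "(\<Prod>i\<in>#M. nprime i) = (\<Prod>i\<in>#N. nprime i)"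
    unfolding weight_scalar_def by (simp only: of_nat_eq_iff)
  moreover have "prime_factorization (\<Prod>i\<in>#M. nprime i) = image_mset nprime M" for M
    by (rule prime_factorization_prod_mset_primes) (auto simp: prime_nprime)
  ultimately have "image_mset nprime M = image_mset nprime N" by metis
  then have "image_mset (inv nprime) (image_mset nprime M) = image_mset (inv nprime) (image_mset nprime N)" by simp
  then show "M = N" by (simp add: multiset.map_comp comp_def inv_f_f[OF inj_nprime])
qed simp

lemma weight_scalar_add_mset:
  "weight_scalar (add_mset i M) = of_nat (nprime i) * (weight_scalar M :: 'k::field_char_0)"
  by (simp add: weight_scalar_def)

lemma weight_scalar_empty [simp]: "weight_scalar {#} = (1 :: 'k::field_char_0)"
  by (simp add: weight_scalar_def)

definition content :: "'i set \<Rightarrow> ('i \<Rightarrow> nat) \<Rightarrow> nat multiset" where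
  "content I T = image_mset T (mset_set I)"

lemma size_content: "size (content I T) = card I"
  by (simp add: content_def)

lemma set_content: "finite I \<Longrightarrow> set_mset (content I T) = T ` I"
  by (simp add: content_def)

lemma sum_content: "sum_mset (content I T) = (\<Sum>c\<in>I. T c)"
  by (simp add: content_def sum_unfold_sum_mset)

lemma prod_content: "(\<Prod>i\<in>#content I T. f i) = (\<Prod>c\<in>I. f (T c))"
  by (simp add: content_def prod_unfold_prod_mset multiset.map_comp comp_def)

lemma weight_scalar_content: "weight_scalar (content I T) = (\<Prod>c\<in>I. of_nat (nprime (T c)) :: 'k::field_char_0)"
  unfolding weight_scalar_def prod_content by simp

lemma PiE_eq_if_le_sum_eq:
  fixes S T :: "'i \<Rightarrow> nat"
  assumes "finite I" "S \<in> PiE I A" "T \<in> PiE I A" "\<And>c. c \<in> I \<Longrightarrow> S c \<le> T c" "(\<Sum>c\<in>I. S c) = (\<Sum>c\<in>I. T c)"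
  shows "S = T"
  by (rule PiE_ext[OF assms(2,3)]) (rule sum_mono_inv[OF assms(5,4) _ assms(1)])

context enumerated_basis
begin

definition entry :: "('w \<Rightarrow> 'w) \<Rightarrow> nat \<Rightarrow> nat \<Rightarrow> 'k" where
  "entry X i j = coord i (X (b j))"

lemma entry_id: "i < m \<Longrightarrow> j < m \<Longrightarrow> entry id i j = (if i = j then 1 else 0)"
  by (auto simp: entry_def coord_b)

lemma entry_comp:
  assumes X: "lin X"
  shows "entry (X \<circ> Y) i j = (\<Sum>k<m. entry X i k * entry Y k j)"
  using dual_expand[OF dual_comp[OF coord_dual X], of i "Y (b j)"] by (simp add: entry_def mult.commute)

lemma tcoord_tensor_op:
  assumes I: "finite I" and X: "lin X" and u: "u \<in> E I"
  shows "tcoord S (tensor_op I (\<lambda>_. X) u) = (\<Sum>T\<in>indices I. tcoord T u * (\<Prod>c\<in>I. entry X (S c) (T c)))"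
proof -
  have "tensor_op I (\<lambda>_. X) u = tensor_op I (\<lambda>_. X) (\<Sum>T\<in>indices I. fscale (tcoord T u) (basis_tensor I T))"
    using E_expand[OF I u] by simp
  also have "\<dots> = (\<Sum>T\<in>indices I. fscale (tcoord T u) (pure I (\<lambda>c. X (b (T c)))))"
    by (simp add: fsp.linear_sum[OF flinear_tensor_op] fsp.linear_scale[OF flinear_tensor_op] basis_tensor_def
        tensor_op_pure X)
  finally show ?thesis by (simp add: tcoord_linear tcoord_pure entry_def)
qed

lemma tcoord_tensor_op_diagonal:
  assumes I: "finite I" and X: "lin X" and u: "u \<in> E I" and S: "S \<in> indices I"
    and off_diagonal: "\<And>T. T \<in> indices I \<Longrightarrow> tcoord T u \<noteq> 0 \<Longrightarrow> (\<And>c. c \<in> I \<Longrightarrow> entry X (S c) (T c) \<noteq> 0) \<Longrightarrow> T = S"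
  shows "tcoord S (tensor_op I (\<lambda>_. X) u) = (\<Prod>i\<in>#content I S. entry X i i) * tcoord S u"
proof -
  have "tcoord S (tensor_op I (\<lambda>_. X) u)
      = (\<Sum>T\<in>indices I. if T = S then tcoord S u * (\<Prod>c\<in>I. entry X (S c) (S c)) else 0)"
    unfolding tcoord_tensor_op[OF I X u] using off_diagonal I by (intro sum.cong) auto
  then show ?thesis using S finite_indices[OF I] by (simp add: prod_content mult.commute)
qed

definition prime_diag :: "'w \<Rightarrow> 'w" where
  "prime_diag w = (\<Sum>j<m. sW (of_nat (nprime j) * coord j w) (b j))"

lemma lin_prime_diag: "lin prime_diag"
  unfolding prime_diag_def
  by (rule linI) (simp_all add: dual_spaceD[OF coord_dual] algebra_simps scale_left_distrib sum.distrib scale_sum_right)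

lemma coord_prime_diag: "i < m \<Longrightarrow> coord i (prime_diag w) = of_nat (nprime i) * coord i w"
  unfolding prime_diag_def by (rule coord_sum)

lemma prime_diag_b: "i < m \<Longrightarrow> prime_diag (b i) = sW (of_nat (nprime i)) (b i)"
  by (rule coord_ext) (simp add: coord_prime_diag dual_spaceD[OF coord_dual] coord_b)

lemma prime_diag_GL: "prime_diag \<in> GL sW"
proof (rule GL_if_inj[OF lin_prime_diag])
  fix w assume zero: "prime_diag w = 0"
  show "w = 0"
  proof (rule coord_ext)
    fix j assume "j < m"
    then show "coord j w = coord j 0"
      using coord_prime_diag[of j w] zero nprime_nonzero[of j, where 'k='k] by (simp add: dual_spaceD[OF coord_dual])
  qed
qed

lemma tcoord_prime_diag:
  assumes I: "finite I" and u: "u \<in> E I" and S: "S \<in> indices I"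
  shows "tcoord S (tensor_act prime_diag u) = weight_scalar (content I S) * tcoord S u"
proof -
  have entry: "entry prime_diag i j = (if i = j then of_nat (nprime i) else 0)" if "i < m" "j < m" for i j
    using that by (simp add: entry_def coord_prime_diag coord_b)
  have "tcoord S (tensor_act prime_diag u) = (\<Prod>i\<in>#content I S. entry prime_diag i i) * tcoord S u"
    unfolding tensor_act_eq_op[OF prime_diag_GL u]
  proof (rule tcoord_tensor_op_diagonal[OF I lin_prime_diag u S])
    fix T assume T: "T \<in> indices I" "\<And>c. c \<in> I \<Longrightarrow> entry prime_diag (S c) (T c) \<noteq> 0"
    show "T = S"
      using S T(1) T(2) entry by (intro PiE_ext[OF T(1) S]) (metis PiE_mem lessThan_iff)
  qed
  also have "(\<Prod>i\<in>#content I S. entry prime_diag i i) = weight_scalar (content I S)"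
    unfolding prod_content weight_scalar_content using S by (intro prod.cong) (auto simp: entry PiE_iff)
  finally show ?thesis .
qed

definition weight_space :: "('w \<Rightarrow> 'w, 'a, 'k) action \<Rightarrow> ('a \<Rightarrow> 'k) set \<Rightarrow> nat multiset \<Rightarrow> ('a \<Rightarrow> 'k) set" where
  "weight_space act N M = fs.eigenspace (act prime_diag) N (weight_scalar M)"

lemma weight_space_iff: "u \<in> weight_space act N M \<longleftrightarrow> u \<in> N \<and> act prime_diag u = fscale (weight_scalar M) u"
  by (simp add: weight_space_def fs.eigenspace_def)

lemma subspace_weight_space: "flinear (act prime_diag) \<Longrightarrow> fs.subspace N \<Longrightarrow> fs.subspace (weight_space act N M)"
  unfolding weight_space_def by (rule fs.subspace_eigenspace)

lemma tensor_weight_space_iff: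
  assumes I: "finite I" and N: "N \<subseteq> E I"
  shows "u \<in> weight_space tensor_act N M \<longleftrightarrow> u \<in> N \<and> (\<forall>T\<in>indices I. tcoord T u \<noteq> 0 \<longrightarrow> content I T = M)"
    (is "_ \<longleftrightarrow> _ \<and> ?support")
proof (cases "u \<in> N")
  case True
  then have u: "u \<in> E I" using N by blast
  have "tensor_act prime_diag u = fscale (weight_scalar M) u \<longleftrightarrow>
      (\<forall>T\<in>indices I. tcoord T (tensor_act prime_diag u) = tcoord T (fscale (weight_scalar M) u))"
    using E_ext[OF I stableD(2)[OF E_stable prime_diag_GL u] fs.subspace_scale[OF E_subspace u]] by auto
  also have "\<dots> \<longleftrightarrow> ?support"
    by (auto simp: tcoord_prime_diag[OF I u] tcoord_linear weight_scalar_inj)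
  finally show ?thesis using True by (simp add: weight_space_iff)
qed (simp add: weight_space_iff)

lemma weight_component_in_stable:
  assumes I: "finite I" and N: "stable (GL sW) tensor_act N" "N \<subseteq> E I" and u: "u \<in> N"
  shows "(\<Sum>T | T \<in> indices I \<and> content I T = M. fscale (tcoord T u) (basis_tensor I T)) \<in> N" (is "?c M \<in> N")
proof -
  have uE: "u \<in> E I" using u N by blast
  let ?F = "insert M (content I ` indices I)"
  have fin: "finite (indices I)" by (rule finite_indices[OF I])
  show ?thesis
  proof (rule fs.eigen_components_in_subspace[OF flinear_tensor_act stableD(1)[OF N(1)], where F="?F" and \<theta>=weight_scalar and u="?c"])
    show "tensor_act prime_diag v \<in> N" if "v \<in> N" for v by (rule stableD(2)[OF N(1) prime_diag_GL that])
    show "inj_on weight_scalar ?F" by (auto simp: inj_on_def weight_scalar_inj)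
    have "(\<Sum>M\<in>?F. ?c M) = (\<Sum>T\<in>indices I. fscale (tcoord T u) (basis_tensor I T))"
      by (rule sum.group) (use fin in auto)
    then show "(\<Sum>M\<in>?F. ?c M) \<in> N" using u E_expand[OF I uE] by simp
    fix M'
    have "?c M' \<in> E I"
      by (intro fs.subspace_sum[OF E_subspace] fs.subspace_scale[OF E_subspace] basis_tensor_in_E)
    moreover have "content I T = M'" if T: "T \<in> indices I" "tcoord T (?c M') \<noteq> 0" for T
    proof -
      obtain S where "S \<in> indices I" "content I S = M'" "tcoord T (fscale (tcoord S u) (basis_tensor I S)) \<noteq> 0"
        using T(2) unfolding tcoord_linear(5) by (rule sum.not_neutral_contains_not_neutral) blast
      then show ?thesis using T(1) by (auto simp: tcoord_linear tcoord_basis_tensor[OF I] split: if_splits)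
    qed
    ultimately have "?c M' \<in> weight_space tensor_act (E I) M'"
      using tensor_weight_space_iff[OF I subset_refl] by blast
    then show "tensor_act prime_diag (?c M') = fscale (weight_scalar M') (?c M')" by (simp add: weight_space_iff)
  qed (use fin in auto)
qed

text \<open>Lowering the index of a basis vector raises its weight, so highest weights have the least index sum.\<close>

definition highest_weight_vector ::
    "'i set \<Rightarrow> ('i, 'w, 'k) tensor set \<Rightarrow> nat multiset \<Rightarrow> ('i, 'w, 'k) tensor \<Rightarrow> bool" where
  "highest_weight_vector I N M u \<longleftrightarrow> u \<in> weight_space tensor_act N M \<and> u \<noteq> 0 \<and>
     (\<forall>v\<in>N. \<forall>T\<in>indices I. tcoord T v \<noteq> 0 \<longrightarrow> sum_mset M \<le> sum_mset (content I T))"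

lemma exists_highest_weight_vector:
  assumes I: "finite I" and N: "stable (GL sW) tensor_act N" "N \<subseteq> E I" "N \<noteq> {0}"
  obtains M u where "highest_weight_vector I N M u" "size M = card I" "set_mset M \<subseteq> {..<m}"
proof -
  let ?P = "\<lambda>(v, T). v \<in> N \<and> T \<in> indices I \<and> tcoord T v \<noteq> 0"
  obtain v0 where v0: "v0 \<in> N" "v0 \<noteq> 0" by (rule fs.subspace_nonzero_element[OF stableD(1)[OF N(1)] N(3)])
  obtain T0 where "T0 \<in> indices I" "tcoord T0 v0 \<noteq> 0" by (rule E_nonzero_tcoord[OF I _ v0(2)]) (use v0 N in auto)
  then have "?P (v0, T0)" using v0 by simp
  then obtain v T where v: "v \<in> N" "T \<in> indices I" "tcoord T v \<noteq> 0"
    and minimal: "\<And>v' T'. ?P (v', T') \<Longrightarrow> sum_mset (content I T) \<le> sum_mset (content I T')"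
    using ex_has_least_nat[of ?P "(v0, T0)" "\<lambda>(v, T). sum_mset (content I T)"] by auto
  let ?M = "content I T"
  let ?u = "\<Sum>S | S \<in> indices I \<and> content I S = ?M. fscale (tcoord S v) (basis_tensor I S)"
  have uN: "?u \<in> N" by (rule weight_component_in_stable[OF I N(1,2) v(1)])
  have tcoord_u: "tcoord S ?u = (if content I S = ?M then tcoord S v else 0)" if S: "S \<in> indices I" for S
  proof -
    have "tcoord S ?u = (\<Sum>T' | T' \<in> indices I \<and> content I T' = ?M. if T' = S then tcoord S v else 0)"
      unfolding tcoord_linear by (intro sum.cong) (auto simp: tcoord_linear tcoord_basis_tensor[OF I S])
    then show ?thesis using S finite_indices[OF I] by simp
  qed
  have "?u \<in> weight_space tensor_act N ?M"
    using uN tcoord_u by (auto simp: tensor_weight_space_iff[OF I N(2)] split: if_splits)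
  moreover have "?u \<noteq> 0" using tcoord_u[OF v(2)] v(3) by (auto simp: tcoord_linear(1))
  ultimately have "highest_weight_vector I N ?M ?u"
    unfolding highest_weight_vector_def using minimal by auto
  then show ?thesis
    by (rule that) (use v(2) in \<open>auto simp: size_content set_content[OF I]\<close>)
qed

lemma highest_weight_vector_upper_triangular:
  assumes I: "finite I" and N: "stable (GL sW) tensor_act N" "N \<subseteq> E I" and u: "highest_weight_vector I N M u"
    and X: "lin X" and upper: "\<And>i j. i < m \<Longrightarrow> j < i \<Longrightarrow> entry X i j = 0"
  shows "tensor_op I (\<lambda>_. X) u = fscale (\<Prod>i\<in>#M. entry X i i) u"
proof -
  have uN: "u \<in> N" and weight: "\<And>T. T \<in> indices I \<Longrightarrow> tcoord T u \<noteq> 0 \<Longrightarrow> content I T = M"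
    and minimal: "\<And>v T. v \<in> N \<Longrightarrow> T \<in> indices I \<Longrightarrow> tcoord T v \<noteq> 0 \<Longrightarrow> sum_mset M \<le> sum_mset (content I T)"
    using u by (auto simp: highest_weight_vector_def tensor_weight_space_iff[OF I N(2)])
  have Xu: "tensor_op I (\<lambda>_. X) u \<in> N" by (rule tensor_op_in_stable[OF I X N uN])
  have uE: "u \<in> E I" using uN N(2) by blast
  show ?thesis
  proof (rule E_ext[OF I _ fs.subspace_scale[OF E_subspace uE]])
    show "tensor_op I (\<lambda>_. X) u \<in> E I" using Xu N(2) by blast
    fix S assume S: "S \<in> indices I"
    show "tcoord S (tensor_op I (\<lambda>_. X) u) = tcoord S (fscale (\<Prod>i\<in>#M. entry X i i) u)"
    proof (cases "sum_mset M \<le> sum_mset (content I S)")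
      case True
      have "tcoord S (tensor_op I (\<lambda>_. X) u) = (\<Prod>i\<in>#content I S. entry X i i) * tcoord S u"
      proof (rule tcoord_tensor_op_diagonal[OF I X uE S])
        fix T assume T: "T \<in> indices I" "tcoord T u \<noteq> 0" "\<And>c. c \<in> I \<Longrightarrow> entry X (S c) (T c) \<noteq> 0"
        have le: "S c \<le> T c" if c: "c \<in> I" for c
          using upper[of "S c" "T c"] T(3)[OF c] S c by (force simp: PiE_iff not_le)
        moreover have "(\<Sum>c\<in>I. T c) \<le> (\<Sum>c\<in>I. S c)"
          using True unfolding weight[OF T(1,2), symmetric] by (simp only: sum_content)
        ultimately have "(\<Sum>c\<in>I. S c) = (\<Sum>c\<in>I. T c)" by (simp add: sum_mono le_antisym)
        then have "S = T" using le by (intro PiE_eq_if_le_sum_eq[OF I S T(1)])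
        then show "T = S" by simp
      qed
      then show ?thesis using weight[OF S] by (cases "tcoord S u = 0") (auto simp: tcoord_linear)
    next
      case False
      then have "tcoord S (tensor_op I (\<lambda>_. X) u) = 0" "tcoord S u = 0"
        using minimal[OF Xu S] minimal[OF uN S] by blast+
      then show ?thesis by (simp add: tcoord_linear)
    qed
  qed
qed

definition lower_triangular :: "('w \<Rightarrow> 'w) \<Rightarrow> bool" where
  "lower_triangular X \<longleftrightarrow> lin X \<and> (\<forall>i j. i < j \<longrightarrow> j < m \<longrightarrow> entry X i j = 0)"

lemma lower_triangular_id: "lower_triangular id"
  by (simp add: lower_triangular_def lin_id entry_id)

lemma lower_triangular_comp:
  assumes "lower_triangular X" "lower_triangular Y"
  shows "lower_triangular (X \<circ> Y)"
proof -
  have "entry (X \<circ> Y) i j = 0" if "i < j" "j < m" for i j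
  proof -
    have "entry X i k * entry Y k j = 0" if "k < m" for k
      using assms \<open>i < j\<close> \<open>j < m\<close> that unfolding lower_triangular_def by (cases "i < k") auto
    then show ?thesis using assms by (auto simp: entry_comp lower_triangular_def intro!: sum.neutral)
  qed
  then show ?thesis using assms lin_comp unfolding lower_triangular_def by blast
qed

lemma weight_vector_lower_triangular:
  assumes I: "finite I" and X: "lower_triangular X" and u: "u \<in> weight_space tensor_act (E I) M"
    and S: "S \<in> indices I" "content I S = M"
  shows "tcoord S (tensor_op I (\<lambda>_. X) u) = (\<Prod>i\<in>#M. entry X i i) * tcoord S u"
  unfolding S(2)[symmetric]
proof (rule tcoord_tensor_op_diagonal[OF I _ _ S(1)])
  show "lin X" using X by (simp add: lower_triangular_def)
  show "u \<in> E I" using u by (simp add: weight_space_iff)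
  fix T assume T: "T \<in> indices I" "tcoord T u \<noteq> 0" "\<And>c. c \<in> I \<Longrightarrow> entry X (S c) (T c) \<noteq> 0"
  have le: "T c \<le> S c" if c: "c \<in> I" for c
  proof (rule ccontr)
    assume "\<not> T c \<le> S c"
    then have "entry X (S c) (T c) = 0" using X T(1) c by (simp add: lower_triangular_def PiE_iff)
    then show False using T(3)[OF c] by contradiction
  qed
  have "content I T = M" using u T(1,2) tensor_weight_space_iff[OF I subset_refl] by blast
  then have "(\<Sum>c\<in>I. T c) = (\<Sum>c\<in>I. S c)" using S(2) by (simp flip: sum_content)
  then show "T = S" by (intro PiE_eq_if_le_sum_eq[OF I T(1) S(1)] le)
qed

declare case_sum_o_inj [simp]

definition pair_op :: "'i set \<Rightarrow> ('w \<Rightarrow> 'w) \<Rightarrow> (('i \<Rightarrow> 'w \<Rightarrow> 'k) + ('i \<Rightarrow> 'w \<Rightarrow> 'k) \<Rightarrow> 'k)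
    \<Rightarrow> ('i \<Rightarrow> 'w \<Rightarrow> 'k) + ('i \<Rightarrow> 'w \<Rightarrow> 'k) \<Rightarrow> 'k" where
  "pair_op I X c = case_sum (tensor_op I (\<lambda>_. X) (c \<circ> Inl)) (tensor_op I (\<lambda>_. X) (c \<circ> Inr))"

lemma flinear_pair_op: "flinear (pair_op I X)"
  by (rule flinearI) (auto simp: pair_op_def tensor_op_def fs_simps split: sum.split)

lemma pair_op_id: "c \<circ> Inl \<in> E I \<Longrightarrow> c \<circ> Inr \<in> E I \<Longrightarrow> pair_op I id c = c"
  by (auto simp: pair_op_def tensor_op_id fun_eq_iff split: sum.split)

lemma pair_op_comp: "lin X \<Longrightarrow> pair_op I X (pair_op I Y c) = pair_op I (X \<circ> Y) c"
  by (simp add: pair_op_def tensor_op_comp)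

definition lower_orbit_span where
  "lower_orbit_span I c = fs.span ((\<lambda>X. pair_op I X c) ` {X. lower_triangular X})"

lemma lower_orbit_span_base: "lower_triangular X \<Longrightarrow> pair_op I X c \<in> lower_orbit_span I c"
  unfolding lower_orbit_span_def by (rule fs.span_base) blast

lemma lower_orbit_span_lower_triangular:
  assumes X: "lower_triangular X" and c': "c' \<in> lower_orbit_span I c"
  shows "pair_op I X c' \<in> lower_orbit_span I c"
proof -
  let ?S = "(\<lambda>Y. pair_op I Y c) ` {Y. lower_triangular Y}"
  have "pair_op I X c' \<in> fs.span (pair_op I X ` ?S)"
    using c' unfolding lower_orbit_span_def fsp.linear_span_image[OF flinear_pair_op] by (rule imageI)
  moreover have "pair_op I X ` ?S \<subseteq> ?S"
    using X lower_triangular_comp[OF X] by (auto simp: pair_op_comp lower_triangular_def[of X])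
  ultimately show ?thesis unfolding lower_orbit_span_def by (rule subsetD[OF fs.span_mono, rotated])
qed

lemma pair_op_line_in_subspace:
  assumes I: "finite I" and X: "lin X" and Y: "lin Y" and c: "c \<circ> Inl \<in> E I" "c \<circ> Inr \<in> E I"
    and A: "infinite A" and S: "fs.subspace S" and inS: "\<And>s. s \<in> A \<Longrightarrow> pair_op I (\<lambda>w. X w + sW s (Y w)) c \<in> S"
  shows "pair_op I X c \<in> S"
proof -
  let ?F = "PiE I (\<lambda>_. UNIV :: bool set)"
  let ?term = "\<lambda>f t. tensor_op I (\<lambda>c. if f c then Y else X) t"
  have line: "pair_op I (\<lambda>w. X w + sW s (Y w)) c
      = (\<Sum>f\<in>?F. fscale (s ^ card {c \<in> I. f c}) (case_sum (?term f (c \<circ> Inl)) (?term f (c \<circ> Inr))))" for s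
    by (rule ext) (simp add: pair_op_def tensor_op_line[OF I X Y] c fs_simps split: sum.split)
  have "pair_op I (\<lambda>w. X w + sW 0 (Y w)) c \<in> S"
    unfolding line by (rule polynomial_curve_in_subspace[OF A S]) (use I inS line in \<open>simp_all add: finite_PiE\<close>)
  then show ?thesis by simp
qed

definition column_elimination :: "nat \<Rightarrow> (nat \<Rightarrow> 'k) \<Rightarrow> 'w \<Rightarrow> 'w" where
  "column_elimination k a w = w + (\<Sum>i\<in>{k<..<m}. sW (a i * coord k w) (b i))"

lemma lin_column_elimination: "lin (column_elimination k a)"
  unfolding column_elimination_def
  by (rule linI) (simp_all add: dual_spaceD[OF coord_dual] algebra_simps scale_left_distrib sum.distrib
      scale_right_distrib scale_sum_right)

lemma coord_column_elimination:
  assumes "i < m"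
  shows "coord i (column_elimination k a w) = coord i w + (if k < i then a i * coord k w else 0)"
proof -
  have "coord i (\<Sum>j\<in>{k<..<m}. sW (a j * coord k w) (b j)) = (\<Sum>j\<in>{k<..<m}. if i = j then a j * coord k w else 0)"
    unfolding dual_spaceD[OF coord_dual] using assms by (intro sum.cong) (auto simp: coord_b)
  then show ?thesis using assms by (simp add: column_elimination_def dual_spaceD[OF coord_dual])
qed

lemma lower_triangular_column_elimination: "k < m \<Longrightarrow> lower_triangular (column_elimination k a)"
  unfolding lower_triangular_def
  by (auto simp: lin_column_elimination entry_def coord_column_elimination coord_b)

lemma column_elimination_inverse:
  assumes "k < m"
  shows "column_elimination k (\<lambda>i. - a i) (column_elimination k a w) = w"
  by (rule coord_ext) (simp add: coord_column_elimination assms)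

definition cleared :: "nat \<Rightarrow> ('w \<Rightarrow> 'w) \<Rightarrow> bool" where
  "cleared k X \<longleftrightarrow> lin X \<and> (\<forall>i j. j < k \<longrightarrow> j < i \<longrightarrow> i < m \<longrightarrow> entry X i j = 0)"

lemma cleared_column_elimination:
  assumes k: "k < m" and Y: "cleared k Y" and pivot: "entry Y k k \<noteq> 0"
  shows "cleared (Suc k) (column_elimination k (\<lambda>i. - (entry Y i k / entry Y k k)) \<circ> Y)"
proof -
  let ?a = "\<lambda>i. - (entry Y i k / entry Y k k)"
  have entry: "entry (column_elimination k ?a \<circ> Y) i j = entry Y i j + (if k < i then ?a i * entry Y k j else 0)"
    if "i < m" for i j using coord_column_elimination[OF that] by (simp add: entry_def)
  have "entry (column_elimination k ?a \<circ> Y) i j = 0" if ij: "j < Suc k" "j < i" "i < m" for i j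
  proof (cases "j = k")
    case True
    then show ?thesis using ij pivot by (simp add: entry)
  next
    case False
    then show ?thesis using ij Y k by (simp add: entry cleared_def)
  qed
  then show ?thesis using Y lin_comp[OF lin_column_elimination] by (simp add: cleared_def)
qed

lemma cleared_add_pivot:
  assumes k: "k < m" and X: "cleared k X"
  shows "cleared k (\<lambda>w. X w + sW s (matrix_unit k k w))"
    and "entry (\<lambda>w. X w + sW s (matrix_unit k k w)) k k = entry X k k + s"
proof -
  have "entry (\<lambda>w. X w + sW s (matrix_unit k k w)) i j = entry X i j + s * (if i = k then coord k (b j) else 0)"
    if "i < m" for i j using that k by (simp add: entry_def matrix_unit_def dual_spaceD[OF coord_dual] coord_b)
  then show "cleared k (\<lambda>w. X w + sW s (matrix_unit k k w))"
    and "entry (\<lambda>w. X w + sW s (matrix_unit k k w)) k k = entry X k k + s"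
    using X k lin_add[OF _ lin_scale[OF lin_matrix_unit]] by (auto simp: cleared_def coord_b)
qed

context
  fixes I :: "'i set" and N N' M u u'
  assumes I: "finite I" and N: "simple_sub (GL sW) tensor_act N" "N \<subseteq> E I"
    and N': "simple_sub (GL sW) tensor_act N'" "N' \<subseteq> E I"
    and u: "highest_weight_vector I N M u" and u': "highest_weight_vector I N' M u'"
begin

abbreviation "pair \<equiv> case_sum u u'"
abbreviation "orbit \<equiv> lower_orbit_span I pair"

lemma pair_members: "u \<in> N" "u' \<in> N'" "u \<in> E I" "u' \<in> E I" "u \<noteq> 0" "u' \<noteq> 0"
  using u u' N(2) N'(2) by (auto simp: highest_weight_vector_def weight_space_iff)

lemma subspace_lower_orbit_span: "fs.subspace orbit"
  unfolding lower_orbit_span_def by (rule fs.subspace_span)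

lemma pair_in_lower_orbit_span: "pair \<in> orbit"
  using lower_orbit_span_base[OF lower_triangular_id, of I pair] pair_members by (simp add: pair_op_id)

lemma pair_op_upper_triangular:
  assumes "lin X" "\<And>i j. i < m \<Longrightarrow> j < i \<Longrightarrow> entry X i j = 0"
  shows "pair_op I X pair = fscale (\<Prod>i\<in>#M. entry X i i) pair"
  using highest_weight_vector_upper_triangular[OF I simple_subD(1)[OF N(1)] N(2) u assms]
    highest_weight_vector_upper_triangular[OF I simple_subD(1)[OF N'(1)] N'(2) u' assms]
  by (auto simp: pair_op_def fs_simps split: sum.split)

lemma gaussian_elimination:
  assumes "k \<le> m" "cleared k X"
  shows "pair_op I X pair \<in> orbit"
  using assms
proof (induction k arbitrary: X rule: inc_induct)
  case base
  then have "pair_op I X pair = fscale (\<Prod>i\<in>#M. entry X i i) pair"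
    by (intro pair_op_upper_triangular) (auto simp: cleared_def)
  then show ?case using fs.subspace_scale[OF subspace_lower_orbit_span pair_in_lower_orbit_span] by simp
next
  case (step k)
  have k: "k < m" by (rule step.hyps(2))
  have pivot: "pair_op I Y pair \<in> orbit" if Y: "cleared k Y" "entry Y k k \<noteq> 0" for Y
  proof -
    let ?a = "\<lambda>i. - (entry Y i k / entry Y k k)"
    have "pair_op I (column_elimination k ?a \<circ> Y) pair \<in> orbit" by (rule step.IH[OF cleared_column_elimination[OF k Y]])
    then have "pair_op I (column_elimination k (\<lambda>i. - ?a i)) (pair_op I (column_elimination k ?a \<circ> Y) pair) \<in> orbit"
      by (rule lower_orbit_span_lower_triangular[OF lower_triangular_column_elimination[OF k]])
    moreover have "column_elimination k (\<lambda>i. - ?a i) \<circ> (column_elimination k ?a \<circ> Y) = Y"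
      using column_elimination_inverse[OF k, of ?a] by (simp add: fun_eq_iff)
    ultimately show ?thesis by (simp only: pair_op_comp[OF lin_column_elimination])
  qed
  show ?case
  proof (cases "entry X k k = 0")
    case True
    have "infinite (UNIV - {0 :: 'k})" using infinite_UNIV_char_0 by simp
    moreover have "pair_op I (\<lambda>w. X w + sW s (matrix_unit k k w)) pair \<in> orbit" if "s \<in> UNIV - {0}" for s
      using that True cleared_add_pivot(2)[OF k step.prems]
      by (intro pivot cleared_add_pivot(1)[OF k step.prems]) simp
    moreover have "lin X" "pair \<circ> Inl \<in> E I" "pair \<circ> Inr \<in> E I"
      using step.prems pair_members by (simp_all add: cleared_def)
    ultimately show ?thesis
      using pair_op_line_in_subspace[OF I _ lin_matrix_unit _ _ _ subspace_lower_orbit_span] by blast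
  qed (use pivot step.prems in blast)
qed

lemma lower_orbit_span_stable: "stable (GL sW) (pair_op I) orbit"
  unfolding lower_orbit_span_def
proof (rule stable_span[OF flinear_pair_op])
  fix g c assume g: "g \<in> GL sW" and "c \<in> (\<lambda>X. pair_op I X pair) ` {X. lower_triangular X}"
  then obtain X where X: "lin X" "c = pair_op I X pair" by (auto simp: lower_triangular_def)
  have "pair_op I (g \<circ> X) pair \<in> orbit"
    by (rule gaussian_elimination[of 0]) (simp_all add: cleared_def lin_comp[OF GL_lin[OF g] X(1)])
  then show "pair_op I g c \<in> fs.span ((\<lambda>X. pair_op I X pair) ` {X. lower_triangular X})"
    by (simp add: X(2) pair_op_comp[OF GL_lin[OF g]] lower_orbit_span_def)
qed

lemma lower_orbit_span_minimal:
  "fs.subspace S \<Longrightarrow> (\<And>X. lower_triangular X \<Longrightarrow> pair_op I X pair \<in> S) \<Longrightarrow> orbit \<subseteq> S"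
  unfolding lower_orbit_span_def by (rule fs.span_minimal) auto

lemma flinear_comp_Inl: "flinear (\<lambda>c. c \<circ> Inl)" and flinear_comp_Inr: "flinear (\<lambda>c. c \<circ> Inr)"
  using flinear_precompose[of Inl] flinear_precompose[of Inr] by (simp_all add: comp_def)

lemma lower_orbit_span_sides: "orbit \<subseteq> (\<lambda>c. c \<circ> Inl) -` N" "orbit \<subseteq> (\<lambda>c. c \<circ> Inr) -` N'"
  using tensor_op_in_stable[OF I _ simple_subD(1)[OF N(1)] N(2) pair_members(1)]
    tensor_op_in_stable[OF I _ simple_subD(1)[OF N'(1)] N'(2) pair_members(2)]
  by (intro lower_orbit_span_minimal fsp.linear_subspace_vimage flinear_comp_Inl flinear_comp_Inr
      stableD(1)[OF simple_subD(1)[OF N(1)]] stableD(1)[OF simple_subD(1)[OF N'(1)]];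
      simp add: pair_op_def lower_triangular_def)+

lemma lower_orbit_span_equivariant:
  "equivariant_on (GL sW) (pair_op I) tensor_act orbit (\<lambda>c. c \<circ> Inl)"
  "equivariant_on (GL sW) (pair_op I) tensor_act orbit (\<lambda>c. c \<circ> Inr)"
  unfolding equivariant_on_def using flinear_comp_Inl flinear_comp_Inr lower_orbit_span_sides N(2) N'(2)
  by (auto simp: pair_op_def tensor_act_eq_op[of _ _ I] subset_iff)

text \<open>A lower triangular operator scales the highest coordinates of \<open>u\<close> and \<open>u'\<close> by the same factor.\<close>

lemma lower_orbit_span_leading:
  assumes T: "T \<in> indices I" "tcoord T u \<noteq> 0" and T': "T' \<in> indices I" "tcoord T' u' \<noteq> 0" and c: "c \<in> orbit"
  shows "tcoord T (c \<circ> Inl) * tcoord T' u' = tcoord T' (c \<circ> Inr) * tcoord T u"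
proof -
  let ?S = "{c. tcoord T (c \<circ> Inl) * tcoord T' u' = tcoord T' (c \<circ> Inr) * tcoord T u}"
  have weight: "u \<in> weight_space tensor_act (E I) M" "u' \<in> weight_space tensor_act (E I) M"
    using u u' N(2) N'(2) by (auto simp: highest_weight_vector_def weight_space_iff)
  then have content: "content I T = M" "content I T' = M"
    using T T' tensor_weight_space_iff[OF I subset_refl] by blast+
  have "orbit \<subseteq> ?S"
  proof (rule lower_orbit_span_minimal)
    show "fs.subspace ?S"
      unfolding fs.subspace_def by (auto simp: tcoord_def fscale_apply algebra_simps)
    show "pair_op I X pair \<in> ?S" if X: "lower_triangular X" for X
      using weight_vector_lower_triangular[OF I X weight(1) T(1) content(1)]
        weight_vector_lower_triangular[OF I X weight(2) T'(1) content(2)] by (simp add: pair_op_def)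
  qed
  then show ?thesis using c by blast
qed

theorem highest_weight_isomorphic: "isomorphic_modules sW (fmod tensor_act N) (fmod tensor_act N')"
proof -
  obtain T T' where T: "T \<in> indices I" "tcoord T u \<noteq> 0" "T' \<in> indices I" "tcoord T' u' \<noteq> 0"
    using E_nonzero_tcoord[OF I pair_members(3,5)] E_nonzero_tcoord[OF I pair_members(4,6)] by metis
  have leading: "c \<in> orbit \<Longrightarrow> c \<circ> Inl = 0 \<Longrightarrow> tcoord T' (c \<circ> Inr) = 0"
    and leading': "c \<in> orbit \<Longrightarrow> c \<circ> Inr = 0 \<Longrightarrow> tcoord T (c \<circ> Inl) = 0" for c
    using lower_orbit_span_leading[OF T, of c] T by (auto simp: tcoord_linear)
  have joint: "c = 0" if "c \<circ> Inl = 0" "c \<circ> Inr = 0" for c :: "('i \<Rightarrow> 'w \<Rightarrow> 'k) + ('i \<Rightarrow> 'w \<Rightarrow> 'k) \<Rightarrow> 'k"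
  proof
    fix x show "c x = 0 x" using fun_cong[OF that(1)] fun_cong[OF that(2)] by (cases x) auto
  qed
  note projection = isomorphic_by_projection[OF flinear_tensor_act flinear_tensor_act lower_orbit_span_stable]
  have "isomorphic_modules sW (fmod (pair_op I) orbit) (fmod tensor_act N)"
    by (rule projection[OF N(1) N'(1) lower_orbit_span_equivariant(1) _ lower_orbit_span_equivariant(2) _ joint
          pair_in_lower_orbit_span]) (use lower_orbit_span_sides pair_members leading T in \<open>auto dest: leading\<close>)
  moreover have "isomorphic_modules sW (fmod (pair_op I) orbit) (fmod tensor_act N')"
    by (rule projection[OF N'(1) N(1) lower_orbit_span_equivariant(2) _ lower_orbit_span_equivariant(1) _ joint
          pair_in_lower_orbit_span]) (use lower_orbit_span_sides pair_members leading' T in \<open>auto dest: leading'\<close>)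
  ultimately show ?thesis
    using isomorphic_modules_trans isomorphic_modules_sym[OF _ lower_orbit_span_stable] by blast
qed

end

end

section \<open>Semistandard tableaux\<close>

lemma finite_cells: "finite (cells lam)"
proof (rule finite_subset)
  show "cells lam \<subseteq> {..<length lam} \<times> {..<Suc (sum_list lam)}"
    by (auto simp: cells_def less_Suc_eq_le intro!: order_trans[OF less_imp_le member_le_sum_list])
qed auto

lemma cells_left: "(i, j) \<in> cells lam \<Longrightarrow> j' \<le> j \<Longrightarrow> (i, j') \<in> cells lam"
  by (auto simp: cells_def)

lemma cells_up:
  assumes "is_partition lam" "(i, j) \<in> cells lam" "i' \<le> i"
  shows "(i', j) \<in> cells lam"
proof (cases "i' = i")
  case False
  then have "lam ! i \<le> lam ! i'"
    using assms by (auto simp: is_partition_def cells_def sorted_wrt_iff_nth_less)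
  then show ?thesis using assms by (auto simp: cells_def)
qed (use assms in simp)

definition column_length :: "nat list \<Rightarrow> nat \<Rightarrow> nat" where
  "column_length lam j = card {i. (i, j) \<in> cells lam}"

lemma cells_iff_column_length:
  assumes lam: "is_partition lam"
  shows "(i, j) \<in> cells lam \<longleftrightarrow> i < column_length lam j"
proof -
  let ?R = "{i. (i, j) \<in> cells lam}"
  have "?R \<subseteq> fst ` cells lam" by force
  then have fin: "finite ?R" using finite_cells finite_subset by blast
  show ?thesis
  proof
    assume "(i, j) \<in> cells lam"
    then have "{..i} \<subseteq> ?R" using cells_up[OF lam] by auto
    then have "card {..i} \<le> card ?R" by (rule card_mono[OF fin])
    then show "i < column_length lam j" by (simp add: column_length_def)
  next
    assume less: "i < column_length lam j"
    show "(i, j) \<in> cells lam"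
    proof (rule ccontr)
      assume "(i, j) \<notin> cells lam"
      then have "i' < i" if "i' \<in> ?R" for i' using cells_up[OF lam, of i' j i] that by (metis mem_Collect_eq not_less)
      then have "?R \<subseteq> {..<i}" by auto
      then show False using card_mono[of "{..<i}" ?R] less unfolding column_length_def by simp
    qed
  qed
qed

definition fibre_group :: "('c \<Rightarrow> 'b) \<Rightarrow> 'c set \<Rightarrow> ('c \<Rightarrow> 'c) set" where
  "fibre_group f C = {p. p permutes C \<and> (\<forall>c. f (p c) = f c)}"

lemma row_group_eq: "row_group lam = fibre_group fst (cells lam)"
  by (simp add: row_group_def fibre_group_def)

lemma column_group_eq: "column_group lam = fibre_group snd (cells lam)"
  by (simp add: column_group_def fibre_group_def)

lemma fibre_groupD:
  "p \<in> fibre_group f C \<Longrightarrow> p permutes C" "p \<in> fibre_group f C \<Longrightarrow> f (p c) = f c"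
  by (simp_all add: fibre_group_def del: split_paired_All)

lemma fibre_group_id: "id \<in> fibre_group f C"
  by (simp add: fibre_group_def permutes_id)

lemma fibre_group_comp: "p \<in> fibre_group f C \<Longrightarrow> q \<in> fibre_group f C \<Longrightarrow> p \<circ> q \<in> fibre_group f C"
  by (simp add: fibre_group_def permutes_compose del: split_paired_All)

lemma fibre_group_inv:
  assumes "p \<in> fibre_group f C"
  shows "inv p \<in> fibre_group f C"
proof -
  have "f (inv p c) = f c" for c
    using fibre_groupD(2)[OF assms, of "inv p c"] permutes_inverses(1)[OF fibre_groupD(1)[OF assms]] by simp
  then show ?thesis using permutes_inv[OF fibre_groupD(1)[OF assms]] by (simp add: fibre_group_def)
qed

lemma fibre_group_transpose:
  "c \<in> C \<Longrightarrow> c' \<in> C \<Longrightarrow> f c = f c' \<Longrightarrow> transpose c c' \<in> fibre_group f C"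
  by (simp add: fibre_group_def permutes_swap_id transpose_def del: split_paired_All)

lemma finite_fibre_group: "finite C \<Longrightarrow> finite (fibre_group f C)"
  by (rule finite_subset[OF _ finite_permutations]) (auto simp: fibre_group_def)

lemma sum_fibre_group_comp_left:
  assumes p: "p \<in> fibre_group f C"
  shows "(\<Sum>q\<in>fibre_group f C. g (p \<circ> q)) = (\<Sum>q\<in>fibre_group f C. g q)"
proof (rule sum.reindex_bij_witness[of _ "\<lambda>q. inv p \<circ> q" "\<lambda>q. p \<circ> q"])
  note permutes_inv_o[OF fibre_groupD(1)[OF p]]
  then show "inv p \<circ> (p \<circ> q) = q" "p \<circ> (inv p \<circ> q) = q" for q by (simp_all add: comp_assoc[symmetric])
qed (simp_all add: fibre_group_comp fibre_group_inv p)

lemma sum_fibre_group_inv: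
  "(\<Sum>q\<in>fibre_group f C. g (inv q)) = (\<Sum>q\<in>fibre_group f C. g q)"
  by (rule sum.reindex_bij_witness[of _ inv inv])
    (simp_all add: fibre_group_inv permutes_inv_inv[OF fibre_groupD(1)])

lemma sign_comp_permutes:
  "finite C \<Longrightarrow> p permutes C \<Longrightarrow> q permutes C \<Longrightarrow> sign (p \<circ> q) = sign p * sign q"
  by (rule sign_compose) (auto simp: permutation_permutes)

lemma sign_square: "of_int (sign p) * of_int (sign p) = (1 :: 'k::ring_1)"
  by (simp add: sign_def)

text \<open>
  The coordinates, with respect to the standard basis of the tensor power, of the Young symmetrizer
  applied to the basis tensor of the filling \<open>T\<close>.
\<close>

definition young_vector :: "nat list \<Rightarrow> (nat \<times> nat \<Rightarrow> nat) \<Rightarrow> (nat \<times> nat \<Rightarrow> nat) \<Rightarrow> 'k::field_char_0" where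
  "young_vector lam T = (\<lambda>S. \<Sum>p\<in>row_group lam. \<Sum>q\<in>column_group lam.
     of_int (sign q) * (if T \<circ> q \<circ> p = S then 1 else 0))"

lemma young_vector_column:
  assumes q: "q \<in> column_group lam"
  shows "young_vector lam (T \<circ> q) = (fscale (of_int (sign q)) (young_vector lam T) :: _ \<Rightarrow> 'k::field_char_0)"
proof
  fix S :: "nat \<times> nat \<Rightarrow> nat"
  have sign: "sign (q \<circ> r) = sign q * sign r" if "r \<in> column_group lam" for r
    using q that by (intro sign_comp_permutes[OF finite_cells[of lam]]) (simp_all add: column_group_def)
  have "(\<Sum>r\<in>column_group lam. of_int (sign r) * (if T \<circ> q \<circ> r \<circ> p = S then 1 else 0 :: 'k))
      = of_int (sign q) * (\<Sum>r\<in>column_group lam. of_int (sign r) * (if T \<circ> r \<circ> p = S then 1 else 0))" for p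
  proof -
    have "(\<Sum>r\<in>column_group lam. of_int (sign r) * (if T \<circ> r \<circ> p = S then 1 else 0 :: 'k))
        = (\<Sum>r\<in>column_group lam. of_int (sign (q \<circ> r)) * (if T \<circ> (q \<circ> r) \<circ> p = S then 1 else 0))"
      using q unfolding column_group_eq by (rule sum_fibre_group_comp_left[symmetric])
    also have "\<dots> = (\<Sum>r\<in>column_group lam. of_int (sign q) * (of_int (sign r) * (if T \<circ> q \<circ> r \<circ> p = S then 1 else 0)))"
      by (intro sum.cong refl) (simp add: sign comp_assoc)
    also have "\<dots> = of_int (sign q) * (\<Sum>r\<in>column_group lam. of_int (sign r) * (if T \<circ> q \<circ> r \<circ> p = S then 1 else 0))"
      by (rule sum_distrib_left[symmetric])
    finally have "(\<Sum>r\<in>column_group lam. of_int (sign r) * (if T \<circ> r \<circ> p = S then 1 else 0 :: 'k))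
        = of_int (sign q) * (\<Sum>r\<in>column_group lam. of_int (sign r) * (if T \<circ> q \<circ> r \<circ> p = S then 1 else 0))" .
    then show ?thesis by (simp only: mult.assoc[symmetric] sign_square mult_1_left)
  qed
  then show "young_vector lam (T \<circ> q) S = fscale (of_int (sign q)) (young_vector lam T :: _ \<Rightarrow> 'k) S"
    by (simp add: young_vector_def fscale_apply sum_distrib_left)
qed

lemma antisymmetrizer_kills_row_symmetrizer:
  assumes G: "finite G" "G \<subseteq> cells lam" and q: "q permutes cells lam"
    and collision: "c \<noteq> c'" "fst c = fst c'" "q c \<in> G" "q c' \<in> G"
  shows "(\<Sum>s | s permutes G. \<Sum>p\<in>row_group lam. of_int (sign s) * (if T \<circ> s \<circ> q \<circ> p = S then 1 else 0))
    = (0 :: 'k::field_char_0)" (is "?F = 0")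
proof -
  let ?t = "transpose c c'" and ?t' = "transpose (q c) (q c')"
  have "c \<in> cells lam" "c' \<in> cells lam" using collision G(2) permutes_in_image[OF q] by blast+
  then have t: "?t \<in> fibre_group fst (cells lam)" using collision(2) by (rule fibre_group_transpose)
  have t': "?t' permutes G" using collision by (simp add: permutes_swap_id)
  have "q \<circ> ?t = ?t' \<circ> q"
    by (rule ext) (simp add: transpose_def inj_eq[OF permutes_inj[OF q]])
  then have move: "T \<circ> s \<circ> q \<circ> (?t \<circ> p) = T \<circ> (s \<circ> ?t') \<circ> q \<circ> p" for s p by (metis comp_assoc)
  have "q c \<noteq> q c'" using collision(1) permutes_inj[OF q] by (simp add: inj_eq)
  then have sign: "sign (s \<circ> ?t') = - sign s" if "s permutes G" for s
    using sign_comp_permutes[OF G(1) that t'] by (simp add: sign_swap_id)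
  have "?F = (\<Sum>s | s permutes G. \<Sum>p\<in>row_group lam. of_int (sign s) * (if T \<circ> s \<circ> q \<circ> (?t \<circ> p) = S then 1 else 0))"
    unfolding row_group_eq by (intro sum.cong refl sum_fibre_group_comp_left[OF t, symmetric])
  also have "\<dots> = (\<Sum>s | s permutes G. \<Sum>p\<in>row_group lam.
      - (of_int (sign (s \<circ> ?t')) * (if T \<circ> (s \<circ> ?t') \<circ> q \<circ> p = S then 1 else 0)))"
    by (intro sum.cong refl) (simp add: move sign)
  also have "\<dots> = - (\<Sum>s | s permutes G. \<Sum>p\<in>row_group lam.
      of_int (sign (s \<circ> ?t')) * (if T \<circ> (s \<circ> ?t') \<circ> q \<circ> p = S then 1 else 0))"
    by (simp add: sum_negf)
  also have "\<dots> = - ?F" by (subst (2) sum_permutations_compose_right[OF t']) (rule refl)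
  finally show ?thesis by simp
qed

text \<open>
  Some two cells in a common row are moved into \<open>G\<close> by each column permutation, so
  that the antisymmetrizer of \<open>G\<close> is killed by the row symmetrizer.
\<close>

lemma young_vector_garnir:
  assumes G: "G \<subseteq> cells lam"
    and collision: "\<And>q. q \<in> column_group lam \<Longrightarrow> \<exists>c c'. c \<noteq> c' \<and> fst c = fst c' \<and> q c \<in> G \<and> q c' \<in> G"
  shows "(\<Sum>s | s permutes G. fscale (of_int (sign s)) (young_vector lam (T \<circ> s))) = (0 :: _ \<Rightarrow> 'k::field_char_0)"
proof
  fix S :: "nat \<times> nat \<Rightarrow> nat"
  let ?P = "{s. s permutes G}"
  let ?\<delta> = "\<lambda>s q p. if T \<circ> s \<circ> q \<circ> p = S then 1 else 0 :: 'k"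
  have finG: "finite G" using G finite_cells finite_subset by blast
  have "(\<Sum>s\<in>?P. fscale (of_int (sign s)) (young_vector lam (T \<circ> s))) S
      = (\<Sum>s\<in>?P. \<Sum>p\<in>row_group lam. \<Sum>q\<in>column_group lam. of_int (sign s) * (of_int (sign q) * ?\<delta> s q p))"
    by (simp add: sum_fun_apply fscale_apply young_vector_def sum_distrib_left)
  also have "\<dots> = (\<Sum>s\<in>?P. \<Sum>q\<in>column_group lam. \<Sum>p\<in>row_group lam. of_int (sign s) * (of_int (sign q) * ?\<delta> s q p))"
    by (intro sum.cong refl sum.swap)
  also have "\<dots> = (\<Sum>q\<in>column_group lam. \<Sum>s\<in>?P. \<Sum>p\<in>row_group lam. of_int (sign s) * (of_int (sign q) * ?\<delta> s q p))"
    by (rule sum.swap)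
  also have "\<dots> = (\<Sum>q\<in>column_group lam. of_int (sign q) * (\<Sum>s\<in>?P. \<Sum>p\<in>row_group lam. of_int (sign s) * ?\<delta> s q p))"
    by (simp only: sum_distrib_left mult.left_commute)
  also have "\<dots> = 0"
  proof (intro sum.neutral ballI)
    fix q assume q: "q \<in> column_group lam"
    obtain c c' where c: "c \<noteq> c'" "fst c = fst c'" "q c \<in> G" "q c' \<in> G" using collision[OF q] by blast
    have "q permutes cells lam" using q unfolding column_group_eq by (rule fibre_groupD(1))
    then show "of_int (sign q) * (\<Sum>s\<in>?P. \<Sum>p\<in>row_group lam. of_int (sign s) * ?\<delta> s q p) = 0"
      by (simp only: antisymmetrizer_kills_row_symmetrizer[OF finG G _ c] mult_zero_right)
  qed
  finally show "(\<Sum>s\<in>?P. fscale (of_int (sign s)) (young_vector lam (T \<circ> s))) S = (0 :: _ \<Rightarrow> 'k) S" by simp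
qed

definition fillings :: "nat list \<Rightarrow> nat multiset \<Rightarrow> (nat \<times> nat \<Rightarrow> nat) set" where
  "fillings lam M = {T \<in> extensional (cells lam). content (cells lam) T = M}"

lemma fillings_comp:
  assumes T: "T \<in> fillings lam M" and s: "s permutes cells lam"
  shows "T \<circ> s \<in> fillings lam M"
proof -
  have "image_mset s (mset_set (cells lam)) = mset_set (cells lam)"
    using image_mset_mset_set[OF permutes_inj_on[OF s], of "cells lam"] permutes_image[OF s] by simp
  then have "content (cells lam) (T \<circ> s) = M"
    using T by (simp add: fillings_def content_def multiset.map_comp[symmetric])
  moreover have "T \<circ> s \<in> extensional (cells lam)"
    using T s by (auto simp: fillings_def extensional_def permutes_not_in)
  ultimately show ?thesis by (simp add: fillings_def)
qed

lemma fillings_in: "T \<in> fillings lam M \<Longrightarrow> c \<in> cells lam \<Longrightarrow> T c \<in># M"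
  using finite_cells[of lam] by (auto simp: fillings_def set_content)

lemma finite_fillings: "finite (fillings lam M)"
proof (rule finite_subset)
  show "fillings lam M \<subseteq> PiE (cells lam) (\<lambda>_. set_mset M)"
  proof (intro subsetI PiE_I)
    fix T c assume T: "T \<in> fillings lam M"
    show "T c \<in> set_mset M" if "c \<in> cells lam" using fillings_in[OF T that] .
    show "T c = undefined" if "c \<notin> cells lam"
      using T that by (intro extensional_arb[of T "cells lam"]) (simp_all add: fillings_def)
  qed
qed (simp add: finite_PiE finite_cells)

definition row_degree :: "nat list \<Rightarrow> (nat \<times> nat \<Rightarrow> nat) \<Rightarrow> nat" where
  "row_degree lam T = (\<Sum>c\<in>cells lam. T c * fst c)"

definition column_degree :: "nat list \<Rightarrow> (nat \<times> nat \<Rightarrow> nat) \<Rightarrow> nat" where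
  "column_degree lam T = (\<Sum>c\<in>cells lam. T c * snd c)"

lemma weighted_sum_permute:
  assumes "s permutes C"
  shows "(\<Sum>c\<in>C. T (s c) * f c) = (\<Sum>c\<in>C. T c * f (inv s c))"
proof -
  have "(\<Sum>c\<in>C. T c * f (inv s c)) = (\<Sum>c\<in>C. T (s c) * f (inv s (s c)))"
    using sum.permute[OF assms, of "\<lambda>c. T c * f (inv s c)"] by (simp add: comp_def)
  then show ?thesis by (simp add: permutes_inverses[OF assms])
qed

lemma column_degree_column: "q \<in> column_group lam \<Longrightarrow> column_degree lam (T \<circ> q) = column_degree lam T"
  unfolding column_group_eq column_degree_def
  by (simp add: weighted_sum_permute[OF fibre_groupD(1)] fibre_groupD(2)[OF fibre_group_inv])

lemma row_degree_row: "p \<in> row_group lam \<Longrightarrow> row_degree lam (T \<circ> p) = row_degree lam T"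
  unfolding row_group_eq row_degree_def
  by (simp add: weighted_sum_permute[OF fibre_groupD(1)] fibre_groupD(2)[OF fibre_group_inv])

definition column_weak :: "nat list \<Rightarrow> (nat \<times> nat \<Rightarrow> nat) \<Rightarrow> bool" where
  "column_weak lam T \<longleftrightarrow>
     (\<forall>i i' j. (i, j) \<in> cells lam \<longrightarrow> (i', j) \<in> cells lam \<longrightarrow> i < i' \<longrightarrow> T (i, j) \<le> T (i', j))"

definition column_strict :: "nat list \<Rightarrow> (nat \<times> nat \<Rightarrow> nat) \<Rightarrow> bool" where
  "column_strict lam T \<longleftrightarrow>
     (\<forall>i i' j. (i, j) \<in> cells lam \<longrightarrow> (i', j) \<in> cells lam \<longrightarrow> i < i' \<longrightarrow> T (i, j) < T (i', j))"

lemma column_strictD: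
  "column_strict lam T \<Longrightarrow> (i, j) \<in> cells lam \<Longrightarrow> (i', j) \<in> cells lam \<Longrightarrow> i < i' \<Longrightarrow> T (i, j) < T (i', j)"
  unfolding column_strict_def by blast

lemma row_degree_swap:
  assumes c: "(i, j) \<in> cells lam" "(i', j) \<in> cells lam" and i: "i < i'" "T (i', j) < T (i, j)"
  shows "row_degree lam T < row_degree lam (T \<circ> transpose (i, j) (i', j))"
proof -
  let ?R = "cells lam - {(i, j)} - {(i', j)}"
  have split: "(\<Sum>c\<in>cells lam. f c) = f (i, j) + (f (i', j) + (\<Sum>c\<in>?R. f c))" for f :: "nat \<times> nat \<Rightarrow> nat"
    using sum.remove[OF finite_cells c(1), of f] sum.remove[of "cells lam - {(i, j)}" "(i', j)" f] c i finite_cells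
    by simp
  have rest: "(\<Sum>c\<in>?R. (T \<circ> transpose (i, j) (i', j)) c * fst c) = (\<Sum>c\<in>?R. T c * fst c)"
    by (rule sum.cong) (auto simp: transpose_def)
  have "0 < (int (T (i, j)) - int (T (i', j))) * (int i' - int i)" using i by simp
  then have "T (i, j) * i + T (i', j) * i' < T (i', j) * i + T (i, j) * i'"
    by (simp add: algebra_simps flip: of_nat_mult of_nat_add)
  then show ?thesis using rest i unfolding row_degree_def split by simp
qed

lemma row_degree_maximal_column_weak:
  assumes q: "q \<in> column_group lam"
    and maximal: "\<And>q'. q' \<in> column_group lam \<Longrightarrow> row_degree lam (T \<circ> q') \<le> row_degree lam (T \<circ> q)"
  shows "column_weak lam (T \<circ> q)"
  unfolding column_weak_def
proof (intro allI impI, rule ccontr)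
  fix i i' j assume c: "(i, j) \<in> cells lam" "(i', j) \<in> cells lam" "i < i'"
    and "\<not> (T \<circ> q) (i, j) \<le> (T \<circ> q) (i', j)"
  then have "row_degree lam (T \<circ> q) < row_degree lam (T \<circ> q \<circ> transpose (i, j) (i', j))"
    by (intro row_degree_swap) simp_all
  moreover have "q \<circ> transpose (i, j) (i', j) \<in> column_group lam"
    using q c unfolding column_group_eq by (intro fibre_group_comp fibre_group_transpose) simp_all
  ultimately show False using maximal by (simp add: comp_assoc not_less[symmetric])
qed

lemma row_degree_maximizer:
  obtains q where "q \<in> column_group lam"
    "\<And>q'. q' \<in> column_group lam \<Longrightarrow> row_degree lam (T \<circ> q') \<le> row_degree lam (T \<circ> q)"
proof -
  let ?A = "(\<lambda>q. row_degree lam (T \<circ> q)) ` column_group lam"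
  have A: "finite ?A" "?A \<noteq> {}"
    using finite_fibre_group[OF finite_cells] fibre_group_id unfolding column_group_eq by blast+
  then have "Max ?A \<in> ?A" by (rule Max_in)
  then obtain q where "Max ?A = row_degree lam (T \<circ> q)" "q \<in> column_group lam" by (rule imageE)
  then show ?thesis using that[of q] Max_ge[OF A(1)] by simp
qed

definition garnir_set :: "nat list \<Rightarrow> nat \<Rightarrow> nat \<Rightarrow> (nat \<times> nat) set" where
  "garnir_set lam i j = (\<lambda>i'. (i', j)) ` {i..<column_length lam j} \<union> (\<lambda>i'. (i', Suc j)) ` {..i}"

lemma garnir_set_subset:
  assumes lam: "is_partition lam" and c: "(i, Suc j) \<in> cells lam"
  shows "garnir_set lam i j \<subseteq> cells lam"
  using cells_up[OF lam c] by (auto simp: garnir_set_def cells_iff_column_length[OF lam])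

lemma finite_garnir_set: "finite (garnir_set lam i j)"
  by (simp add: garnir_set_def)

lemma garnir_set_snd: "c \<in> garnir_set lam i j \<Longrightarrow> snd c = j \<or> snd c = Suc j"
  by (auto simp: garnir_set_def)

lemma garnir_collision:
  assumes lam: "is_partition lam" and c: "(i, Suc j) \<in> cells lam" and q: "q \<in> column_group lam"
  shows "\<exists>c c'. c \<noteq> c' \<and> fst c = fst c' \<and> q c \<in> garnir_set lam i j \<and> q c' \<in> garnir_set lam i j"
proof -
  let ?G = "garnir_set lam i j" and ?r = "column_length lam j"
  note q = fibre_groupD[OF q[unfolded column_group_eq]]
  have ir: "i < ?r"
    using cells_left[OF c, of j] cells_iff_column_length[OF lam, of i j] by simp
  have "card ?G = (?r - i) + Suc i"
    unfolding garnir_set_def by (subst card_Un_disjoint) (auto simp: card_image inj_on_def)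
  then have card_G: "card ?G = Suc ?r" using ir by simp
  let ?H = "{c. q c \<in> ?G}"
  have "q ` ?H = ?G" using surj_image_vimage_eq[OF permutes_surj[OF q(1)], of ?G] by (simp add: vimage_def)
  then have card_H: "card ?H = Suc ?r"
    using card_G card_image[OF inj_on_subset[OF permutes_inj[OF q(1)] subset_UNIV], of ?H] by simp
  have H_row: "fst ` ?H \<subseteq> {..<?r}"
  proof clarify
    fix a d assume H: "q (a, d) \<in> ?G"
    have "j \<le> d" using garnir_set_snd[OF H] q(2)[of "(a, d)"] by auto
    moreover have "(a, d) \<in> cells lam" using H garnir_set_subset[OF lam c] permutes_in_image[OF q(1)] by blast
    ultimately show "fst (a, d) < ?r" using cells_left[of a d lam j] by (simp add: cells_iff_column_length[OF lam])
  qed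
  have "\<not> inj_on fst ?H"
  proof
    assume "inj_on fst ?H"
    then have "card ?H \<le> card {..<?r}" by (rule card_inj_on_le[OF _ H_row finite_lessThan])
    then show False using card_H by simp
  qed
  then show ?thesis unfolding inj_on_def by blast
qed

lemma sum_mult_pos:
  fixes a \<Delta> :: "'c \<Rightarrow> int"
  assumes G: "finite G" and sum: "(\<Sum>c\<in>G. \<Delta> c) = 0" and nonzero: "\<exists>c\<in>G. \<Delta> c \<noteq> 0"
    and nonneg: "\<And>c. c \<in> G \<Longrightarrow> 0 \<le> a c * \<Delta> c" and neg: "\<And>c. c \<in> G \<Longrightarrow> \<Delta> c < 0 \<Longrightarrow> a c \<noteq> 0"
  shows "0 < (\<Sum>c\<in>G. a c * \<Delta> c)"
proof -
  have "(\<Sum>c\<in>G. a c * \<Delta> c) \<noteq> 0"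
  proof
    assume "(\<Sum>c\<in>G. a c * \<Delta> c) = 0"
    then have "a c * \<Delta> c = 0" if "c \<in> G" for c using that by (simp only: sum_nonneg_eq_0_iff[OF G nonneg])
    then have "0 \<le> \<Delta> c" if "c \<in> G" for c using neg[OF that] that by force
    then have "\<Delta> c = 0" if "c \<in> G" for c using sum that by (simp only: sum_nonneg_eq_0_iff[OF G])
    then show False using nonzero by blast
  qed
  then show ?thesis using sum_nonneg[of G "\<lambda>c. a c * \<Delta> c"] nonneg by force
qed

lemma garnir_set_left:
  assumes "column_strict lam T" "(i, j) \<in> cells lam" "garnir_set lam i j \<subseteq> cells lam" "c \<in> garnir_set lam i j" "snd c = j"
  shows "T (i, j) \<le> T c"
proof -
  obtain i' where "c = (i', j)" "i \<le> i'" using assms(4,5) by (cases c) (auto simp: garnir_set_def)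
  then show ?thesis using column_strictD[OF assms(1,2), of i'] assms(3,4) by (cases "i = i'") auto
qed

lemma garnir_set_right:
  assumes "column_strict lam T" "(i, Suc j) \<in> cells lam" "garnir_set lam i j \<subseteq> cells lam" "c \<in> garnir_set lam i j"
    "snd c = Suc j"
  shows "T c \<le> T (i, Suc j)"
proof -
  obtain i' where "c = (i', Suc j)" "i' \<le> i" using assms(4,5) by (cases c) (auto simp: garnir_set_def)
  then show ?thesis using column_strictD[OF assms(1) _ assms(2), of i'] assms(3,4) by (cases "i = i'") auto
qed

text \<open>
  The rearrangement idea: the entries of the Garnir set in column \<open>j\<close> are at least \<open>T (i, j)\<close>, those in
  column \<open>Suc j\<close> are smaller, so moving entries across can only increase the column degree.
\<close>

lemma garnir_column_degree_less:
  assumes lam: "is_partition lam" and T: "column_strict lam T"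
    and descent: "(i, Suc j) \<in> cells lam" "T (i, Suc j) < T (i, j)"
    and s: "s permutes garnir_set lam i j" "s \<notin> column_group lam"
  shows "column_degree lam T < column_degree lam (T \<circ> s)"
proof -
  let ?G = "garnir_set lam i j" and ?C = "cells lam"
  let ?\<Delta> = "\<lambda>c. int (snd (inv s c)) - int (snd c)"
  note inv_s = permutes_inv[OF s(1)]
  have GC: "?G \<subseteq> ?C" by (rule garnir_set_subset[OF lam descent(1)])
  have sC: "s permutes ?C" by (rule permutes_subset[OF s(1) GC])
  have ij: "(i, j) \<in> ?C" using cells_left[OF descent(1)] by simp
  have sides: "T (i, j) \<le> T c \<and> 0 \<le> ?\<Delta> c \<or> T c < T (i, j) \<and> ?\<Delta> c \<le> 0" if c: "c \<in> ?G" for c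
    using garnir_set_snd[OF c] garnir_set_snd[of "inv s c"] permutes_in_image[OF inv_s, of c] c descent(2)
      garnir_set_left[OF T ij GC c] garnir_set_right[OF T descent(1) GC c] by force
  have \<Delta>_sum: "(\<Sum>c\<in>?G. ?\<Delta> c) = 0"
    using sum.permute[OF inv_s, of "\<lambda>c. int (snd c)"] by (simp add: sum_subtractf comp_def)
  have "\<exists>c\<in>?G. ?\<Delta> c \<noteq> 0"
  proof (rule ccontr)
    assume "\<not> (\<exists>c\<in>?G. ?\<Delta> c \<noteq> 0)"
    then have "snd (inv s c) = snd c" for c by (cases "c \<in> ?G") (auto simp: permutes_not_in[OF inv_s])
    then have "inv s \<in> column_group lam"
      using permutes_inv[OF sC] by (simp add: column_group_eq fibre_group_def)
    then have "inv (inv s) \<in> column_group lam" unfolding column_group_eq by (rule fibre_group_inv)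
    then show False using s(2) permutes_inv_inv[OF sC] by simp
  qed
  then have "0 < (\<Sum>c\<in>?G. (int (T c) - int (T (i, j))) * ?\<Delta> c)"
    using sides
    by (intro sum_mult_pos[OF finite_garnir_set \<Delta>_sum]) (force simp: mult_nonneg_nonneg mult_nonpos_nonpos)+
  also have "\<dots> = (\<Sum>c\<in>?G. int (T c) * ?\<Delta> c)"
    using \<Delta>_sum by (simp add: left_diff_distrib sum_subtractf flip: sum_distrib_left)
  also have "\<dots> = (\<Sum>c\<in>?C. int (T c) * ?\<Delta> c)"
    by (rule sum.mono_neutral_left[OF finite_cells GC]) (simp add: permutes_not_in[OF inv_s])
  also have "\<dots> = int (column_degree lam (T \<circ> s)) - int (column_degree lam T)"
    by (simp add: column_degree_def weighted_sum_permute[OF sC] sum_subtractf right_diff_distrib)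
  finally show ?thesis by simp
qed

lemma straightening_step:
  assumes lam: "is_partition lam" and T: "T \<in> fillings lam M" "column_strict lam T"
    and descent: "(i, Suc j) \<in> cells lam" "T (i, Suc j) < T (i, j)"
  shows "(young_vector lam T :: _ \<Rightarrow> 'k::field_char_0)
    \<in> fs.span (young_vector lam ` {S \<in> fillings lam M. column_degree lam T < column_degree lam S})" (is "_ \<in> fs.span ?W")
proof -
  let ?G = "garnir_set lam i j"
  let ?P = "{s. s permutes ?G}" and ?Q = "{s. s permutes ?G \<and> s \<in> column_group lam}"
  let ?v = "\<lambda>s. fscale (of_int (sign s)) (young_vector lam (T \<circ> s)) :: _ \<Rightarrow> 'k"
  have finP: "finite ?P" by (simp add: finite_permutations finite_garnir_set)
  have GC: "?G \<subseteq> cells lam" by (rule garnir_set_subset[OF lam descent(1)])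
  have "0 = (\<Sum>s\<in>?P. ?v s)" by (rule young_vector_garnir[OF GC garnir_collision[OF lam descent(1)], symmetric])
  also have "\<dots> = (\<Sum>s\<in>?P - ?Q. ?v s) + (\<Sum>s\<in>?Q. ?v s)" by (rule sum.subset_diff[OF _ finP]) auto
  also have "(\<Sum>s\<in>?Q. ?v s) = (\<Sum>s\<in>?Q. young_vector lam T)"
    by (rule sum.cong) (simp_all add: young_vector_column sign_square)
  also have "\<dots> = fscale (of_nat (card ?Q)) (young_vector lam T)" by (rule fs.sum_constant_scale)
  finally have zero: "0 = (\<Sum>s\<in>?P - ?Q. ?v s) + fscale (of_nat (card ?Q)) (young_vector lam T)" .
  have "fscale (of_nat (card ?Q)) (young_vector lam T) = - (\<Sum>s\<in>?P - ?Q. ?v s)"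
    by (rule minus_unique[OF zero[symmetric], symmetric])
  also have "\<dots> \<in> fs.span ?W"
    using garnir_column_degree_less[OF lam T(2) descent] fillings_comp[OF T(1) permutes_subset[OF _ GC]]
    by (intro fs.span_neg fs.span_sum fs.span_scale fs.span_base imageI) (auto simp: comp_def)
  finally have "fscale (of_nat (card ?Q)) (young_vector lam T) \<in> fs.span ?W" .
  moreover have "card ?Q \<noteq> 0"
  proof -
    have "id \<in> ?Q" by (simp add: permutes_id column_group_eq fibre_group_id)
    moreover have "finite ?Q" using finP by (rule finite_subset[rotated]) auto
    ultimately show ?thesis by (metis card_0_eq empty_iff)
  qed
  ultimately show ?thesis
    using fs.span_scale[of "fscale (of_nat (card ?Q)) (young_vector lam T)" ?W "inverse (of_nat (card ?Q))"] by simp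
qed

definition ssyt_content :: "nat list \<Rightarrow> nat multiset \<Rightarrow> (nat \<times> nat \<Rightarrow> nat) set" where
  "ssyt_content lam M = {T \<in> ssyt lam. content (cells lam) T = M}"

lemma ssyt_contentI:
  assumes T: "T \<in> fillings lam M" "column_strict lam T"
    and row: "\<And>i j. (i, Suc j) \<in> cells lam \<Longrightarrow> T (i, j) \<le> T (i, Suc j)"
  shows "T \<in> ssyt_content lam M"
proof -
  have "T (i, j) \<le> T (i, j + d)" if "(i, j + d) \<in> cells lam" for i j d
    using that
  proof (induction d)
    case (Suc d)
    then have "(i, j + d) \<in> cells lam" using cells_left[of i "j + Suc d"] by simp
    then show ?case using Suc row[of i "j + d"] by simp
  qed simp
  then have "T (i, j) \<le> T (i, j')" if "(i, j') \<in> cells lam" "j < j'" for i j j'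
    using that less_imp_add_positive[OF that(2)] by blast
  then show ?thesis using T by (auto simp: ssyt_content_def ssyt_def fillings_def column_strict_def)
qed

lemma ssyt_column_strict: "T \<in> ssyt lam \<Longrightarrow> column_strict lam T"
  by (auto simp: ssyt_def column_strict_def)

lemma ssyt_content_subset: "ssyt_content lam M \<subseteq> fillings lam M"
  by (auto simp: ssyt_content_def ssyt_def fillings_def)

lemma young_vector_repeated_column_entry:
  assumes c: "(i, j) \<in> cells lam" "(i', j) \<in> cells lam" "i \<noteq> i'" "T (i, j) = T (i', j)"
  shows "young_vector lam T = (0 :: _ \<Rightarrow> 'k::field_char_0)"
proof -
  let ?t = "transpose (i, j) (i', j)"
  have "T \<circ> ?t = T" using c(4) by (auto simp: fun_eq_iff transpose_def)
  moreover have "?t \<in> column_group lam"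
    using c unfolding column_group_eq by (intro fibre_group_transpose) simp_all
  ultimately have "(young_vector lam T :: _ \<Rightarrow> 'k) = fscale (of_int (sign ?t)) (young_vector lam T)"
    using young_vector_column[of ?t lam T] by simp
  then have "(young_vector lam T :: _ \<Rightarrow> 'k) = - young_vector lam T" using c(3) by (simp add: sign_swap_id)
  then show ?thesis by (auto simp: fun_eq_iff)
qed

lemma column_degree_bound:
  assumes "T \<in> fillings lam M"
  shows "column_degree lam T \<le> sum_mset M * (\<Sum>c\<in>cells lam. snd c)"
proof -
  have "T c \<le> sum_mset M" if "c \<in> cells lam" for c
    using fillings_in[OF assms that] by (metis le_add1 multi_member_split sum_mset.add_mset)
  then show ?thesis unfolding column_degree_def sum_distrib_left by (intro sum_mono mult_le_mono1)
qed

lemma straightening: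
  assumes lam: "is_partition lam" and T: "T \<in> fillings lam M"
  shows "(young_vector lam T :: _ \<Rightarrow> 'k::field_char_0) \<in> fs.span (young_vector lam ` ssyt_content lam M)" (is "_ \<in> ?Span")
  using T
proof (induction "sum_mset M * (\<Sum>c\<in>cells lam. snd c) - column_degree lam T" arbitrary: T rule: less_induct)
  case less
  obtain q where q: "q \<in> column_group lam"
    and maximal: "\<And>q'. q' \<in> column_group lam \<Longrightarrow> row_degree lam (T \<circ> q') \<le> row_degree lam (T \<circ> q)"
    by (rule row_degree_maximizer[of lam T]) blast
  let ?T = "T \<circ> q"
  have weak: "column_weak lam ?T" by (rule row_degree_maximal_column_weak[OF q maximal])
  have filling: "?T \<in> fillings lam M"
    by (rule fillings_comp[OF less.prems]) (use q in \<open>simp add: column_group_eq fibre_groupD(1)\<close>)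
  have "(young_vector lam ?T :: _ \<Rightarrow> 'k) \<in> ?Span"
  proof (cases "column_strict lam ?T")
    case False
    then obtain i i' j where c: "(i, j) \<in> cells lam" "(i', j) \<in> cells lam" "i < i'" "?T (i, j) = ?T (i', j)"
      using weak unfolding column_weak_def column_strict_def by (metis le_neq_implies_less)
    then have "young_vector lam ?T = (0 :: _ \<Rightarrow> 'k)"
      by (intro young_vector_repeated_column_entry[of i j lam i' ?T]) auto
    then show ?thesis by (simp only: fs.span_zero)
  next
    case strict: True
    show ?thesis
    proof (cases "\<exists>i j. (i, Suc j) \<in> cells lam \<and> ?T (i, Suc j) < ?T (i, j)")
      case True
      then obtain i j where descent: "(i, Suc j) \<in> cells lam" "?T (i, Suc j) < ?T (i, j)" by blast
      have "young_vector lam ` {S \<in> fillings lam M. column_degree lam ?T < column_degree lam S} \<subseteq> ?Span"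
      proof clarify
        fix S assume S: "S \<in> fillings lam M" "column_degree lam ?T < column_degree lam S"
        show "(young_vector lam S :: _ \<Rightarrow> 'k) \<in> ?Span"
          by (rule less.hyps[OF _ S(1)])
            (use S column_degree_bound[OF S(1)] column_degree_column[OF q, of T] in simp)
      qed
      then show ?thesis
        using straightening_step[OF lam filling strict descent] fs.span_minimal[OF _ fs.subspace_span] by blast
    next
      case False
      then have "?T \<in> ssyt_content lam M" by (intro ssyt_contentI[OF filling strict]) (auto simp: not_less)
      then show ?thesis by (intro fs.span_base imageI)
    qed
  qed
  moreover have "(young_vector lam T :: _ \<Rightarrow> 'k) = fscale (of_int (sign q)) (young_vector lam ?T)"
    unfolding young_vector_column[OF q] by (simp add: sign_square)
  ultimately show ?case using fs.span_scale by metis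
qed

lemma column_strict_permutation_id:
  assumes lam: "is_partition lam" and T: "column_strict lam T"
    and r: "r \<in> column_group lam" "column_weak lam (T \<circ> r)"
  shows "r = id"
proof -
  note r' = fibre_groupD[OF r(1)[unfolded column_group_eq]]
  have r_pair: "r (i, j) = (fst (r (i, j)), j)" for i j using r'(2)[of "(i, j)"] by (cases "r (i, j)") simp
  have increasing: "fst (r (i, j)) < fst (r (i', j))"
    if c: "(i, j) \<in> cells lam" "(i', j) \<in> cells lam" "i < i'" for i i' j
  proof (rule ccontr)
    assume "\<not> fst (r (i, j)) < fst (r (i', j))"
    moreover have "r (i, j) \<noteq> r (i', j)" using c(3) injD[OF permutes_inj[OF r'(1)]] by fastforce
    ultimately have less: "fst (r (i', j)) < fst (r (i, j))" using r_pair by (metis linorder_neqE_nat)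
    have "r (i, j) \<in> cells lam" "r (i', j) \<in> cells lam" using c permutes_in_image[OF r'(1)] by blast+
    then have "T (r (i', j)) < T (r (i, j))" using column_strictD[OF T _ _ less] r_pair by metis
    moreover have "T (r (i, j)) \<le> T (r (i', j))" using r(2) c unfolding column_weak_def by simp
    ultimately show False by simp
  qed
  have ge: "fst c \<le> fst (r c)" if "c \<in> cells lam" for c
  proof -
    have "i \<le> fst (r (i, j))" if "(i, j) \<in> cells lam" for i j
      using that
    proof (induction i)
      case (Suc i)
      have "(i, j) \<in> cells lam" by (rule cells_up[OF lam Suc.prems]) simp
      then show ?case using Suc.IH increasing[OF _ Suc.prems] by fastforce
    qed simp
    from this[of "fst c" "snd c"] show ?thesis using that by simp
  qed
  have "(\<Sum>c\<in>cells lam. fst c) = (\<Sum>c\<in>cells lam. fst (r c))"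
    using sum.permute[OF r'(1), of fst] by (simp add: comp_def)
  then have "fst c = fst (r c)" if "c \<in> cells lam" for c
    using ge that by (rule sum_mono_inv[OF _ _ _ finite_cells])
  then have "r c = c" if "c \<in> cells lam" for c using that r'(2)[of c] by (simp add: prod_eq_iff)
  then show ?thesis using permutes_not_in[OF r'(1)] by (metis eq_id_iff)
qed

lemma row_degree_column_maximal_id:
  assumes lam: "is_partition lam" and T: "column_strict lam T" and q: "q \<in> column_group lam"
    and le: "row_degree lam T \<le> row_degree lam (T \<circ> q)"
  shows "q = id"
proof -
  obtain r where r: "r \<in> column_group lam"
    "\<And>q'. q' \<in> column_group lam \<Longrightarrow> row_degree lam (T \<circ> q') \<le> row_degree lam (T \<circ> r)"
    by (rule row_degree_maximizer[of lam T]) blast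
  have "r = id" by (rule column_strict_permutation_id[OF lam T r(1) row_degree_maximal_column_weak[OF r]])
  then have "row_degree lam (T \<circ> q') \<le> row_degree lam (T \<circ> q)" if "q' \<in> column_group lam" for q'
    using r(2)[OF that] le by simp
  then show ?thesis
    by (rule column_strict_permutation_id[OF lam T q row_degree_maximal_column_weak[OF q]])
qed

lemma ssyt_row_unique:
  assumes T: "T \<in> ssyt lam" "T' \<in> ssyt lam" and p: "p \<in> row_group lam" "T' \<circ> p = T"
  shows "T' = T"
proof (rule extensionalityI)
  show "T' \<in> extensional (cells lam)" "T \<in> extensional (cells lam)" using T by (simp_all add: ssyt_def)
  fix c assume "c \<in> cells lam"
  then obtain i j where c: "c = (i, j)" "i < length lam" "j < lam ! i" by (auto simp: cells_def)
  let ?n = "lam ! i"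
  let ?R = "Pair i ` {..<?n}" and ?row = "\<lambda>U. map (\<lambda>j. U (i, j)) [0..<?n]"
  note p' = fibre_groupD[OF p(1)[unfolded row_group_eq]]
  have R: "?R = {d \<in> cells lam. fst d = i}" using c by (auto simp: cells_def)
  have "p ` ?R \<subseteq> ?R" unfolding R using permutes_in_image[OF p'(1)] p'(2) by auto
  then have pR: "p ` ?R = ?R"
    by (intro card_seteq) (auto simp: card_image[OF inj_on_subset[OF permutes_inj[OF p'(1)] subset_UNIV]])
  have row: "mset (?row U) = image_mset U (mset_set ?R)" for U :: "nat \<times> nat \<Rightarrow> nat"
  proof -
    have "mset_set ?R = image_mset (Pair i) (mset_set {..<?n})"
      by (rule image_mset_mset_set[symmetric]) (auto simp: inj_on_def)
    then show ?thesis by (simp add: multiset.map_comp comp_def lessThan_atLeast0)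
  qed
  have "image_mset p (mset_set ?R) = mset_set (p ` ?R)"
    by (rule image_mset_mset_set) (rule inj_on_subset[OF permutes_inj[OF p'(1)] subset_UNIV])
  then have "image_mset T (mset_set ?R) = image_mset T' (mset_set ?R)"
    unfolding p(2)[symmetric] pR by (simp flip: multiset.map_comp)
  then have "mset (?row T) = mset (?row T')" unfolding row .
  moreover have "sorted (?row U)" if "U \<in> ssyt lam" for U
    using that c by (auto simp: ssyt_def cells_def sorted_wrt_iff_nth_less)
  ultimately have "?row T = ?row T'"
    using properties_for_sort sorted_sort_id T by metis
  then have "?row T ! j = ?row T' ! j" by (rule arg_cong)
  then show "T' c = T c" using c by simp
qed

lemma young_vector_coeff:
  assumes lam: "is_partition lam" and T: "T \<in> ssyt lam" and T': "T' \<in> ssyt lam"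
    and le: "row_degree lam T' \<le> row_degree lam T"
  shows "young_vector lam T' T = (if T' = T then of_nat (card {p \<in> row_group lam. T \<circ> p = T}) else (0 :: 'k::field_char_0))"
proof -
  have only: "q = id \<and> T' = T" if q: "q \<in> column_group lam" and p: "p \<in> row_group lam" and eq: "T' \<circ> q \<circ> p = T" for p q
  proof -
    have "row_degree lam T' \<le> row_degree lam (T' \<circ> q)" using le row_degree_row[OF p, of "T' \<circ> q"] eq by simp
    then have "q = id" by (rule row_degree_column_maximal_id[OF lam ssyt_column_strict[OF T'] q])
    then show ?thesis using ssyt_row_unique[OF T T' p] eq by simp
  qed
  show ?thesis
  proof (cases "T' = T")
    case True
    have "young_vector lam T T = (\<Sum>p\<in>row_group lam. \<Sum>q\<in>column_group lam. if q = id then if T \<circ> p = T then 1 else 0 else 0 :: 'k)"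
      unfolding young_vector_def using only True by (intro sum.cong refl) (auto simp: sign_id)
    also have "\<dots> = (\<Sum>p\<in>row_group lam. if T \<circ> p = T then 1 else 0)"
      by (simp add: column_group_eq fibre_group_id finite_fibre_group finite_cells)
    finally show ?thesis
      using True by (simp add: sum.If_cases Int_def row_group_eq finite_fibre_group finite_cells)
  next
    case False
    then have "T' \<circ> q \<circ> p \<noteq> T" if "p \<in> row_group lam" "q \<in> column_group lam" for p q using only that by blast
    then show ?thesis using False unfolding young_vector_def by (simp add: sum.neutral)
  qed
qed

lemma young_vector_independent:
  assumes lam: "is_partition lam" and X: "finite X" "X \<subseteq> ssyt lam"
    and zero: "(\<Sum>T\<in>X. fscale (a T) (young_vector lam T)) = (0 :: _ \<Rightarrow> 'k::field_char_0)" and T0: "T0 \<in> X"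
  shows "a T0 = 0"
proof (rule ccontr)
  assume "a T0 \<noteq> 0"
  let ?Y = "{T \<in> X. a T \<noteq> 0}"
  have "finite (row_degree lam ` ?Y)" "row_degree lam ` ?Y \<noteq> {}" using X T0 \<open>a T0 \<noteq> 0\<close> by auto
  then have fin: "finite (row_degree lam ` ?Y)" and "Max (row_degree lam ` ?Y) \<in> row_degree lam ` ?Y"
    by (simp_all only: Max_in simp_thms)
  then obtain T where max: "Max (row_degree lam ` ?Y) = row_degree lam T" and "T \<in> ?Y" by blast
  then have T: "T \<in> X" "a T \<noteq> 0" by simp_all
  have maximal: "row_degree lam T' \<le> row_degree lam T" if "T' \<in> ?Y" for T'
    unfolding max[symmetric] by (rule Max_ge[OF fin imageI[OF that]])
  have coeff: "a T' * young_vector lam T' T = (if T' = T then a T * of_nat (card {p \<in> row_group lam. T \<circ> p = T}) else 0)"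
    if T': "T' \<in> X" for T'
  proof (cases "a T' = 0")
    case False
    have "T \<in> ssyt lam" "T' \<in> ssyt lam" using T(1) T' X(2) by blast+
    moreover have "row_degree lam T' \<le> row_degree lam T" using maximal T' False by simp
    ultimately show ?thesis by (simp add: young_vector_coeff[OF lam])
  qed (use T in auto)
  have "0 = (\<Sum>T'\<in>X. a T' * young_vector lam T' T)"
    using fun_cong[OF zero, of T] by (simp add: sum_fun_apply fscale_apply)
  also have "\<dots> = a T * of_nat (card {p \<in> row_group lam. T \<circ> p = T})"
    using X(1) T(1) by (simp add: coeff)
  finally have "{p \<in> row_group lam. T \<circ> p = T} = {}"
    using T(2) by (simp add: row_group_eq finite_fibre_group finite_cells)
  moreover have "id \<in> row_group lam" unfolding row_group_eq by (rule fibre_group_id)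
  ultimately show False by fastforce
qed

lemma finite_ssyt_content: "finite (ssyt_content lam M)"
  using finite_subset[OF ssyt_content_subset finite_fillings] .

lemma xcoeff_schur: "xcoeff (schur lam) M = int (card (ssyt_content lam M))"
  by (simp add: schur_def Abs_xps_inverse ssyt_content_def content_def)

theorem dim_span_young_vectors:
  assumes lam: "is_partition lam"
  shows "fs.dim (fs.span (young_vector lam ` fillings lam M :: (_ \<Rightarrow> 'k::field_char_0) set)) = card (ssyt_content lam M)"
proof -
  let ?S = "ssyt_content lam M" and ?v = "young_vector lam :: _ \<Rightarrow> _ \<Rightarrow> 'k"
  have sub: "?S \<subseteq> ssyt lam" by (auto simp: ssyt_content_def)
  have inj: "inj_on ?v ?S"
  proof (rule inj_onI, rule ccontr)
    fix T T' assume T: "T \<in> ?S" "T' \<in> ?S" "?v T = ?v T'" "T \<noteq> T'"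
    have zero: "(\<Sum>U\<in>{T, T'}. fscale (if U = T then 1 else -1) (?v U)) = 0" using T by simp
    have "(if T = T then 1 else -1 :: 'k) = 0"
      by (rule young_vector_independent[OF lam _ _ zero, of T]) (use T sub in auto)
    then show False by simp
  qed
  have ind: "fs.independent (?v ` ?S)"
  proof (rule fs.independent_if_scalars_zero)
    show "finite (?v ` ?S)" using finite_ssyt_content by simp
    fix f x assume zero: "(\<Sum>x\<in>?v ` ?S. fscale (f x) x) = 0" and x: "x \<in> ?v ` ?S"
    have "(\<Sum>T\<in>?S. fscale (f (?v T)) (?v T)) = 0" using zero by (simp add: sum.reindex[OF inj])
    then show "f x = 0"
      using young_vector_independent[OF lam finite_ssyt_content sub, of "\<lambda>T. f (?v T)"] x by blast
  qed
  have "fs.span (?v ` fillings lam M) = fs.span (?v ` ?S)"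
    unfolding fs.span_eq
  proof
    show "?v ` fillings lam M \<subseteq> fs.span (?v ` ?S)" using straightening[OF lam] by blast
    show "?v ` ?S \<subseteq> fs.span (?v ` fillings lam M)"
      by (rule subset_trans[OF image_mono[OF ssyt_content_subset] fs.span_superset])
  qed
  then show ?thesis using fs.dim_span_eq_card_independent[OF ind] card_image[OF inj] by simp
qed

definition relabel :: "nat list \<Rightarrow> (nat \<Rightarrow> nat) \<Rightarrow> (nat \<times> nat \<Rightarrow> nat) \<Rightarrow> nat \<times> nat \<Rightarrow> nat" where
  "relabel lam \<pi> T = restrict (\<pi> \<circ> T) (cells lam)"

lemma relabel_in: "relabel lam \<pi> T \<in> extensional (cells lam)"
  by (simp add: relabel_def)

lemma relabel_relabel:
  "T \<in> extensional (cells lam) \<Longrightarrow> \<pi> \<circ> \<rho> = id \<Longrightarrow> relabel lam \<pi> (relabel lam \<rho> T) = T"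
  by (auto simp: relabel_def restrict_def extensional_def fun_eq_iff)

lemma relabel_comp: "r permutes cells lam \<Longrightarrow> relabel lam \<pi> (T \<circ> r) = relabel lam \<pi> T \<circ> r"
  by (auto simp: relabel_def restrict_def fun_eq_iff permutes_in_image permutes_not_in)

lemma relabel_fillings:
  assumes "T \<in> fillings lam M"
  shows "relabel lam \<pi> T \<in> fillings lam (image_mset \<pi> M)"
proof -
  have "content (cells lam) (relabel lam \<pi> T) = image_mset \<pi> (content (cells lam) T)"
    unfolding content_def relabel_def multiset.map_comp using finite_cells by (intro image_mset_cong) auto
  then show ?thesis using assms by (simp add: fillings_def relabel_in)
qed

lemma young_vector_relabel:
  assumes \<pi>: "bij \<pi>" and T: "T \<in> extensional (cells lam)" and S: "S \<in> extensional (cells lam)"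
  shows "young_vector lam (relabel lam \<pi> T) S = young_vector lam T (relabel lam (inv \<pi>) S)"
proof -
  have inverse: "\<pi> \<circ> inv \<pi> = id" "inv \<pi> \<circ> \<pi> = id"
    using \<pi> by (simp_all add: surj_iff[symmetric] inj_iff[symmetric] bij_is_surj bij_is_inj)
  have "relabel lam \<pi> T \<circ> q \<circ> p = S \<longleftrightarrow> T \<circ> q \<circ> p = relabel lam (inv \<pi>) S"
    if "p \<in> row_group lam" "q \<in> column_group lam" for p q
  proof -
    have pq: "p permutes cells lam" "q permutes cells lam"
      using that by (simp_all add: row_group_eq column_group_eq fibre_groupD(1))
    have "T \<circ> q \<circ> p \<in> extensional (cells lam)"
      using T pq by (simp add: extensional_def permutes_not_in)
    then have "relabel lam \<pi> (T \<circ> q \<circ> p) = S \<longleftrightarrow> T \<circ> q \<circ> p = relabel lam (inv \<pi>) S"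
      using relabel_relabel[OF _ inverse(1), of S] relabel_relabel[OF _ inverse(2), of "T \<circ> q \<circ> p"] S by metis
    then show ?thesis by (simp only: relabel_comp pq)
  qed
  then show ?thesis unfolding young_vector_def by (intro sum.cong refl) simp
qed

lemma card_ssyt_permute_le:
  assumes lam: "is_partition lam" and \<pi>: "bij \<pi>"
  shows "card (ssyt_content lam (image_mset \<pi> M)) \<le> card (ssyt_content lam M)"
proof -
  let ?C = "cells lam" and ?v = "young_vector lam :: _ \<Rightarrow> _ \<Rightarrow> rat"
  define F :: "((nat \<times> nat \<Rightarrow> nat) \<Rightarrow> rat) \<Rightarrow> (nat \<times> nat \<Rightarrow> nat) \<Rightarrow> rat"
    where "F f = (\<lambda>S. if S \<in> extensional ?C then f (relabel lam (inv \<pi>) S) else 0)" for f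
  have F: "flinear F" by (rule flinearI) (auto simp: F_def fs_simps)
  have outside: "?v T S = 0" if T: "T \<in> extensional ?C" and S: "S \<notin> extensional ?C" for T S
  proof -
    have "T \<circ> q \<circ> p \<noteq> S" if "p \<in> row_group lam" "q \<in> column_group lam" for p q
      using that S T by (auto simp: row_group_def column_group_def extensional_def permutes_not_in)
    then show ?thesis unfolding young_vector_def by (auto intro!: sum.neutral)
  qed
  have F_young: "F (?v T) = ?v (relabel lam \<pi> T)" if T: "T \<in> extensional ?C" for T
    by (rule ext) (simp add: F_def young_vector_relabel[OF \<pi> T] outside[OF relabel_in])
  have "?v ` fillings lam (image_mset \<pi> M) \<subseteq> F ` ?v ` fillings lam M"
  proof clarify
    fix T assume T: "T \<in> fillings lam (image_mset \<pi> M)"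
    let ?U = "relabel lam (inv \<pi>) T"
    have "?U \<in> fillings lam M"
      using relabel_fillings[OF T, of "inv \<pi>"] \<pi> by (simp add: multiset.map_comp comp_def bij_is_inj)
    moreover have "\<pi> \<circ> inv \<pi> = id" using \<pi> by (simp add: surj_iff[symmetric] bij_is_surj)
    then have "relabel lam \<pi> ?U = T" using T by (intro relabel_relabel) (simp_all add: fillings_def)
    ultimately show "?v T \<in> F ` ?v ` fillings lam M"
      using F_young[OF relabel_in, of "inv \<pi>" T] by (intro image_eqI[of _ _ "?v ?U"]) auto
  qed
  then have sub: "fs.span (?v ` fillings lam (image_mset \<pi> M)) \<subseteq> F ` fs.span (?v ` fillings lam M)"
    unfolding fsp.linear_span_image[OF F, symmetric] by (rule fs.span_mono)
  have fin: "fs.findim (fs.span (?v ` fillings lam M))"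
    by (rule fs.findim_span) (simp add: finite_fillings)
  have "fs.dim (fs.span (?v ` fillings lam (image_mset \<pi> M))) \<le> fs.dim (F ` fs.span (?v ` fillings lam M))"
    by (rule fs.dim_mono_findim[OF sub fsp.findim_image[OF F fin]])
  also have "\<dots> \<le> fs.dim (fs.span (?v ` fillings lam M))"
    using fsp.rank_nullity[OF F fs.subspace_span fin] by simp
  finally show ?thesis unfolding dim_span_young_vectors[OF lam] .
qed

lemma schur_symmetric:
  assumes lam: "is_partition lam"
  shows "schur lam \<in> Sym_bar"
  unfolding Sym_bar_def
proof (intro CollectI allI impI)
  fix \<pi> :: "nat \<Rightarrow> nat" and M assume \<pi>: "bij \<pi>"
  have "image_mset (inv \<pi>) (image_mset \<pi> M) = M" using \<pi> by (simp add: multiset.map_comp comp_def bij_is_inj)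
  then have "card (ssyt_content lam M) \<le> card (ssyt_content lam (image_mset \<pi> M))"
    using card_ssyt_permute_le[OF lam bij_imp_bij_inv[OF \<pi>], of "image_mset \<pi> M"] by simp
  then show "xcoeff (schur lam) (image_mset \<pi> M) = xcoeff (schur lam) M"
    using card_ssyt_permute_le[OF lam \<pi>, of M] by (simp add: xcoeff_schur)
qed

section \<open>Expansion into Schur functions\<close>

lemma unitriangular_solvable:
  fixes A :: "'i \<Rightarrow> 'i \<Rightarrow> 'r::comm_ring_1" and rank :: "'i \<Rightarrow> nat"
  assumes "finite P" "\<And>l. l \<in> P \<Longrightarrow> A l l = 1"
    "\<And>l m. l \<in> P \<Longrightarrow> m \<in> P \<Longrightarrow> l \<noteq> m \<Longrightarrow> A l m \<noteq> 0 \<Longrightarrow> rank l < rank m"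
  shows "\<exists>a. \<forall>m\<in>P. (\<Sum>l\<in>P. a l * A l m) = g m"
  using assms
proof (induction P rule: finite_ranking_induct[where f=rank])
  case (insert x S)
  then obtain a where a: "\<forall>m\<in>S. (\<Sum>l\<in>S. a l * A l m) = g m" by auto
  let ?a = "a(x := g x - (\<Sum>l\<in>S. a l * A l x))"
  show ?case
  proof (cases "x \<in> S")
    case False
    then have old: "(\<Sum>l\<in>S. ?a l * A l m) = (\<Sum>l\<in>S. a l * A l m)" for m by (intro sum.cong) auto
    have "A x m = 0" if "m \<in> S" for m
      using insert.prems(2)[of x m] insert.hyps(2)[OF that] that False by fastforce
    then have "(\<Sum>l\<in>insert x S. ?a l * A l m) = g m" if "m \<in> insert x S" for m
      using that a insert.hyps(1) insert.prems(1)[of x] False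
      unfolding sum.insert[OF insert.hyps(1) False] old by auto
    then show ?thesis by blast
  qed (use a insert_absorb in metis)
qed simp

lemma triangular_unique:
  fixes A :: "'i \<Rightarrow> 'i \<Rightarrow> 'r::idom" and rank :: "'i \<Rightarrow> nat"
  assumes "finite P" "\<And>l. l \<in> P \<Longrightarrow> A l l \<noteq> 0"
    "\<And>l m. l \<in> P \<Longrightarrow> m \<in> P \<Longrightarrow> l \<noteq> m \<Longrightarrow> A l m \<noteq> 0 \<Longrightarrow> rank l < rank m"
    "\<And>m. m \<in> P \<Longrightarrow> (\<Sum>l\<in>P. a l * A l m) = 0" "l \<in> P"
  shows "a l = 0"
  using assms
proof (induction P arbitrary: l rule: finite_ranking_induct[where f=rank])
  case (insert x S)
  show ?case
  proof (cases "x \<in> S")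
    case True
    then have "insert x S = S" by (rule insert_absorb)
    then show ?thesis using insert.IH[of l] insert.prems by simp
  next
    case False
    have "A x m = 0" if "m \<in> S" for m
      using insert.prems(2)[of x m] insert.hyps(2)[OF that] that False by fastforce
    then have "(\<Sum>l\<in>S. a l * A l m) = 0" if "m \<in> S" for m
      using insert.prems(3)[of m] insert.hyps(1) False that by simp
    then have zero: "a l = 0" if "l \<in> S" for l
      using insert.IH[OF _ _ _ that] insert.prems(1,2) by blast
    moreover have "a x = 0" using insert.prems(1,3)[of x] insert.hyps(1) False zero by simp
    ultimately show ?thesis using insert.prems(4) by blast
  qed
qed simp

definition shape_mset :: "nat list \<Rightarrow> nat multiset" where
  "shape_mset lam = content (cells lam) fst"

lemma count_shape_mset: "count (shape_mset lam) i = (if i < length lam then lam ! i else 0)"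
proof -
  have "count (shape_mset lam) i = (\<Sum>c\<in>fst -` {i} \<inter> cells lam. 1)"
    unfolding shape_mset_def content_def count_image_mset using finite_cells[of lam] by (intro sum.cong) auto
  also have "fst -` {i} \<inter> cells lam = (if i < length lam then Pair i ` {..<lam ! i} else {})"
    by (auto simp: cells_def)
  finally show ?thesis by (auto simp: card_image inj_on_def)
qed

lemma shape_mset_inj:
  assumes "is_partition lam" "is_partition mu" "shape_mset lam = shape_mset mu"
  shows "lam = mu"
proof -
  have entries: "(if i < length lam then lam ! i else 0) = (if i < length mu then mu ! i else 0)" for i
    using assms(3) count_shape_mset by metis
  have pos: "nu ! i \<noteq> 0" if "is_partition nu" "i < length nu" for nu i
    using that nth_mem[of i nu] unfolding is_partition_def by metis
  have len: "length lam = length mu"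
  proof (cases "length lam" "length mu" rule: linorder_cases)
    case less
    then show ?thesis using entries[of "length lam"] pos[OF assms(2) less] by simp
  next
    case greater
    then show ?thesis using entries[of "length mu"] pos[OF assms(1) greater] by simp
  qed
  show ?thesis
  proof (rule nth_equalityI[OF len])
    fix i assume "i < length lam"
    then show "lam ! i = mu ! i" using entries[of i] len by simp
  qed
qed

lemma card_cells: "card (cells lam) = sum_list lam"
proof -
  have "cells lam = (\<Union>i<length lam. Pair i ` {..<lam ! i})" by (auto simp: cells_def)
  then have "card (cells lam) = (\<Sum>i<length lam. card (Pair i ` {..<lam ! i}))"
    by (simp only:) (rule card_UN_disjoint, auto)
  also have "\<dots> = (\<Sum>i<length lam. lam ! i)" by (simp add: card_image inj_on_def)
  finally show ?thesis by (simp add: sum_list_sum_nth lessThan_atLeast0)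
qed

lemma size_shape_mset: "size (shape_mset lam) = sum_list lam"
  by (simp add: shape_mset_def size_content card_cells)

definition partitions_of :: "nat \<Rightarrow> nat list set" where
  "partitions_of k = {lam. is_partition lam \<and> sum_list lam = k}"

lemma finite_partitions_of: "finite (partitions_of k)"
proof (rule finite_subset)
  have "length mu \<le> sum_list mu" if "0 \<notin> set mu" for mu :: "nat list"
    using that by (induction mu) auto
  moreover have "set mu \<subseteq> {..sum_list mu}" for mu :: "nat list"
    by (auto intro: member_le_sum_list)
  ultimately show "partitions_of k \<subseteq> {mu. set mu \<subseteq> {..k} \<and> length mu \<le> k}"
    unfolding is_partition_def partitions_of_def by blast
  show "finite {mu. set mu \<subseteq> {..k} \<and> length mu \<le> k}"
    by (rule finite_lists_length_le) simp
qed

lemma ssyt_entry_ge_row: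
  assumes "is_partition lam" "T \<in> ssyt lam" "(i, j) \<in> cells lam"
  shows "i \<le> T (i, j)"
  using assms(3)
proof (induction i)
  case (Suc i)
  have "(i, j) \<in> cells lam" using cells_up[OF assms(1) Suc.prems] by simp
  moreover from this have "T (i, j) < T (Suc i, j)" using assms(2) Suc.prems by (auto simp: ssyt_def)
  ultimately show ?case using Suc.IH by simp
qed simp

lemma ssyt_content_shape_le:
  assumes lam: "is_partition lam" and T: "T \<in> ssyt_content lam M"
  shows "sum_mset (shape_mset lam) \<le> sum_mset M"
    and "sum_mset (shape_mset lam) = sum_mset M \<Longrightarrow> T = restrict fst (cells lam)"
proof -
  have T': "T \<in> ssyt lam" "M = content (cells lam) T" using T by (auto simp: ssyt_content_def)
  have ge: "fst c \<le> T c" if "c \<in> cells lam" for c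
    using ssyt_entry_ge_row[OF lam T'(1), of "fst c" "snd c"] that by simp
  show "sum_mset (shape_mset lam) \<le> sum_mset M"
    unfolding T'(2) shape_mset_def sum_content by (rule sum_mono[OF ge])
  assume "sum_mset (shape_mset lam) = sum_mset M"
  then have eq: "(\<Sum>c\<in>cells lam. fst c) = (\<Sum>c\<in>cells lam. T c)"
    unfolding T'(2) shape_mset_def sum_content .
  have "T c = fst c" if "c \<in> cells lam" for c
    using sum_mono_inv[OF eq ge that finite_cells] by simp
  moreover have "T \<in> extensional (cells lam)" using T'(1) unfolding ssyt_def by blast
  ultimately show "T = restrict fst (cells lam)"
    by (intro extensionalityI[OF _ restrict_extensional]) simp_all
qed

lemma content_restrict_fst: "content (cells lam) (restrict fst (cells lam)) = shape_mset lam"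
  unfolding shape_mset_def content_def using finite_cells[of lam] by (intro image_mset_cong) auto

lemma ssyt_content_shape:
  assumes lam: "is_partition lam"
  shows "ssyt_content lam (shape_mset lam) = {restrict fst (cells lam)}"
proof
  show "ssyt_content lam (shape_mset lam) \<subseteq> {restrict fst (cells lam)}"
    using ssyt_content_shape_le(2)[OF lam] by blast
  show "{restrict fst (cells lam)} \<subseteq> ssyt_content lam (shape_mset lam)"
    by (auto simp: ssyt_content_def ssyt_def content_restrict_fst)
qed

definition kostka :: "nat list \<Rightarrow> nat list \<Rightarrow> int" where
  "kostka lam mu = xcoeff (schur lam) (shape_mset mu)"

lemma kostka_self: "is_partition lam \<Longrightarrow> kostka lam lam = 1"
  by (simp add: kostka_def xcoeff_schur ssyt_content_shape)

lemma kostka_triangular: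
  assumes "is_partition lam" "is_partition mu" "kostka lam mu \<noteq> 0" "lam \<noteq> mu"
  shows "sum_mset (shape_mset lam) < sum_mset (shape_mset mu)"
proof -
  have "ssyt_content lam (shape_mset mu) \<noteq> {}" using assms(3) by (auto simp: kostka_def xcoeff_schur)
  then obtain T where T: "T \<in> ssyt_content lam (shape_mset mu)" by blast
  have "shape_mset mu = shape_mset lam" if "sum_mset (shape_mset lam) = sum_mset (shape_mset mu)"
    using ssyt_content_shape_le(2)[OF assms(1) T that] T content_restrict_fst by (simp add: ssyt_content_def)
  then have "sum_mset (shape_mset lam) \<noteq> sum_mset (shape_mset mu)"
    using shape_mset_inj[OF assms(2,1)] assms(4) by blast
  then show ?thesis using ssyt_content_shape_le(1)[OF assms(1) T] by simp
qed

lemma kostka_solvable: "\<exists>a. \<forall>mu\<in>partitions_of k. (\<Sum>lam\<in>partitions_of k. a lam * kostka lam mu) = g mu"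
  by (rule unitriangular_solvable[where rank="\<lambda>mu. sum_mset (shape_mset mu)", OF finite_partitions_of])
    (auto simp: partitions_of_def kostka_self kostka_triangular)

lemma kostka_unique:
  assumes "\<And>mu. mu \<in> partitions_of k \<Longrightarrow> (\<Sum>lam\<in>partitions_of k. a lam * kostka lam mu) = 0" "lam \<in> partitions_of k"
  shows "a lam = 0"
  by (rule triangular_unique[where rank="\<lambda>mu. sum_mset (shape_mset mu)", OF finite_partitions_of _ _ assms])
    (auto simp: partitions_of_def kostka_self kostka_triangular)

lemma distinct_list_extends_to_bij:
  fixes xs :: "nat list"
  assumes xs: "distinct xs"
  obtains p :: "nat \<Rightarrow> nat" where "bij p" "\<And>i. i < length xs \<Longrightarrow> p i = xs ! i"
proof -
  obtain N where N: "set xs \<subseteq> {..<N}" using finite_nat_bounded by blast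
  define ys where "ys = xs @ sorted_list_of_set ({..<N} - set xs)"
  have ys: "distinct ys" "set ys = {..<N}" using xs N by (auto simp: ys_def)
  then have len: "length ys = N" using distinct_card by fastforce
  let ?p = "\<lambda>i. if i < N then ys ! i else i"
  have "bij_betw ((!) ys) {..<N} {..<N}" using bij_betw_nth[OF ys(1)] ys(2) len by simp
  then have "bij_betw ?p {..<N} {..<N}" by (subst bij_betw_cong[of _ _ "(!) ys"]) auto
  then have "?p permutes {..<N}" by (rule bij_imp_permutes) auto
  moreover have "?p i = xs ! i" if "i < length xs" for i
    using that len by (simp add: ys_def nth_append)
  ultimately show ?thesis by (intro that[of ?p] permutes_bij)
qed

lemma mset_sorted_by_count:
  fixes M :: "nat multiset"
  obtains xs where "distinct xs" "set xs = set_mset M" "is_partition (map (count M) xs)"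
proof -
  let ?s = "sort_key (count M) (sorted_list_of_set (set_mset M))"
  have "sorted_wrt (\<ge>) (rev (map (count M) ?s))" unfolding sorted_wrt_rev by (simp add: sorted_wrt_mono_rel)
  then have "is_partition (map (count M) (rev ?s))"
    unfolding is_partition_def rev_map by (auto simp: not_in_iff[symmetric] count_eq_zero_iff)
  then show ?thesis by (intro that[of "rev ?s"]) simp_all
qed

lemma mset_is_permuted_shape:
  fixes M :: "nat multiset"
  obtains p mu where "bij p" "mu \<in> partitions_of (size M)" "M = image_mset p (shape_mset mu)"
proof -
  obtain xs where xs: "distinct xs" "set xs = set_mset M" "is_partition (map (count M) xs)"
    by (rule mset_sorted_by_count)
  obtain p where p: "bij p" "\<And>i. i < length xs \<Longrightarrow> p i = xs ! i"
    by (rule distinct_list_extends_to_bij[OF xs(1)]) blast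
  let ?mu = "map (count M) xs"
  have M: "M = image_mset p (shape_mset ?mu)"
  proof (rule multiset_eqI)
    fix x
    obtain i where i: "x = p i" using bij_is_surj[OF p(1)] by (metis surjD)
    have "p -` {p i} = {i}" using bij_is_inj[OF p(1)] by (auto simp: inj_eq)
    then have "count (image_mset p (shape_mset ?mu)) x = count (shape_mset ?mu) i"
      unfolding i count_image_mset
      by (cases "i \<in># shape_mset ?mu") (auto simp: not_in_iff[symmetric] count_eq_zero_iff)
    also have "\<dots> = (if i < length xs then count M (xs ! i) else 0)" by (simp add: count_shape_mset)
    also have "\<dots> = count M x"
    proof (cases "i < length xs")
      case False
      have "x \<notin> set xs"
      proof
        assume "x \<in> set xs"
        then obtain i' where i': "i' < length xs" "x = xs ! i'" by (metis in_set_conv_nth)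
        then have "p i' = p i" using p(2) i by simp
        then show False using injD[OF bij_is_inj[OF p(1)]] False i'(1) by blast
      qed
      then show ?thesis using False xs(2) by (simp add: not_in_iff)
    qed (use p(2) i in simp)
    finally show "count M x = count (image_mset p (shape_mset ?mu)) x" by simp
  qed
  moreover have "?mu \<in> partitions_of (size M)"
    using xs(3) arg_cong[OF M, of size] by (simp add: partitions_of_def size_shape_mset)
  ultimately show ?thesis using that p(1) by blast
qed

lemma xcoeff_schur_sum: "xcoeff (schur_sum a) M = (\<Sum>lam\<in>partitions_of (size M). a lam * xcoeff (schur lam) M)"
  by (simp add: schur_sum_def Abs_xps_inverse partitions_of_def)

lemma xcoeff_schur_sum_shape:
  "mu \<in> partitions_of k \<Longrightarrow>
    xcoeff (schur_sum a) (shape_mset mu) = (\<Sum>lam\<in>partitions_of k. a lam * kostka lam mu)"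
  by (simp add: xcoeff_schur_sum size_shape_mset kostka_def partitions_of_def)

lemma schur_sum_eqI:
  assumes f: "f \<in> Sym_bar"
    and eq: "\<And>k mu. mu \<in> partitions_of k \<Longrightarrow> xcoeff (schur_sum a) (shape_mset mu) = xcoeff f (shape_mset mu)"
  shows "f = schur_sum a"
proof (rule xps_eqI)
  fix M :: "nat multiset"
  obtain p mu where p: "bij p" "mu \<in> partitions_of (size M)" "M = image_mset p (shape_mset mu)"
    by (rule mset_is_permuted_shape[of M])
  have "xcoeff (schur lam) M = kostka lam mu" if "lam \<in> partitions_of (size M)" for lam
    using schur_symmetric[of lam] that p(1,3) by (simp add: partitions_of_def Sym_bar_def kostka_def)
  then have "xcoeff (schur_sum a) M = xcoeff f (shape_mset mu)"
    using eq[OF p(2)] unfolding xcoeff_schur_sum_shape[OF p(2)] by (simp add: xcoeff_schur_sum)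
  also have "\<dots> = xcoeff f M" using f p(1,3) by (simp add: Sym_bar_def)
  finally show "xcoeff f M = xcoeff (schur_sum a) M" by simp
qed

lemma schur_sum_inj:
  assumes "schur_sum a = schur_sum a'" "is_partition lam"
  shows "a lam = a' lam"
proof -
  have "(\<Sum>nu\<in>partitions_of (sum_list lam). (a nu - a' nu) * kostka nu mu) = 0"
    if "mu \<in> partitions_of (sum_list lam)" for mu
    using xcoeff_schur_sum_shape[OF that, of a] xcoeff_schur_sum_shape[OF that, of a'] assms(1)
    by (simp add: left_diff_distrib sum_subtractf)
  then have "a lam - a' lam = 0"
    by (rule kostka_unique[where a="\<lambda>nu. a nu - a' nu"]) (simp_all add: partitions_of_def assms(2))
  then show ?thesis by simp
qed

theorem schur_sum_schur_coeff:
  assumes f: "f \<in> Sym_bar"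
  shows "f = schur_sum (schur_coeff f)"
proof -
  let ?P = "\<lambda>a. f = schur_sum a \<and> (\<forall>lam. \<not> is_partition lam \<longrightarrow> a lam = 0)"
  obtain A where A: "\<And>k mu. mu \<in> partitions_of k \<Longrightarrow>
      (\<Sum>lam\<in>partitions_of k. A k lam * kostka lam mu) = xcoeff f (shape_mset mu)"
    using kostka_solvable[where g="\<lambda>mu. xcoeff f (shape_mset mu)"] by metis
  define a where "a lam = (if is_partition lam then A (sum_list lam) lam else 0)" for lam
  have "f = schur_sum a"
  proof (rule schur_sum_eqI[OF f])
    fix k mu assume mu: "mu \<in> partitions_of k"
    have "(\<Sum>lam\<in>partitions_of k. a lam * kostka lam mu) = (\<Sum>lam\<in>partitions_of k. A k lam * kostka lam mu)"
      by (rule sum.cong) (auto simp: a_def partitions_of_def)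
    then show "xcoeff (schur_sum a) (shape_mset mu) = xcoeff f (shape_mset mu)"
      using A[OF mu] by (simp add: xcoeff_schur_sum_shape[OF mu])
  qed
  then have a: "?P a" by (simp add: a_def)
  have "a' = a" if a': "?P a'" for a'
  proof
    fix lam show "a' lam = a lam"
      using schur_sum_inj[of a' a lam] a a' by (cases "is_partition lam") auto
  qed
  then have "?P (schur_coeff f)" unfolding schur_coeff_def using a by (rule theI[where P="?P", rotated])
  then show ?thesis by blast
qed

section \<open>Multiplicities and characters\<close>

context enumerated_basis
begin

abbreviation "isomorphic \<equiv> isomorphic_modules sW"

definition weights :: "nat \<Rightarrow> nat multiset set" where
  "weights k = {M. size M = k \<and> set_mset M \<subseteq> {..<m}}"

definition weight_dim :: "('w \<Rightarrow> 'w, 'a, 'k) action \<Rightarrow> ('a \<Rightarrow> 'k) set \<Rightarrow> nat multiset \<Rightarrow> nat" where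
  "weight_dim act N M = fs.dim (weight_space act N M)"

lemma weight_space_isomorphic:
  assumes N: "stable (GL sW) act N" and lin: "flinear (act prime_diag)" and fin: "fs.findim (weight_space act N M)"
    and iso: "isomorphic (fmod act N) (fmod act' N')"
  shows "weight_dim act' N' M = weight_dim act N M" "fs.findim (weight_space act' N' M)"
proof -
  obtain h where h: "bij_betw h N N'" "equivariant_on (GL sW) act act' N h"
    using iso N by (rule isomorphic_fmodE)
  note flin = equivariant_onD(1)[OF h(2)]
  have transport: "act' prime_diag (h u) = fscale (weight_scalar M) (h u) \<longleftrightarrow> act prime_diag u = fscale (weight_scalar M) u"
    if u: "u \<in> N" for u
  proof -
    have "act' prime_diag (h u) = h (act prime_diag u)"
      using equivariant_onD(2)[OF h(2) prime_diag_GL u] by simp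
    moreover have "fscale (weight_scalar M) (h u) = h (fscale (weight_scalar M) u)"
      by (simp add: fsp.linear_scale[OF flin])
    moreover have "act prime_diag u \<in> N" "fscale (weight_scalar M) u \<in> N"
      using stableD(2)[OF N prime_diag_GL u] fs.subspace_scale[OF stableD(1)[OF N] u] by auto
    ultimately show ?thesis using h(1) by (auto simp: bij_betw_def inj_on_eq_iff)
  qed
  have image: "weight_space act' N' M = h ` weight_space act N M"
  proof -
    have "N' = h ` N" using h(1) by (simp add: bij_betw_def)
    then show ?thesis using transport by (auto simp: weight_space_iff)
  qed
  have "inj_on h (weight_space act N M)"
    by (rule inj_on_subset[OF bij_betw_imp_inj_on[OF h(1)]]) (auto simp: weight_space_iff)
  then show "weight_dim act' N' M = weight_dim act N M"
    unfolding weight_dim_def image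
    by (rule fsp.dim_image_inj[OF flin subspace_weight_space[where act=act, OF lin stableD(1)[OF N]]])
  show "fs.findim (weight_space act' N' M)" unfolding image by (rule fsp.findim_image[OF flin fin])
qed

lemma weight_dim_eq_0_iff:
  assumes "flinear (act prime_diag)" "fs.subspace N" "fs.findim (weight_space act N M)"
  shows "weight_dim act N M = 0 \<longleftrightarrow> weight_space act N M = {0}"
  unfolding weight_dim_def by (rule fs.dim_eq_0_iff[OF subspace_weight_space[where act=act, OF assms(1,2)] assms(3)])

definition simples :: "nat \<Rightarrow> (nat, 'w, 'k) tensor set set" where
  "simples k = {N. N \<subseteq> E {..<k} \<and> simple_sub (GL sW) tensor_act N}"

lemma simplesD:
  "N \<in> simples k \<Longrightarrow> N \<subseteq> E {..<k}" "N \<in> simples k \<Longrightarrow> simple_sub (GL sW) tensor_act N"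
  "N \<in> simples k \<Longrightarrow> stable (GL sW) tensor_act N" "N \<in> simples k \<Longrightarrow> fs.subspace N"
  by (auto simp: simples_def simple_sub_def stable_def)

lemma iso_simples_sym: "N \<in> simples k \<Longrightarrow> isomorphic (fmod tensor_act N) U \<Longrightarrow> isomorphic U (fmod tensor_act N)"
  by (rule isomorphic_modules_sym[OF _ simplesD(3)])

lemma simples_weight_space_findim: "N \<in> simples k \<Longrightarrow> fs.findim (weight_space tensor_act N M)"
  using simplesD(1)[of N k]
  by (intro fs.findim_mono[OF E_findim[OF finite_lessThan, of k]]) (auto simp: weight_space_iff)

lemma simples_weight_dim_eq_0_iff:
  "N \<in> simples k \<Longrightarrow> weight_dim tensor_act N M = 0 \<longleftrightarrow> weight_space tensor_act N M = {0}"
  by (rule weight_dim_eq_0_iff[OF flinear_tensor_act simplesD(4) simples_weight_space_findim])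

lemma simples_weight_dim_nonzero:
  assumes N: "N \<in> simples k" and nonzero: "weight_dim tensor_act N M \<noteq> 0"
  obtains u T where "u \<in> weight_space tensor_act N M" "u \<noteq> 0" "T \<in> indices {..<k}" "tcoord T u \<noteq> 0" "content {..<k} T = M"
proof -
  have "weight_space tensor_act N M \<noteq> {0}" using simples_weight_dim_eq_0_iff[OF N] nonzero by simp
  then obtain u where u: "u \<in> weight_space tensor_act N M" "u \<noteq> 0"
    using fs.subspace_nonzero_element[OF subspace_weight_space[where act=tensor_act, OF flinear_tensor_act simplesD(4)[OF N]]]
    by blast
  have "u \<in> E {..<k}" using u(1) simplesD(1)[OF N] by (auto simp: weight_space_iff)
  then obtain T where "T \<in> indices {..<k}" "tcoord T u \<noteq> 0"
    using E_nonzero_tcoord[OF finite_lessThan _ u(2)] by blast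
  then show ?thesis
    using that u tensor_weight_space_iff[OF finite_lessThan simplesD(1)[OF N]] by blast
qed

lemma simples_weights:
  assumes "N \<in> simples k" "weight_dim tensor_act N M \<noteq> 0"
  shows "M \<in> weights k"
proof -
  obtain u T where "T \<in> indices {..<k}" "content {..<k} T = M"
    by (rule simples_weight_dim_nonzero[OF assms]) blast
  then show ?thesis using size_content[of "{..<k}" T] set_content[of "{..<k}" T] by (auto simp: weights_def)
qed

lemma finite_weights: "finite (weights k)"
proof -
  have "weights k \<subseteq> mset ` {xs. set xs \<subseteq> {..<m} \<and> length xs = k}"
  proof
    fix M assume M: "M \<in> weights k"
    obtain xs where "M = mset xs" using ex_mset by metis
    then show "M \<in> mset ` {xs. set xs \<subseteq> {..<m} \<and> length xs = k}" using M by (auto simp: weights_def)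
  qed
  then show ?thesis by (rule finite_subset) (simp add: finite_lists_length_eq)
qed

definition irreps :: "nat \<Rightarrow> (nat, 'w, 'k) tensor set set" where
  "irreps k = (\<lambda>N. SOME N'. N' \<in> simples k \<and> isomorphic (fmod tensor_act N) (fmod tensor_act N')) ` simples k"

lemma irreps_representative:
  assumes "N \<in> simples k"
  obtains \<kappa> where "\<kappa> \<in> irreps k" "\<kappa> \<in> simples k" "isomorphic (fmod tensor_act N) (fmod tensor_act \<kappa>)"
proof -
  let ?P = "\<lambda>N'. N' \<in> simples k \<and> isomorphic (fmod tensor_act N) (fmod tensor_act N')"
  have "?P (SOME N'. ?P N')" by (rule someI[of ?P N]) (simp add: assms isomorphic_modules_refl)
  moreover have "(SOME N'. ?P N') \<in> irreps k" unfolding irreps_def using assms by (rule imageI)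
  ultimately show ?thesis using that by blast
qed

lemma irreps_simples: "\<kappa> \<in> irreps k \<Longrightarrow> \<kappa> \<in> simples k"
  unfolding irreps_def by (auto intro: someI2[of _ _ "\<lambda>N. N \<in> simples k"] isomorphic_modules_refl)

lemma irreps_iso_eq:
  assumes \<kappa>: "\<kappa> \<in> irreps k" "\<kappa>' \<in> irreps k" and iso: "isomorphic (fmod tensor_act \<kappa>) (fmod tensor_act \<kappa>')"
  shows "\<kappa> = \<kappa>'"
proof -
  let ?P = "\<lambda>N N'. N' \<in> simples k \<and> isomorphic (fmod tensor_act N) (fmod tensor_act N')"
  obtain N N' where N: "N \<in> simples k" "\<kappa> = (SOME L. ?P N L)" and N': "N' \<in> simples k" "\<kappa>' = (SOME L. ?P N' L)"
    using \<kappa> by (auto simp: irreps_def)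
  have "isomorphic (fmod tensor_act N) (fmod tensor_act \<kappa>)" "isomorphic (fmod tensor_act N') (fmod tensor_act \<kappa>')"
    unfolding N(2) N'(2)
    using someI[of "?P N" N] someI[of "?P N'" N'] N(1) N'(1) by (simp_all add: isomorphic_modules_refl)
  then have NN': "isomorphic (fmod tensor_act N) (fmod tensor_act N')"
    using isomorphic_modules_trans iso iso_simples_sym[OF N'(1)] by blast
  then have "?P N = ?P N'"
    using isomorphic_modules_trans[OF NN'] isomorphic_modules_trans[OF iso_simples_sym[OF N(1) NN']]
    by (intro ext) blast
  then show ?thesis unfolding N(2) N'(2) by (rule arg_cong)
qed

definition highest_weight :: "nat \<Rightarrow> (nat, 'w, 'k) tensor set \<Rightarrow> nat multiset" where
  "highest_weight k N = (SOME M. \<exists>u. highest_weight_vector {..<k} N M u)"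

lemma highest_weight:
  assumes "N \<in> simples k"
  obtains u where "highest_weight_vector {..<k} N (highest_weight k N) u"
proof -
  have "\<exists>M u. highest_weight_vector {..<k} N M u"
    by (rule exists_highest_weight_vector[OF finite_lessThan simplesD(3,1)[OF assms] simple_subD(2)[OF simplesD(2)[OF assms]]])
      blast
  then have "\<exists>u. highest_weight_vector {..<k} N (highest_weight k N) u"
    unfolding highest_weight_def by (rule someI_ex)
  then show ?thesis using that by blast
qed

lemma highest_weight_dim:
  assumes N: "N \<in> simples k"
  shows "weight_dim tensor_act N (highest_weight k N) \<noteq> 0"
proof -
  obtain u where "highest_weight_vector {..<k} N (highest_weight k N) u" by (rule highest_weight[OF N])
  then show ?thesis using simples_weight_dim_eq_0_iff[OF N] by (auto simp: highest_weight_vector_def)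
qed

lemma highest_weight_triangular:
  assumes \<kappa>: "\<kappa> \<in> irreps k" "\<kappa>' \<in> irreps k" "\<kappa> \<noteq> \<kappa>'"
    and nonzero: "weight_dim tensor_act \<kappa> (highest_weight k \<kappa>') \<noteq> 0"
  shows "sum_mset (highest_weight k \<kappa>) < sum_mset (highest_weight k \<kappa>')"
proof -
  note simple = irreps_simples[OF \<kappa>(1)] irreps_simples[OF \<kappa>(2)]
  obtain u where u: "highest_weight_vector {..<k} \<kappa> (highest_weight k \<kappa>) u" by (rule highest_weight[OF simple(1)])
  obtain u' where u': "highest_weight_vector {..<k} \<kappa>' (highest_weight k \<kappa>') u'"
    by (rule highest_weight[OF simple(2)])
  obtain v T where v: "v \<in> weight_space tensor_act \<kappa> (highest_weight k \<kappa>')" "v \<noteq> 0"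
    and T: "T \<in> indices {..<k}" "tcoord T v \<noteq> 0" "content {..<k} T = highest_weight k \<kappa>'"
    by (rule simples_weight_dim_nonzero[OF simple(1) nonzero])
  have "v \<in> \<kappa>" using v(1) by (simp add: weight_space_iff)
  then have "sum_mset (highest_weight k \<kappa>) \<le> sum_mset (highest_weight k \<kappa>')"
    using u T unfolding highest_weight_vector_def by metis
  moreover have "sum_mset (highest_weight k \<kappa>) \<noteq> sum_mset (highest_weight k \<kappa>')"
  proof
    assume "sum_mset (highest_weight k \<kappa>) = sum_mset (highest_weight k \<kappa>')"
    then have "highest_weight_vector {..<k} \<kappa> (highest_weight k \<kappa>') v"
      using u v by (simp add: highest_weight_vector_def)
    then have "isomorphic (fmod tensor_act \<kappa>) (fmod tensor_act \<kappa>')"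
      by (rule highest_weight_isomorphic[OF finite_lessThan simplesD(2,1)[OF simple(1)] simplesD(2,1)[OF simple(2)] _ u'])
    then show False using irreps_iso_eq[OF \<kappa>(1,2)] \<kappa>(3) by blast
  qed
  ultimately show ?thesis by simp
qed

lemma finite_irreps: "finite (irreps k)"
proof (rule finite_imageD)
  show "inj_on (highest_weight k) (irreps k)"
  proof (rule inj_onI, rule ccontr)
    fix \<kappa> \<kappa>' assume "\<kappa> \<in> irreps k" "\<kappa>' \<in> irreps k" "highest_weight k \<kappa> = highest_weight k \<kappa>'" "\<kappa> \<noteq> \<kappa>'"
    then show False using highest_weight_triangular[of \<kappa> k \<kappa>'] highest_weight_dim[OF irreps_simples, of \<kappa> k] by simp
  qed
  have "highest_weight k ` irreps k \<subseteq> weights k"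
    using simples_weights highest_weight_dim irreps_simples by blast
  then show "finite (highest_weight k ` irreps k)" using finite_weights finite_subset by blast
qed

lemma characters_independent:
  assumes zero: "\<And>M. M \<in> weights k \<Longrightarrow> (\<Sum>\<kappa>\<in>irreps k. a \<kappa> * int (weight_dim tensor_act \<kappa> M)) = 0"
    and \<kappa>: "\<kappa> \<in> irreps k"
  shows "a \<kappa> = 0"
proof (rule triangular_unique[where rank="\<lambda>\<kappa>. sum_mset (highest_weight k \<kappa>)"
      and A="\<lambda>\<kappa> \<mu>. int (weight_dim tensor_act \<kappa> (highest_weight k \<mu>))", OF finite_irreps _ _ _ \<kappa>])
  show "int (weight_dim tensor_act \<kappa> (highest_weight k \<kappa>)) \<noteq> 0" if "\<kappa> \<in> irreps k" for \<kappa>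
    using highest_weight_dim[OF irreps_simples[OF that]] by simp
  show "(\<Sum>\<kappa>\<in>irreps k. a \<kappa> * int (weight_dim tensor_act \<kappa> (highest_weight k \<mu>))) = 0" if "\<mu> \<in> irreps k" for \<mu>
    using irreps_simples[OF that] by (intro zero simples_weights[OF _ highest_weight_dim])
qed (simp add: highest_weight_triangular)

definition polynomial_module :: "('w \<Rightarrow> 'w, 'a, 'k) action \<Rightarrow> ('a \<Rightarrow> 'k) set \<Rightarrow> bool" where
  "polynomial_module act N \<longleftrightarrow>
     (\<forall>g. flinear (act g)) \<and> (\<forall>u. act id u = u) \<and> (\<forall>g h u. act (g \<circ> h) u = act g (act h u)) \<and>
     stable (GL sW) act N \<and> (\<forall>M. fs.findim (weight_space act N M)) \<and>
     N \<subseteq> fs.span (\<Union>{h ` E {..<k} | (k :: nat) h. equivariant_on (GL sW) tensor_act act (E {..<k}) h})"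

lemma polynomial_moduleD:
  assumes "polynomial_module act N"
  shows "flinear (act g)" "act id u = u" "act (g \<circ> h) u = act g (act h u)"
    "stable (GL sW) act N" "fs.findim (weight_space act N M)"
    "N \<subseteq> fs.span (\<Union>{h ` E {..<k} | (k :: nat) h. equivariant_on (GL sW) tensor_act act (E {..<k}) h})"
  using assms unfolding polynomial_module_def by blast+

lemma irreducible_iff_simple:
  assumes N: "polynomial_module act N"
  shows "irreducible_module sW (fmod act T) \<longleftrightarrow> simple_sub (GL sW) act T"
proof -
  note lin = polynomial_moduleD(1)[OF N]
  have "gl_module sW (fmod act T) \<longleftrightarrow> stable (GL sW) act T"
    unfolding gl_module_def stable_def fmod_simps
    by (simp add: fs.vector_space_axioms fsp.linear_add[OF lin] fsp.linear_scale[OF lin] polynomial_moduleD(2,3)[OF N])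
  then show ?thesis
    unfolding irreducible_module_def gl_submodule_def simple_sub_def fmod_simps stable_def by blast
qed

definition constituents :: "('w \<Rightarrow> 'w, 'a, 'k) action \<Rightarrow> ('a \<Rightarrow> 'k) set set" where
  "constituents act = {T. simple_sub (GL sW) act T \<and> (\<exists>k. \<exists>T'\<in>simples k. isomorphic (fmod tensor_act T') (fmod act T))}"

lemma constituents_simple: "T \<in> constituents act \<Longrightarrow> simple_sub (GL sW) act T"
  by (simp add: constituents_def)

lemma equivariant_image_in_constituents:
  fixes k :: nat
  assumes lin: "\<And>g. flinear (act g)" and h: "equivariant_on (GL sW) tensor_act act (E {..<k}) h"
  shows "h ` E {..<k} \<subseteq> fs.span (\<Union>(constituents act))"
proof -
  have "E {..<k} = fs.span (\<Union>(simples k))" using E_sum_of_simples[of "{..<k}"] by (simp add: simples_def)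
  then have "h ` E {..<k} = fs.span (h ` \<Union>(simples k))"
    by (simp only: fsp.linear_span_image[OF equivariant_onD(1)[OF h]])
  also have "\<dots> \<subseteq> fs.span (\<Union>(constituents act))"
  proof (rule fs.span_minimal[OF _ fs.subspace_span], clarify)
    fix x T assume T: "T \<in> simples k" "x \<in> T"
    have "h ` T = {0} \<or> h ` T \<in> constituents act"
      using image_zero_or_isomorphic[OF lin simplesD(2)[OF T(1)] equivariant_on_subset[OF h simplesD(1)[OF T(1)]]] T(1)
      by (auto simp: constituents_def)
    then show "h x \<in> fs.span (\<Union>(constituents act))"
    proof
      assume "h ` T = {0}"
      then have "h x = 0" using T(2) by blast
      then show ?thesis by (simp only: fs.span_zero)
    next
      assume "h ` T \<in> constituents act"
      then show ?thesis using T(2) by (intro fs.span_base) blast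
    qed
  qed
  finally show ?thesis .
qed

lemma polynomial_module_in_constituents:
  assumes N: "polynomial_module act N"
  shows "N \<subseteq> fs.span (\<Union>(constituents act))"
proof -
  have "fs.span (\<Union>{h ` E {..<k} | (k :: nat) h. equivariant_on (GL sW) tensor_act act (E {..<k}) h}) \<subseteq> fs.span (\<Union>(constituents act))"
  proof (intro fs.span_minimal[OF _ fs.subspace_span] Union_least)
    fix S assume "S \<in> {h ` E {..<k} | (k :: nat) h. equivariant_on (GL sW) tensor_act act (E {..<k}) h}"
    then obtain k :: nat and h where h: "S = h ` E {..<k}" "equivariant_on (GL sW) tensor_act act (E {..<k}) h"
      by blast
    show "S \<subseteq> fs.span (\<Union>(constituents act))"
      unfolding h(1) by (rule equivariant_image_in_constituents[OF polynomial_moduleD(1)[OF N] h(2)])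
  qed
  then show ?thesis using polynomial_moduleD(6)[OF N] by blast
qed

lemma irreducible_decompositionD:
  assumes N: "polynomial_module act N" and D: "irreducible_decomposition sW (fmod act N) D"
  shows "T \<in> D \<Longrightarrow> simple_sub (GL sW) act T" "N = fs.span (\<Union>D)" "fs.independent_family D"
    "T \<in> D \<Longrightarrow> \<exists>k. \<exists>\<kappa>\<in>irreps k. isomorphic (fmod tensor_act \<kappa>) (fmod act T)"
proof -
  show simple: "simple_sub (GL sW) act T" if "T \<in> D" for T
    using D that irreducible_iff_simple[OF N] by (auto simp: irreducible_decomposition_def)
  show "N = fs.span (\<Union>D)" using D by (simp add: irreducible_decomposition_def)
  show "fs.independent_family D"
    using D simple_sub_subspace[OF simple]
    by (intro fs.independent_familyI) (auto simp: irreducible_decomposition_def)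
  assume T: "T \<in> D"
  have "T \<subseteq> N" using D T by (auto simp: irreducible_decomposition_def gl_submodule_def)
  then have T_sub: "T \<subseteq> fs.span (\<Union>(constituents act))" using polynomial_module_in_constituents[OF N] by blast
  obtain T' where T': "T' \<in> constituents act" "isomorphic (fmod act T') (fmod act T)"
    by (rule simple_sub_iso_summand[OF polynomial_moduleD(1)[OF N] constituents_simple simple[OF T] T_sub])
  then obtain k L where L: "L \<in> simples k" "isomorphic (fmod tensor_act L) (fmod act T)"
    using isomorphic_modules_trans unfolding constituents_def by blast
  obtain \<kappa> where "\<kappa> \<in> irreps k" "isomorphic (fmod tensor_act L) (fmod tensor_act \<kappa>)"
    by (rule irreps_representative[OF L(1)])
  then show "\<exists>k. \<exists>\<kappa>\<in>irreps k. isomorphic (fmod tensor_act \<kappa>) (fmod act T)"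
    using isomorphic_modules_trans[OF iso_simples_sym[OF L(1)] L(2)] by blast
qed

lemma irreducible_decomposition_exists:
  assumes N: "polynomial_module act N"
  shows "\<exists>D. irreducible_decomposition sW (fmod act N) D"
proof -
  let ?S = "isotypic_parts sW act (constituents act) N"
  have lin: "flinear (act g)" for g by (rule polynomial_moduleD(1)[OF N])
  have N_span: "N = fs.span (\<Union>?S)"
    by (rule stable_eq_span_isotypic_parts[OF lin constituents_simple polynomial_moduleD(4)[OF N]
          polynomial_module_in_constituents[OF N]])
  have simple: "simple_sub (GL sW) act T" "T \<subseteq> N" if "T \<in> ?S" for T using that by (auto simp: isotypic_parts_def)
  obtain D where D: "D \<subseteq> ?S" "{0} \<notin> D" "fs.independent_family (insert {0} D)" "\<Union>?S \<subseteq> fs.span (\<Union>(insert {0} D))"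
    by (rule maximal_independent_subfamily[OF lin simple(1) stable_zero[OF lin]])
  have span_D: "fs.span (\<Union>(insert {0} D)) = fs.span (\<Union>D)" by simp
  have "irreducible_decomposition sW (fmod act N) D"
    unfolding irreducible_decomposition_def fmod_simps irreducible_iff_simple[OF N]
  proof (intro conjI ballI)
    show "N = fs.span (\<Union>D)"
    proof
      show "N \<subseteq> fs.span (\<Union>D)"
        using fs.span_minimal[OF D(4)[unfolded span_D] fs.subspace_span] N_span by simp
      show "fs.span (\<Union>D) \<subseteq> N"
        by (rule fs.span_minimal[OF _ stableD(1)[OF polynomial_moduleD(4)[OF N]]]) (use D(1) simple(2) in blast)
    qed
    fix T assume T: "T \<in> D"
    have "T \<in> ?S" using T D(1) by blast
    note simple_T = simple[OF this]
    show "simple_sub (GL sW) act T" by (rule simple_T(1))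
    show "gl_submodule sW (fmod act N) T"
      unfolding gl_submodule_def fmod_simps
      by (intro conjI ballI simple_T(2) stableD[OF simple_subD(1)[OF simple_T(1)]])
    have "fs.independent_family D" by (rule fs.independent_family_subset[OF D(3)]) blast
    then show "T \<inter> fs.span (\<Union>(D - {T})) = {0}"
      by (rule fs.independent_family_Int_span[OF _ _ T]) (use D(1) simple(1) simple_sub_subspace in blast)
  qed
  then show ?thesis by blast
qed

lemma decomposition_weight_dim:
  assumes N: "polynomial_module act N" and D: "irreducible_decomposition sW (fmod act N) D"
  shows "finite {T \<in> D. weight_dim act T M \<noteq> 0}"
    and "weight_dim act N M = (\<Sum>T | T \<in> D \<and> weight_dim act T M \<noteq> 0. weight_dim act T M)"
proof -
  note DD = irreducible_decompositionD[OF N D]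
  have lin: "flinear (act g)" for g by (rule polynomial_moduleD(1)[OF N])
  have inv: "act prime_diag u \<in> T" if "T \<in> D" "u \<in> T" for T u
    using stableD(2)[OF simple_subD(1)[OF DD(1)[OF that(1)]] prime_diag_GL that(2)] .
  have subspaces: "fs.subspace T" if "T \<in> D" for T by (rule simple_sub_subspace[OF DD(1)[OF that]])
  have fin: "fs.findim (fs.eigenspace (act prime_diag) (fs.span (\<Union>D)) (weight_scalar M))"
    using polynomial_moduleD(5)[OF N] unfolding DD(2)[symmetric] weight_space_def .
  have "fs.findim (weight_space act T M)" if "T \<in> D" for T
  proof (rule fs.findim_mono[OF polynomial_moduleD(5)[OF N]])
    have "T \<subseteq> N" using that DD(2) fs.span_base[of _ "\<Union>D"] by blast
    then show "weight_space act T M \<subseteq> weight_space act N M" by (auto simp: weight_space_iff)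
  qed
  then have nonzero: "weight_dim act T M \<noteq> 0 \<longleftrightarrow> fs.eigenspace (act prime_diag) T (weight_scalar M) \<noteq> {0}" if "T \<in> D" for T
    using weight_dim_eq_0_iff[OF lin subspaces[OF that]] that by (simp add: weight_space_def)
  have eq: "{T \<in> D. weight_dim act T M \<noteq> 0} = {T \<in> D. fs.eigenspace (act prime_diag) T (weight_scalar M) \<noteq> {0}}"
    using nonzero by blast
  note dim = fs.dim_eigenspace_span_Union[OF lin DD(3) subspaces inv fin]
  show "finite {T \<in> D. weight_dim act T M \<noteq> 0}" unfolding eq by (rule dim(1))
  show "weight_dim act N M = (\<Sum>T | T \<in> D \<and> weight_dim act T M \<noteq> 0. weight_dim act T M)"
    using dim(2) unfolding eq by (simp add: weight_dim_def weight_space_def flip: DD(2))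
qed

lemma decomposition_character:
  assumes N: "polynomial_module act N" and D: "irreducible_decomposition sW (fmod act N) D"
  shows "\<kappa> \<in> irreps k \<Longrightarrow> finite {T \<in> D. isomorphic (fmod act T) (fmod tensor_act \<kappa>)}"
    and "M \<in> weights k \<Longrightarrow> weight_dim act N M =
      (\<Sum>\<kappa>\<in>irreps k. card {T \<in> D. isomorphic (fmod act T) (fmod tensor_act \<kappa>)} * weight_dim tensor_act \<kappa> M)"
proof -
  note DD = irreducible_decompositionD[OF N D] and weight = decomposition_weight_dim[OF N D]
  let ?D = "\<lambda>\<kappa>. {T \<in> D. isomorphic (fmod act T) (fmod tensor_act \<kappa>)}"
  have sym: "isomorphic (fmod tensor_act \<kappa>) (fmod act T)" if "T \<in> ?D \<kappa>" for T \<kappa>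
    using that isomorphic_modules_sym simple_subD(1)[OF DD(1)] by blast
  have dim: "weight_dim act T M = weight_dim tensor_act \<kappa> M"
    if "\<kappa> \<in> irreps k" "isomorphic (fmod tensor_act \<kappa>) (fmod act T)" for \<kappa> T M k
    using weight_space_isomorphic(1)[OF simplesD(3) flinear_tensor_act simples_weight_space_findim that(2)]
      irreps_simples[OF that(1)] by blast
  have fin: "finite (?D \<kappa>)" if \<kappa>: "\<kappa> \<in> irreps k" for \<kappa> k
  proof (rule finite_subset[OF _ weight(1)[of "highest_weight k \<kappa>"]])
    show "?D \<kappa> \<subseteq> {T \<in> D. weight_dim act T (highest_weight k \<kappa>) \<noteq> 0}"
      using dim[OF \<kappa> sym] highest_weight_dim[OF irreps_simples[OF \<kappa>]] by auto
  qed
  then show "\<kappa> \<in> irreps k \<Longrightarrow> finite (?D \<kappa>)" .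
  assume M: "M \<in> weights k"
  have "\<exists>\<kappa>\<in>irreps k. T \<in> ?D \<kappa>" if T: "T \<in> D" "weight_dim act T M \<noteq> 0" for T
  proof -
    obtain k' \<kappa> where \<kappa>: "\<kappa> \<in> irreps k'" "isomorphic (fmod tensor_act \<kappa>) (fmod act T)" using DD(4)[OF T(1)] by blast
    have "M \<in> weights k'" using simples_weights[OF irreps_simples[OF \<kappa>(1)]] dim[OF \<kappa>] T(2) by simp
    then have "k' = k" using M by (simp add: weights_def)
    then show ?thesis using \<kappa> T(1) iso_simples_sym[OF irreps_simples[OF \<kappa>(1)]] by blast
  qed
  then have cover: "{T \<in> D. weight_dim act T M \<noteq> 0} \<subseteq> (\<Union>\<kappa>\<in>irreps k. ?D \<kappa>)" by blast
  have "(\<Sum>\<kappa>\<in>irreps k. card (?D \<kappa>) * weight_dim tensor_act \<kappa> M) = (\<Sum>\<kappa>\<in>irreps k. \<Sum>T\<in>?D \<kappa>. weight_dim act T M)"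
  proof (rule sum.cong[OF refl])
    fix \<kappa> assume "\<kappa> \<in> irreps k"
    then have "(\<Sum>T\<in>?D \<kappa>. weight_dim act T M) = (\<Sum>T\<in>?D \<kappa>. weight_dim tensor_act \<kappa> M)"
      using dim sym by (intro sum.cong refl) blast
    then show "card (?D \<kappa>) * weight_dim tensor_act \<kappa> M = (\<Sum>T\<in>?D \<kappa>. weight_dim act T M)" by simp
  qed
  also have "\<dots> = (\<Sum>T\<in>(\<Union>\<kappa>\<in>irreps k. ?D \<kappa>). weight_dim act T M)"
  proof (rule sum.UNION_disjoint[symmetric, OF finite_irreps])
    show "\<forall>\<kappa>\<in>irreps k. finite (?D \<kappa>)" using fin by blast
    show "\<forall>\<kappa>\<in>irreps k. \<forall>\<kappa>'\<in>irreps k. \<kappa> \<noteq> \<kappa>' \<longrightarrow> ?D \<kappa> \<inter> ?D \<kappa>' = {}"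
      using isomorphic_modules_trans[OF sym] irreps_iso_eq by blast
  qed
  also have "\<dots> = (\<Sum>T | T \<in> D \<and> weight_dim act T M \<noteq> 0. weight_dim act T M)"
    by (rule sum.mono_neutral_right[OF _ cover]) (use finite_irreps fin in auto)
  finally show "weight_dim act N M = (\<Sum>\<kappa>\<in>irreps k. card (?D \<kappa>) * weight_dim tensor_act \<kappa> M)"
    using weight(2) by simp
qed

lemma decomposition_card_unique:
  assumes N: "polynomial_module act N" and \<kappa>: "\<kappa> \<in> irreps k"
    and D: "irreducible_decomposition sW (fmod act N) D" "irreducible_decomposition sW (fmod act N) D'"
  shows "card {T \<in> D. isomorphic (fmod act T) (fmod tensor_act \<kappa>)} = card {T \<in> D'. isomorphic (fmod act T) (fmod tensor_act \<kappa>)}"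
    (is "?c D \<kappa> = ?c D' \<kappa>")
proof -
  have "int (?c D \<kappa>) - int (?c D' \<kappa>) = 0"
  proof (rule characters_independent[OF _ \<kappa>])
    fix M assume M: "M \<in> weights k"
    have "(\<Sum>\<kappa>\<in>irreps k. int (?c D \<kappa> * weight_dim tensor_act \<kappa> M)) = (\<Sum>\<kappa>\<in>irreps k. int (?c D' \<kappa> * weight_dim tensor_act \<kappa> M))"
      using decomposition_character(2)[OF N D(1) M] decomposition_character(2)[OF N D(2) M]
      by (simp only: of_nat_sum[symmetric])
    then show "(\<Sum>\<kappa>\<in>irreps k. (int (?c D \<kappa>) - int (?c D' \<kappa>)) * int (weight_dim tensor_act \<kappa> M)) = 0"
      by (simp add: left_diff_distrib sum_subtractf)
  qed
  then show ?thesis by simp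
qed

lemma gl_mult_eqI:
  assumes N: "polynomial_module act N"
    and card: "\<And>D. irreducible_decomposition sW (fmod act N) D \<Longrightarrow>
      finite {T \<in> D. isomorphic (fmod act T) U} \<and> card {T \<in> D. isomorphic (fmod act T) U} = n"
  shows "gl_mult sW (fmod act N) U = n"
  unfolding gl_mult_def fmod_simps
  by (rule the_equality) (use irreducible_decomposition_exists[OF N] card in blast)+

lemma gl_mult_irrep:
  assumes N: "polynomial_module act N" and \<kappa>: "\<kappa> \<in> irreps k" and D: "irreducible_decomposition sW (fmod act N) D"
  shows "gl_mult sW (fmod act N) (fmod tensor_act \<kappa>) = card {T \<in> D. isomorphic (fmod act T) (fmod tensor_act \<kappa>)}"
  using decomposition_character(1)[OF N _ \<kappa>] decomposition_card_unique[OF N \<kappa> _ D] by (intro gl_mult_eqI[OF N]) blast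

lemma gl_mult_character:
  assumes N: "polynomial_module act N" and M: "M \<in> weights k"
  shows "weight_dim act N M
    = (\<Sum>\<kappa>\<in>irreps k. gl_mult sW (fmod act N) (fmod tensor_act \<kappa>) * weight_dim tensor_act \<kappa> M)"
proof -
  obtain D where D: "irreducible_decomposition sW (fmod act N) D"
    using irreducible_decomposition_exists[OF N] by blast
  show ?thesis using decomposition_character(2)[OF N D M] by (simp add: gl_mult_irrep[OF N _ D])
qed

lemma gl_mult_iso:
  fixes M :: "('k, 'w, 'c::ab_group_add) glmod"
  assumes "\<kappa> \<in> simples k" "isomorphic (fmod tensor_act \<kappa>) U"
  shows "gl_mult sW M U = gl_mult sW M (fmod tensor_act \<kappa>)"
proof -
  have "isomorphic L U \<longleftrightarrow> isomorphic L (fmod tensor_act \<kappa>)" for L :: "('k, 'w, 'c) glmod"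
    using isomorphic_modules_trans[OF _ assms(2)] isomorphic_modules_trans[OF _ iso_simples_sym[OF assms]] by blast
  then show ?thesis by (simp add: gl_mult_def)
qed

lemma gl_mult_zero:
  assumes N: "polynomial_module act N" and U: "\<And>k \<kappa>. \<kappa> \<in> irreps k \<Longrightarrow> \<not> isomorphic (fmod tensor_act \<kappa>) U"
  shows "gl_mult sW (fmod act N) U = 0"
proof (rule gl_mult_eqI[OF N])
  fix D assume "irreducible_decomposition sW (fmod act N) D"
  then have "{T \<in> D. isomorphic (fmod act T) U} = {}"
    using irreducible_decompositionD(4)[OF N] isomorphic_modules_trans U by blast
  then show "finite {T \<in> D. isomorphic (fmod act T) U} \<and> card {T \<in> D. isomorphic (fmod act T) U} = 0"
    by (simp only: finite.emptyI card.empty simp_thms)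
qed

section \<open>The character of a Schur functor\<close>

abbreviation schur_module :: "nat list \<Rightarrow> (nat \<times> nat, 'w, 'k) tensor set" where
  "schur_module lam \<equiv> young_symmetrizer lam ` E (cells lam)"

lemma schur_functor_fmod: "schur_functor sW lam = fmod tensor_act (schur_module lam)"
  by (simp add: schur_functor_def fmod_def tensor_act_def[abs_def])

lemma young_symmetrizer_perm_act:
  "young_symmetrizer lam t
    = (\<Sum>p\<in>row_group lam. \<Sum>q\<in>column_group lam. fscale (of_int (sign q)) (perm_act (p \<circ> q) t))"
  by (simp add: young_symmetrizer_def perm_act_def fun_eq_iff sum_fun_apply fscale_apply comp_assoc)

lemma flinear_young_symmetrizer: "flinear (young_symmetrizer lam :: (nat \<times> nat, 'w, 'k) tensor \<Rightarrow> _)"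
  unfolding young_symmetrizer_perm_act by (intro flinear_sum flinear_scale flinear_perm_act)

lemma young_symmetrizer_E: "t \<in> E (cells lam) \<Longrightarrow> young_symmetrizer lam t \<in> E (cells lam)"
  unfolding young_symmetrizer_perm_act
  by (intro fs.subspace_sum[OF E_subspace] fs.subspace_scale[OF E_subspace] perm_act_E permutes_compose)
    (simp_all add: row_group_def column_group_def)

lemma young_symmetrizer_tensor_act:
  "young_symmetrizer lam (tensor_act g t) = tensor_act g (young_symmetrizer lam t)"
  unfolding young_symmetrizer_perm_act
  by (simp only: fsp.linear_sum[OF flinear_tensor_act] fsp.linear_scale[OF flinear_tensor_act] tensor_act_perm_act)

lemma tcoord_young_symmetrizer:
  assumes T: "T \<in> indices (cells lam)" and S: "S \<in> indices (cells lam)"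
  shows "tcoord S (young_symmetrizer lam (basis_tensor (cells lam) T)) = young_vector lam T S"
proof -
  let ?C = "cells lam"
  let ?\<delta> = "\<lambda>p q. if T \<circ> q \<circ> p = S then 1 else 0 :: 'k"
  have tcoord_perm: "tcoord S (perm_act (p \<circ> q) (basis_tensor ?C T)) = ?\<delta> (inv p) (inv q)"
    if "p \<in> row_group lam" "q \<in> column_group lam" for p q
  proof -
    have p: "p permutes ?C" and q: "q permutes ?C" using that by (simp_all add: row_group_def column_group_def)
    have "perm_act (p \<circ> q) (basis_tensor ?C T) = basis_tensor ?C (T \<circ> inv (p \<circ> q))"
      unfolding basis_tensor_def perm_act_pure[OF permutes_compose[OF q p]] by (simp add: comp_assoc)
    also have "T \<circ> inv (p \<circ> q) = T \<circ> inv q \<circ> inv p"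
      using o_inv_distrib[OF permutes_bij[OF p] permutes_bij[OF q]] by (simp add: comp_assoc)
    finally have "perm_act (p \<circ> q) (basis_tensor ?C T) = basis_tensor ?C (T \<circ> inv q \<circ> inv p)" .
    then show ?thesis
      using tcoord_basis_tensor[OF finite_cells S indices_comp[OF permutes_inv[OF p] indices_comp[OF permutes_inv[OF q] T]]]
      by (simp only: eq_commute)
  qed
  have "tcoord S (young_symmetrizer lam (basis_tensor ?C T))
      = (\<Sum>p\<in>row_group lam. \<Sum>q\<in>column_group lam. of_int (sign q) * ?\<delta> (inv p) (inv q))"
    unfolding young_symmetrizer_perm_act tcoord_linear by (intro sum.cong refl arg_cong2[where f="(*)"] tcoord_perm)
  also have "\<dots> = (\<Sum>p\<in>row_group lam. \<Sum>q\<in>column_group lam. of_int (sign (inv q)) * ?\<delta> (inv p) (inv q))"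
  proof (intro sum.cong refl arg_cong2[where f="(*)"] arg_cong[where f=of_int])
    fix q assume "q \<in> column_group lam"
    then have "permutation q" using finite_cells unfolding permutation_permutes column_group_def by blast
    then show "sign q = sign (inv q)" by (rule sign_inverse[symmetric])
  qed
  also have "\<dots> = (\<Sum>p\<in>row_group lam. \<Sum>q\<in>column_group lam. of_int (sign q) * ?\<delta> (inv p) q)"
    unfolding column_group_eq by (intro sum.cong refl sum_fibre_group_inv)
  also have "\<dots> = young_vector lam T S"
    unfolding young_vector_def row_group_eq by (rule sum_fibre_group_inv)
  finally show ?thesis .
qed

lemma fillings_eq_indices:
  assumes "set_mset M \<subseteq> {..<m}"
  shows "fillings lam M = {T \<in> indices (cells lam). content (cells lam) T = M}"
  using assms finite_cells[of lam]
  by (auto simp: fillings_def PiE_def Pi_def set_content image_subset_iff simp del: split_paired_All)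

lemma weight_space_schur_module:
  assumes M: "set_mset M \<subseteq> {..<m}"
  shows "weight_space tensor_act (schur_module lam) M
    = fs.span ((\<lambda>T. young_symmetrizer lam (basis_tensor (cells lam) T)) ` fillings lam M)"
proof -
  let ?C = "cells lam" and ?y = "\<lambda>T. young_symmetrizer lam (basis_tensor (cells lam) T)"
  have "schur_module lam = fs.span (?y ` indices ?C)"
    by (simp add: E_span[OF finite_cells] image_image flip: fsp.linear_span_image[OF flinear_young_symmetrizer])
  moreover have "tensor_act prime_diag (?y T) = fscale (weight_scalar (content ?C T)) (?y T)" if T: "T \<in> indices ?C" for T
  proof -
    have "basis_tensor ?C T \<in> weight_space tensor_act (E ?C) (content ?C T)"
      by (auto simp: tensor_weight_space_iff[OF finite_cells subset_refl] basis_tensor_in_E tcoord_basis_tensor[OF finite_cells _ T]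
          split: if_splits)
    then show ?thesis
      by (simp add: weight_space_iff flip: young_symmetrizer_tensor_act fsp.linear_scale[OF flinear_young_symmetrizer])
  qed
  ultimately have "weight_space tensor_act (schur_module lam) M
      = fs.span (?y ` {T \<in> indices ?C. weight_scalar (content ?C T) = (weight_scalar M :: 'k)})"
    unfolding weight_space_def by (simp add: fs.eigenspace_span[OF flinear_tensor_act])
  then show ?thesis by (simp add: weight_scalar_inj fillings_eq_indices[OF M])
qed

lemma weight_dim_schur_module:
  assumes lam: "is_partition lam" and M: "set_mset M \<subseteq> {..<m}"
  shows "weight_dim tensor_act (schur_module lam) M = card (ssyt_content lam M)"
proof -
  let ?C = "cells lam" and ?y = "\<lambda>T. young_symmetrizer lam (basis_tensor (cells lam) T)"
  define coords where "coords = (\<lambda>(t :: (nat \<times> nat \<Rightarrow> 'w \<Rightarrow> 'k) \<Rightarrow> 'k) S. if S \<in> indices ?C then tcoord S t else 0)"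
  have coords: "flinear coords" by (rule flinearI) (auto simp: coords_def fs_simps tcoord_linear)
  have sub: "fillings lam M \<subseteq> indices ?C" unfolding fillings_eq_indices[OF M] by blast
  have coords_y: "coords (?y T) = young_vector lam T" if T: "T \<in> indices ?C" for T
  proof
    fix S
    have "young_vector lam T S = (0 :: 'k)" if S: "S \<notin> indices ?C"
    proof -
      have "T \<circ> q \<circ> p \<noteq> S" if "p \<in> row_group lam" "q \<in> column_group lam" for p q
        using indices_comp[OF _ indices_comp[OF _ T], of p q] that S by (auto simp: row_group_def column_group_def)
      then show ?thesis unfolding young_vector_def by (simp add: sum.neutral)
    qed
    then show "coords (?y T) S = young_vector lam T S" using tcoord_young_symmetrizer[OF T] by (simp add: coords_def)
  qed
  have inj: "inj_on coords (fs.span (?y ` fillings lam M))"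
  proof (rule inj_onI)
    have "fs.span (?y ` fillings lam M) \<subseteq> E ?C"
      by (rule fs.span_minimal[OF _ E_subspace]) (auto intro: young_symmetrizer_E basis_tensor_in_E)
    moreover fix u v assume "u \<in> fs.span (?y ` fillings lam M)" "v \<in> fs.span (?y ` fillings lam M)" and eq: "coords u = coords v"
    ultimately have uv: "u \<in> E ?C" "v \<in> E ?C" by blast+
    show "u = v"
    proof (rule E_ext[OF finite_cells uv])
      fix T assume "T \<in> indices ?C"
      then show "tcoord T u = tcoord T v" using fun_cong[OF eq, of T] by (simp add: coords_def)
    qed
  qed
  have "weight_dim tensor_act (schur_module lam) M = fs.dim (coords ` fs.span (?y ` fillings lam M))"
    unfolding weight_dim_def weight_space_schur_module[OF M]
    by (rule fsp.dim_image_inj[OF coords fs.subspace_span inj, symmetric])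
  also have "coords ` fs.span (?y ` fillings lam M) = fs.span (young_vector lam ` fillings lam M)"
    unfolding fsp.linear_span_image[OF coords, symmetric] image_image
    using sub coords_y by (intro arg_cong[where f=fs.span] image_cong) auto
  finally show ?thesis by (simp only: dim_span_young_vectors[OF lam])
qed

lemma polynomial_module_schur_module: "polynomial_module tensor_act (schur_module lam)"
proof -
  let ?C = "cells lam" and ?k = "sum_list lam"
  obtain e where e: "bij_betw e {..<?k} ?C"
    using finite_same_card_bij[of "{..<?k}" ?C] finite_cells card_cells by auto
  define h :: "(nat, 'w, 'k) tensor \<Rightarrow> (nat \<times> nat, 'w, 'k) tensor" where "h t = (\<lambda>\<xi>. t (\<lambda>l. \<xi> (e l)))" for t
  have h: "flinear h" unfolding h_def by (rule flinear_precompose)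
  have "h (pure {..<?k} (\<lambda>l. w (e l))) = pure ?C w" for w
  proof
    fix \<xi>
    have "dual_family {..<?k} (\<lambda>l. \<xi> (e l)) \<longleftrightarrow> dual_family ?C \<xi>"
      unfolding dual_family_def bij_betw_imp_surj_on[OF e, symmetric] by simp
    then show "h (pure {..<?k} (\<lambda>l. w (e l))) \<xi> = pure ?C w \<xi>"
      by (simp add: h_def pure_apply prod.reindex_bij_betw[OF e, of "\<lambda>c. \<xi> c (w c)"])
  qed
  then have "range (pure ?C) \<subseteq> h ` range (pure {..<?k})" by (metis image_subsetI rangeI image_eqI)
  then have "E ?C \<subseteq> h ` E {..<?k}"
    unfolding tensor_power_def fsp.linear_span_image[OF h, symmetric] by (rule fs.span_mono)
  moreover have sub: "schur_module lam \<subseteq> E ?C" using young_symmetrizer_E by blast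
  moreover have "equivariant_on (GL sW) tensor_act tensor_act (E {..<?k}) h"
    using h by (simp add: equivariant_on_def h_def tensor_act_def)
  ultimately have "schur_module lam
      \<subseteq> fs.span (\<Union>{h ` E {..<k} | (k :: nat) h. equivariant_on (GL sW) tensor_act tensor_act (E {..<k}) h})"
    by (intro subset_trans[OF _ fs.span_superset] subset_trans[OF _ Union_upper[of "h ` E {..<?k}"]]) blast+
  moreover have "stable (GL sW) tensor_act (schur_module lam)"
    by (rule stable_image[OF _ E_stable])
      (simp add: equivariant_on_def flinear_young_symmetrizer young_symmetrizer_tensor_act)
  moreover have "fs.findim (weight_space tensor_act (schur_module lam) M)" for M
    by (rule fs.findim_mono[OF E_findim[OF finite_cells[of lam]]]) (use sub in \<open>auto simp: weight_space_iff\<close>)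
  ultimately show ?thesis
    unfolding polynomial_module_def using flinear_tensor_act tensor_act_id tensor_act_comp by blast
qed

definition schur_mult :: "nat list \<Rightarrow> (nat, 'w, 'k) tensor set \<Rightarrow> nat" where
  "schur_mult lam \<kappa> = gl_mult sW (schur_functor sW lam) (fmod tensor_act \<kappa>)"

lemma schur_mult_character:
  assumes "is_partition lam" "M \<in> weights k"
  shows "(\<Sum>\<kappa>\<in>irreps k. int (schur_mult lam \<kappa>) * int (weight_dim tensor_act \<kappa> M)) = xcoeff (schur lam) M"
proof -
  have "xcoeff (schur lam) M = int (weight_dim tensor_act (schur_module lam) M)"
    using assms weight_dim_schur_module[of lam M] by (simp add: xcoeff_schur weights_def)
  then show ?thesis
    by (simp add: gl_mult_character[OF polynomial_module_schur_module assms(2)] schur_mult_def schur_functor_fmod)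
qed

lemma schur_mult_off_degree:
  assumes lam: "is_partition lam" "sum_list lam \<noteq> k" and \<kappa>: "\<kappa> \<in> irreps k"
  shows "schur_mult lam \<kappa> = 0"
proof -
  have "int (schur_mult lam \<kappa>) = 0"
  proof (rule characters_independent[OF _ \<kappa>])
    fix M assume M: "M \<in> weights k"
    have "ssyt_content lam M = {}"
      using M lam(2) size_content[of "cells lam"] by (auto simp: ssyt_content_def weights_def card_cells)
    then show "(\<Sum>\<kappa>\<in>irreps k. int (schur_mult lam \<kappa>) * int (weight_dim tensor_act \<kappa> M)) = 0"
      by (simp add: schur_mult_character[OF lam(1) M] xcoeff_schur)
  qed
  then show ?thesis by simp
qed

lemma sym_star_irrep:
  assumes \<kappa>: "\<kappa> \<in> irreps k"
  shows "sym_star sW f (fmod tensor_act \<kappa>) = (\<Sum>lam\<in>partitions_of k. schur_coeff f lam * int (schur_mult lam \<kappa>))"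
  unfolding sym_star_def schur_mult_def[symmetric]
proof (rule sum.mono_neutral_left[OF finite_partitions_of])
  have "sum_list lam = k" if "is_partition lam" "schur_mult lam \<kappa> \<noteq> 0" for lam
    using schur_mult_off_degree[OF that(1) _ \<kappa>] that(2) by blast
  then show "{lam. is_partition lam \<and> schur_mult lam \<kappa> \<noteq> 0} \<subseteq> partitions_of k"
    unfolding partitions_of_def by blast
qed (simp add: partitions_of_def)

lemma sym_star_character:
  assumes f: "f \<in> Sym_bar" and M: "M \<in> weights k"
  shows "(\<Sum>\<kappa>\<in>irreps k. sym_star sW f (fmod tensor_act \<kappa>) * int (weight_dim tensor_act \<kappa> M)) = xcoeff f M"
proof -
  have "(\<Sum>\<kappa>\<in>irreps k. sym_star sW f (fmod tensor_act \<kappa>) * int (weight_dim tensor_act \<kappa> M))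
      = (\<Sum>\<kappa>\<in>irreps k. \<Sum>lam\<in>partitions_of k. schur_coeff f lam * (int (schur_mult lam \<kappa>) * int (weight_dim tensor_act \<kappa> M)))"
    by (simp add: sym_star_irrep sum_distrib_right mult.assoc)
  also have "\<dots> = (\<Sum>lam\<in>partitions_of k. schur_coeff f lam *
      (\<Sum>\<kappa>\<in>irreps k. int (schur_mult lam \<kappa>) * int (weight_dim tensor_act \<kappa> M)))"
    unfolding sum_distrib_left by (rule sum.swap)
  also have "\<dots> = (\<Sum>lam\<in>partitions_of k. schur_coeff f lam * xcoeff (schur lam) M)"
    using schur_mult_character[OF _ M] by (simp add: partitions_of_def)
  also have "\<dots> = xcoeff f M"
    using xcoeff_schur_sum[of "schur_coeff f" M] schur_sum_schur_coeff[OF f] M by (simp add: weights_def)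
  finally show ?thesis .
qed

theorem sym_star_eq_sum_gl_mult:
  fixes act :: "('w \<Rightarrow> 'w) \<Rightarrow> ('a \<Rightarrow> 'k) \<Rightarrow> 'a \<Rightarrow> 'k" and U :: "('k, 'w, 'u::ab_group_add) glmod"
  assumes f: "f \<in> Sym_bar" and N: "\<And>i. i \<in> F \<Longrightarrow> polynomial_module act (N i)"
    and coeff: "\<And>M. set_mset M \<subseteq> {..<m} \<Longrightarrow> xcoeff f M = (\<Sum>i\<in>F. s i * int (weight_dim act (N i) M))"
  shows "sym_star sW f U = (\<Sum>i\<in>F. s i * int (gl_mult sW (fmod act (N i)) U))"
proof (cases "\<exists>k. \<exists>\<kappa>\<in>irreps k. isomorphic (fmod tensor_act \<kappa>) U")
  case False
  then have no: "\<And>k \<kappa>. \<kappa> \<in> irreps k \<Longrightarrow> \<not> isomorphic (fmod tensor_act \<kappa>) U" by blast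
  have "gl_mult sW (schur_functor sW lam) U = 0" for lam
    unfolding schur_functor_fmod by (rule gl_mult_zero[OF polynomial_module_schur_module no])
  moreover have "gl_mult sW (fmod act (N i)) U = 0" if "i \<in> F" for i by (rule gl_mult_zero[OF N[OF that] no])
  ultimately show ?thesis by (simp add: sym_star_def)
next
  case True
  then obtain k \<kappa> where \<kappa>: "\<kappa> \<in> irreps k" "isomorphic (fmod tensor_act \<kappa>) U" by blast
  note gl_mult_U = gl_mult_iso[OF irreps_simples[OF \<kappa>(1)] \<kappa>(2)]
  let ?n = "\<lambda>\<kappa> i. gl_mult sW (fmod act (N i)) (fmod tensor_act \<kappa>)"
  have "sym_star sW f (fmod tensor_act \<kappa>) - (\<Sum>i\<in>F. s i * int (?n \<kappa> i)) = 0"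
  proof (rule characters_independent[OF _ \<kappa>(1)])
    fix M assume M: "M \<in> weights k"
    have "(\<Sum>\<kappa>\<in>irreps k. (\<Sum>i\<in>F. s i * int (?n \<kappa> i)) * int (weight_dim tensor_act \<kappa> M))
        = (\<Sum>i\<in>F. s i * int (\<Sum>\<kappa>\<in>irreps k. ?n \<kappa> i * weight_dim tensor_act \<kappa> M))"
      unfolding sum_distrib_right of_nat_sum sum_distrib_left of_nat_mult by (subst sum.swap) (simp add: mult.assoc)
    also have "\<dots> = (\<Sum>i\<in>F. s i * int (weight_dim act (N i) M))"
      by (intro sum.cong refl) (simp only: gl_mult_character[OF N M])
    finally show "(\<Sum>\<kappa>\<in>irreps k. (sym_star sW f (fmod tensor_act \<kappa>) - (\<Sum>i\<in>F. s i * int (?n \<kappa> i)))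
        * int (weight_dim tensor_act \<kappa> M)) = 0"
      using sym_star_character[OF f M] coeff[of M] M by (simp add: left_diff_distrib sum_subtractf weights_def)
  qed
  then show ?thesis by (simp add: sym_star_def gl_mult_U)
qed

end

section \<open>The Koszul complex of a finite set\<close>

locale koszul =
  fixes X :: "'x set"
  assumes finite_X: "finite X"
begin

definition position :: "'x \<Rightarrow> nat" where
  "position = (SOME f. inj_on f X)"

lemma inj_on_position: "inj_on position X"
  unfolding position_def using finite_imp_inj_to_nat_seg[OF finite_X] by (metis someI_ex)

definition koszul_sign :: "'x \<Rightarrow> 'x set \<Rightarrow> 'r::comm_ring_1" where
  "koszul_sign x A = (-1) ^ card {y \<in> A. position y < position x}"

definition boundary :: "('x set \<Rightarrow> 'r::comm_ring_1) \<Rightarrow> 'x set \<Rightarrow> 'r" where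
  "boundary c A = (\<Sum>x\<in>X - A. koszul_sign x A * c (insert x A))"

lemma koszul_sign_square: "koszul_sign x A * koszul_sign x A = 1"
  by (simp add: koszul_sign_def flip: power_mult_distrib)

lemma koszul_sign_square_left: "koszul_sign x A * (koszul_sign x A * r) = r"
  by (simp add: koszul_sign_square flip: mult.assoc)

lemma koszul_sign_insert:
  assumes "A \<subseteq> X" "v \<notin> A"
  shows "koszul_sign u (insert v A) = (if position v < position u then - koszul_sign u A else koszul_sign u A)"
proof -
  have "finite {w \<in> A. position w < position u}" using finite_subset[OF assms(1) finite_X] by simp
  moreover have "{w \<in> insert v A. position w < position u}
      = (if position v < position u then insert v {w \<in> A. position w < position u} else {w \<in> A. position w < position u})"
    by auto
  ultimately show ?thesis using assms(2) by (simp add: koszul_sign_def)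
qed

lemma koszul_sign_swap:
  assumes "x \<in> X" "y \<in> X" "x \<noteq> y" "A \<subseteq> X" "x \<notin> A" "y \<notin> A"
  shows "koszul_sign x A * koszul_sign y (insert x A) = - (koszul_sign y A * koszul_sign x (insert y A))"
    and "koszul_sign y A * koszul_sign x A = - (koszul_sign x (insert y A) * koszul_sign y (insert x A))"
proof -
  have "position x \<noteq> position y" using inj_on_position assms(1-3) by (auto dest: inj_onD)
  then have "position x < position y \<or> position y < position x" by (simp only: nat_neq_iff)
  then show "koszul_sign x A * koszul_sign y (insert x A) = - (koszul_sign y A * koszul_sign x (insert y A))"
    "koszul_sign y A * koszul_sign x A = - (koszul_sign x (insert y A) * koszul_sign y (insert x A))"
    by (auto simp: koszul_sign_insert[OF assms(4,5)] koszul_sign_insert[OF assms(4,6)] mult.commute)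
qed

lemma boundary_add: "boundary (\<lambda>A. c A + d A) A = boundary c A + boundary d A"
  by (simp add: boundary_def distrib_left sum.distrib)

lemma boundary_diff: "boundary (\<lambda>A. c A - d A) A = boundary c A - boundary d A"
  by (simp add: boundary_def right_diff_distrib sum_subtractf)

lemma boundary_mult: "boundary (\<lambda>A. r * c A) A = r * boundary c A"
  by (simp add: boundary_def sum_distrib_left mult.left_commute)

lemma boundary_cong: "(\<And>x. x \<in> X - A \<Longrightarrow> c (insert x A) = d (insert x A)) \<Longrightarrow> boundary c A = boundary d A"
  unfolding boundary_def by (intro sum.cong) auto

lemma boundary_boundary:
  fixes c :: "'x set \<Rightarrow> 'r::comm_ring_1"
  assumes A: "A \<subseteq> X"
  shows "boundary (boundary c) A = 0"
proof -
  let ?t = "\<lambda>(x, y). koszul_sign x A * koszul_sign y (insert x A) * c (insert y (insert x A))"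
  let ?P = "{(x, y). x \<in> X - A \<and> y \<in> X - A \<and> position x < position y}"
  let ?P' = "{(x, y). x \<in> X - A \<and> y \<in> X - A \<and> position y < position x}"
  have "finite (?P \<union> ?P')" by (rule finite_subset[of _ "X \<times> X"]) (auto simp: finite_X)
  then have fin: "finite ?P" "finite ?P'" by simp_all
  have split: "(SIGMA x:X - A. X - insert x A) = ?P \<union> ?P'"
    using inj_on_position by (auto simp: inj_on_def not_less_iff_gr_or_eq)
  have "boundary (boundary c) A = (\<Sum>x\<in>X - A. \<Sum>y\<in>X - insert x A. ?t (x, y))"
    by (simp add: boundary_def sum_distrib_left mult.assoc)
  also have "\<dots> = sum ?t (?P \<union> ?P')"
    unfolding split[symmetric] using finite_X by (subst sum.Sigma) simp_all
  also have "\<dots> = sum ?t ?P + sum ?t ?P'" by (rule sum.union_disjoint[OF fin]) auto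
  also have "sum ?t ?P' = (\<Sum>p\<in>?P. - ?t p)"
  proof (rule sum.reindex_bij_witness[of _ prod.swap prod.swap])
    fix p assume p: "p \<in> ?P'"
    obtain x y where xy: "p = (x, y)" by fastforce
    then have "koszul_sign y A * koszul_sign x (insert y A) = (- (koszul_sign x A * koszul_sign y (insert x A)) :: 'r)"
      using p A by (intro koszul_sign_swap(1)) auto
    then show "- ?t (prod.swap p) = ?t p" by (simp add: xy insert_commute)
  qed auto
  also have "sum ?t ?P + (\<Sum>p\<in>?P. - ?t p) = 0" by (simp add: sum_negf)
  finally show ?thesis .
qed

definition homotopy :: "('x \<Rightarrow> 'r::comm_ring_1) \<Rightarrow> ('x set \<Rightarrow> 'r) \<Rightarrow> 'x set \<Rightarrow> 'r" where
  "homotopy l h A = (\<Sum>v\<in>A. koszul_sign v (A - {v}) * (l v * h (A - {v})))"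

lemma boundary_homotopy:
  assumes A: "A \<subseteq> X"
  shows "boundary (homotopy l h) A = (\<Sum>x\<in>X - A. l x * h A)
    + (\<Sum>x\<in>X - A. \<Sum>v\<in>A. koszul_sign x A * (koszul_sign v (insert x A - {v}) * (l v * h (insert x A - {v}))))"
proof -
  have "koszul_sign x A * homotopy l h (insert x A)
      = l x * h A + (\<Sum>v\<in>A. koszul_sign x A * (koszul_sign v (insert x A - {v}) * (l v * h (insert x A - {v}))))"
    if x: "x \<in> X - A" for x
  proof -
    have "insert x A - {x} = A" "finite A" using x A finite_X finite_subset by auto
    then show ?thesis
      using x by (simp add: homotopy_def distrib_left sum_distrib_left koszul_sign_square_left)
  qed
  then show ?thesis unfolding boundary_def sum.distrib[symmetric] by (intro sum.cong) auto
qed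

lemma homotopy_boundary:
  assumes A: "A \<subseteq> X"
  shows "homotopy l (boundary h) A = (\<Sum>v\<in>A. l v * h A)
    + (\<Sum>v\<in>A. \<Sum>x\<in>X - A. koszul_sign v (A - {v}) * (l v * (koszul_sign x (A - {v}) * h (insert x (A - {v})))))"
  unfolding homotopy_def sum.distrib[symmetric]
proof (rule sum.cong[OF refl])
  fix v assume v: "v \<in> A"
  then have "X - (A - {v}) = insert v (X - A)" "insert v (A - {v}) = A" using A by auto
  then have "boundary h (A - {v})
      = koszul_sign v (A - {v}) * h A + (\<Sum>x\<in>X - A. koszul_sign x (A - {v}) * h (insert x (A - {v})))"
    using v finite_X by (simp add: boundary_def)
  then show "koszul_sign v (A - {v}) * (l v * boundary h (A - {v})) = l v * h A
      + (\<Sum>x\<in>X - A. koszul_sign v (A - {v}) * (l v * (koszul_sign x (A - {v}) * h (insert x (A - {v})))))"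
    by (simp add: distrib_left sum_distrib_left koszul_sign_square_left mult.left_commute[of "l v" "koszul_sign _ _"])
qed

lemma koszul_homotopy:
  fixes h :: "'x set \<Rightarrow> 'r::comm_ring_1"
  assumes A: "A \<subseteq> X"
  shows "boundary (homotopy l h) A + homotopy l (boundary h) A = (\<Sum>x\<in>X. l x) * h A"
proof -
  let ?t = "\<lambda>x v. koszul_sign x A * (koszul_sign v (insert x A - {v}) * (l v * h (insert x A - {v})))"
  let ?t' = "\<lambda>x v. koszul_sign v (A - {v}) * (l v * (koszul_sign x (A - {v}) * h (insert x (A - {v}))))"
  have "?t x v + ?t' x v = 0" if "x \<in> X - A" "v \<in> A" for x v
  proof -
    have eq: "insert x A - {v} = insert x (A - {v})" "insert v (A - {v}) = A" using that by auto
    have "koszul_sign v (A - {v}) * koszul_sign x (A - {v})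
        = (- (koszul_sign x A * koszul_sign v (insert x (A - {v}))) :: 'r)"
      using koszul_sign_swap(2)[of x v "A - {v}"] that A unfolding eq(2) by auto
    then have "koszul_sign v (A - {v}) * koszul_sign x (A - {v}) * r
        = - (koszul_sign x A * koszul_sign v (insert x (A - {v})) * r)" for r :: 'r
      by (simp only: mult_minus_left)
    then show ?thesis unfolding eq(1) by (simp only: mult.assoc mult.left_commute[of "l v"] add.right_inverse)
  qed
  then have "(\<Sum>x\<in>X - A. \<Sum>v\<in>A. ?t x v) + (\<Sum>v\<in>A. \<Sum>x\<in>X - A. ?t' x v) = 0"
    by (subst sum.swap[of _ A]) (simp add: sum.distrib[symmetric])
  moreover have "(\<Sum>x\<in>X - A. l x * h A) + (\<Sum>v\<in>A. l v * h A) = (\<Sum>x\<in>X. l x) * h A"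
    using sum.subset_diff[OF A finite_X, of "\<lambda>x. l x * h A"] by (simp add: sum_distrib_right)
  ultimately show ?thesis
    unfolding boundary_homotopy[OF A] homotopy_boundary[OF A] by (simp add: algebra_simps)
qed

end

section \<open>Products of linear ideals\<close>

lemma (in vector_space) span_hyperplane:
  assumes B: "finite B" and z: "z \<in> dual_space scale" and e: "e \<in> span B" "z e \<noteq> 0"
  obtains B' where "finite B'" "card B' < card B" "span B' = {y \<in> span B. z y = 0}"
proof -
  interpret endo: vector_space_pair scale scale ..
  have "subspace {y. z y = 0}" by (auto simp: subspace_def dual_spaceD[OF z])
  then have "\<not> B \<subseteq> {y. z y = 0}" using span_minimal e by blast
  then obtain b where b: "b \<in> B" "z b \<noteq> 0" by blast
  define \<pi> where "\<pi> y = y - scale (z y / z b) b" for y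
  have \<pi>: "Vector_Spaces.linear scale scale \<pi>"
    using vector_space_axioms
    by (auto simp: Vector_Spaces.linear_iff \<pi>_def dual_spaceD[OF z] scale_right_diff_distrib scale_left_distrib
        add_divide_distrib)
  have "\<pi> b = 0" using b(2) by (simp add: \<pi>_def)
  moreover have "\<pi> ` B = insert (\<pi> b) (\<pi> ` (B - {b}))" using b(1) by blast
  ultimately have "span (\<pi> ` (B - {b})) = \<pi> ` span B"
    using endo.linear_span_image[OF \<pi>, of B] by (simp add: span_insert_0)
  also have "\<dots> = {y \<in> span B. z y = 0}"
  proof
    show "\<pi> ` span B \<subseteq> {y \<in> span B. z y = 0}"
      using b by (auto simp: \<pi>_def dual_spaceD[OF z] intro!: span_diff span_scale intro: span_base)
    have "\<pi> y = y" if "z y = 0" for y using that by (simp add: \<pi>_def)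
    then show "{y \<in> span B. z y = 0} \<subseteq> \<pi> ` span B" by (auto simp: image_iff) metis
  qed
  finally have "span (\<pi> ` (B - {b})) = {y \<in> span B. z y = 0}" .
  moreover have "card (\<pi> ` (B - {b})) < card B"
    using card_image_le[of "B - {b}" \<pi>] card_Diff1_less[OF B b(1)] B by simp
  ultimately show ?thesis using that[of "\<pi> ` (B - {b})"] B by blast
qed

locale linear_ideals = vector_space sY + koszul X
  for sY :: "'k::field_char_0 \<Rightarrow> 'a::ab_group_add \<Rightarrow> 'a" and X :: "'x set" +
  fixes Z :: "'x \<Rightarrow> 'a set"
  assumes subspace_Z: "x \<in> X \<Longrightarrow> subspace (Z x)"
begin

interpretation endo: vector_space_pair sY sY ..

abbreviation "forms \<equiv> dual_space sY"

lemma forms_add_scaled: "l \<in> forms \<Longrightarrow> l' \<in> forms \<Longrightarrow> (\<lambda>y. l y + c * l' y) \<in> forms"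
  by (simp add: dual_space_iff algebra_simps)

lemma zero_form: "(\<lambda>y. 0) \<in> forms"
  by (simp add: dual_space_iff)

definition L :: "'x \<Rightarrow> ('a \<Rightarrow> 'k) set" where
  "L x = {l \<in> forms. \<forall>y\<in>Z x. l y = 0}"

lemma L_forms: "l \<in> L x \<Longrightarrow> l \<in> forms"
  by (simp add: L_def)

inductive product_form :: "'x set \<Rightarrow> nat \<Rightarrow> ('a \<Rightarrow> 'k) \<Rightarrow> bool" where
  one: "product_form {} 0 1"
| form: "l \<in> forms \<Longrightarrow> product_form A k f \<Longrightarrow> product_form A (Suc k) (l * f)"
| factor: "x \<notin> A \<Longrightarrow> l \<in> L x \<Longrightarrow> product_form A k f \<Longrightarrow> product_form (insert x A) (Suc k) (l * f)"

text \<open>The degree \<open>k\<close> part of the product over \<open>x \<in> A\<close> of the ideals generated by \<open>L x\<close>.\<close>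

definition J :: "'x set \<Rightarrow> nat \<Rightarrow> ('a \<Rightarrow> 'k) set" where
  "J A k = fs.span {f. product_form A k f}"

lemma subspace_J: "fs.subspace (J A k)"
  unfolding J_def by (rule fs.subspace_span)

lemma J_base: "product_form A k f \<Longrightarrow> f \<in> J A k"
  unfolding J_def by (rule fs.span_base) simp

lemma J_minimal: "(\<And>f. product_form A k f \<Longrightarrow> f \<in> S) \<Longrightarrow> fs.subspace S \<Longrightarrow> J A k \<subseteq> S"
  unfolding J_def by (rule fs.span_minimal) auto

lemma J_image_subset:
  assumes F: "flinear F" and S: "\<And>f. product_form A k f \<Longrightarrow> F f \<in> S" "fs.subspace S" and f: "f \<in> J A k"
  shows "F f \<in> S"
proof -
  have "J A k \<subseteq> F -` S"
    by (rule J_minimal) (use S(1) fsp.linear_subspace_vimage[OF F S(2)] in auto)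
  then show ?thesis using f by blast
qed

lemma J_form: "l \<in> forms \<Longrightarrow> f \<in> J A k \<Longrightarrow> l * f \<in> J A (Suc k)"
  by (rule J_image_subset[OF flinear_times _ subspace_J]) (auto intro: J_base product_form.form)

lemma J_factor: "x \<notin> A \<Longrightarrow> l \<in> L x \<Longrightarrow> f \<in> J A k \<Longrightarrow> l * f \<in> J (insert x A) (Suc k)"
  by (rule J_image_subset[OF flinear_times _ subspace_J]) (auto intro: J_base product_form.factor)

lemma product_form_remove: "product_form A k f \<Longrightarrow> product_form (A - {x}) k f"
proof (induction rule: product_form.induct)
  case (factor x' A l k f)
  show ?case
  proof (cases "x' = x")
    case True
    then have "insert x' A - {x} = A - {x}" by auto
    then show ?thesis using product_form.form[OF L_forms[OF factor.hyps(2)] factor.IH] by metis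
  next
    case False
    then have "insert x' A - {x} = insert x' (A - {x})" by auto
    then show ?thesis using product_form.factor[OF _ factor.hyps(2) factor.IH] factor.hyps(1) by (metis Diff_iff)
  qed
qed (simp_all only: empty_Diff product_form.intros)

lemma J_remove: "J A k \<subseteq> J (A - {x}) k"
  by (rule J_minimal[OF _ subspace_J]) (rule J_base[OF product_form_remove])

lemma J_empty: "J A k \<subseteq> J {} k"
proof (rule J_minimal[OF _ subspace_J])
  fix f assume "product_form A k f"
  then have "product_form {} k f"
    by (induction rule: product_form.induct) (blast intro: product_form.intros L_forms)+
  then show "f \<in> J {} k" by (rule J_base)
qed

lemma J_at_0: "f \<in> J A k \<Longrightarrow> 0 < k \<Longrightarrow> f 0 = 0"
proof -
  assume "0 < k" "f \<in> J A k"
  moreover have "J A k \<subseteq> {f. f 0 = 0}"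
  proof (rule J_minimal)
    fix f assume "product_form A k f"
    then show "f \<in> {f. f 0 = 0}"
      using \<open>0 < k\<close> by cases (auto simp: dual_spaceD L_forms)
  qed (auto simp: fs.subspace_def fscale_apply)
  ultimately show ?thesis by blast
qed

lemma J_degree_0:
  assumes "f \<in> J A 0"
  shows "f y = f 0"
proof -
  have "fs.subspace {f :: 'a \<Rightarrow> 'k. \<forall>y. f y = f 0}"
    unfolding fs.subspace_def by (auto simp: fscale_apply) metis
  then have "J A 0 \<subseteq> {f. \<forall>y. f y = f 0}"
    by (intro J_minimal) (auto elim: product_form.cases)
  then show ?thesis using assms by blast
qed

lemma J_below_card:
  assumes "finite A" "k < card A"
  shows "J A k = {0}"
proof -
  have "card A \<le> k" if "product_form A k f" "finite A" for A k f
    using that by (induction rule: product_form.induct) auto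
  then have "{f. product_form A k f} = {}" using assms by fastforce
  then show ?thesis by (simp add: J_def)
qed

lemma J_polynomial_on_line:
  assumes "f \<in> J A k"
  shows "\<exists>p. \<forall>t. f (y + sY t e) = poly p t"
proof -
  have "J A k \<subseteq> {f. \<exists>p. \<forall>t. f (y + sY t e) = poly p t}"
  proof (rule J_minimal)
    fix f assume "product_form A k f"
    then have "\<exists>p. \<forall>t. f (y + sY t e) = poly p t"
    proof (induction rule: product_form.induct)
      case one
      show ?case by (rule exI[of _ 1]) simp
    next
      case (form l A k f)
      then obtain p where "\<forall>t. f (y + sY t e) = poly p t" by blast
      then show ?case
        using dual_spaceD[OF form.hyps(1)] by (intro exI[of _ "[:l y, l e:] * p"]) (simp add: distrib_right)
    next
      case (factor x A l k f)
      then obtain p where "\<forall>t. f (y + sY t e) = poly p t" by blast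
      then show ?case
        using dual_spaceD[OF L_forms[OF factor.hyps(2)]]
        by (intro exI[of _ "[:l y, l e:] * p"]) (simp add: distrib_right)
    qed
    then show "f \<in> {f. \<exists>p. \<forall>t. f (y + sY t e) = poly p t}" by blast
  next
    have "\<exists>r. \<forall>t. f (y + sY t e) + g (y + sY t e) = poly r t"
      if "\<forall>t. f (y + sY t e) = poly p t" "\<forall>t. g (y + sY t e) = poly q t" for f g p q
      by (rule exI[of _ "p + q"]) (simp add: that)
    moreover have "\<exists>r. \<forall>t. c * f (y + sY t e) = poly r t" if "\<forall>t. f (y + sY t e) = poly p t" for f p c
      by (rule exI[of _ "smult c p"]) (simp add: that)
    moreover have "\<exists>r. \<forall>t :: 'k. 0 = poly r t" by (rule exI[of _ 0]) simp
    ultimately show "fs.subspace {f. \<exists>p. \<forall>t. f (y + sY t e) = poly p t}"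
      unfolding fs.subspace_def by (auto simp: fscale_apply)
  qed
  then show ?thesis using assms by blast
qed

lemma J_compose:
  assumes \<eta>: "\<And>y y'. \<eta> (y + y') = \<eta> y + \<eta> y'" "\<And>a y. \<eta> (sY a y) = sY a (\<eta> y)"
    and stable: "\<And>x y. x \<in> A \<Longrightarrow> y \<in> Z x \<Longrightarrow> \<eta> y \<in> Z x" and f: "f \<in> J A k"
  shows "(\<lambda>y. f (\<eta> y)) \<in> J A k"
proof (rule J_image_subset[OF flinear_precompose _ subspace_J f], rule J_base)
  fix f assume "product_form A k f"
  then show "product_form A k (\<lambda>y. f (\<eta> y))"
    using stable
  proof (induction rule: product_form.induct)
    case one
    show ?case using product_form.one by (simp add: one_fun_def)
  next
    case (form l A k f)
    have "(\<lambda>y. l (\<eta> y)) \<in> forms" using form.hyps(1) by (simp add: dual_space_iff \<eta>)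
    then show ?case using product_form.form[OF _ form.IH[OF form.prems]] by (simp add: times_fun_def)
  next
    case (factor x A l k f)
    have "(\<lambda>y. l (\<eta> y)) \<in> L x" using factor.hyps(2) factor.prems[of x] by (simp add: L_def dual_space_iff \<eta>)
    moreover have "product_form A k (\<lambda>y. f (\<eta> y))" by (rule factor.IH) (use factor.prems in blast)
    ultimately show ?case using product_form.factor[OF factor.hyps(1)] by (simp add: times_fun_def)
  qed
qed

lemma J_mult:
  assumes "A \<inter> B = {}" "f \<in> J A k" "g \<in> J B l"
  shows "f * g \<in> J (A \<union> B) (k + l)"
proof -
  have "f * g \<in> J (A \<union> B) (k + l)" if "product_form A k f" "A \<inter> B = {}" "product_form B l g" for A k f g
    using that
  proof (induction rule: product_form.induct)
    case one
    then show ?case by (simp add: J_base)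
  next
    case (form l' A k f)
    have "f * g \<in> J (A \<union> B) (k + l)" by (rule form.IH[OF form.prems])
    then show ?case using J_form[OF form.hyps(1)] by (simp only: mult.assoc add_Suc)
  next
    case (factor x A l' k f)
    then have "f * g \<in> J (A \<union> B) (k + l)" "x \<notin> A \<union> B" by blast+
    then show ?case using J_factor[OF _ factor.hyps(2)] by (simp only: mult.assoc add_Suc Un_insert_left)
  qed
  then have "f * g \<in> J (A \<union> B) (k + l)" if "product_form B l g" for g
    using J_image_subset[OF flinear_times[of g], of A k "J (A \<union> B) (k + l)" f] assms(1,2) subspace_J that
    by (simp add: mult.commute)
  then show ?thesis
    using J_image_subset[OF flinear_times[of f] _ subspace_J assms(3)] by blast
qed

lemma J_minus_projection:
  assumes P: "\<And>y y'. P (y + y') = P y + P y'" "\<And>a y. P (sY a y) = sY a (P y)" "\<And>y. y \<in> Z x \<Longrightarrow> P y = y"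
    and f: "f \<in> J A k"
  shows "(\<lambda>y. f y - f (P y)) \<in> J {x} k"
proof -
  have step: "(\<lambda>y. (l * f) y - (l * f) (P y)) \<in> J {x} (Suc k)"
    if l: "l \<in> forms" and f: "f \<in> J {} k" "(\<lambda>y. f y - f (P y)) \<in> J {x} k" for l f k
  proof -
    have "(\<lambda>y. l y - l (P y)) \<in> L x" "(\<lambda>y. l (P y)) \<in> forms"
      using l P by (auto simp: L_def dual_space_iff algebra_simps)
    then have "(\<lambda>y. l y - l (P y)) * f \<in> J {x} (Suc k)" "(\<lambda>y. l (P y)) * (\<lambda>y. f y - f (P y)) \<in> J {x} (Suc k)"
      using J_factor[OF _ _ f(1)] J_form[OF _ f(2)] by blast+
    then have "(\<lambda>y. l y - l (P y)) * f + (\<lambda>y. l (P y)) * (\<lambda>y. f y - f (P y)) \<in> J {x} (Suc k)"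
      by (rule fs.subspace_add[OF subspace_J])
    then show ?thesis by (simp add: plus_fun_def times_fun_def algebra_simps)
  qed
  have "flinear (\<lambda>f y. f y - f (P y))" by (rule flinearI) (auto simp: fs_simps algebra_simps)
  then show ?thesis
  proof (rule J_image_subset[OF _ _ subspace_J f])
    fix f assume "product_form A k f"
    then show "(\<lambda>y. f y - f (P y)) \<in> J {x} k"
    proof (induction rule: product_form.induct)
      case one
      show ?case using fs.subspace_0[OF subspace_J] by (simp add: zero_fun_def)
    next
      case (form l A k f)
      then show ?case using J_empty J_base by (intro step) blast+
    next
      case (factor x' A l k f)
      then show ?case using J_empty J_base L_forms by (intro step) blast+
    qed
  qed
qed

text \<open>The quotients of elements of \<open>J A k\<close> by a linear form lie in \<open>J_pred A k\<close>.\<close>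

definition J_pred :: "'x set \<Rightarrow> nat \<Rightarrow> ('a \<Rightarrow> 'k) set" where
  "J_pred A k = (case k of 0 \<Rightarrow> {0} | Suc k' \<Rightarrow> J A k')"

lemma subspace_J_pred: "fs.subspace (J_pred A k)"
  by (simp add: J_pred_def subspace_J split: nat.split)

lemma J_pred_form: "l \<in> forms \<Longrightarrow> f \<in> J_pred A k \<Longrightarrow> l * f \<in> J A k"
  by (auto simp: J_pred_def J_form fs.subspace_0[OF subspace_J] split: nat.splits)

lemma J_pred_factor: "x \<notin> A \<Longrightarrow> l \<in> L x \<Longrightarrow> f \<in> J_pred A k \<Longrightarrow> l * f \<in> J (insert x A) k"
  by (auto simp: J_pred_def J_factor fs.subspace_0[OF subspace_J] split: nat.splits)

lemma J_difference_quotient: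
  assumes z: "z \<in> forms" "z e = 1" and e: "\<And>x. x \<in> A \<Longrightarrow> x \<in> X \<and> e \<in> Z x" and f: "f \<in> J A k"
  shows "(\<lambda>y. f y - f (y - sY (z y) e)) \<in> (*) z ` J_pred A k"
proof -
  let ?\<pi> = "\<lambda>y. y - sY (z y) e" and ?Q = "\<lambda>A k. (*) z ` J_pred A k"
  have \<pi>: "?\<pi> (y + y') = ?\<pi> y + ?\<pi> y'" "?\<pi> (sY a y) = sY a (?\<pi> y)" for y y' a
    using dual_spaceD[OF z(1)] by (simp_all add: scale_left_distrib scale_right_diff_distrib algebra_simps)
  have subQ: "fs.subspace (?Q A k)" for A k
    by (rule fsp.linear_subspace_image[OF flinear_times subspace_J_pred])
  have "flinear (\<lambda>f y. f y - f (?\<pi> y))" by (rule flinearI) (auto simp: fs_simps algebra_simps)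
  then show ?thesis
  proof (rule J_image_subset[OF _ _ subQ f])
    fix f assume "product_form A k f"
    then show "(\<lambda>y. f y - f (?\<pi> y)) \<in> ?Q A k"
      using e
    proof (induction rule: product_form.induct)
      case one
      have "(\<lambda>y. 1 y - 1 (?\<pi> y)) = (0 :: 'a \<Rightarrow> 'k)" by (simp add: fun_eq_iff)
      then show ?case using fs.subspace_0[OF subQ] by metis
    next
      case (form l A k f)
      obtain f' where f': "f' \<in> J_pred A k" "(\<lambda>y. f y - f (?\<pi> y)) = z * f'" using form.IH[OF form.prems] by blast
      have "?\<pi> y \<in> Z x" if "x \<in> A" "y \<in> Z x" for x y
        using form.prems[OF that(1)] that(2) subspace_Z by (auto intro: subspace_diff subspace_scale)
      then have f\<pi>: "(\<lambda>y. f (?\<pi> y)) \<in> J A k"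
        by (intro J_compose[OF \<pi>] J_base form.hyps(2)) blast+
      have "l * f' + fscale (l e) (\<lambda>y. f (?\<pi> y)) \<in> J A k"
        by (intro fs.subspace_add[OF subspace_J] fs.subspace_scale[OF subspace_J] J_pred_form form.hyps(1) f'(1) f\<pi>)
      moreover have "(\<lambda>y. (l * f) y - (l * f) (?\<pi> y)) = z * (l * f' + fscale (l e) (\<lambda>y. f (?\<pi> y)))"
      proof
        fix y
        have "f y = f (?\<pi> y) + z y * f' y" using fun_cong[OF f'(2), of y] by (simp add: algebra_simps)
        then show "(l * f) y - (l * f) (?\<pi> y) = (z * (l * f' + fscale (l e) (\<lambda>y. f (?\<pi> y)))) y"
          by (simp add: dual_spaceD[OF form.hyps(1)] fscale_apply algebra_simps)
      qed
      ultimately show ?case by (intro image_eqI) (simp_all only: J_pred_def nat.case)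
    next
      case (factor x A l k f)
      have "(\<lambda>y. f y - f (?\<pi> y)) \<in> ?Q A k" by (rule factor.IH) (use factor.prems in blast)
      then obtain f' where f': "f' \<in> J_pred A k" "(\<lambda>y. f y - f (?\<pi> y)) = z * f'" by blast
      have "l e = 0" using factor.hyps(2) factor.prems[of x] by (simp add: L_def)
      then have "l (?\<pi> y) = l y" for y using dual_spaceD[OF L_forms[OF factor.hyps(2)]] by simp
      then have "(\<lambda>y. (l * f) y - (l * f) (?\<pi> y)) = l * (\<lambda>y. f y - f (?\<pi> y))"
        by (simp add: fun_eq_iff algebra_simps)
      also have "\<dots> = z * (l * f')" unfolding f'(2) by (rule mult.left_commute)
      finally show ?case
        using J_pred_factor[OF factor.hyps(1,2) f'(1)] by (intro image_eqI) (simp_all only: J_pred_def nat.case)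
    qed
  qed
qed

definition zero_off :: "'a set \<Rightarrow> ('a \<Rightarrow> 'k) \<Rightarrow> 'a \<Rightarrow> 'k" where
  "zero_off S f = (\<lambda>y. if y \<in> S then f y else 0)"

definition J_on :: "'a set \<Rightarrow> 'x set \<Rightarrow> nat \<Rightarrow> ('a \<Rightarrow> 'k) set" where
  "J_on S A k = zero_off S ` J A k"

lemma flinear_zero_off: "flinear (zero_off S)"
  by (rule flinearI) (auto simp: zero_off_def fs_simps)

lemma zero_off_times: "zero_off S (l * f) = l * zero_off S f"
  by (auto simp: zero_off_def)

lemma zero_off_mult: "zero_off S f * zero_off S g = zero_off S (f * g)"
  by (auto simp: zero_off_def)

lemma zero_off_zero_off: "S' \<subseteq> S \<Longrightarrow> zero_off S' (zero_off S f) = zero_off S' f"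
  by (auto simp: zero_off_def fun_eq_iff)

lemma zero_off_eq_0_iff: "zero_off S f = 0 \<longleftrightarrow> (\<forall>y\<in>S. f y = 0)"
  by (auto simp: zero_off_def fun_eq_iff)

lemma subspace_J_on: "fs.subspace (J_on S A k)"
  unfolding J_on_def by (rule fsp.linear_subspace_image[OF flinear_zero_off subspace_J])

lemma J_on_zero_off: "f \<in> J_on S A k \<Longrightarrow> zero_off S f = f"
  by (auto simp: J_on_def zero_off_zero_off)

lemma J_on_outside: "f \<in> J_on S A k \<Longrightarrow> y \<notin> S \<Longrightarrow> f y = 0"
  by (auto simp: J_on_def zero_off_def)

lemma J_on_form: "l \<in> forms \<Longrightarrow> f \<in> J_on S A k \<Longrightarrow> l * f \<in> J_on S A (Suc k)"
  unfolding J_on_def by (auto simp: J_form simp flip: zero_off_times)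

lemma J_on_factor: "x \<in> A \<Longrightarrow> l \<in> L x \<Longrightarrow> f \<in> J_on S (A - {x}) k \<Longrightarrow> l * f \<in> J_on S A (Suc k)"
  unfolding J_on_def using J_factor[of x "A - {x}" l _ k] by (auto simp: insert_absorb simp flip: zero_off_times)

lemma J_on_remove: "J_on S A k \<subseteq> J_on S (A - {x}) k"
  unfolding J_on_def by (rule image_mono[OF J_remove])

lemma J_on_empty: "J_on S A k \<subseteq> J_on S {} k"
  unfolding J_on_def by (rule image_mono[OF J_empty])

lemma J_on_restrict: "S' \<subseteq> S \<Longrightarrow> f \<in> J_on S A k \<Longrightarrow> zero_off S' f \<in> J_on S' A k"
  by (auto simp: J_on_def zero_off_zero_off)

lemma J_on_lift:
  assumes "S' \<subseteq> S" "f \<in> J_on S' A k"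
  obtains g where "g \<in> J_on S A k" "zero_off S' g = f"
  using assms that by (auto simp: J_on_def) (metis imageI zero_off_zero_off)

lemma J_on_origin: "0 < k \<Longrightarrow> J_on {0} A k = {0}"
  using J_at_0 fs.subspace_0[OF subspace_J_on[of "{0}" A k]] by (auto simp: J_on_def zero_off_eq_0_iff)

lemma J_on_cancel:
  assumes z: "z \<in> forms" and S: "subspace S" "e \<in> S" "z e \<noteq> 0" and f: "f \<in> J_on S A k" and zf: "z * f = 0"
  shows "f = 0"
proof
  fix y
  obtain g where g: "g \<in> J A k" "f = zero_off S g" using f by (auto simp: J_on_def)
  show "f y = 0 y"
  proof (cases "y \<in> S")
    case True
    obtain p where p: "\<forall>t. g (y + sY t e) = poly p t" using J_polynomial_on_line[OF g(1)] by blast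
    let ?q = "[:z y, z e:]"
    have "poly (?q * p) t = 0" for t
    proof -
      have "y + sY t e \<in> S" using S True by (intro subspace_add subspace_scale)
      then have "z (y + sY t e) * g (y + sY t e) = 0"
        using fun_cong[OF zf, of "y + sY t e"] by (simp add: g(2) zero_off_def)
      then show ?thesis using p dual_spaceD[OF z] by (simp only: poly_mult) simp
    qed
    then have "?q * p = 0" using poly_all_0_iff_0 by blast
    moreover have "?q \<noteq> 0" using S(3) by simp
    ultimately have "p = 0" using mult_eq_0_iff by blast
    then show ?thesis using p[rule_format, of 0] True by (simp add: g(2) zero_off_def)
  qed (simp add: J_on_outside[OF f])
qed

lemma J_on_divide:
  assumes S: "subspace S" and z: "z \<in> forms" and e: "e \<in> S" "z e \<noteq> 0" "\<And>x. x \<in> A \<Longrightarrow> e \<in> Z x" and A: "A \<subseteq> X"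
    and f: "f \<in> J_on S A (Suc k)" "zero_off {y \<in> S. z y = 0} f = 0"
  obtains f' where "f' \<in> J_on S A k" "f = z * f'"
proof -
  let ?e = "sY (1 / z e) e"
  obtain g where g: "g \<in> J A (Suc k)" "f = zero_off S g" using f(1) by (auto simp: J_on_def)
  have ze: "z ?e = 1" using dual_spaceD(2)[OF z] e(2) by simp
  have "x \<in> X \<and> ?e \<in> Z x" if "x \<in> A" for x using subspace_scale[OF subspace_Z e(3)[OF that]] A that by blast
  then have "(\<lambda>y. g y - g (y - sY (z y) ?e)) \<in> (*) z ` J_pred A (Suc k)"
    by (rule J_difference_quotient[OF z ze _ g(1)])
  then obtain g' where g': "g' \<in> J A k" "(\<lambda>y. g y - g (y - sY (z y) ?e)) = z * g'" by (auto simp: J_pred_def)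
  have "g y = z y * g' y" if y: "y \<in> S" for y
  proof -
    let ?y = "y - sY (z y) ?e"
    have "?y \<in> S" "z ?y = 0"
      using y S e(1) ze dual_spaceD[OF z] by (auto intro: subspace_diff subspace_scale)
    then have "g ?y = 0" using f(2) unfolding zero_off_eq_0_iff g(2) by (auto simp: zero_off_def)
    then show ?thesis using fun_cong[OF g'(2), of y] by simp
  qed
  then have "f = z * zero_off S g'" by (auto simp: g(2) zero_off_def)
  then show ?thesis using that g'(1) by (auto simp: J_on_def)
qed

definition form_ideal :: "'a set \<Rightarrow> 'x set \<Rightarrow> ('a \<Rightarrow> 'k) set" where
  "form_ideal S A = fs.span (\<Union>(range (J_on S A)))"

lemma subspace_form_ideal: "fs.subspace (form_ideal S A)"
  by (simp add: form_ideal_def)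

lemma form_ideal_base: "f \<in> J A k \<Longrightarrow> zero_off S f \<in> form_ideal S A"
  unfolding form_ideal_def by (rule fs.span_base) (auto simp: J_on_def)

lemma form_ideal_image_subset:
  assumes F: "flinear F" and T: "\<And>k f. product_form A k f \<Longrightarrow> F (zero_off S f) \<in> T" "fs.subspace T"
    and u: "u \<in> form_ideal S A"
  shows "F u \<in> T"
proof -
  have "J_on S A k \<subseteq> F -` T" for k
  proof -
    have "J A k \<subseteq> zero_off S -` (F -` T)"
      using T(1)
      by (intro J_minimal fsp.linear_subspace_vimage[OF flinear_zero_off] fsp.linear_subspace_vimage[OF F T(2)]) auto
    then show ?thesis by (auto simp: J_on_def)
  qed
  then have "form_ideal S A \<subseteq> F -` T"
    unfolding form_ideal_def by (intro fs.span_minimal fsp.linear_subspace_vimage[OF F T(2)]) blast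
  then show ?thesis using u by blast
qed

lemma form_ideal_mult:
  assumes "A \<inter> B = {}" "u \<in> form_ideal S A" "v \<in> form_ideal S B"
  shows "u * v \<in> form_ideal S (A \<union> B)"
proof -
  have "zero_off S g * zero_off S f \<in> form_ideal S (A \<union> B)" if "product_form A k f" "product_form B l g" for f g k l
  proof -
    have "f * g \<in> J (A \<union> B) (k + l)" using that by (intro J_mult assms(1) J_base)
    then show ?thesis unfolding zero_off_mult mult.commute[of g] by (rule form_ideal_base)
  qed
  then have "zero_off S g * u \<in> form_ideal S (A \<union> B)" if "product_form B l g" for g l
    using form_ideal_image_subset[OF flinear_times _ subspace_form_ideal assms(2)] that by blast
  then have "u * zero_off S g \<in> form_ideal S (A \<union> B)" if "product_form B l g" for g l
    using that by (metis mult.commute)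
  then show ?thesis using form_ideal_image_subset[OF flinear_times _ subspace_form_ideal assms(3)] by blast
qed

lemma duality:
  assumes S: "subspace S" and A: "A \<subseteq> X" and z: "z \<in> forms" "\<And>y. y \<in> S \<Longrightarrow> \<forall>x\<in>A. y \<in> Z x \<Longrightarrow> z y = 0"
  obtains l where "\<And>x. x \<in> A \<Longrightarrow> l x \<in> L x" "\<And>y. y \<in> S \<Longrightarrow> z y = (\<Sum>x\<in>A. l x y)"
proof -
  have "finite A" using A finite_X finite_subset by blast
  then have "\<exists>l. (\<forall>x\<in>A. l x \<in> L x) \<and> (\<forall>y\<in>S. z y = (\<Sum>x\<in>A. l x y))"
    using A z
  proof (induction A arbitrary: z)
    case empty
    then show ?case by simp
  next
    case (insert x A)
    interpret functionals: vector_space_pair sY "(*) :: 'k \<Rightarrow> 'k \<Rightarrow> 'k"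
      by (intro vector_space_pair.intro vector_space_axioms vector_space_mult)
    have x: "subspace (Z x)" using insert.prems(1) subspace_Z by blast
    have "subspace (S \<inter> (\<Inter>x\<in>A. Z x))"
      using S subspace_Z insert.prems(1) by (intro subspace_inter subspace_Inter) auto
    then obtain l where l: "l \<in> forms" "\<And>y. y \<in> Z x \<Longrightarrow> l y = 0" "\<And>y. y \<in> S \<inter> (\<Inter>x\<in>A. Z x) \<Longrightarrow> l y = z y"
      by (rule functionals.linear_extend_vanishing[OF _ x, of _ z])
        (use insert.prems in \<open>auto simp: dual_space_def\<close>)
    have "(\<lambda>y. z y + (-1) * l y) \<in> forms" by (rule forms_add_scaled[OF insert.prems(2) l(1)])
    then obtain l' where l': "\<forall>x\<in>A. l' x \<in> L x" "\<forall>y\<in>S. z y + (-1) * l y = (\<Sum>x\<in>A. l' x y)"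
      using insert.IH[of "\<lambda>y. z y + (-1) * l y"] insert.prems l(3) by auto
    have "(\<Sum>v\<in>A. (l'(x := l)) v y) = (\<Sum>v\<in>A. l' v y)" for y using insert.hyps by (intro sum.cong) auto
    then show ?case using l l' insert.hyps by (intro exI[of _ "l'(x := l)"]) (auto simp: L_def algebra_simps)
  qed
  then obtain l where "\<forall>x\<in>A. l x \<in> L x" "\<forall>y\<in>S. z y = (\<Sum>x\<in>A. l x y)" by blast
  then show ?thesis by (intro that[of l]) simp_all
qed

lemma J_on_mult_trivial_section:
  assumes S: "subspace S" and A: "A \<subseteq> X" "S \<inter> (\<Inter>x\<in>A. Z x) \<subseteq> {0}" and z: "z \<in> forms"
    and h: "\<And>x. x \<in> A \<Longrightarrow> h \<in> J_on S (A - {x}) k" "zero_off S h = h"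
  shows "z * h \<in> J_on S A (Suc k)"
proof -
  obtain l where l: "\<And>x. x \<in> A \<Longrightarrow> l x \<in> L x" "\<And>y. y \<in> S \<Longrightarrow> z y = (\<Sum>x\<in>A. l x y)"
    using duality[OF S A(1) z] A(2) dual_spaceD(3)[OF z] by (metis INT_I IntI singletonD subsetD)
  have "(z * h) y = (\<Sum>x\<in>A. l x * h) y" for y
  proof (cases "y \<in> S")
    case False
    then have "h y = 0" using fun_cong[OF h(2), of y] by (simp add: zero_off_def)
    then show ?thesis by (simp add: sum_fun_apply)
  qed (simp add: l(2) sum_fun_apply sum_distrib_right)
  then have "z * h = (\<Sum>x\<in>A. l x * h)" by (rule ext)
  moreover have "(\<Sum>x\<in>A. l x * h) \<in> J_on S A (Suc k)"
    using l(1) h(1) by (intro fs.subspace_sum[OF subspace_J_on] J_on_factor) blast+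
  ultimately show ?thesis by simp
qed

lemma generic_form:
  assumes "finite F" "0 \<notin> F"
  obtains z where "z \<in> forms" "\<And>v. v \<in> F \<Longrightarrow> z v \<noteq> 0"
proof -
  interpret functionals: vector_space_pair sY "(*) :: 'k \<Rightarrow> 'k \<Rightarrow> 'k"
    by (intro vector_space_pair.intro vector_space_axioms vector_space_mult)
  have "\<exists>z\<in>forms. \<forall>v\<in>F. z v \<noteq> 0"
    using assms
  proof (induction F)
    case empty
    then show ?case using zero_form by blast
  next
    case (insert v F)
    then obtain z where z: "z \<in> forms" "\<forall>v\<in>F. z v \<noteq> 0" by auto
    obtain l where l: "l \<in> forms" "l v = 1"
      using functionals.linear_independent_extend[of "{v}" "\<lambda>_. 1"] insert.prems by (auto simp: dual_space_def)
    let ?bad = "(\<lambda>u. - z u / l u) ` insert v F \<union> {0}"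
    obtain c where c: "c \<notin> ?bad"
      using ex_new_if_finite[OF infinite_UNIV_char_0, of ?bad] insert.hyps by auto
    have "z u + c * l u \<noteq> 0" if u: "u \<in> insert v F" for u
    proof (cases "l u = 0")
      case True
      then show ?thesis using z(2) u l(2) by auto
    next
      case False
      then have "c = - z u / l u" if "z u + c * l u = 0" using that by (simp add: field_simps eq_neg_iff_add_eq_0)
      then show ?thesis using c u by blast
    qed
    then show ?case by (intro bexI[OF _ forms_add_scaled[OF z(1) l(1), of c]] ballI)
  qed
  then show ?thesis using that by blast
qed

definition regular_on :: "'a set \<Rightarrow> ('a \<Rightarrow> 'k) \<Rightarrow> bool" where
  "regular_on S z \<longleftrightarrow> z \<in> forms \<and> (S = {0} \<or> (\<exists>e\<in>S. z e \<noteq> 0)) \<and>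
    (\<forall>A k h. A \<subseteq> X \<longrightarrow> card A \<le> k \<longrightarrow> h \<in> J_on S {} k \<longrightarrow> z * h \<in> J_on S A (Suc k) \<longrightarrow> h \<in> J_on S A k)"

lemma divide_nontrivial_section:
  assumes S: "subspace S" and z: "z \<in> forms" and A: "A \<subseteq> X"
    and e: "e \<in> S" "z e \<noteq> 0" "\<And>x. x \<in> A \<Longrightarrow> e \<in> Z x"
    and h: "h \<in> J_on S {} k" "z * h \<in> J_on S A (Suc k)"
  shows "h \<in> J_on S A k"
proof -
  have "zero_off {y \<in> S. z y = 0} (z * h) = 0" by (simp add: zero_off_eq_0_iff)
  from J_on_divide[OF S z e A h(2) this] obtain f where f: "f \<in> J_on S A k" "z * h = z * f" by blast
  have "h - f \<in> J_on S {} k" using h(1) f(1) J_on_empty by (intro fs.subspace_diff[OF subspace_J_on]) blast+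
  moreover have "z * (h - f) = 0" using f(2) by (simp only: right_diff_distrib diff_self)
  ultimately have "h - f = 0" by (rule J_on_cancel[OF z S e(1,2)])
  then show ?thesis using f(1) by simp
qed

lemma divide_trivial_section:
  assumes S: "subspace S" and z: "z \<in> forms" and e: "e \<in> S" "z e \<noteq> 0"
    and z': "regular_on {y \<in> S. z y = 0} z'"
    and A: "A \<subseteq> X" "card A \<le> Suc k" "S \<inter> (\<Inter>x\<in>A. Z x) \<subseteq> {0}"
    and IH: "\<And>x k h. x \<in> A \<Longrightarrow> card (A - {x}) \<le> k \<Longrightarrow> h \<in> J_on S {} k \<Longrightarrow> z * h \<in> J_on S (A - {x}) (Suc k)
      \<Longrightarrow> h \<in> J_on S (A - {x}) k"
    and h: "h \<in> J_on S {} (Suc k)" "z * h \<in> J_on S A (Suc (Suc k))"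
  shows "h \<in> J_on S A (Suc k)"
proof -
  let ?S = "{y \<in> S. z y = 0}"
  have finA: "finite A" using A(1) finite_X finite_subset by blast
  have card: "card (A - {x}) \<le> k" if "x \<in> A" for x using card_Diff1_less[OF finA that] A(2) by simp
  have hx: "h \<in> J_on S (A - {x}) (Suc k)" if "x \<in> A" for x
    using card[OF that] h(2) J_on_remove by (intro IH[OF that _ h(1)]) (simp, blast)
  have sub: "?S \<subseteq> S" by blast
  have "z' * h \<in> J_on S A (Suc (Suc k))"
    by (rule J_on_mult_trivial_section[OF S A(1,3) _ hx J_on_zero_off[OF h(1)]]) (use z' in \<open>simp add: regular_on_def\<close>)
  then have "z' * zero_off ?S h \<in> J_on ?S A (Suc (Suc k))"
    using J_on_restrict[OF sub] unfolding zero_off_times[symmetric] by blast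
  then have "zero_off ?S h \<in> J_on ?S A (Suc k)"
    using z' A(1,2) J_on_restrict[OF sub h(1)] unfolding regular_on_def by blast
  then obtain g where g: "g \<in> J_on S A (Suc k)" "zero_off ?S g = zero_off ?S h"
    by (rule J_on_lift[OF sub]) blast
  have "zero_off ?S (h - g) = 0" using g(2) by (simp add: fsp.linear_diff[OF flinear_zero_off])
  moreover have "h - g \<in> J_on S {} (Suc k)"
    using h(1) g(1) J_on_empty by (intro fs.subspace_diff[OF subspace_J_on]) blast+
  ultimately obtain f where f: "f \<in> J_on S {} k" "h - g = z * f"
    using J_on_divide[OF S z e, of "{}" "h - g" k] by blast
  have "f \<in> J_on S (A - {x}) k" if x: "x \<in> A" for x
  proof (rule IH[OF x card[OF x] f(1)])
    show "z * f \<in> J_on S (A - {x}) (Suc k)"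
      unfolding f(2)[symmetric] using hx[OF x] g(1) J_on_remove by (intro fs.subspace_diff[OF subspace_J_on]) blast+
  qed
  then have "z * f \<in> J_on S A (Suc k)"
    using J_on_zero_off[OF f(1)] by (intro J_on_mult_trivial_section[OF S A(1,3) z])
  then have "z * f + g \<in> J_on S A (Suc k)" using g(1) by (rule fs.subspace_add[OF subspace_J_on])
  then show ?thesis by (simp flip: f(2))
qed

lemma regular_origin: "regular_on {0} (\<lambda>y. 0)"
proof -
  have "h \<in> J_on {0} A k" if "A \<subseteq> X" "card A \<le> k" "h \<in> J_on {0} {} k" for A k h
  proof (cases "A = {}")
    case False
    then have "0 < k" using that finite_X finite_subset by (metis card_gt_0_iff order.strict_trans2)
    then show ?thesis using that(3) by (simp add: J_on_origin)
  qed (use that in simp)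
  then show ?thesis by (simp add: regular_on_def zero_form)
qed

text \<open>The form is chosen nonzero on every nonzero section of \<open>S\<close>. If a section is zero, every linear form is
  on \<open>S\<close> a sum of elements of the \<open>L x\<close>, and one restricts to the hyperplane.\<close>

lemma regular_exists: "finite B \<Longrightarrow> \<exists>z. regular_on (span B) z"
proof (induction "card B" arbitrary: B rule: less_induct)
  case less
  let ?S = "span B" and ?section = "\<lambda>A. span B \<inter> (\<Inter>x\<in>A. Z x)"
  show ?case
  proof (cases "?S = {0}")
    case True
    then show ?thesis using regular_origin by metis
  next
    case False
    define G where "G = {A \<in> Pow X. \<not> ?section A \<subseteq> {0}}"
    have "\<forall>A\<in>G. \<exists>v. v \<in> ?section A \<and> v \<noteq> 0" by (auto simp: G_def)
    then obtain e where e: "\<forall>A\<in>G. e A \<in> ?section A \<and> e A \<noteq> 0" by (rule bchoice[THEN exE])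
    have "finite (e ` G)" "0 \<notin> e ` G" using finite_X e by (auto simp: G_def)
    then obtain z where z: "z \<in> forms" "\<And>A. A \<in> G \<Longrightarrow> z (e A) \<noteq> 0" by (rule generic_form) blast
    have "{} \<in> G" using False span_zero[of B] by (auto simp: G_def)
    then have e0: "e {} \<in> ?S" "z (e {}) \<noteq> 0" using e z(2) by auto
    obtain B' where B': "finite B'" "card B' < card B" "span B' = {y \<in> ?S. z y = 0}"
      by (rule span_hyperplane[OF less.prems z(1) e0])
    obtain z' where z': "regular_on (span B') z'" using less.hyps[OF B'(2,1)] by blast
    have "h \<in> J_on ?S A k" if "A \<subseteq> X" "card A \<le> k" "h \<in> J_on ?S {} k" "z * h \<in> J_on ?S A (Suc k)" for A k h
      using that
    proof (induction "card A" arbitrary: A k h rule: less_induct)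
      case (less A k h)
      show ?case
      proof (cases "A \<in> G")
        case True
        show ?thesis
          using e True
          by (intro divide_nontrivial_section[OF _ z(1) less.prems(1) _ z(2)[OF True] _ less.prems(3,4)]) auto
      next
        case False
        then have "?section A \<subseteq> {0}" "A \<noteq> {}" using less.prems(1) \<open>{} \<in> G\<close> by (auto simp: G_def)
        moreover have finA: "finite A" using less.prems(1) finite_X finite_subset by blast
        ultimately obtain k' where k': "k = Suc k'" using less.prems(2) by (cases k) auto
        show ?thesis
          unfolding k'
        proof (rule divide_trivial_section[OF _ z(1) e0 z'[unfolded B'(3)] less.prems(1) _ \<open>?section A \<subseteq> {0}\<close>])
          fix x k h assume x: "x \<in> A"
            and h: "card (A - {x}) \<le> k" "h \<in> J_on ?S {} k" "z * h \<in> J_on ?S (A - {x}) (Suc k)"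
          have "A - {x} \<subseteq> X" using less.prems(1) by blast
          then show "h \<in> J_on ?S (A - {x}) k" by (rule less.hyps[OF card_Diff1_less[OF finA x] _ h])
        qed (use less.prems k' in simp_all)
      qed
    qed
    then show ?thesis using z(1) e0 unfolding regular_on_def by blast
  qed
qed

lemma zero_off_boundary: "zero_off S (boundary c A) = boundary (\<lambda>A. zero_off S (c A)) A"
  by (simp only: boundary_def fsp.linear_sum[OF flinear_zero_off] zero_off_times)

lemma J_on_koszul_sign: "f \<in> J_on S A k \<Longrightarrow> koszul_sign x B * f \<in> J_on S A k"
  by (cases "even (card {y \<in> B. position y < position x})")
    (simp_all add: koszul_sign_def fs.subspace_neg[OF subspace_J_on])

definition chains :: "'a set \<Rightarrow> nat \<Rightarrow> ('x set \<Rightarrow> 'a \<Rightarrow> 'k) set" where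
  "chains S k = {c. \<forall>A\<subseteq>X. c A \<in> J_on S A k}"

lemma chainsD: "c \<in> chains S k \<Longrightarrow> A \<subseteq> X \<Longrightarrow> c A \<in> J_on S A k"
  by (simp add: chains_def)

lemma boundary_J_on:
  assumes c: "c \<in> chains S k" and A: "A \<subseteq> X"
  shows "boundary c A \<in> J_on S A k"
  unfolding boundary_def
proof (rule fs.subspace_sum[OF subspace_J_on], rule J_on_koszul_sign)
  fix x assume x: "x \<in> X - A"
  then have "c (insert x A) \<in> J_on S (insert x A - {x}) k" using chainsD[OF c, of "insert x A"] A J_on_remove by blast
  then show "c (insert x A) \<in> J_on S A k" using x by simp
qed

lemma cycle_top:
  assumes "\<And>A. A \<subseteq> X \<Longrightarrow> boundary c A = 0" "X \<noteq> {}"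
  shows "c X = 0"
proof -
  obtain x where x: "x \<in> X" using assms(2) by blast
  have "X - (X - {x}) = {x}" "insert x (X - {x}) = X" using x by auto
  then have "koszul_sign x (X - {x}) * c X = 0"
    using assms(1)[of "X - {x}"] by (simp only: boundary_def sum.insert) simp
  then show ?thesis using koszul_sign_square_left[of x "X - {x}" "c X"] by simp
qed

definition exact_on :: "'a set \<Rightarrow> nat \<Rightarrow> bool" where
  "exact_on S k \<longleftrightarrow> (\<forall>c\<in>chains S k. (\<forall>A\<subseteq>X. boundary c A = 0) \<longrightarrow> (\<exists>d\<in>chains S k. \<forall>A\<subseteq>X. c A = boundary d A))"

context
  fixes S z e k
  assumes S: "subspace S" "S \<inter> (\<Inter>x\<in>X. Z x) \<subseteq> {0}" and z: "regular_on S z" and e: "e \<in> S" "z e \<noteq> 0"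
    and X: "X \<noteq> {}" "card X \<le> Suc k"
begin

lemma regular_form: "z \<in> forms"
  using z by (simp add: regular_on_def)

lemma divide_cycle:
  assumes u: "u \<in> chains S (Suc k)" "\<And>A. A \<subseteq> X \<Longrightarrow> boundary u A = 0"
    "\<And>A. A \<subseteq> X \<Longrightarrow> zero_off {y \<in> S. z y = 0} (u A) = 0"
  obtains h where "h \<in> chains S k" "\<And>A. A \<subseteq> X \<Longrightarrow> u A = z * h A" "\<And>A. A \<subseteq> X \<Longrightarrow> boundary h A = 0"
proof -
  have "\<exists>h. h \<in> J_on S {} k \<and> u A = z * h" if A: "A \<subseteq> X" for A
  proof -
    have "u A \<in> J_on S {} (Suc k)" using chainsD[OF u(1) A] J_on_empty by blast
    from J_on_divide[OF S(1) regular_form e _ _ this u(3)[OF A]] show ?thesis by blast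
  qed
  then obtain h where h: "\<And>A. A \<subseteq> X \<Longrightarrow> h A \<in> J_on S {} k" "\<And>A. A \<subseteq> X \<Longrightarrow> u A = z * h A" by metis
  have boundary_h: "boundary h A = 0" if A: "A \<subseteq> X" for A
  proof (rule J_on_cancel[OF regular_form S(1) e])
    show "boundary h A \<in> J_on S {} k"
      unfolding boundary_def using h(1) A by (intro fs.subspace_sum[OF subspace_J_on] J_on_koszul_sign) blast
    have "z * boundary h A = boundary u A"
      unfolding boundary_mult[symmetric] using h(2) A by (intro boundary_cong) (metis DiffD1 insert_subset)
    then show "z * boundary h A = 0" using u(2)[OF A] by simp
  qed
  have "h A \<in> J_on S A k" if A: "A \<subseteq> X" for A
  proof (cases "A = X")
    case True
    then show ?thesis using cycle_top[OF boundary_h X(1)] fs.subspace_0[OF subspace_J_on] by metis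
  next
    case False
    then have "card A < card X" using A by (intro psubset_card_mono[OF finite_X]) blast
    then have "card A \<le> k" using X(2) by simp
    moreover have "z * h A \<in> J_on S A (Suc k)" using chainsD[OF u(1) A] h(2)[OF A] by metis
    ultimately show ?thesis using z A h(1)[OF A] unfolding regular_on_def by blast
  qed
  then show ?thesis using that[of h] h(2) boundary_h by (simp add: chains_def)
qed

lemma cycle_times_form_is_boundary:
  assumes h: "h \<in> chains S k" "\<And>A. A \<subseteq> X \<Longrightarrow> boundary h A = 0"
  obtains s where "s \<in> chains S (Suc k)" "\<And>A. A \<subseteq> X \<Longrightarrow> z * h A = boundary s A"
proof -
  obtain l where l: "\<And>x. x \<in> X \<Longrightarrow> l x \<in> L x" "\<And>y. y \<in> S \<Longrightarrow> z y = (\<Sum>x\<in>X. l x y)"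
    using duality[OF S(1) subset_refl regular_form] S(2) dual_spaceD(3)[OF regular_form]
    by (metis INT_I IntI singletonD subsetD)
  show ?thesis
  proof (rule that)
    show "homotopy l h \<in> chains S (Suc k)"
      unfolding chains_def homotopy_def
    proof (clarify, intro fs.subspace_sum[OF subspace_J_on] J_on_koszul_sign)
      fix A v assume "A \<subseteq> X" "v \<in> A"
      then have "v \<in> X" "A - {v} \<subseteq> X" by blast+
      then show "l v * h (A - {v}) \<in> J_on S A (Suc k)" by (rule J_on_factor[OF \<open>v \<in> A\<close> l(1) chainsD[OF h(1)]])
    qed
  next
    fix A assume A: "A \<subseteq> X"
    have "homotopy l (boundary h) A = 0"
      unfolding homotopy_def using h(2) A by (intro sum.neutral) (metis Diff_subset mult_zero_right subset_trans)
    moreover have "(\<Sum>x\<in>X. l x) * h A = z * h A"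
    proof
      fix y show "((\<Sum>x\<in>X. l x) * h A) y = (z * h A) y"
        using l(2)[of y] J_on_outside[OF chainsD[OF h(1) A], of y] by (cases "y \<in> S") (simp_all add: sum_fun_apply)
    qed
    ultimately show "z * h A = boundary (homotopy l h) A" using koszul_homotopy[OF A, of l h] by simp
  qed
qed

lemma exact_on_if_exact_on_hyperplane:
  assumes exact: "exact_on {y \<in> S. z y = 0} (Suc k)"
  shows "exact_on S (Suc k)"
  unfolding exact_on_def
proof (intro ballI impI)
  let ?S = "{y \<in> S. z y = 0}"
  have sub: "?S \<subseteq> S" by blast
  fix c assume c: "c \<in> chains S (Suc k)" "\<forall>A\<subseteq>X. boundary c A = 0"
  have "(\<lambda>A. zero_off ?S (c A)) \<in> chains ?S (Suc k)"
    unfolding chains_def using chainsD[OF c(1)] J_on_restrict[OF sub] by blast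
  moreover have "boundary (\<lambda>A. zero_off ?S (c A)) A = 0" if "A \<subseteq> X" for A
    unfolding zero_off_boundary[symmetric] using c(2) that by (simp add: zero_off_eq_0_iff)
  ultimately obtain d' where d': "d' \<in> chains ?S (Suc k)" "\<And>A. A \<subseteq> X \<Longrightarrow> zero_off ?S (c A) = boundary d' A"
    using exact unfolding exact_on_def by blast
  have "\<exists>f. f \<in> J_on S A (Suc k) \<and> zero_off ?S f = d' A" if "A \<subseteq> X" for A
    using J_on_lift[OF sub chainsD[OF d'(1) that]] by blast
  then obtain d where d: "\<And>A. A \<subseteq> X \<Longrightarrow> d A \<in> J_on S A (Suc k)" "\<And>A. A \<subseteq> X \<Longrightarrow> zero_off ?S (d A) = d' A" by metis
  have d_chain: "d \<in> chains S (Suc k)" using d(1) by (simp add: chains_def)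
  let ?u = "\<lambda>A. c A - boundary d A"
  have "boundary ?u A = 0" if "A \<subseteq> X" for A
    using c(2) boundary_boundary[OF that, of d] that by (simp only: boundary_diff diff_0_right)
  moreover have "?u \<in> chains S (Suc k)"
    unfolding chains_def using chainsD[OF c(1)] boundary_J_on[OF d_chain]
    by (blast intro: fs.subspace_diff[OF subspace_J_on])
  moreover have "zero_off ?S (?u A) = 0" if A: "A \<subseteq> X" for A
  proof -
    have "boundary (\<lambda>A. zero_off ?S (d A)) A = boundary d' A" using d(2) A by (intro boundary_cong) blast
    then show ?thesis
      using d'(2)[OF A] by (simp only: fsp.linear_diff[OF flinear_zero_off] zero_off_boundary diff_self)
  qed
  ultimately obtain h where h: "h \<in> chains S k" "\<And>A. A \<subseteq> X \<Longrightarrow> ?u A = z * h A" "\<And>A. A \<subseteq> X \<Longrightarrow> boundary h A = 0"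
    using divide_cycle by blast
  obtain s where s: "s \<in> chains S (Suc k)" "\<And>A. A \<subseteq> X \<Longrightarrow> z * h A = boundary s A"
    by (rule cycle_times_form_is_boundary[OF h(1,3)]) blast+
  have "c A = boundary (\<lambda>A. d A + s A) A" if "A \<subseteq> X" for A
    using h(2)[OF that] unfolding boundary_add s(2)[OF that, symmetric] by (simp add: algebra_simps)
  moreover have "(\<lambda>A. d A + s A) \<in> chains S (Suc k)"
    using d(1) chainsD[OF s(1)] unfolding chains_def by (blast intro: fs.subspace_add[OF subspace_J_on])
  ultimately show "\<exists>d\<in>chains S (Suc k). \<forall>A\<subseteq>X. c A = boundary d A" by blast
qed

end

lemma exactness:
  assumes X: "X \<noteq> {}" "card X \<le> k"
  shows "finite B \<Longrightarrow> span B \<inter> (\<Inter>x\<in>X. Z x) \<subseteq> {0} \<Longrightarrow> exact_on (span B) k"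
proof (induction "card B" arbitrary: B rule: less_induct)
  case (less B)
  obtain k' where k': "k = Suc k'" using X finite_X by (cases k) auto
  obtain z where z: "regular_on (span B) z" using regular_exists[OF less.prems(1)] by blast
  show ?case
  proof (cases "span B = {0}")
    case True
    then have "c A = 0" if "c \<in> chains (span B) k" "A \<subseteq> X" for c A
      using chainsD[OF that] by (simp add: J_on_origin k')
    then show ?thesis unfolding exact_on_def by (auto simp: boundary_def intro!: bexI)
  next
    case False
    then obtain e where e: "e \<in> span B" "z e \<noteq> 0" using z by (auto simp: regular_on_def)
    obtain B' where B': "finite B'" "card B' < card B" "span B' = {y \<in> span B. z y = 0}"
      by (rule span_hyperplane[OF less.prems(1) z[unfolded regular_on_def, THEN conjunct1] e])
    have "exact_on (span B') k" by (rule less.hyps[OF B'(2,1)]) (use less.prems(2) B'(3) in blast)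
    then show ?thesis
      using exact_on_if_exact_on_hyperplane[OF subspace_span less.prems(2) z e] X unfolding B'(3) k' by blast
  qed
qed

end

section \<open>Weight multiplicities of products of linear ideals\<close>

locale weighted_linear_ideals = linear_ideals sY X Z
  for sY :: "'k::field_char_0 \<Rightarrow> 'a::ab_group_add \<Rightarrow> 'a" and X :: "'x set" and Z +
  fixes \<eta> :: "'a \<Rightarrow> 'a" and C :: "'c set" and \<zeta> :: "'c \<Rightarrow> 'a \<Rightarrow> 'k" and w :: "'c \<Rightarrow> nat" and Y :: "'a set"
  assumes eta_linear: "\<eta> (y + y') = \<eta> y + \<eta> y'" "\<eta> (sY a y) = sY a (\<eta> y)"
    and eta_Z: "x \<in> X \<Longrightarrow> y \<in> Z x \<Longrightarrow> \<eta> y \<in> Z x"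
    and finite_C: "finite C" and zeta_forms: "c \<in> C \<Longrightarrow> \<zeta> c \<in> forms"
    and zeta_eta: "c \<in> C \<Longrightarrow> y \<in> Y \<Longrightarrow> \<zeta> c (\<eta> y) = of_nat (nprime (w c)) * \<zeta> c y"
    and zeta_span: "l \<in> forms \<Longrightarrow> \<exists>a. \<forall>y\<in>Y. l y = (\<Sum>c\<in>C. a c * \<zeta> c y)"
begin

definition admissible :: "'a set \<Rightarrow> bool" where
  "admissible S \<longleftrightarrow> S \<subseteq> Y \<and> (\<exists>B. finite B \<and> S = span B) \<and> (\<forall>y. \<eta> y \<in> S \<longleftrightarrow> y \<in> S)"

definition pullback :: "('a \<Rightarrow> 'k) \<Rightarrow> 'a \<Rightarrow> 'k" where
  "pullback f = (\<lambda>y. f (\<eta> y))"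

definition form_weight_space :: "'a set \<Rightarrow> 'x set \<Rightarrow> nat multiset \<Rightarrow> ('a \<Rightarrow> 'k) set" where
  "form_weight_space S A M = fs.eigenspace pullback (J_on S A (size M)) (weight_scalar M)"

definition form_weight_dim :: "'a set \<Rightarrow> 'x set \<Rightarrow> nat multiset \<Rightarrow> nat" where
  "form_weight_dim S A M = fs.dim (form_weight_space S A M)"

definition monomial :: "'c list \<Rightarrow> 'a \<Rightarrow> 'k" where
  "monomial cs y = (\<Prod>c\<leftarrow>cs. \<zeta> c y)"

definition monomial_weight :: "'c list \<Rightarrow> nat multiset" where
  "monomial_weight cs = mset (map w cs)"

definition words :: "nat \<Rightarrow> 'c list set" where
  "words k = {cs. set cs \<subseteq> C \<and> length cs = k}"

lemma admissibleD:
  assumes "admissible S"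
  shows "S \<subseteq> Y" "subspace S" "\<eta> y \<in> S \<longleftrightarrow> y \<in> S"
  using assms by (auto simp: admissible_def)

lemma flinear_pullback: "flinear pullback"
  by (rule flinearI) (auto simp: pullback_def fs_simps)

lemma pullback_zero_off: "admissible S \<Longrightarrow> pullback (zero_off S f) = zero_off S (pullback f)"
  by (auto simp: pullback_def zero_off_def admissibleD)

lemma pullback_J_on:
  assumes "admissible S" "A \<subseteq> X" "u \<in> J_on S A k"
  shows "pullback u \<in> J_on S A k"
proof -
  obtain f where f: "f \<in> J A k" "u = zero_off S f" using assms(3) by (auto simp: J_on_def)
  have "pullback f \<in> J A k"
    unfolding pullback_def by (rule J_compose[OF eta_linear eta_Z f(1)]) (use assms(2) in blast)+
  then show ?thesis by (auto simp: f(2) pullback_zero_off[OF assms(1)] J_on_def)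
qed

lemma form_weight_space_iff:
  "u \<in> form_weight_space S A M \<longleftrightarrow> u \<in> J_on S A (size M) \<and> pullback u = fscale (weight_scalar M) u"
  by (simp add: form_weight_space_def fs.eigenspace_def)

lemma subspace_form_weight_space: "fs.subspace (form_weight_space S A M)"
  unfolding form_weight_space_def by (rule fs.subspace_eigenspace[OF flinear_pullback subspace_J_on])

lemma finite_words: "finite (words k)"
  unfolding words_def by (rule finite_lists_length_eq[OF finite_C])

lemma zeta_times_monomials:
  assumes c: "c \<in> C" and f: "f \<in> fs.span ((\<lambda>cs. zero_off S (monomial cs)) ` words k)"
  shows "\<zeta> c * f \<in> fs.span ((\<lambda>cs. zero_off S (monomial cs)) ` words (Suc k))"
proof -
  have "(*) (\<zeta> c) ` (\<lambda>cs. zero_off S (monomial cs)) ` words k \<subseteq> (\<lambda>cs. zero_off S (monomial cs)) ` words (Suc k)"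
  proof (clarify, rule image_eqI)
    fix cs assume "cs \<in> words k"
    then show "c # cs \<in> words (Suc k)" using c by (simp add: words_def)
    show "\<zeta> c * zero_off S (monomial cs) = zero_off S (monomial (c # cs))"
      by (auto simp: zero_off_def monomial_def)
  qed
  from fs.span_mono[OF this] show ?thesis using f unfolding fsp.linear_span_image[OF flinear_times] by blast
qed

lemma J_on_subset_span_monomials:
  assumes S: "S \<subseteq> Y"
  shows "J_on S A k \<subseteq> fs.span ((\<lambda>cs. zero_off S (monomial cs)) ` words k)"
proof -
  let ?D = "\<lambda>k. fs.span ((\<lambda>cs. zero_off S (monomial cs)) ` words k)"
  have step: "zero_off S (l * f) \<in> ?D (Suc k)" if l: "l \<in> forms" and f: "zero_off S f \<in> ?D k" for l k f
  proof -
    obtain a where a: "\<forall>y\<in>Y. l y = (\<Sum>c\<in>C. a c * \<zeta> c y)" using zeta_span[OF l] by blast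
    have "zero_off S (l * f) = (\<Sum>c\<in>C. fscale (a c) (\<zeta> c * zero_off S f))"
      using a S by (auto simp: zero_off_def fs_simps sum_distrib_right mult.assoc)
    then show ?thesis using zeta_times_monomials f by (simp add: fs.span_sum fs.span_scale)
  qed
  have "zero_off S f \<in> ?D k" if "product_form A k f" for f
    using that
  proof (induction rule: product_form.induct)
    case one
    have "zero_off S 1 = zero_off S (monomial [])" by (simp add: monomial_def zero_off_def fun_eq_iff)
    moreover have "zero_off S (monomial []) \<in> ?D 0" by (intro fs.span_base imageI) (simp add: words_def)
    ultimately show ?case by (simp only:)
  qed (blast intro: step L_forms)+
  then show ?thesis unfolding J_on_def using J_image_subset[OF flinear_zero_off _ fs.subspace_span] by blast
qed

lemma findim_form_weight_space:
  assumes "admissible S"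
  shows "fs.findim (form_weight_space S A M)"
proof -
  have "form_weight_space S A M \<subseteq> fs.span ((\<lambda>cs. zero_off S (monomial cs)) ` words (size M))"
    using J_on_subset_span_monomials[OF admissibleD(1)[OF assms]] form_weight_space_iff by blast
  then show ?thesis using fs.findim_mono[OF fs.findim_span] finite_words by blast
qed

lemma pullback_monomial:
  assumes S: "admissible S" and cs: "cs \<in> words k"
  shows "pullback (zero_off S (monomial cs)) = fscale (weight_scalar (monomial_weight cs)) (zero_off S (monomial cs))"
proof -
  have "monomial cs (\<eta> y) = weight_scalar (monomial_weight cs) * monomial cs y" if y: "y \<in> Y" for y
    using cs unfolding words_def monomial_weight_def mem_Collect_eq
    by (induction cs arbitrary: k) (auto simp: monomial_def weight_scalar_add_mset zeta_eta[OF _ y])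
  then show ?thesis using admissibleD(1,3)[OF S] by (auto simp: pullback_def zero_off_def fs_simps)
qed

lemma eigenvalue_is_weight_scalar:
  assumes S: "admissible S" and u: "u \<in> J_on S A k" "pullback u = fscale \<theta> u" "u \<noteq> 0"
  obtains M where "\<theta> = weight_scalar M"
proof -
  have "u \<in> fs.eigenspace pullback (fs.span ((\<lambda>cs. zero_off S (monomial cs)) ` words k)) \<theta>"
    using u(1,2) J_on_subset_span_monomials[OF admissibleD(1)[OF S]] by (auto simp: fs.eigenspace_def)
  also have "\<dots> = fs.span ((\<lambda>cs. zero_off S (monomial cs)) ` {cs \<in> words k. weight_scalar (monomial_weight cs) = \<theta>})"
    by (rule fs.eigenspace_span[OF flinear_pullback pullback_monomial[OF S]])
  finally have "{cs \<in> words k. weight_scalar (monomial_weight cs) = \<theta>} \<noteq> {}"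
    using u(3) by (metis fs.span_empty image_empty singletonD)
  then show ?thesis using that by blast
qed

lemma weight_projection:
  assumes K: "finite K"
  obtains P where "flinear P" "\<And>u. pullback u = fscale (weight_scalar M) u \<Longrightarrow> P u = u"
    "\<And>S A u. admissible S \<Longrightarrow> A \<subseteq> X \<Longrightarrow> u \<in> J_on S A (size M) \<Longrightarrow> P u \<in> form_weight_space S A M"
    "\<And>S A k u. admissible S \<Longrightarrow> u \<in> J_on S A k \<Longrightarrow> k \<in> K \<Longrightarrow> k \<noteq> size M \<Longrightarrow> P u = 0"
    "\<And>F u. flinear F \<Longrightarrow> (\<And>u. F (pullback u) = pullback (F u)) \<Longrightarrow> F (P u) = P (F u)"
proof -
  let ?weights = "monomial_weight ` (\<Union>k\<in>insert (size M) K. words k)"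
  let ?others = "weight_scalar ` (?weights - {M}) :: 'k set"
  have "finite ?others" "weight_scalar M \<notin> ?others" using finite_words K by (auto simp: weight_scalar_inj)
  from fs.spectral_projection[OF flinear_pullback this]
  obtain P where P: "flinear P" "\<And>u. pullback u = fscale (weight_scalar M) u \<Longrightarrow> P u = u"
    "\<And>\<theta> u. \<theta> \<in> ?others \<Longrightarrow> pullback u = fscale \<theta> u \<Longrightarrow> P u = 0"
    "\<And>S u. fs.subspace S \<Longrightarrow> (\<And>u. u \<in> S \<Longrightarrow> pullback u \<in> S) \<Longrightarrow> u \<in> S \<Longrightarrow> P u \<in> S"
    "\<And>F u. flinear F \<Longrightarrow> (\<And>u. F (pullback u) = pullback (F u)) \<Longrightarrow> F (P u) = P (F u)"
    by blast
  have P_monomial: "P (zero_off S (monomial cs)) = (if monomial_weight cs = M then zero_off S (monomial cs) else 0)"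
    if S: "admissible S" and k: "k \<in> insert (size M) K" "cs \<in> words k" for S k cs
  proof (cases "monomial_weight cs = M")
    case True
    then show ?thesis using P(2) pullback_monomial[OF S k(2)] by simp
  next
    case False
    then have "weight_scalar (monomial_weight cs) \<in> ?others" using k by blast
    then show ?thesis using False P(3) pullback_monomial[OF S k(2)] by simp
  qed
  have P_span: "P u \<in> T"
    if S: "admissible S" and k: "k \<in> insert (size M) K" and T: "fs.subspace T"
      "\<And>cs. cs \<in> words k \<Longrightarrow> monomial_weight cs = M \<Longrightarrow> zero_off S (monomial cs) \<in> T" and u: "u \<in> J_on S A k" for S A k T u
  proof -
    have "fs.span ((\<lambda>cs. zero_off S (monomial cs)) ` words k) \<subseteq> P -` T"
      using P_monomial[OF S k] T fs.subspace_0[OF T(1)]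
      by (intro fs.span_minimal fsp.linear_subspace_vimage[OF P(1)]) auto
    then show ?thesis using u J_on_subset_span_monomials[OF admissibleD(1)[OF S]] by blast
  qed
  show ?thesis
  proof (rule that[OF P(1,2) _ _ P(5)])
    fix S A u assume S: "admissible S" and A: "A \<subseteq> X" and u: "u \<in> J_on S A (size M)"
    have "P u \<in> fs.eigenspace pullback UNIV (weight_scalar M)"
      using pullback_monomial[OF S] by (intro P_span[OF S insertI1 _ _ u] fs.subspace_eigenspace[OF flinear_pullback])
        (auto simp: fs.eigenspace_def)
    moreover have "P u \<in> J_on S A (size M)" using pullback_J_on[OF S A] u by (intro P(4) subspace_J_on)
    ultimately show "P u \<in> form_weight_space S A M" by (simp add: form_weight_space_def fs.eigenspace_def)
  next
    fix S A k u assume "admissible S" "u \<in> J_on S A k" "k \<in> K" "k \<noteq> size M"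
    then have "P u \<in> {0}" by (intro P_span[of S k "{0}" u A]) (auto simp: words_def monomial_weight_def)
    then show "P u = 0" by simp
  qed
qed

lemma restrict_form_weight_space:
  assumes S: "admissible S" "admissible S'" "S' \<subseteq> S" and A: "A \<subseteq> X"
  shows "zero_off S' ` form_weight_space S A M = form_weight_space S' A M"
proof
  show "zero_off S' ` form_weight_space S A M \<subseteq> form_weight_space S' A M"
    using J_on_restrict[OF S(3)]
    by (auto simp: form_weight_space_iff pullback_zero_off[OF S(2)] fsp.linear_scale[OF flinear_zero_off])
  show "form_weight_space S' A M \<subseteq> zero_off S' ` form_weight_space S A M"
  proof
    fix v assume v: "v \<in> form_weight_space S' A M"
    obtain P where P: "flinear P" "\<And>u. pullback u = fscale (weight_scalar M) u \<Longrightarrow> P u = u"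
      "\<And>S A u. admissible S \<Longrightarrow> A \<subseteq> X \<Longrightarrow> u \<in> J_on S A (size M) \<Longrightarrow> P u \<in> form_weight_space S A M"
      "\<And>F u. flinear F \<Longrightarrow> (\<And>u. F (pullback u) = pullback (F u)) \<Longrightarrow> F (P u) = P (F u)"
      by (rule weight_projection[OF finite.emptyI, of M]) blast
    obtain u where u: "u \<in> J_on S A (size M)" "zero_off S' u = v"
      using v J_on_lift[OF S(3)] by (metis form_weight_space_iff)
    have "zero_off S' (P u) = P v"
      using P(4)[OF flinear_zero_off, of S' u] pullback_zero_off[OF S(2)] u(2) by simp
    also have "\<dots> = v" using v by (simp add: form_weight_space_iff P(2))
    finally show "v \<in> zero_off S' ` form_weight_space S A M" using P(3)[OF S(1) A u(1)] by blast
  qed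
qed

lemma eigenspace_form_ideal:
  assumes S: "admissible S" and A: "A \<subseteq> X"
  shows "fs.eigenspace pullback (form_ideal S A) (weight_scalar M) = form_weight_space S A M"
proof
  have "J_on S A (size M) \<subseteq> form_ideal S A"
    unfolding form_ideal_def by (intro subset_trans[OF Union_upper fs.span_superset] rangeI)
  then show "form_weight_space S A M \<subseteq> fs.eigenspace pullback (form_ideal S A) (weight_scalar M)"
    by (auto simp: form_weight_space_iff fs.eigenspace_def)
  show "fs.eigenspace pullback (form_ideal S A) (weight_scalar M) \<subseteq> form_weight_space S A M"
  proof
    fix u assume "u \<in> fs.eigenspace pullback (form_ideal S A) (weight_scalar M)"
    then have u: "u \<in> form_ideal S A" "pullback u = fscale (weight_scalar M) u"
      by (auto simp: fs.eigenspace_def)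
    have "fs.subspace N" if "N \<in> range (J_on S A)" for N using that subspace_J_on by auto
    then obtain F v where F: "finite F" "F \<subseteq> range (J_on S A)" "\<And>N. N \<in> F \<Longrightarrow> v N \<in> N" "u = (\<Sum>N\<in>F. v N)"
      by (rule fs.in_span_Union_sum[OF u(1)[unfolded form_ideal_def]]) blast+
    obtain K where K: "finite K" "F = J_on S A ` K" using finite_subset_image[OF F(1,2)] by blast
    obtain P where P: "flinear P" "\<And>u. pullback u = fscale (weight_scalar M) u \<Longrightarrow> P u = u"
      "\<And>S A u. admissible S \<Longrightarrow> A \<subseteq> X \<Longrightarrow> u \<in> J_on S A (size M) \<Longrightarrow> P u \<in> form_weight_space S A M"
      "\<And>S A k u. admissible S \<Longrightarrow> u \<in> J_on S A k \<Longrightarrow> k \<in> K \<Longrightarrow> k \<noteq> size M \<Longrightarrow> P u = 0"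
      by (rule weight_projection[OF K(1), of M]) blast
    have "P (v N) \<in> form_weight_space S A M" if N: "N \<in> F" for N
    proof -
      obtain k where k: "k \<in> K" "N = J_on S A k" using N K(2) by blast
      then have v: "v N \<in> J_on S A k" using F(3)[OF N] by simp
      show ?thesis
      proof (cases "k = size M")
        case True
        then show ?thesis using P(3)[OF S A] v by simp
      next
        case False
        then show ?thesis using P(4)[OF S v k(1)] fs.subspace_0[OF subspace_form_weight_space] by simp
      qed
    qed
    then have "P u \<in> form_weight_space S A M"
      unfolding F(4) fsp.linear_sum[OF P(1)] by (rule fs.subspace_sum[OF subspace_form_weight_space])
    then show "u \<in> form_weight_space S A M" by (simp only: P(2)[OF u(2)])
  qed
qed

lemma admissible_slice:
  assumes S: "admissible S" and c: "c \<in> C" and e: "e \<in> S" "\<zeta> c e \<noteq> 0"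
  shows "admissible {y \<in> S. \<zeta> c y = 0}"
proof -
  obtain B where B: "finite B" "S = span B" using S by (auto simp: admissible_def)
  obtain B' where B': "finite B'" "card B' < card B" "span B' = {y \<in> span B. \<zeta> c y = 0}"
    by (rule span_hyperplane[OF B(1) zeta_forms[OF c] e(1)[unfolded B(2)] e(2)])
  then have "\<exists>B. finite B \<and> {y \<in> S. \<zeta> c y = 0} = span B" unfolding B(2) by metis
  then show ?thesis
    unfolding admissible_def using admissibleD(1,3)[OF S] zeta_eta[OF c] nprime_nonzero[of "w c", where 'k = 'k] by auto
qed

lemma pullback_zeta_times:
  assumes S: "admissible S" and c: "c \<in> C" and f: "zero_off S f = f"
  shows "pullback (\<zeta> c * f) = fscale (of_nat (nprime (w c))) (\<zeta> c * pullback f)"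
proof
  fix y
  show "pullback (\<zeta> c * f) y = fscale (of_nat (nprime (w c))) (\<zeta> c * pullback f) y"
  proof (cases "\<eta> y \<in> S")
    case True
    then show ?thesis using admissibleD(1,3)[OF S] zeta_eta[OF c, of y] by (auto simp: pullback_def fscale_apply)
  next
    case False
    then have "f (\<eta> y) = 0" using fun_cong[OF f, of "\<eta> y"] by (simp add: zero_off_def)
    then show ?thesis by (simp add: pullback_def fscale_apply)
  qed
qed

lemma zeta_times_form_weight_space:
  assumes S: "admissible S" and c: "c \<in> C" and v: "v \<in> form_weight_space S A M"
  shows "\<zeta> c * v \<in> form_weight_space S A (add_mset (w c) M)"
proof -
  have v': "v \<in> J_on S A (size M)" "pullback v = fscale (weight_scalar M) v"
    using v by (auto simp: form_weight_space_iff)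
  have "pullback (\<zeta> c * v) = fscale (weight_scalar (add_mset (w c) M)) (\<zeta> c * v)"
    unfolding pullback_zeta_times[OF S c J_on_zero_off[OF v'(1)]] v'(2) weight_scalar_add_mset
      fsp.linear_scale[OF flinear_times] fs.scale_scale ..
  then show ?thesis using J_on_form[OF zeta_forms[OF c] v'(1)] by (simp add: form_weight_space_iff)
qed

lemma zeta_divides_form_weight_space:
  assumes S: "admissible S" and A: "A \<subseteq> X" and c: "c \<in> C" and e: "e \<in> S" "\<zeta> c e \<noteq> 0"
    and v: "v \<in> J_on S A k" "v \<noteq> 0" "\<zeta> c * v \<in> form_weight_space S A M"
  obtains N where "M = add_mset (w c) N" "pullback v = fscale (weight_scalar N) v"
proof -
  let ?p = "of_nat (nprime (w c)) :: 'k"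
  let ?d = "fscale ?p (pullback v) - fscale (weight_scalar M) v"
  have "\<zeta> c * ?d = pullback (\<zeta> c * v) - fscale (weight_scalar M) (\<zeta> c * v)"
    unfolding pullback_zeta_times[OF S c J_on_zero_off[OF v(1)]] right_diff_distrib
      fsp.linear_scale[OF flinear_times] ..
  then have "\<zeta> c * ?d = 0" using v(3) by (simp only: form_weight_space_iff diff_self)
  moreover have "?d \<in> J_on S A k"
    by (intro fs.subspace_diff[OF subspace_J_on] fs.subspace_scale[OF subspace_J_on] pullback_J_on[OF S A] v(1))
  ultimately have "?d = 0" by (rule J_on_cancel[OF zeta_forms[OF c] admissibleD(2)[OF S] e, rotated])
  then have "fscale (inverse ?p) (fscale ?p (pullback v)) = fscale (inverse ?p) (fscale (weight_scalar M) v)" by simp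
  then have eigen: "pullback v = fscale (inverse ?p * weight_scalar M) v"
    by (simp only: fs.scale_scale left_inverse[OF nprime_nonzero] fs.scale_one)
  obtain N where N: "inverse ?p * weight_scalar M = weight_scalar N"
    by (rule eigenvalue_is_weight_scalar[OF S v(1) eigen v(2)])
  have "weight_scalar M = ?p * (inverse ?p * weight_scalar M)"
    by (simp only: mult.assoc[symmetric] right_inverse[OF nprime_nonzero] mult_1_left)
  then have "weight_scalar M = (weight_scalar (add_mset (w c) N) :: 'k)" by (simp only: N weight_scalar_add_mset)
  then show ?thesis using that eigen N by (simp add: weight_scalar_inj)
qed

lemma form_weight_space_kernel:
  assumes S: "admissible S" and A: "A \<subseteq> X" and c: "c \<in> C" and e: "e \<in> S" "\<zeta> c e \<noteq> 0" "\<And>x. x \<in> A \<Longrightarrow> e \<in> Z x"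
  shows "{u \<in> form_weight_space S A M. zero_off {y \<in> S. \<zeta> c y = 0} u = 0}
    = (if w c \<in># M then (*) (\<zeta> c) ` form_weight_space S A (M - {#w c#}) else {0})" (is "?K = ?R")
proof
  show "?R \<subseteq> ?K"
    using zeta_times_form_weight_space[OF S c, of _ A "M - {#w c#}"] fs.subspace_0[OF subspace_form_weight_space, of S A M]
    by (auto simp: zero_off_eq_0_iff)
  show "?K \<subseteq> ?R"
  proof
    fix u assume "u \<in> ?K"
    then have u: "u \<in> J_on S A (size M)" "u \<in> form_weight_space S A M" "zero_off {y \<in> S. \<zeta> c y = 0} u = 0"
      by (auto simp: form_weight_space_iff)
    have zero: "0 \<in> ?R"
      using fs.subspace_0[OF fsp.linear_subspace_image[OF flinear_times subspace_form_weight_space]] by simp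
    show "u \<in> ?R"
    proof (cases "size M")
      case 0
      obtain f where f: "f \<in> J A 0" "u = zero_off S f" using u(1) 0 by (auto simp: J_on_def)
      have "u 0 = 0"
        using u(3) subspace_0[OF admissibleD(2)[OF S]] dual_spaceD(3)[OF zeta_forms[OF c]]
        by (simp add: zero_off_eq_0_iff)
      then have "f 0 = 0" using subspace_0[OF admissibleD(2)[OF S]] by (simp add: f(2) zero_off_def)
      then have "u = 0" using J_degree_0[OF f(1)] by (simp add: f(2) zero_off_eq_0_iff)
      then show ?thesis using zero by simp
    next
      case (Suc k)
      obtain v where v: "v \<in> J_on S A k" "u = \<zeta> c * v"
        by (rule J_on_divide[OF admissibleD(2)[OF S] zeta_forms[OF c] e A u(1)[unfolded Suc] u(3)]) blast+
      show ?thesis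
      proof (cases "v = 0")
        case True
        then show ?thesis using zero by (simp add: v(2))
      next
        case False
        obtain N where N: "M = add_mset (w c) N" "pullback v = fscale (weight_scalar N) v"
          by (rule zeta_divides_form_weight_space[OF S A c e(1,2) v(1) False u(2)[unfolded v(2)]])
        then have "v \<in> form_weight_space S A N" using v(1) Suc by (simp add: form_weight_space_iff)
        then show ?thesis by (auto simp: N(1) v(2))
      qed
    qed
  qed
qed

lemma form_weight_dim_slice:
  assumes S: "admissible S" and A: "A \<subseteq> X" and c: "c \<in> C" and e: "e \<in> S" "\<zeta> c e \<noteq> 0" "\<And>x. x \<in> A \<Longrightarrow> e \<in> Z x"
  shows "form_weight_dim S A M = form_weight_dim {y \<in> S. \<zeta> c y = 0} A M
    + (if w c \<in># M then form_weight_dim S A (M - {#w c#}) else 0)"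
proof -
  let ?S = "{y \<in> S. \<zeta> c y = 0}"
  have "inj_on ((*) (\<zeta> c)) (form_weight_space S A N)" for N
  proof -
    have "v = 0" if "v \<in> form_weight_space S A N" "\<zeta> c * v = 0" for v
      using J_on_cancel[OF zeta_forms[OF c] admissibleD(2)[OF S] e(1,2)] that by (auto simp: form_weight_space_iff)
    then show ?thesis unfolding fsp.linear_inj_on_iff_eq_0[OF flinear_times subspace_form_weight_space] by blast
  qed
  then have "fs.dim ((*) (\<zeta> c) ` form_weight_space S A N) = form_weight_dim S A N" for N
    unfolding form_weight_dim_def by (rule fsp.dim_image_inj[OF flinear_times subspace_form_weight_space])
  then have kernel: "fs.dim {u \<in> form_weight_space S A M. zero_off ?S u = 0}
      = (if w c \<in># M then form_weight_dim S A (M - {#w c#}) else 0)"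
    by (simp only: form_weight_space_kernel[OF S A c e] if_distrib[of fs.dim] fs.dim_singleton_0)
  have "zero_off ?S ` form_weight_space S A M = form_weight_space ?S A M"
    by (rule restrict_form_weight_space[OF S admissible_slice[OF S c e(1,2)] _ A]) blast
  then show ?thesis
    using kernel fsp.rank_nullity[OF flinear_zero_off[of ?S] subspace_form_weight_space findim_form_weight_space[OF S], of A M]
    by (simp add: form_weight_dim_def)
qed

lemma form_weight_dim_origin:
  assumes "admissible {0}"
  shows "form_weight_dim {0} {} M = (if M = {#} then 1 else 0)"
proof (cases "M = {#}")
  case True
  let ?u = "zero_off {0} 1"
  have "product_form {} 0 f \<longleftrightarrow> f = 1" for f by (auto intro: product_form.one elim: product_form.cases)
  then have J: "J_on {0} {} 0 = fs.span {?u}"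
    by (simp only: J_on_def J_def fsp.linear_span_image[OF flinear_zero_off, symmetric] singleton_conv image_insert image_empty)
  have "pullback ?u = fscale 1 ?u" using pullback_zero_off[OF assms, of 1] by (simp add: pullback_def one_fun_def)
  then have "fs.eigenspace pullback (fs.span ((\<lambda>_. ?u) ` {()})) 1 = fs.span ((\<lambda>_. ?u) ` {j \<in> {()}. (1 :: 'k) = 1})"
    by (intro fs.eigenspace_span[OF flinear_pullback])
  then have "form_weight_space {0} {} {#} = fs.span {?u}" by (simp add: form_weight_space_def J)
  moreover have "?u \<noteq> 0" by (auto simp: zero_off_def fun_eq_iff)
  ultimately have "form_weight_dim {0} {} {#} = 1"
    using fs.dim_span_eq_card_independent[of "{?u}"] by (simp add: form_weight_dim_def)
  then show ?thesis using True by simp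
next
  case False
  then have "J_on {0} {} (size M) = {0}" using nonempty_has_size by (intro J_on_origin) blast
  then have "form_weight_space {0} {} M \<subseteq> {0}" by (metis form_weight_space_def fs.eigenspace_subset)
  moreover have "0 \<in> form_weight_space {0} {} M" by (rule fs.subspace_0[OF subspace_form_weight_space])
  ultimately have "form_weight_space {0} {} M = {0}" by blast
  then show ?thesis using False by (simp add: form_weight_dim_def)
qed

definition parity_sets :: "bool \<Rightarrow> 'x set set" where
  "parity_sets p = {A \<in> Pow X. even (card A) = p}"

lemma parity_sets_insert: "A \<in> parity_sets p \<Longrightarrow> x \<in> X - A \<Longrightarrow> insert x A \<in> parity_sets (\<not> p)"
  using finite_X finite_subset[of A X] by (auto simp: parity_sets_def)

definition total_boundary :: "('x set \<times> 'a \<Rightarrow> 'k) \<Rightarrow> 'x set \<times> 'a \<Rightarrow> 'k" where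
  "total_boundary c = (\<lambda>(A, y). if A \<subseteq> X then boundary (\<lambda>A. slice A c) A y else 0)"

lemma slice_total_boundary: "slice A (total_boundary c) = (if A \<subseteq> X then boundary (\<lambda>A. slice A c) A else 0)"
  by (auto simp: slice_def total_boundary_def)

lemma koszul_sign_times_fscale: "(koszul_sign x A :: 'b \<Rightarrow> 'k) * f = fscale (koszul_sign x A) f"
  by (cases "even (card {y \<in> A. position y < position x})") (simp_all add: koszul_sign_def fs_simps)

lemma flinear_apply_boundary:
  "flinear F \<Longrightarrow> F (boundary c A) = boundary (\<lambda>A. F (c A)) A" for F :: "('b \<Rightarrow> 'k) \<Rightarrow> 'b \<Rightarrow> 'k"
  by (simp only: boundary_def fsp.linear_sum koszul_sign_times_fscale fsp.linear_scale)

lemma flinear_total_boundary: "flinear total_boundary"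
proof (rule flinearI; rule slice_ext)
  fix c d :: "'x set \<times> 'a \<Rightarrow> 'k" and r A
  show "slice A (total_boundary (c + d)) = slice A (total_boundary c + total_boundary d)"
    by (simp add: slice_total_boundary fsp.linear_add[OF flinear_slice] boundary_add)
  show "slice A (total_boundary (fscale r c)) = slice A (fscale r (total_boundary c))"
    by (simp add: slice_total_boundary fsp.linear_scale[OF flinear_slice]
        flinear_apply_boundary[OF flinear_scale[OF flinear_id]])
qed

lemma total_boundary_square: "total_boundary (total_boundary c) = 0"
proof (rule slice_ext)
  fix A
  have "boundary (\<lambda>A. slice A (total_boundary c)) A = boundary (boundary (\<lambda>A. slice A c)) A" if "A \<subseteq> X"
    by (rule boundary_cong) (use that in \<open>simp add: slice_total_boundary\<close>)
  then show "slice A (total_boundary (total_boundary c)) = slice A 0"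
    using boundary_boundary[of A "\<lambda>A. slice A c"] by (simp add: slice_total_boundary fsp.linear_0[OF flinear_slice])
qed

definition parity_chains :: "'a set \<Rightarrow> nat multiset \<Rightarrow> bool \<Rightarrow> ('x set \<times> 'a \<Rightarrow> 'k) set" where
  "parity_chains S M p = fprod (parity_sets p) (\<lambda>A. form_weight_space S A M)"

lemma total_boundary_parity_chains:
  assumes c: "c \<in> parity_chains S M (\<not> p)"
  shows "total_boundary c \<in> parity_chains S M p"
  unfolding parity_chains_def fprod_def
proof (intro CollectI conjI ballI allI impI)
  fix A assume A: "A \<in> parity_sets p"
  have "slice (insert x A) c \<in> form_weight_space S A M" if x: "x \<in> X - A" for x
  proof -
    have "slice (insert x A) c \<in> form_weight_space S (insert x A) M"
      using c parity_sets_insert[OF A x] by (auto simp: parity_chains_def fprod_def)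
    then show ?thesis using x J_on_remove[of S "insert x A" "size M" x] by (auto simp: form_weight_space_iff)
  qed
  then have "boundary (\<lambda>A. slice A c) A \<in> form_weight_space S A M"
    unfolding boundary_def koszul_sign_times_fscale
    by (intro fs.subspace_sum[OF subspace_form_weight_space] fs.subspace_scale[OF subspace_form_weight_space])
  then show "slice A (total_boundary c) \<in> form_weight_space S A M"
    using A by (simp add: slice_total_boundary parity_sets_def)
next
  fix A assume A: "A \<notin> parity_sets p"
  have "slice (insert x A) c = 0" if "A \<subseteq> X" "x \<in> X - A" for x
  proof -
    have "insert x A \<in> parity_sets (\<not> \<not> p)" using A that by (intro parity_sets_insert) (simp_all add: parity_sets_def)
    then show ?thesis using c by (simp add: parity_chains_def fprod_def parity_sets_def)
  qed
  then show "slice A (total_boundary c) = 0" by (simp add: slice_total_boundary boundary_def)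
qed

lemma total_boundary_exact:
  assumes S: "admissible S" "S \<inter> (\<Inter>x\<in>X. Z x) \<subseteq> {0}" and X: "X \<noteq> {}" "card X \<le> size M"
    and t: "t \<in> parity_chains S M p" "total_boundary t = 0"
  shows "t \<in> total_boundary ` parity_chains S M (\<not> p)"
proof -
  obtain B where B: "finite B" "S = span B" using S by (auto simp: admissible_def)
  obtain P where P: "flinear P" "\<And>u. pullback u = fscale (weight_scalar M) u \<Longrightarrow> P u = u"
    "\<And>S A u. admissible S \<Longrightarrow> A \<subseteq> X \<Longrightarrow> u \<in> J_on S A (size M) \<Longrightarrow> P u \<in> form_weight_space S A M"
    by (rule weight_projection[OF finite.emptyI, of M]) blast
  have slice_t: "slice A t \<in> form_weight_space S A M" for A
    using t(1) fs.subspace_0[OF subspace_form_weight_space]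
    by (cases "A \<in> parity_sets p") (auto simp: parity_chains_def fprod_def)
  have "(\<lambda>A. slice A t) \<in> chains (span B) (size M)"
    unfolding chains_def using slice_t by (auto simp: form_weight_space_iff B(2))
  moreover have "boundary (\<lambda>A. slice A t) A = 0" if "A \<subseteq> X" for A
    using arg_cong[OF t(2), of "slice A"] that by (simp add: slice_total_boundary fsp.linear_0[OF flinear_slice])
  ultimately obtain d where d: "d \<in> chains (span B) (size M)" "\<And>A. A \<subseteq> X \<Longrightarrow> slice A t = boundary d A"
    using exactness[OF X B(1)] S(2) unfolding B(2) exact_on_def by blast
  define v where "v = (\<lambda>(A, y). if A \<in> parity_sets (\<not> p) then P (d A) y else 0)"
  have slice_v: "slice A v = (if A \<in> parity_sets (\<not> p) then P (d A) else 0)" for A by (auto simp: slice_def v_def)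
  have v: "v \<in> parity_chains S M (\<not> p)"
    unfolding parity_chains_def fprod_def
    using P(3)[OF S(1)] chainsD[OF d(1)] by (auto simp: slice_v B(2) parity_sets_def)
  have "total_boundary v = t"
  proof (rule slice_ext)
    fix A
    show "slice A (total_boundary v) = slice A t"
    proof (cases "A \<in> parity_sets p")
      case True
      then have A: "A \<subseteq> X" by (simp add: parity_sets_def)
      have "slice A t = P (boundary d A)" using P(2) slice_t[of A] d(2)[OF A] by (simp add: form_weight_space_iff)
      also have "\<dots> = boundary (\<lambda>A. P (d A)) A" by (rule flinear_apply_boundary[OF P(1)])
      also have "\<dots> = boundary (\<lambda>A. slice A v) A"
        using parity_sets_insert[OF True] by (intro boundary_cong) (simp add: slice_v)
      finally show ?thesis using A by (simp add: slice_total_boundary)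
    next
      case False
      then show ?thesis using total_boundary_parity_chains[OF v] t(1) by (simp add: parity_chains_def fprod_def)
    qed
  qed
  then show ?thesis using v by blast
qed

lemma alternating_sum_form_weight_dim:
  assumes S: "admissible S" "S \<inter> (\<Inter>x\<in>X. Z x) \<subseteq> {0}" and X: "X \<noteq> {}" "card X \<le> size M"
  shows "(\<Sum>A\<in>Pow X. (-1) ^ card A * int (form_weight_dim S A M)) = 0"
proof -
  have fin: "finite (parity_sets p)" for p using finite_X by (simp add: parity_sets_def)
  have "total_boundary ` parity_chains S M (\<not> p) = {t \<in> parity_chains S M p. total_boundary t = 0}" for p
    using total_boundary_parity_chains total_boundary_square total_boundary_exact[OF S X] by blast
  from this[of True] this[of False] have "fs.dim (parity_chains S M True) = fs.dim (parity_chains S M False)"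
    unfolding parity_chains_def
    by (intro fsp.dim_eq_of_exact_pair[OF flinear_total_boundary flinear_total_boundary])
      (auto intro!: subspace_fprod findim_fprod subspace_form_weight_space findim_form_weight_space S fin)
  then have eq: "(\<Sum>A\<in>parity_sets True. form_weight_dim S A M) = (\<Sum>A\<in>parity_sets False. form_weight_dim S A M)"
    by (simp add: parity_chains_def dim_fprod[OF fin subspace_form_weight_space findim_form_weight_space[OF S(1)]]
        form_weight_dim_def)
  have "Pow X = parity_sets True \<union> parity_sets False" "parity_sets True \<inter> parity_sets False = {}"
    by (auto simp: parity_sets_def)
  then have "(\<Sum>A\<in>Pow X. (-1) ^ card A * int (form_weight_dim S A M))
      = (\<Sum>A\<in>parity_sets True. (-1) ^ card A * int (form_weight_dim S A M))
        + (\<Sum>A\<in>parity_sets False. (-1) ^ card A * int (form_weight_dim S A M))"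
    using fin by (simp add: sum.union_disjoint)
  also have "\<dots> = int (\<Sum>A\<in>parity_sets True. form_weight_dim S A M) - int (\<Sum>A\<in>parity_sets False. form_weight_dim S A M)"
    by (simp add: parity_sets_def sum_negf)
  finally show ?thesis using eq by simp
qed

end

section \<open>Power series in finitely many variables\<close>

lemma xcoeff_Abs_xps [simp]: "xcoeff (Abs_xps f) M = f M"
  by (simp add: Abs_xps_inverse)

lemma xcoeff_sum: "xcoeff (\<Sum>i\<in>F. f i) M = (\<Sum>i\<in>F. xcoeff (f i) M)"
  by (induction F rule: infinite_finite_induct) (auto simp: zero_xps.rep_eq plus_xps.rep_eq)

lemma xcoeff_sign: "xcoeff ((-1) ^ k * f) M = (-1) ^ k * xcoeff f M"
  by (induction k) (auto simp: uminus_xps.rep_eq)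

definition restrict_vars :: "nat \<Rightarrow> xps \<Rightarrow> xps" where
  "restrict_vars m f = Abs_xps (\<lambda>M. if set_mset M \<subseteq> {..<m} then xcoeff f M else 0)"

lemma xcoeff_restrict_vars [simp]:
  "xcoeff (restrict_vars m f) M = (if set_mset M \<subseteq> {..<m} then xcoeff f M else 0)"
  by (simp add: restrict_vars_def)

lemma restrict_vars_one: "restrict_vars m 1 = 1"
  by (auto intro!: xps_eqI simp: one_xps.rep_eq)

lemma restrict_vars_minus: "restrict_vars m (- f) = - restrict_vars m f"
  by (auto intro!: xps_eqI simp: uminus_xps.rep_eq)

lemma restrict_vars_sum: "restrict_vars m (\<Sum>i\<in>F. f i) = (\<Sum>i\<in>F. restrict_vars m (f i))"
  by (rule xps_eqI) (simp add: xcoeff_sum)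

lemma restrict_vars_mult: "restrict_vars m (f * g) = restrict_vars m f * restrict_vars m g"
proof (rule xps_eqI)
  fix M
  show "xcoeff (restrict_vars m (f * g)) M = xcoeff (restrict_vars m f * restrict_vars m g) M"
  proof (cases "set_mset M \<subseteq> {..<m}")
    case True
    then show ?thesis
      unfolding times_xps.rep_eq xcoeff_restrict_vars by (auto simp: times_xps.rep_eq intro!: sum.cong)
  next
    case False
    have "(\<Sum>(A, B)\<in>{(A, B). A + B = M}. xcoeff (restrict_vars m f) A * xcoeff (restrict_vars m g) B) = 0"
      using False by (intro sum.neutral) auto
    then show ?thesis using False by (simp add: times_xps.rep_eq)
  qed
qed

lemma restrict_vars_power: "restrict_vars m (f ^ k) = restrict_vars m f ^ k"
  by (induction k) (simp_all add: restrict_vars_one restrict_vars_mult)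

lemmas restrict_vars_simps = restrict_vars_one restrict_vars_minus restrict_vars_mult restrict_vars_power

lemma restrict_vars_trunc: "restrict_vars m (trunc k f) = trunc k (restrict_vars m f)"
  by (rule xps_eqI) (simp add: trunc_def)

definition variable :: "nat \<Rightarrow> xps" where
  "variable j = Abs_xps (\<lambda>M. if M = {#j#} then 1 else 0)"

lemma xcoeff_variable_times: "xcoeff (variable j * f) M = (if j \<in># M then xcoeff f (M - {#j#}) else 0)"
proof -
  let ?splits = "if j \<in># M then {({#j#}, M - {#j#})} else {}"
  have "xcoeff (variable j * f) M = (\<Sum>(A, B)\<in>?splits. xcoeff (variable j) A * xcoeff f B)"
    unfolding times_xps.rep_eq
  proof (rule sum.mono_neutral_right[OF finite_mset_splits])
    show "?splits \<subseteq> {(A, B). A + B = M}" by auto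
    show "\<forall>i\<in>{(A, B). A + B = M} - ?splits. (case i of (A, B) \<Rightarrow> xcoeff (variable j) A * xcoeff f B) = 0"
      by (auto simp: variable_def split: if_splits)
  qed
  then show ?thesis by (simp add: variable_def)
qed

lemma xcoeff_one_minus_variable_times:
  "xcoeff ((1 - variable j) * f) M = xcoeff f M - (if j \<in># M then xcoeff f (M - {#j#}) else 0)"
  by (simp only: left_diff_distrib mult_1_left minus_xps.rep_eq xcoeff_variable_times)

lemma xcoeff_sigma_prod_one_minus_variable:
  "xcoeff (sigma * (\<Prod>j<l. 1 - variable j)) M = (if set_mset M \<inter> {..<l} = {} then 1 else 0)"
proof (induction l arbitrary: M)
  case 0
  then show ?case by (simp add: xcoeff_sigma)
next
  case (Suc l)
  have "sigma * (\<Prod>j<Suc l. 1 - variable j) = (1 - variable l) * (sigma * (\<Prod>j<l. 1 - variable j))"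
    by (simp add: mult_ac)
  moreover have "set_mset (M - {#l#}) \<inter> {..<l} = set_mset M \<inter> {..<l}"
    by (auto simp: in_diff_count split: if_splits)
  moreover have "set_mset M \<inter> {..<Suc l} = {} \<longleftrightarrow> set_mset M \<inter> {..<l} = {} \<and> l \<notin># M"
    by (auto simp: less_Suc_eq)
  ultimately show ?case by (simp add: xcoeff_one_minus_variable_times Suc.IH del: prod.lessThan_Suc)
qed

lemma restrict_sigma_inverse: "restrict_vars m sigma * restrict_vars m sigma_inv = 1"
  by (simp flip: restrict_vars_mult add: sigma_sigma_inv restrict_vars_one)

lemma restrict_prod_one_minus_variable: "restrict_vars m (\<Prod>j<m. 1 - variable j) = restrict_vars m sigma_inv"
proof -
  let ?p = "restrict_vars m (\<Prod>j<m. 1 - variable j)"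
  have "restrict_vars m sigma * ?p = 1"
    unfolding restrict_vars_mult[symmetric]
    by (rule xps_eqI) (auto simp: xcoeff_sigma_prod_one_minus_variable one_xps.rep_eq Int_absorb2)
  then have "restrict_vars m sigma_inv = restrict_vars m sigma_inv * (restrict_vars m sigma * ?p)" by simp
  also have "\<dots> = (restrict_vars m sigma * restrict_vars m sigma_inv) * ?p" by (simp only: mult_ac)
  finally show ?thesis by (simp add: restrict_sigma_inverse)
qed

lemma sigma_inv_power_times_sigma_power:
  assumes "i \<le> j"
  shows "restrict_vars m sigma_inv ^ j * restrict_vars m sigma ^ i = restrict_vars m sigma_inv ^ (j - i)"
proof -
  have "restrict_vars m sigma_inv ^ j = restrict_vars m sigma_inv ^ (j - i) * restrict_vars m sigma_inv ^ i"
    using assms by (simp flip: power_add)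
  then have "restrict_vars m sigma_inv ^ j * restrict_vars m sigma ^ i
      = restrict_vars m sigma_inv ^ (j - i) * (restrict_vars m sigma * restrict_vars m sigma_inv) ^ i"
    by (simp add: power_mult_distrib mult_ac)
  then show ?thesis by (simp add: restrict_sigma_inverse)
qed

lemma sigma_Sym_bar: "sigma \<in> Sym_bar"
  by (simp add: Sym_bar_def xcoeff_sigma)

lemma sigma_inv_Sym_bar: "sigma_inv \<in> Sym_bar"
proof -
  let ?e = "Abs_xps (\<lambda>M. if \<forall>x. count M x \<le> 1 then (-1) ^ size M else 0)"
  have "sigma_inv = sigma_inv * (sigma * ?e)" by (simp only: sigma_times_alternating_elementary mult_1_right)
  also have "\<dots> = (sigma * sigma_inv) * ?e" by (simp only: mult_ac)
  finally have sigma_inv_eq: "sigma_inv = ?e" by (simp only: sigma_sigma_inv mult_1_left)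
  have "(\<forall>x. count (image_mset \<pi> M) x \<le> 1) \<longleftrightarrow> (\<forall>x. count M x \<le> 1)" if \<pi>: "bij \<pi>" for \<pi> and M :: "nat multiset"
  proof -
    have "count (image_mset \<pi> M) (\<pi> x) = count M x" for x
    proof -
      have "\<pi> -` {\<pi> x} = {x}" using bij_is_inj[OF \<pi>] by (auto simp: inj_eq)
      then show ?thesis unfolding count_image_mset by (cases "x \<in># M") (auto simp: count_eq_zero_iff)
    qed
    then show ?thesis by (metis surjD[OF bij_is_surj[OF \<pi>]])
  qed
  then show ?thesis unfolding sigma_inv_eq Sym_bar_def by auto
qed

lemma polyP_Sym_bar: "sigma ^ k * polyP X rk \<in> Sym_bar"
  using polyP_in_Sym[of X rk] by (auto simp: Sym_def intro!: Sym_bar_mult Sym_bar_power sigma_Sym_bar)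

lemma polyH_Sym_bar: "sigma ^ k * polyH X rk sigma_inv (-1) \<in> Sym_bar"
proof -
  have "polyP A rk \<in> Sym_bar" for A using polyP_in_Sym[of A rk] by (simp add: Sym_def)
  then show ?thesis
    unfolding polyH_def
    by (intro Sym_bar_mult Sym_bar_power Sym_bar_sum sigma_Sym_bar sigma_inv_Sym_bar Sym_bar_minus Sym_bar_one)
qed

text \<open>The conditions under which \<open>c\<close> is the restriction of \<open>\<sigma>\<^sup>n \<H>(\<sigma>\<inverse>, -1)\<close>: they determine the alternating sums
  of \<open>c\<close> by the recursion for \<open>\<P>\<close>, and Moebius inversion recovers \<open>c\<close>.\<close>

locale truncated_recursion =
  fixes X :: "'x set" and rk :: "'x set \<Rightarrow> nat" and n m :: nat and c :: "'x set \<Rightarrow> xps"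
  assumes polymatroid: "polymatroid X rk" and rk_le: "B \<subseteq> X \<Longrightarrow> rk B \<le> n"
    and empty: "restrict_vars m sigma_inv ^ n * c {} = 1"
    and low: "B \<subseteq> X \<Longrightarrow> size M < card B \<Longrightarrow> xcoeff (restrict_vars m sigma_inv ^ (n - rk B) * c B) M = 0"
    and high: "B \<subseteq> X \<Longrightarrow> B \<noteq> {} \<Longrightarrow> card B \<le> size M \<Longrightarrow>
      xcoeff (restrict_vars m sigma_inv ^ (n - rk B) * (\<Sum>A\<in>Pow B. (-1) ^ card A * c A)) M = 0"
begin

definition alternating :: "'x set \<Rightarrow> xps" where
  "alternating B = (\<Sum>A\<in>Pow B. (-1) ^ card A * c A)"

lemma finite_subsets: "B \<subseteq> X \<Longrightarrow> finite B"
  using polymatroid finite_subset by (auto simp: polymatroid_def)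

lemma restrict_summand:
  assumes A: "A \<subseteq> B" "B \<subseteq> X"
    and P: "restrict_vars m (polyP A rk) = restrict_vars m sigma_inv ^ (n - rk A) * alternating A"
  shows "restrict_vars m (polyP A rk * sigma ^ (rk B - rk A) * (-1) ^ (card B - card A))
    = (-1) ^ card B * (restrict_vars m sigma_inv ^ (n - rk B) * ((-1) ^ card A * alternating A))"
proof -
  have "rk A \<le> rk B" "rk B \<le> n" using polymatroid A rk_le by (auto simp: polymatroid_def)
  then have "restrict_vars m sigma_inv ^ (n - rk A) * restrict_vars m sigma ^ (rk B - rk A)
      = restrict_vars m sigma_inv ^ (n - rk B)"
    using sigma_inv_power_times_sigma_power[of "rk B - rk A" "n - rk A"] by simp
  moreover have "(-1) ^ (card B - card A) = ((-1) ^ card B * (-1) ^ card A :: xps)"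
    using card_mono[OF finite_subsets[OF A(2)] A(1)]
    by (auto simp: minus_one_power_iff even_diff_nat simp flip: power_add)
  ultimately show ?thesis
    by (simp add: P restrict_vars_simps mult_ac)
qed

lemma moebius_proper:
  assumes "finite B"
  shows "(\<Sum>A | A \<subset> B. (-1) ^ card A * alternating A) = c B - (-1) ^ card B * alternating B"
proof -
  have "Pow B = insert B {A. A \<subset> B}" by auto
  moreover have "finite {A. A \<subset> B}" using assms by (intro finite_subset[of "{A. A \<subset> B}" "Pow B"]) auto
  ultimately have "c B = (-1) ^ card B * alternating B + (\<Sum>A | A \<subset> B. (-1) ^ card A * alternating A)"
    using moebius_Pow[OF assms, of c] unfolding alternating_def[symmetric] by simp
  then show ?thesis by simp
qed

lemma restrict_polyP: "B \<subseteq> X \<Longrightarrow> restrict_vars m (polyP B rk) = restrict_vars m sigma_inv ^ (n - rk B) * alternating B"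
proof (induction "card B" arbitrary: B rule: less_induct)
  case less
  have finB: "finite B" by (rule finite_subsets[OF less.prems])
  show ?case
  proof (cases "B = {}")
    case True
    then show ?thesis
      using empty polymatroid by (simp add: polyP.simps[of "{}"] restrict_vars_one alternating_def polymatroid_def)
  next
    case False
    let ?\<tau> = "restrict_vars m sigma_inv ^ (n - rk B)"
    let ?f = "- (\<Sum>A | A \<subset> B. polyP A rk * sigma ^ (rk B - rk A) * (-1) ^ (card B - card A))"
    have sign_square: "(-1) ^ card B * ((-1) ^ card B * f) = f" for f :: xps
      by (simp flip: mult.assoc power_mult_distrib)
    have "restrict_vars m ?f = - (\<Sum>A | A \<subset> B. (-1) ^ card B * (?\<tau> * ((-1) ^ card A * alternating A)))"
      unfolding restrict_vars_minus restrict_vars_sum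
      using less
      by (intro arg_cong[where f = uminus] sum.cong restrict_summand) (auto simp: psubset_card_mono[OF finB])
    also have "\<dots> = - ((-1) ^ card B * (?\<tau> * (c B - (-1) ^ card B * alternating B)))"
      unfolding sum_distrib_left[symmetric] moebius_proper[OF finB] ..
    also have "\<dots> = ?\<tau> * alternating B - (-1) ^ card B * (?\<tau> * c B)"
      by (simp add: right_diff_distrib mult.left_commute[of ?\<tau>] sign_square)
    finally have "trunc (card B) (restrict_vars m ?f) = trunc (card B) (?\<tau> * alternating B - (-1) ^ card B * (?\<tau> * c B))"
      by (rule arg_cong)
    also have "\<dots> = ?\<tau> * alternating B"
    proof (rule xps_eqI)
      fix M
      show "xcoeff (trunc (card B) (?\<tau> * alternating B - (-1) ^ card B * (?\<tau> * c B))) M = xcoeff (?\<tau> * alternating B) M"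
        using low[OF less.prems, of M] high[OF less.prems False, of M]
        by (auto simp: trunc_def minus_xps.rep_eq xcoeff_sign alternating_def)
    qed
    finally show ?thesis using False finB by (simp add: polyP.simps[of B] restrict_vars_trunc)
  qed
qed

lemma restrict_sigma_polyP: "restrict_vars m (sigma ^ (n - rk X) * polyP X rk) = alternating X"
proof -
  have "restrict_vars m (sigma ^ (n - rk X) * polyP X rk)
      = restrict_vars m sigma_inv ^ (n - rk X) * restrict_vars m sigma ^ (n - rk X) * alternating X"
    using restrict_polyP[OF subset_refl] by (simp add: restrict_vars_simps mult_ac)
  then show ?thesis using sigma_inv_power_times_sigma_power[of "n - rk X" "n - rk X"] by simp
qed

lemma restrict_sigma_polyH: "restrict_vars m (sigma ^ n * polyH X rk sigma_inv (-1)) = c X"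
proof -
  let ?\<tau> = "restrict_vars m sigma_inv"
  have "restrict_vars m (sigma ^ n * (polyP A rk * sigma_inv ^ rk A * (-1) ^ card A)) = (-1) ^ card A * alternating A"
    if A: "A \<in> Pow X" for A
  proof -
    have "?\<tau> ^ (n - rk A) * ?\<tau> ^ rk A = ?\<tau> ^ n" using rk_le[of A] A by (simp flip: power_add)
    moreover have "?\<tau> ^ n * restrict_vars m sigma ^ n = 1" using sigma_inv_power_times_sigma_power[of n n] by simp
    moreover have "restrict_vars m (sigma ^ n * (polyP A rk * sigma_inv ^ rk A * (-1) ^ card A))
        = (?\<tau> ^ (n - rk A) * ?\<tau> ^ rk A) * restrict_vars m sigma ^ n * ((-1) ^ card A * alternating A)"
      using restrict_polyP[of A] A
      by (simp add: restrict_vars_simps mult_ac)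
    ultimately show ?thesis by simp
  qed
  then have "restrict_vars m (sigma ^ n * polyH X rk sigma_inv (-1)) = (\<Sum>A\<in>Pow X. (-1) ^ card A * alternating A)"
    unfolding polyH_def sum_distrib_left restrict_vars_sum by (intro sum.cong) auto
  then show ?thesis using moebius_Pow[OF finite_subsets[OF subset_refl], of c] by (simp add: alternating_def)
qed

end

section \<open>Ideals of subspace arrangements\<close>

locale arrangement = enumerated_basis sW BW b m + vs: finite_dimensional_vector_space sV BV
  for sW :: "'k::field_char_0 \<Rightarrow> 'w::ab_group_add \<Rightarrow> 'w" and BW b m
    and sV :: "'k \<Rightarrow> 'v::ab_group_add \<Rightarrow> 'v" and BV +
  fixes X :: "'x set" and V :: "'x \<Rightarrow> 'v set"
  assumes finite_X: "finite X" and subspace_V: "x \<in> X \<Longrightarrow> vs.subspace (V x)"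
begin

sublocale hom: vector_space_pair sW sV ..

abbreviation sY :: "'k \<Rightarrow> ('w \<Rightarrow> 'v) \<Rightarrow> 'w \<Rightarrow> 'v" where "sY \<equiv> \<lambda>c \<phi> w. sV c (\<phi> w)"
abbreviation "tdual \<equiv> tensor_dual sV sW"
abbreviation "Y \<equiv> tdual UNIV"
abbreviation "linear_map \<equiv> Vector_Spaces.linear sW sV"

sublocale ys: vector_space sY
  by unfold_locales (auto simp: fun_eq_iff vs.scale_right_distrib vs.scale_left_distrib)

lemma linear_map_iff:
  "linear_map \<phi> \<longleftrightarrow> (\<forall>u v. \<phi> (u + v) = \<phi> u + \<phi> v) \<and> (\<forall>c u. \<phi> (sW c u) = sV c (\<phi> u))"
  by (simp add: Vector_Spaces.linear_iff vector_space_axioms vs.vector_space_axioms)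

lemma linear_map_basis_expand:
  assumes "linear_map \<phi>"
  shows "\<phi> = (\<Sum>j<m. (\<lambda>w. sV (coord j w) (\<phi> (b j))))"
proof
  fix w
  have "\<phi> w = \<phi> (\<Sum>j<m. sW (coord j w) (b j))" by (rule arg_cong[OF coord_expand])
  also have "\<dots> = (\<Sum>j<m. sV (coord j w) (\<phi> (b j)))"
    by (simp add: hom.linear_sum[OF assms] hom.linear_scale[OF assms])
  finally show "\<phi> w = (\<Sum>j<m. (\<lambda>w. sV (coord j w) (\<phi> (b j)))) w" by (simp add: sum_fun_apply)
qed

lemma tensor_dual_iff:
  assumes S: "vs.subspace S"
  shows "\<phi> \<in> tdual S \<longleftrightarrow> linear_map \<phi> \<and> (\<forall>w. \<phi> w \<in> S)"
proof
  let ?G = "{(\<lambda>w. sV (\<eta> w) v) | v \<eta>. v \<in> S \<and> \<eta> \<in> dual}"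
  have "ys.subspace {\<phi>. linear_map \<phi> \<and> (\<forall>w. \<phi> w \<in> S)}"
    unfolding ys.subspace_def linear_map_iff
    using vs.subspace_0[OF S] vs.subspace_add[OF S] vs.subspace_scale[OF S]
    by (auto simp: vs.scale_right_distrib vs.scale_left_commute)
  moreover have "?G \<subseteq> {\<phi>. linear_map \<phi> \<and> (\<forall>w. \<phi> w \<in> S)}"
    using vs.subspace_scale[OF S] by (auto simp: linear_map_iff dual_spaceD vs.scale_left_distrib)
  ultimately have "tdual S \<subseteq> {\<phi>. linear_map \<phi> \<and> (\<forall>w. \<phi> w \<in> S)}"
    unfolding tensor_dual_def by (intro ys.span_minimal)
  then show "\<phi> \<in> tdual S \<Longrightarrow> linear_map \<phi> \<and> (\<forall>w. \<phi> w \<in> S)" by blast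
  assume \<phi>: "linear_map \<phi> \<and> (\<forall>w. \<phi> w \<in> S)"
  have "(\<lambda>w. sV (coord j w) (\<phi> (b j))) \<in> ?G" for j using \<phi> coord_dual by blast
  then have "(\<Sum>j<m. (\<lambda>w. sV (coord j w) (\<phi> (b j)))) \<in> tdual S"
    unfolding tensor_dual_def by (intro ys.span_sum ys.span_base)
  then show "\<phi> \<in> tdual S" using linear_map_basis_expand[of \<phi>] \<phi> by metis
qed

lemma Y_iff: "\<phi> \<in> Y \<longleftrightarrow> linear_map \<phi>"
  using tensor_dual_iff[OF vs.subspace_UNIV] by simp

lemma tensor_dual_V_iff: "x \<in> X \<Longrightarrow> \<phi> \<in> tdual (V x) \<longleftrightarrow> linear_map \<phi> \<and> (\<forall>w. \<phi> w \<in> V x)"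
  by (rule tensor_dual_iff[OF subspace_V])

lemma linear_map_comp_GL_iff:
  assumes g: "g \<in> GL sW"
  shows "linear_map (\<phi> \<circ> g) \<longleftrightarrow> linear_map \<phi>"
proof
  show "linear_map \<phi> \<Longrightarrow> linear_map (\<phi> \<circ> g)" by (rule Vector_Spaces.linear_compose[OF GL_lin[OF g]])
  assume "linear_map (\<phi> \<circ> g)"
  then have "linear_map (\<phi> \<circ> g \<circ> inv g)" by (rule Vector_Spaces.linear_compose[OF GL_lin[OF GL_inv(1)[OF g]]])
  then show "linear_map \<phi>" by (simp only: comp_assoc GL_inv(2)[OF g] comp_id)
qed

definition rescale :: "('w \<Rightarrow> 'v) \<Rightarrow> 'w \<Rightarrow> 'v" where
  "rescale \<phi> = \<phi> \<circ> prime_diag"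

definition function_act :: "('w \<Rightarrow> 'w) \<Rightarrow> (('w \<Rightarrow> 'v) \<Rightarrow> 'k) \<Rightarrow> ('w \<Rightarrow> 'v) \<Rightarrow> 'k" where
  "function_act g f = (\<lambda>\<phi>. f (\<phi> \<circ> g))"

lemma flinear_function_act: "flinear (function_act g)"
  by (rule flinearI) (auto simp: function_act_def fs_simps)

abbreviation "ideal \<equiv> prod_ideal sV sW V"

lemma J_module_fmod: "J_module sV sW V A = fmod function_act (ideal A)"
  by (simp add: J_module_def fmod_def function_act_def[abs_def])

definition ideal_series :: "'x set \<Rightarrow> xps" where
  "ideal_series A = Abs_xps (\<lambda>M. if set_mset M \<subseteq> {..<m} then int (weight_dim function_act (ideal A) M) else 0)"

lemma poly_fun_outside: "f \<in> poly_fun sV sW \<Longrightarrow> \<phi> \<notin> Y \<Longrightarrow> f \<phi> = 0"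
  by (induction rule: poly_fun.induct) auto

lemma poly_fun_scale:
  assumes "f \<in> poly_fun sV sW"
  shows "fscale c f \<in> poly_fun sV sW"
proof -
  have "fscale c f = (\<lambda>\<phi>. if \<phi> \<in> Y then c else 0) * f" using poly_fun_outside[OF assms] by (auto simp: fscale_def)
  then show ?thesis using poly_fun.mult[OF poly_fun.const assms] by simp
qed

lemma poly_fun_sum:
  assumes "\<And>i. i \<in> F \<Longrightarrow> f i \<in> poly_fun sV sW"
  shows "(\<Sum>i\<in>F. f i) \<in> poly_fun sV sW"
proof -
  have "0 \<in> poly_fun sV sW" using poly_fun.const[where c = 0 and sV = sV and sW = sW] by (simp add: zero_fun_def)
  then show ?thesis using assms by (induction F rule: infinite_finite_induct) (auto intro: poly_fun.add)
qed

lemma subspace_ideal: "fs.subspace (ideal A)"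
  by (simp add: prod_ideal_def)

lemma ideal_generator:
  "q \<in> poly_fun sV sW \<Longrightarrow> (\<And>x. x \<in> A \<Longrightarrow> f x \<in> vanishing_ideal sV sW (V x)) \<Longrightarrow> q * (\<Prod>x\<in>A. f x) \<in> ideal A"
  unfolding prod_ideal_def by (rule fs.span_base) blast

lemma ideal_image_subset:
  assumes h: "flinear h" and T: "fs.subspace T" and u: "u \<in> ideal A"
    and gen: "\<And>q f. q \<in> poly_fun sV sW \<Longrightarrow> (\<And>x. x \<in> A \<Longrightarrow> f x \<in> vanishing_ideal sV sW (V x)) \<Longrightarrow> h (q * (\<Prod>x\<in>A. f x)) \<in> T"
  shows "h u \<in> T"
proof -
  have "ideal A \<subseteq> h -` T"
    unfolding prod_ideal_def
    by (rule fs.span_minimal[OF _ fsp.linear_subspace_vimage[OF h T]]) (use gen in blast)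
  then show ?thesis using u by blast
qed

end

locale adapted_arrangement = arrangement sW BW b m sV BV X V
  for sW :: "'k::field_char_0 \<Rightarrow> 'w::ab_group_add \<Rightarrow> 'w" and BW b m
    and sV :: "'k \<Rightarrow> 'v::ab_group_add \<Rightarrow> 'v" and BV and X :: "'x set" and V +
  fixes B :: "'x set" and B0 B1 :: "'v set"
  assumes B_subset: "B \<subseteq> X"
    and B0: "B0 \<subseteq> B1" "B0 \<subseteq> (\<Inter>x\<in>B. V x)" "(\<Inter>x\<in>B. V x) \<subseteq> vs.span B0"
    and B1: "vs.independent B1" "vs.span B1 = UNIV"
begin

definition \<xi> :: "'v \<Rightarrow> 'v \<Rightarrow> 'k" where
  "\<xi> v u = vs.representation B1 u v"

definition \<zeta> :: "'v \<times> nat \<Rightarrow> ('w \<Rightarrow> 'v) \<Rightarrow> 'k" where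
  "\<zeta> c \<phi> = \<xi> (fst c) (\<phi> (b (snd c)))"

definition elementary :: "'v \<times> nat \<Rightarrow> 'w \<Rightarrow> 'v" where
  "elementary c = (\<lambda>w. sV (coord (snd c) w) (fst c))"

abbreviation "C \<equiv> B1 \<times> {..<m}"

lemma finite_B1: "finite B1"
  using B1(1) by (rule vs.finiteI_independent)

lemma B_finite: "A \<subseteq> B \<Longrightarrow> finite A"
  by (rule finite_subset[OF subset_trans[OF _ B_subset] finite_X])

lemma xi_dual: "\<xi> v \<in> dual_space sV"
  unfolding vs.dual_space_iff \<xi>_def
  using B1(2) by (simp add: vs.representation_add[OF B1(1)] vs.representation_scale[OF B1(1)])

lemma xi_basis: "v \<in> B1 \<Longrightarrow> \<xi> v' v = (if v' = v then 1 else 0)"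
  by (auto simp: \<xi>_def vs.representation_basis[OF B1(1)])

lemma xi_expand: "u = (\<Sum>v\<in>B1. sV (\<xi> v u) v)"
  unfolding \<xi>_def using vs.sum_representation_eq[OF B1(1) _ finite_B1 subset_refl, of u] B1(2) by simp

lemma xi_Inter_V:
  assumes "u \<in> (\<Inter>x\<in>B. V x)" "v \<notin> B0"
  shows "\<xi> v u = 0"
proof -
  have "u \<in> vs.span B0" using assms(1) B0(3) by blast
  then have "\<xi> v u = vs.representation B0 u v"
    unfolding \<xi>_def by (simp only: vs.representation_extend[OF B1(1) _ B0(1)])
  then show ?thesis using vs.representation_ne_zero[of B0 u v] assms(2) by auto
qed

lemma card_B0: "card B0 = vs.dim (\<Inter>x\<in>B. V x)"
  by (rule vs.basis_card_eq_dim[OF B0(2,3) vs.independent_mono[OF B1(1) B0(1)]])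

lemma elementary_Y: "elementary c \<in> Y"
  by (simp add: Y_iff linear_map_iff elementary_def dual_spaceD[OF coord_dual] vs.scale_left_distrib)

lemma zeta_elementary: "c \<in> C \<Longrightarrow> c' \<in> C \<Longrightarrow> \<zeta> c (elementary c') = (if c = c' then 1 else 0)"
  by (cases c; cases c')
    (auto simp: \<zeta>_def elementary_def vs.dual_spaceD[OF xi_dual] xi_basis coord_b)

lemma Y_expand:
  assumes "\<phi> \<in> Y"
  shows "\<phi> = (\<Sum>c\<in>C. sY (\<zeta> c \<phi>) (elementary c))"
proof
  fix w
  have "\<phi> w = (\<Sum>j<m. sV (coord j w) (\<phi> (b j)))"
    using fun_cong[OF linear_map_basis_expand[OF assms[unfolded Y_iff]], of w] unfolding sum_fun_apply .
  also have "\<dots> = (\<Sum>j<m. sV (coord j w) (\<Sum>v\<in>B1. sV (\<xi> v (\<phi> (b j))) v))" unfolding xi_expand[symmetric] ..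
  also have "\<dots> = (\<Sum>v\<in>B1. \<Sum>j<m. sV (\<xi> v (\<phi> (b j))) (sV (coord j w) v))"
    unfolding vs.scale_sum_right by (subst sum.swap) (simp add: mult.commute)
  also have "\<dots> = (\<Sum>c\<in>C. sV (\<zeta> c \<phi>) (elementary c w))"
    by (simp add: sum.cartesian_product case_prod_unfold \<zeta>_def elementary_def)
  finally show "\<phi> w = (\<Sum>c\<in>C. sY (\<zeta> c \<phi>) (elementary c)) w" by (simp add: sum_fun_apply)
qed

sublocale wt: weighted_linear_ideals sY B "\<lambda>x. tdual (V x)" rescale C \<zeta> snd Y
proof unfold_locales
  show "finite B" by (rule B_finite[OF subset_refl])
  show "ys.subspace (tdual (V x))" for x unfolding tensor_dual_def by (rule ys.subspace_span)
  show "rescale (\<phi> + \<psi>) = rescale \<phi> + rescale \<psi>" for \<phi> \<psi> :: "'w \<Rightarrow> 'v" by (auto simp: rescale_def fun_eq_iff)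
  show "rescale (sY a \<phi>) = sY a (rescale \<phi>)" for a \<phi> by (simp add: rescale_def fun_eq_iff)
  show "rescale \<phi> \<in> tdual (V x)" if "x \<in> B" "\<phi> \<in> tdual (V x)" for x \<phi>
    using that B_subset tensor_dual_V_iff[of x] linear_map_comp_GL_iff[OF prime_diag_GL] by (auto simp: rescale_def)
  show "finite C" using finite_B1 by simp
  show "\<zeta> c \<in> dual_space sY" if "c \<in> C" for c by (simp add: ys.dual_space_iff \<zeta>_def vs.dual_spaceD[OF xi_dual])
  show "\<zeta> c (rescale \<phi>) = of_nat (nprime (snd c)) * \<zeta> c \<phi>" if "c \<in> C" "\<phi> \<in> Y" for c \<phi>
    using that by (auto simp: rescale_def \<zeta>_def prime_diag_b Y_iff hom.linear_scale vs.dual_spaceD[OF xi_dual])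
  show "\<exists>a. \<forall>\<phi>\<in>Y. l \<phi> = (\<Sum>c\<in>C. a c * \<zeta> c \<phi>)" if l: "l \<in> dual_space sY" for l
  proof (intro exI ballI)
    fix \<phi> assume "\<phi> \<in> Y"
    have "l \<phi> = l (\<Sum>c\<in>C. sY (\<zeta> c \<phi>) (elementary c))" by (rule arg_cong[OF Y_expand[OF \<open>\<phi> \<in> Y\<close>]])
    also have "\<dots> = (\<Sum>c\<in>C. l (elementary c) * \<zeta> c \<phi>)"
      by (simp only: ys.dual_spaceD(5)[OF l] ys.dual_spaceD(2)[OF l] mult.commute)
    finally show "l \<phi> = (\<Sum>c\<in>C. l (elementary c) * \<zeta> c \<phi>)" .
  qed
qed

definition coord_section :: "('v \<times> nat) set \<Rightarrow> ('w \<Rightarrow> 'v) set" where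
  "coord_section F = {\<phi> \<in> Y. \<forall>c\<in>F. \<zeta> c \<phi> = 0}"

lemma coord_section_empty: "coord_section {} = Y"
  by (simp add: coord_section_def)

lemma coord_section_insert: "coord_section (insert c F) = {\<phi> \<in> coord_section F. \<zeta> c \<phi> = 0}"
  by (auto simp: coord_section_def)

lemma elementary_section: "F \<subseteq> C \<Longrightarrow> c \<in> C \<Longrightarrow> c \<notin> F \<Longrightarrow> elementary c \<in> coord_section F"
  using zeta_elementary elementary_Y by (auto simp: coord_section_def)

lemma admissible_Y: "wt.admissible Y"
proof -
  have "Y = ys.span (elementary ` C)"
  proof
    show "ys.span (elementary ` C) \<subseteq> Y"
      using elementary_Y ys.subspace_span by (intro ys.span_minimal) (auto simp: tensor_dual_def)
    show "Y \<subseteq> ys.span (elementary ` C)"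
    proof
      fix \<phi> assume \<phi>: "\<phi> \<in> Y"
      have "(\<Sum>c\<in>C. sY (\<zeta> c \<phi>) (elementary c)) \<in> ys.span (elementary ` C)"
        by (intro ys.span_sum ys.span_scale ys.span_base imageI)
      then show "\<phi> \<in> ys.span (elementary ` C)" using Y_expand[OF \<phi>] by metis
    qed
  qed
  moreover have "rescale \<phi> \<in> Y \<longleftrightarrow> \<phi> \<in> Y" for \<phi>
    unfolding Y_iff rescale_def by (rule linear_map_comp_GL_iff[OF prime_diag_GL])
  ultimately show ?thesis
    unfolding wt.admissible_def using finite_B1
    by (intro conjI subset_refl exI[of _ "elementary ` C"] allI) (assumption | simp)+
qed

lemma admissible_section:
  assumes "F \<subseteq> C"
  shows "wt.admissible (coord_section F)"
proof -
  have "finite F" by (rule finite_subset[OF assms]) (simp add: finite_B1)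
  then show ?thesis
    using assms
  proof (induction F)
    case empty
    show ?case unfolding coord_section_empty by (rule admissible_Y)
  next
    case (insert c F)
    then show ?case
      unfolding coord_section_insert using elementary_section zeta_elementary[of c c]
      by (intro wt.admissible_slice[where e = "elementary c"]) auto
  qed
qed

definition form_series :: "('w \<Rightarrow> 'v) set \<Rightarrow> 'x set \<Rightarrow> xps" where
  "form_series S A = Abs_xps (\<lambda>M. if set_mset M \<subseteq> {..<m} then int (wt.form_weight_dim S A M) else 0)"

lemma form_series_slice:
  assumes A: "A \<subseteq> B" and F: "F \<subseteq> C" and c: "c \<in> B0 \<times> {..<m}" "c \<notin> F"
  shows "form_series (coord_section (insert c F)) A
    = (1 - variable (snd c)) * form_series (coord_section F) A"
proof (rule xps_eqI)
  have cC: "c \<in> C" using c B0(1) by auto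
  have e: "elementary c \<in> coord_section F" "\<zeta> c (elementary c) \<noteq> 0"
    using elementary_section[OF F cC c(2)] zeta_elementary[OF cC cC] by auto
  have e_V: "elementary c \<in> tdual (V x)" if "x \<in> A" for x
  proof -
    have x: "x \<in> X" "fst c \<in> B0" "x \<in> B" using that A B_subset c(1) by auto
    then have "fst c \<in> V x" using B0(2) by blast
    then show ?thesis
      using elementary_Y[of c] vs.subspace_scale[OF subspace_V[OF x(1)]]
      unfolding tensor_dual_V_iff[OF x(1)] Y_iff by (simp add: elementary_def)
  qed
  fix M
  have "set_mset (M - {#snd c#}) \<subseteq> {..<m} \<longleftrightarrow> set_mset M \<subseteq> {..<m}" if "snd c \<in># M"
  proof -
    have "set_mset M = insert (snd c) (set_mset (M - {#snd c#}))"
      using arg_cong[OF insert_DiffM[OF that], of set_mset] by simp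
    then show ?thesis using c(1) by auto
  qed
  then show "xcoeff (form_series (coord_section (insert c F)) A) M
      = xcoeff ((1 - variable (snd c)) * form_series (coord_section F) A) M"
    using wt.form_weight_dim_slice[OF admissible_section[OF F] A cC e e_V, of M]
    unfolding xcoeff_one_minus_variable_times coord_section_insert by (auto simp: form_series_def)
qed

lemma form_series_section:
  assumes A: "A \<subseteq> B" and F: "F \<subseteq> B0 \<times> {..<m}"
  shows "form_series (coord_section F) A = (\<Prod>c\<in>F. 1 - variable (snd c)) * form_series Y A"
proof -
  have "finite F" by (rule finite_subset[OF F]) (simp add: finite_subset[OF B0(1) finite_B1])
  then show ?thesis
    using F
  proof (induction F)
    case empty
    show ?case by (simp add: coord_section_empty)
  next
    case (insert c F)
    have "F \<subseteq> C" using insert.prems B0(1) by auto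
    then have "form_series (coord_section (insert c F)) A
        = (1 - variable (snd c)) * form_series (coord_section F) A"
      using insert by (intro form_series_slice[OF A]) auto
    then show ?case using insert by (simp add: mult.assoc)
  qed
qed

abbreviation "transversal \<equiv> coord_section (B0 \<times> {..<m})"

lemma form_series_transversal:
  assumes "A \<subseteq> B"
  shows "form_series transversal A = restrict_vars m sigma_inv ^ card B0 * form_series Y A"
proof -
  have "(\<Prod>c\<in>B0 \<times> {..<m}. 1 - variable (snd c)) = (\<Prod>j<m. 1 - variable j) ^ card B0"
    using prod.cartesian_product[of "\<lambda>v j. 1 - variable j" "{..<m}" B0] by (simp add: case_prod_unfold)
  then have "form_series transversal A = (\<Prod>j<m. 1 - variable j) ^ card B0 * form_series Y A"
    using form_series_section[OF assms subset_refl] by simp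
  moreover have "restrict_vars m (form_series S A) = form_series S A" for S
    by (rule xps_eqI) (simp add: form_series_def)
  ultimately show ?thesis
    using restrict_prod_one_minus_variable[of m] by (metis restrict_vars_mult restrict_vars_power)
qed

lemma admissible_transversal: "wt.admissible transversal"
  using B0(1) by (intro admissible_section) auto

lemma transversal_Inter: "transversal \<inter> (\<Inter>x\<in>B. tdual (V x)) \<subseteq> {0}"
proof
  fix \<phi> assume \<phi>: "\<phi> \<in> transversal \<inter> (\<Inter>x\<in>B. tdual (V x))"
  then have Y: "\<phi> \<in> Y" by (simp add: coord_section_def)
  have V: "\<phi> w \<in> (\<Inter>x\<in>B. V x)" for w using \<phi> B_subset tensor_dual_V_iff by blast
  have "\<zeta> c \<phi> = 0" if c: "c \<in> C" for c
  proof (cases "fst c \<in> B0")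
    case True
    then show ?thesis using \<phi> c by (auto simp: coord_section_def)
  next
    case False
    then show ?thesis using xi_Inter_V[OF V] by (simp add: \<zeta>_def)
  qed
  then have "(\<Sum>c\<in>C. sY (\<zeta> c \<phi>) (elementary c)) = 0" by (intro sum.neutral ballI) (simp add: zero_fun_def)
  then show "\<phi> \<in> {0}" using Y_expand[OF Y] by simp
qed

lemma alternating_sum_form_series:
  assumes "B \<noteq> {}" "card B \<le> size M"
  shows "xcoeff (restrict_vars m sigma_inv ^ card B0 * (\<Sum>A\<in>Pow B. (-1) ^ card A * form_series Y A)) M = 0"
proof -
  have "restrict_vars m sigma_inv ^ card B0 * (\<Sum>A\<in>Pow B. (-1) ^ card A * form_series Y A)
      = (\<Sum>A\<in>Pow B. (-1) ^ card A * form_series transversal A)"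
    unfolding sum_distrib_left using form_series_transversal by (intro sum.cong) (auto simp: mult.left_commute)
  moreover have "(\<Sum>A\<in>Pow B. (-1) ^ card A * int (wt.form_weight_dim transversal A M)) = 0"
    by (rule wt.alternating_sum_form_weight_dim[OF admissible_transversal transversal_Inter assms])
  ultimately show ?thesis by (cases "set_mset M \<subseteq> {..<m}") (simp_all add: xcoeff_sum xcoeff_sign form_series_def)
qed

lemma form_series_below_card:
  assumes "size M < card B"
  shows "xcoeff (restrict_vars m sigma_inv ^ card B0 * form_series Y B) M = 0"
proof -
  have "wt.J_on transversal B (size M) = {0}"
    unfolding wt.J_on_def wt.J_below_card[OF B_finite[OF subset_refl] assms]
    by (simp add: fsp.linear_0[OF wt.flinear_zero_off])
  then have "wt.form_weight_space transversal B M \<subseteq> {0}"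
    by (metis wt.form_weight_space_def fs.eigenspace_subset)
  moreover have "0 \<in> wt.form_weight_space transversal B M"
    by (rule fs.subspace_0[OF wt.subspace_form_weight_space])
  ultimately have "wt.form_weight_space transversal B M = {0}" by blast
  then have "wt.form_weight_dim transversal B M = 0" by (simp add: wt.form_weight_dim_def)
  then show ?thesis unfolding form_series_transversal[OF subset_refl, symmetric] by (simp add: form_series_def)
qed

lemma form_series_empty:
  assumes "B = {}"
  shows "restrict_vars m sigma_inv ^ card B0 * form_series Y {} = 1"
proof -
  have "0 \<in> transversal" by (rule ys.subspace_0[OF wt.admissibleD(2)[OF admissible_transversal]])
  then have "transversal = {0}" using transversal_Inter assms by auto
  then have "xcoeff (form_series transversal {}) M = xcoeff 1 M" for M
    using wt.form_weight_dim_origin admissible_transversal by (simp add: form_series_def one_xps.rep_eq)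
  then have "form_series transversal {} = 1" by (rule xps_eqI)
  then show ?thesis using form_series_transversal[of "{}"] by simp
qed

lemma form_poly_fun:
  assumes l: "l \<in> wt.forms"
  shows "wt.zero_off Y l \<in> poly_fun sV sW"
proof -
  obtain a where a: "\<forall>\<phi>\<in>Y. l \<phi> = (\<Sum>c\<in>C. a c * \<zeta> c \<phi>)" using wt.zeta_span[OF l] by blast
  have "wt.zero_off Y l = (\<Sum>c\<in>C. fscale (a c) (\<lambda>\<phi>. if \<phi> \<in> Y then \<xi> (fst c) (\<phi> (b (snd c))) else 0))"
    using a by (auto simp: wt.zero_off_def fs_simps \<zeta>_def)
  also have "\<dots> \<in> poly_fun sV sW" by (intro poly_fun_sum poly_fun_scale poly_fun.coord xi_dual)
  finally show ?thesis .
qed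

lemma poly_fun_form_ideal: "f \<in> poly_fun sV sW \<Longrightarrow> f \<in> wt.form_ideal Y {}"
proof (induction rule: poly_fun.induct)
  case (const c)
  have J: "fscale c 1 \<in> wt.J {} 0"
    by (intro fs.subspace_scale[OF wt.subspace_J] wt.J_base wt.product_form.one)
  have eq: "(\<lambda>\<phi>. if \<phi> \<in> Y then c else 0) = wt.zero_off Y (fscale c 1)"
    by (auto simp: wt.zero_off_def fscale_def)
  show ?case unfolding eq by (rule wt.form_ideal_base[OF J])
next
  case (coord \<xi>' w)
  have "(\<lambda>\<phi>. \<xi>' (\<phi> w)) \<in> wt.forms" using coord by (simp add: ys.dual_space_iff vs.dual_space_iff)
  then have J: "(\<lambda>\<phi>. \<xi>' (\<phi> w)) * 1 \<in> wt.J {} (Suc 0)"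
    by (intro wt.J_form wt.J_base wt.product_form.one)
  have eq: "(\<lambda>\<phi>. if \<phi> \<in> Y then \<xi>' (\<phi> w) else 0) = wt.zero_off Y ((\<lambda>\<phi>. \<xi>' (\<phi> w)) * 1)"
    by (auto simp: wt.zero_off_def)
  show ?case unfolding eq by (rule wt.form_ideal_base[OF J])
next
  case (add f f')
  show ?case by (rule fs.subspace_add[OF wt.subspace_form_ideal add.IH])
next
  case (mult f f')
  show ?case using wt.form_ideal_mult[OF Int_empty_left mult.IH] by (simp only: Un_empty_left)
qed

text \<open>A function vanishing on \<open>V x\<close> is the difference of itself and of its composite with a projection onto \<open>V x\<close>.\<close>

lemma vanishing_ideal_form_ideal:
  assumes x: "x \<in> B" and f: "f \<in> vanishing_ideal sV sW (V x)"
  shows "f \<in> wt.form_ideal Y {x}"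
proof -
  have xX: "x \<in> X" using x B_subset by blast
  interpret endo: vector_space_pair sV sV ..
  obtain p where p: "range p \<subseteq> V x" "Vector_Spaces.linear sV sV p" "\<And>u. u \<in> V x \<Longrightarrow> p u = u"
    using endo.linear_exists_left_inverse_on[OF vs.linear_id subspace_V[OF xX]] by auto
  define D where "D f = wt.zero_off Y (\<lambda>\<phi>. f \<phi> - f (p \<circ> \<phi>))" for f :: "('w \<Rightarrow> 'v) \<Rightarrow> 'k"
  have p_V: "p \<circ> \<phi> \<in> tdual (V x)" if "\<phi> \<in> Y" for \<phi>
    using that p(1) Vector_Spaces.linear_compose[OF _ p(2)] unfolding Y_iff tensor_dual_V_iff[OF xX] by auto
  have V_Y: "tdual (V x) \<subseteq> Y" using tensor_dual_V_iff[OF xX] Y_iff by blast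
  have flinear_D: "flinear D" by (rule flinearI) (auto simp: D_def wt.zero_off_def fs_simps algebra_simps)
  have D_product: "D (wt.zero_off Y g) \<in> wt.form_ideal Y {x}" if "wt.product_form {} k g" for g k
  proof -
    have J: "(\<lambda>\<phi>. g \<phi> - g (p \<circ> \<phi>)) \<in> wt.J {x} k"
    proof (rule wt.J_minus_projection)
      show "p \<circ> (\<phi> + \<psi>) = (p \<circ> \<phi>) + (p \<circ> \<psi>)" for \<phi> \<psi> :: "'w \<Rightarrow> 'v" by (simp add: fun_eq_iff endo.linear_add[OF p(2)])
      show "p \<circ> sY a \<phi> = sY a (p \<circ> \<phi>)" for a \<phi> by (simp add: fun_eq_iff endo.linear_scale[OF p(2)])
      show "p \<circ> \<phi> = \<phi>" if "\<phi> \<in> tdual (V x)" for \<phi> using that p(3) tensor_dual_V_iff[OF xX] by (auto simp: fun_eq_iff)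
    qed (rule wt.J_base[OF that])
    have eq: "D (wt.zero_off Y g) = wt.zero_off Y (\<lambda>\<phi>. g \<phi> - g (p \<circ> \<phi>))"
      using p_V V_Y by (auto simp: D_def wt.zero_off_def fun_eq_iff)
    show ?thesis unfolding eq by (rule wt.form_ideal_base[OF J])
  qed
  have "f \<in> wt.form_ideal Y {}" using f poly_fun_form_ideal by (auto simp: vanishing_ideal_def)
  then have "D f \<in> wt.form_ideal Y {x}"
    by (rule wt.form_ideal_image_subset[OF flinear_D _ wt.subspace_form_ideal, rotated]) (rule D_product)
  moreover have "D f = f"
    using f p_V poly_fun_outside by (auto simp: D_def wt.zero_off_def vanishing_ideal_def fun_eq_iff)
  ultimately show ?thesis by (simp only:)
qed

lemma generator_form_ideal:
  assumes A: "A \<subseteq> B" and q: "q \<in> poly_fun sV sW" and f: "\<And>x. x \<in> A \<Longrightarrow> f x \<in> vanishing_ideal sV sW (V x)"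
  shows "q * (\<Prod>x\<in>A. f x) \<in> wt.form_ideal Y A"
  using B_finite[OF A] A f
proof (induction A)
  case empty
  then show ?case using poly_fun_form_ideal[OF q] by simp
next
  case (insert x A)
  have "f x \<in> wt.form_ideal Y {x}" by (rule vanishing_ideal_form_ideal) (use insert.prems in auto)
  moreover have "q * (\<Prod>x\<in>A. f x) \<in> wt.form_ideal Y A" by (rule insert.IH) (use insert.prems in auto)
  ultimately have "f x * (q * (\<Prod>x\<in>A. f x)) \<in> wt.form_ideal Y ({x} \<union> A)"
    using insert.hyps by (intro wt.form_ideal_mult) auto
  then show ?case by (simp only: prod.insert[OF insert.hyps] mult.left_commute insert_is_Un[symmetric])
qed

lemma product_form_ideal: "wt.product_form A k f \<Longrightarrow> A \<subseteq> B \<Longrightarrow> wt.zero_off Y f \<in> ideal A"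
proof (induction rule: wt.product_form.induct)
  case one
  have "wt.zero_off Y 1 \<in> poly_fun sV sW" using poly_fun.const[of sV sW 1] by (simp add: wt.zero_off_def one_fun_def)
  from ideal_generator[OF this, of "{}"] show ?case by (simp only: empty_iff prod.empty mult_1_right simp_thms)
next
  case (form l A k f)
  have "wt.zero_off Y l * wt.zero_off Y f \<in> ideal A"
  proof (rule ideal_image_subset[OF flinear_times subspace_ideal form.IH[OF form.prems]])
    fix q f assume "q \<in> poly_fun sV sW" "\<And>x. x \<in> A \<Longrightarrow> f x \<in> vanishing_ideal sV sW (V x)"
    then show "wt.zero_off Y l * (q * (\<Prod>x\<in>A. f x)) \<in> ideal A"
      unfolding mult.assoc[symmetric] by (intro ideal_generator poly_fun.mult form_poly_fun form.hyps)
  qed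
  then show ?case by (simp only: wt.zero_off_mult)
next
  case (factor x A l k f)
  have A: "A \<subseteq> B" "x \<in> X" "finite A" using factor.prems B_subset B_finite by auto
  have "tdual (V x) \<subseteq> Y" using tensor_dual_V_iff[OF A(2)] Y_iff by blast
  then have l: "wt.zero_off Y l \<in> vanishing_ideal sV sW (V x)"
    using form_poly_fun[OF wt.L_forms[OF factor.hyps(2)]] factor.hyps(2)
    by (auto simp: vanishing_ideal_def wt.zero_off_def wt.L_def)
  have "wt.zero_off Y l * wt.zero_off Y f \<in> ideal (insert x A)"
  proof (rule ideal_image_subset[OF flinear_times subspace_ideal factor.IH[OF A(1)]])
    fix q g assume g: "q \<in> poly_fun sV sW" "\<And>x. x \<in> A \<Longrightarrow> g x \<in> vanishing_ideal sV sW (V x)"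
    have "(\<Prod>v\<in>A. (g(x := wt.zero_off Y l)) v) = (\<Prod>v\<in>A. g v)"
      using factor.hyps(1) by (intro prod.cong) auto
    then have "wt.zero_off Y l * (q * (\<Prod>v\<in>A. g v)) = q * (\<Prod>v\<in>insert x A. (g(x := wt.zero_off Y l)) v)"
      using factor.hyps(1) A(3) by (simp add: mult.left_commute)
    also have "\<dots> \<in> ideal (insert x A)" by (rule ideal_generator[OF g(1)]) (use g(2) l in auto)
    finally show "wt.zero_off Y l * (q * (\<Prod>v\<in>A. g v)) \<in> ideal (insert x A)" .
  qed
  then show ?case by (simp only: wt.zero_off_mult)
qed

lemma ideal_eq_form_ideal:
  assumes A: "A \<subseteq> B"
  shows "ideal A = wt.form_ideal Y A"
proof
  show "ideal A \<subseteq> wt.form_ideal Y A"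
    using ideal_image_subset[OF flinear_id wt.subspace_form_ideal] generator_form_ideal[OF A] by blast
  show "wt.form_ideal Y A \<subseteq> ideal A"
    using wt.form_ideal_image_subset[OF flinear_id _ subspace_ideal] product_form_ideal[OF _ A] by blast
qed

lemma weight_space_ideal:
  assumes A: "A \<subseteq> B"
  shows "weight_space function_act (ideal A) M = wt.form_weight_space Y A M"
proof -
  have "wt.pullback = function_act prime_diag" by (intro ext) (simp add: wt.pullback_def function_act_def rescale_def)
  then show ?thesis
    unfolding weight_space_def ideal_eq_form_ideal[OF A] using wt.eigenspace_form_ideal[OF admissible_Y A] by simp
qed

lemma form_series_eq_ideal_series: "A \<subseteq> B \<Longrightarrow> form_series Y A = ideal_series A"
  by (simp add: form_series_def ideal_series_def wt.form_weight_dim_def weight_dim_def weight_space_ideal cong: if_cong)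

lemma comp_GL_Y_iff: "g \<in> GL sW \<Longrightarrow> \<phi> \<circ> g \<in> Y \<longleftrightarrow> \<phi> \<in> Y"
  unfolding Y_iff by (rule linear_map_comp_GL_iff)

lemma ideal_stable:
  assumes A: "A \<subseteq> B"
  shows "stable (GL sW) function_act (ideal A)"
  unfolding stable_def ideal_eq_form_ideal[OF A]
proof (intro conjI ballI wt.subspace_form_ideal)
  fix g u assume g: "g \<in> GL sW" and u: "u \<in> wt.form_ideal Y A"
  show "function_act g u \<in> wt.form_ideal Y A"
  proof (rule wt.form_ideal_image_subset[OF flinear_function_act _ wt.subspace_form_ideal u])
    fix k f assume f: "wt.product_form A k f"
    have J: "(\<lambda>\<phi>. f (\<phi> \<circ> g)) \<in> wt.J A k"
    proof (rule wt.J_compose)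
      show "\<phi> + \<psi> \<circ> g = (\<phi> \<circ> g) + (\<psi> \<circ> g)" for \<phi> \<psi> :: "'w \<Rightarrow> 'v" by (auto simp: fun_eq_iff)
      show "sY a \<phi> \<circ> g = sY a (\<phi> \<circ> g)" for a \<phi> by (simp add: fun_eq_iff)
      show "\<phi> \<circ> g \<in> tdual (V x)" if "x \<in> A" "\<phi> \<in> tdual (V x)" for x \<phi>
        using that A B_subset tensor_dual_V_iff[of x] linear_map_comp_GL_iff[OF g] by auto
    qed (rule wt.J_base[OF f])
    have eq: "function_act g (wt.zero_off Y f) = wt.zero_off Y (\<lambda>\<phi>. f (\<phi> \<circ> g))"
      using comp_GL_Y_iff[OF g] by (auto simp: function_act_def wt.zero_off_def)
    show "function_act g (wt.zero_off Y f) \<in> wt.form_ideal Y A"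
      unfolding eq by (rule wt.form_ideal_base[OF J])
  qed
qed

definition tensor_function :: "'v list \<Rightarrow> (nat, 'w, 'k) tensor \<Rightarrow> ('w \<Rightarrow> 'v) \<Rightarrow> 'k" where
  "tensor_function vl t = (\<lambda>\<phi>. if \<phi> \<in> Y then t (\<lambda>l. \<xi> (vl ! l) \<circ> \<phi>) else 0)"

lemma tensor_function_equivariant:
  "equivariant_on (GL sW) tensor_act function_act (E {..<k}) (tensor_function vl)"
proof -
  have "flinear (tensor_function vl)" by (rule flinearI) (auto simp: tensor_function_def fs_simps)
  then show ?thesis
    unfolding equivariant_on_def
    by (auto simp: tensor_function_def tensor_act_def function_act_def comp_assoc fun_eq_iff comp_GL_Y_iff)
qed

lemma monomial_tensor_function:
  "wt.zero_off Y (wt.monomial cs)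
    = tensor_function (map fst cs) (pure {..<length cs} (\<lambda>l. b (snd (cs ! l))))"
proof
  fix \<phi>
  have "\<xi> v \<circ> \<phi> \<in> dual" if "\<phi> \<in> Y" for v
    using that xi_dual[of v] unfolding Y_iff dual_space_def by (auto intro: Vector_Spaces.linear_compose)
  moreover have "wt.monomial cs \<phi> = (\<Prod>l<length cs. \<xi> (map fst cs ! l) (\<phi> (b (snd (cs ! l)))))"
    unfolding wt.monomial_def
    by (subst prod.list_conv_set_nth) (auto simp: \<zeta>_def lessThan_atLeast0 intro!: prod.cong)
  ultimately show "wt.zero_off Y (wt.monomial cs) \<phi>
      = tensor_function (map fst cs) (pure {..<length cs} (\<lambda>l. b (snd (cs ! l)))) \<phi>"
    by (auto simp: wt.zero_off_def tensor_function_def pure_apply dual_family_def)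
qed

lemma ideal_polynomial_module:
  assumes A: "A \<subseteq> B"
  shows "polynomial_module function_act (ideal A)"
proof -
  let ?images = "\<Union>{h ` E {..<k} | (k :: nat) h. equivariant_on (GL sW) tensor_act function_act (E {..<k}) h}"
  have "tensor_function vl ` E {..<k} \<subseteq> ?images" for vl and k :: nat
    using tensor_function_equivariant by (intro Union_upper) blast
  then have "wt.zero_off Y (wt.monomial cs) \<in> ?images" for cs
    unfolding monomial_tensor_function by (rule subsetD[OF _ imageI[OF pure_in_E]])
  then have "fs.span ((\<lambda>cs. wt.zero_off Y (wt.monomial cs)) ` wt.words k) \<subseteq> fs.span ?images" for k
    by (intro fs.span_mono image_subsetI)
  then have "ideal A \<subseteq> fs.span ?images"
    unfolding ideal_eq_form_ideal[OF A] wt.form_ideal_def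
    using wt.J_on_subset_span_monomials[OF subset_refl] by (intro fs.span_minimal fs.subspace_span) blast
  then show ?thesis
    unfolding polynomial_module_def weight_space_ideal[OF A]
    using flinear_function_act ideal_stable[OF A] wt.findim_form_weight_space[OF admissible_Y]
    by (simp add: function_act_def comp_assoc)
qed

end

context arrangement
begin

lemma adapted_arrangement_exists:
  assumes B: "B \<subseteq> X"
  obtains B0 B1 where "adapted_arrangement sW BW b m sV BV X V B B0 B1"
proof -
  let ?S = "\<Inter>x\<in>B. V x"
  obtain B0 where B0: "B0 \<subseteq> ?S" "vs.independent B0" "?S \<subseteq> vs.span B0" by (rule vs.basis_exists) blast
  have "adapted_arrangement sW BW b m sV BV X V B B0 (vs.extend_basis B0)"
    using B B0 vs.extend_basis_superset[OF B0(2)] vs.independent_extend_basis[OF B0(2)] vs.span_extend_basis[OF B0(2)]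
    by unfold_locales auto
  then show ?thesis by (rule that)
qed

lemma ideal_series_recursion:
  assumes "polymatroid X rk" "realization sV V X rk"
  shows "truncated_recursion X rk (vs.dim UNIV) m ideal_series"
proof
  let ?n = "vs.dim UNIV" and ?\<tau> = "restrict_vars m sigma_inv"
  have dim: "rk B \<le> ?n" "vs.dim (\<Inter>x\<in>B. V x) = ?n - rk B" if "B \<subseteq> X" for B
  proof -
    have "int (rk B) = int ?n - int (vs.dim (\<Inter>x\<in>B. V x))" using assms(2) that by (simp add: realization_def)
    then show "rk B \<le> ?n" "vs.dim (\<Inter>x\<in>B. V x) = ?n - rk B" by linarith+
  qed
  show "polymatroid X rk" by fact
  show "rk B \<le> ?n" if "B \<subseteq> X" for B by (rule dim[OF that])
  show "?\<tau> ^ ?n * ideal_series {} = 1"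
  proof -
    obtain B0 B1 where "adapted_arrangement sW BW b m sV BV X V {} B0 B1"
      by (rule adapted_arrangement_exists[OF empty_subsetI])
    then interpret adapted_arrangement sW BW b m sV BV X V "{}" B0 B1 .
    show ?thesis using form_series_empty card_B0 by (simp add: form_series_eq_ideal_series)
  qed
  fix B M assume B: "B \<subseteq> X"
  obtain B0 B1 where "adapted_arrangement sW BW b m sV BV X V B B0 B1" by (rule adapted_arrangement_exists[OF B])
  then interpret adapted_arrangement sW BW b m sV BV X V B B0 B1 .
  note card_B0 = card_B0[unfolded dim(2)[OF B]]
  show "xcoeff (?\<tau> ^ (?n - rk B) * ideal_series B) M = 0" if "size M < card B"
    using form_series_below_card[OF that] by (simp add: form_series_eq_ideal_series card_B0)
  show "xcoeff (?\<tau> ^ (?n - rk B) * (\<Sum>A\<in>Pow B. (-1) ^ card A * ideal_series A)) M = 0"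
    if "B \<noteq> {}" "card B \<le> size M"
    using alternating_sum_form_series[OF that] by (simp add: form_series_eq_ideal_series card_B0)
qed

theorem sym_star_ideals:
  fixes U :: "('k, 'w, 'u::ab_group_add) glmod"
  assumes "polymatroid X rk" "realization sV V X rk" and n: "vs.dim UNIV = n"
  shows "sym_star sW (sigma ^ (n - rk X) * polyP X rk) U
      = (\<Sum>A\<in>Pow X. (-1) ^ card A * int (gl_mult sW (J_module sV sW V A) U))"
    and "sym_star sW (sigma ^ n * polyH X rk sigma_inv (-1)) U = int (gl_mult sW (J_module sV sW V X) U)"
proof -
  interpret truncated_recursion X rk n m ideal_series
    using ideal_series_recursion[OF assms(1,2)] by (simp only: n)
  obtain B0 B1 where "adapted_arrangement sW BW b m sV BV X V X B0 B1"
    by (rule adapted_arrangement_exists[OF subset_refl])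
  then interpret adapted_arrangement sW BW b m sV BV X V X B0 B1 .
  have "xcoeff (sigma ^ (n - rk X) * polyP X rk) M
      = (\<Sum>A\<in>Pow X. (-1) ^ card A * int (weight_dim function_act (ideal A) M))" if "set_mset M \<subseteq> {..<m}" for M
    using arg_cong[OF restrict_sigma_polyP, of "\<lambda>f. xcoeff f M"] that
    by (simp add: alternating_def xcoeff_sum xcoeff_sign ideal_series_def)
  then show "sym_star sW (sigma ^ (n - rk X) * polyP X rk) U
      = (\<Sum>A\<in>Pow X. (-1) ^ card A * int (gl_mult sW (J_module sV sW V A) U))"
    unfolding J_module_fmod using ideal_polynomial_module by (intro sym_star_eq_sum_gl_mult polyP_Sym_bar) auto
  have "xcoeff (sigma ^ n * polyH X rk sigma_inv (-1)) M = (\<Sum>A\<in>{X}. 1 * int (weight_dim function_act (ideal A) M))"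
    if "set_mset M \<subseteq> {..<m}" for M
    using arg_cong[OF restrict_sigma_polyH, of "\<lambda>f. xcoeff f M"] that by (simp add: ideal_series_def)
  then have "sym_star sW (sigma ^ n * polyH X rk sigma_inv (-1)) U
      = (\<Sum>A\<in>{X}. 1 * int (gl_mult sW (fmod function_act (ideal A)) U))"
    using ideal_polynomial_module by (intro sym_star_eq_sum_gl_mult polyH_Sym_bar) auto
  then show "sym_star sW (sigma ^ n * polyH X rk sigma_inv (-1)) U = int (gl_mult sW (J_module sV sW V X) U)"
    unfolding J_module_fmod by simp
qed

end

theorem theorem5p2:
  fixes X :: "'x set" and rk :: "'x set \<Rightarrow> nat" and d n :: nat
    and sV :: "'k::field_char_0 \<Rightarrow> 'v::ab_group_add \<Rightarrow> 'v" and BV :: "'v set"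
    and V :: "'x \<Rightarrow> 'v set"
    and sW :: "'k \<Rightarrow> 'w::ab_group_add \<Rightarrow> 'w" and BW :: "'w set"
    and U :: "('k, 'w, 'u::ab_group_add) glmod"
  assumes "polymatroid X rk" and "card X = d"
    and "finite_dimensional_vector_space sV BV" and "vector_space.dim sV UNIV = n"
    and "realization sV V X rk"
    and "finite_dimensional_vector_space sW BW"
    and "rational_module sW U" and "irreducible_module sW U"
  shows "sym_star sW (sigma ^ (n - rk X) * polyP X rk) U
           = (\<Sum>A\<in>Pow X. (-1) ^ card A * int (gl_mult sW (J_module sV sW V A) U))
         \<and> sym_star sW (sigma ^ n * polyH X rk sigma_inv (-1)) U
           = int (gl_mult sW (J_module sV sW V X) U)"
proof -
  interpret vs: finite_dimensional_vector_space sV BV by fact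
  interpret ws: finite_dimensional_vector_space sW BW by fact
  obtain b where b: "bij_betw b {..<card BW} BW"
    using finite_same_card_bij[of "{..<card BW}" BW] ws.finite_Basis by auto
  interpret arrangement sW BW b "card BW" sV BV X V
    using b assms(1,5) by unfold_locales (auto simp: polymatroid_def realization_def)
  show ?thesis using sym_star_ideals[OF assms(1,5,4)] by blast
qed

end
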